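(* Let $0<\delta\leq1$ and let $\{\Lambda_k\}_{k\in\mathbb Z}\in LPSO(n+2\delta,\delta)$. If $S_\Lambda$ is bounded on $L^2(\mathbb R^n)$, then $S_\Lambda$ extends to a bounded operator from $H^p(\mathbb R^n)$ into $L^p(\mathbb R^n)$ for all $\frac{n}{n+\delta}<p\leq1$.
   Context: For $N>0$, $k\in\mathbb Z$, $x\in\mathbb R^n$ put $\Phi_k^N(x)=2^{kn}(1+2^k|x|)^{-N}$. Given kernels $\lambda_k:\mathbb R^{2n}\to\mathbb C$, $k\in\mathbb Z$, set $\Lambda_kf(x)=\int_{\mathbb R^n}\lambda_k(x,y)f(y)\,dy$ and $S_\Lambda f(x)=\left(\sum_{k\in\mathbb Z}|\Lambda_kf(x)|^2\right)^{1/2}$. $\{\Lambda_k\}\in LPSO(N,\delta)$ (the case $L=0$ of the class $LPSO(N,L+\delta)$, with $N>0$, $0<\delta\le 1$) means there is a constant $C$ (independent of $k,x,y,y'$) such that $|\lambda_k(x,y)|\leq C\,\Phi_k^{N}(x-y)$ and $|\lambda_k(x,y)-\lambda_k(x,y')|\leq C|y-y'|^\delta 2^{k\delta}\left(\Phi_k^{N}(x-y)+\Phi_k^{N}(x-y')\right)$. $H^p=H^p(\mathbb R^n)$ is the classical real Hardy space, with (quasi-)norm given by the $L^p$ norm of the non-tangential maximal function $\sup_{t>0}\sup_{|x-y|\leq t}|\varphi_t*f(y)|$, $\varphi_t(x)=t^{-n}\varphi(x/t)$, for a Schwartz function $\varphi$ with non-zero integral. Boundedness by extension is understood from the dense subspace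 $H^p\cap L^2$. *)

theory Defs
  imports "HOL-Analysis.Analysis"
begin

definition ennpowr :: "ennreal \<Rightarrow> real \<Rightarrow> ennreal" where
  "ennpowr a p = (if a = \<infinity> then \<infinity> else ennreal (enn2real a powr p))"

text \<open>Only used for \<^term>\<open>p > 0\<close>; a quasi-norm when \<^term>\<open>p < 1\<close>. Measurability has to be required
  separately, since the nonnegative integral of a non-measurable function is a lower integral.\<close>

definition lp_norm :: "real \<Rightarrow> ('a::euclidean_space \<Rightarrow> ennreal) \<Rightarrow> ennreal" where
  "lp_norm p g = ennpowr (\<integral>\<^sup>+x. ennpowr (g x) p \<partial>lebesgue) (1 / p)"

definition Lp_norm :: "real \<Rightarrow> ('a::euclidean_space \<Rightarrow> 'b::real_normed_vector) \<Rightarrow> ennreal" where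
  "Lp_norm p f = lp_norm p (\<lambda>x. ennreal (norm (f x)))"

definition Lp_space :: "real \<Rightarrow> ('a::euclidean_space \<Rightarrow> 'b::real_normed_vector) set" where
  "Lp_space p = {f. f \<in> borel_measurable lebesgue \<and> Lp_norm p f < \<infinity>}"

definition Phi :: "real \<Rightarrow> int \<Rightarrow> 'a::euclidean_space \<Rightarrow> real" where
  "Phi N k x = 2 powr (real_of_int k * real DIM('a)) * (1 + 2 powr real_of_int k * norm x) powr (- N)"

definition Lambda ::
  "(int \<Rightarrow> 'a::euclidean_space \<Rightarrow> 'a \<Rightarrow> complex) \<Rightarrow> int \<Rightarrow> ('a \<Rightarrow> complex) \<Rightarrow> 'a \<Rightarrow> complex" where
  "Lambda lam k f x = (LINT y|lebesgue. lam k x y * f y)"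

text \<open>The value \<^term>\<open>\<infinity>::ennreal\<close> is attained where the series diverges.\<close>

definition square_fun ::
  "(int \<Rightarrow> 'a::euclidean_space \<Rightarrow> 'a \<Rightarrow> complex) \<Rightarrow> ('a \<Rightarrow> complex) \<Rightarrow> 'a \<Rightarrow> ennreal" where
  "square_fun lam f x = ennpowr (\<Sum>\<^sub>\<infinity>k\<in>UNIV. ennreal ((cmod (Lambda lam k f x))\<^sup>2)) (1 / 2)"

definition LPSO ::
  "real \<Rightarrow> real \<Rightarrow> (int \<Rightarrow> 'a::euclidean_space \<Rightarrow> 'a \<Rightarrow> complex) \<Rightarrow> bool" where
  "LPSO N \<delta> lam \<longleftrightarrow>
     (\<exists>C. (\<forall>k x y. cmod (lam k x y) \<le> C * Phi N k (x - y)) \<and>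
          (\<forall>k x y y'. cmod (lam k x y - lam k x y') \<le>
             C * norm (y - y') powr \<delta> * 2 powr (real_of_int k * \<delta>) *
             (Phi N k (x - y) + Phi N k (x - y'))))"

text \<open>That the square function of an \<open>L\<^sup>2\<close> function is measurable is part of boundedness on \<open>L\<^sup>2\<close>.
  The operator is not linear, so boundedness is the norm inequality.\<close>

definition bounded_on_L2 :: "(('a::euclidean_space \<Rightarrow> complex) \<Rightarrow> 'a \<Rightarrow> ennreal) \<Rightarrow> bool" where
  "bounded_on_L2 S \<longleftrightarrow>
     (\<exists>C::real. \<forall>f\<in>Lp_space 2.
        S f \<in> borel_measurable lebesgue \<and> lp_norm 2 (S f) \<le> ennreal C * Lp_norm 2 f)"

primrec iter_partial ::
  "'a::euclidean_space list \<Rightarrow> ('a \<Rightarrow> complex) \<Rightarrow> 'a \<Rightarrow> complex" where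
  "iter_partial [] f = f"
| "iter_partial (b # bs) f = (\<lambda>x. frechet_derivative (iter_partial bs f) (at x) b)"

definition schwartz :: "('a::euclidean_space \<Rightarrow> complex) \<Rightarrow> bool" where
  "schwartz \<psi> \<longleftrightarrow>
     (\<forall>bs. set bs \<subseteq> Basis \<longrightarrow>
        (\<forall>x. iter_partial bs \<psi> differentiable at x) \<and>
        (\<forall>m::nat. bdd_above (range (\<lambda>x. (1 + norm x) ^ m * cmod (iter_partial bs \<psi> x)))))"

definition schwartz_seminorm :: "nat \<Rightarrow> ('a::euclidean_space \<Rightarrow> complex) \<Rightarrow> real" where
  "schwartz_seminorm m \<psi> =
     (\<Sum>bs\<in>{bs. set bs \<subseteq> Basis \<and> length bs \<le> m}.
        SUP x. (1 + norm x) ^ m * cmod (iter_partial bs \<psi> x))"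

text \<open>A distribution is represented by a functional on all functions, of which only the values on
  Schwartz functions are constrained and used. Linearity is complex linearity.\<close>

definition tempered :: "(('a::euclidean_space \<Rightarrow> complex) \<Rightarrow> complex) \<Rightarrow> bool" where
  "tempered u \<longleftrightarrow>
     (\<forall>\<psi> \<eta>. schwartz \<psi> \<longrightarrow> schwartz \<eta> \<longrightarrow> u (\<lambda>x. \<psi> x + \<eta> x) = u \<psi> + u \<eta>) \<and>
     (\<forall>c \<psi>. schwartz \<psi> \<longrightarrow> u (\<lambda>x. c * \<psi> x) = c * u \<psi>) \<and>
     (\<exists>C m. \<forall>\<psi>. schwartz \<psi> \<longrightarrow> cmod (u \<psi>) \<le> C * schwartz_seminorm m \<psi>)"

definition dist_of :: "('a::euclidean_space \<Rightarrow> complex) \<Rightarrow> ('a \<Rightarrow> complex) \<Rightarrow> complex" where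
  "dist_of f \<psi> = (LINT x|lebesgue. f x * \<psi> x)"

definition dilate :: "real \<Rightarrow> ('a::euclidean_space \<Rightarrow> complex) \<Rightarrow> 'a \<Rightarrow> complex" where
  "dilate t \<phi> x = (1 / t ^ DIM('a)) *\<^sub>R \<phi> ((1 / t) *\<^sub>R x)"

definition dist_conv ::
  "('a::euclidean_space \<Rightarrow> complex) \<Rightarrow> (('a \<Rightarrow> complex) \<Rightarrow> complex) \<Rightarrow> 'a \<Rightarrow> complex" where
  "dist_conv \<psi> u y = u (\<lambda>z. \<psi> (y - z))"

definition nontangential_max ::
  "('a::euclidean_space \<Rightarrow> complex) \<Rightarrow> (('a \<Rightarrow> complex) \<Rightarrow> complex) \<Rightarrow> 'a \<Rightarrow> ennreal" where
  "nontangential_max \<phi> u x =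
     (SUP t\<in>{0<..}. SUP y\<in>{y. norm (x - y) \<le> t}. ennreal (cmod (dist_conv (dilate t \<phi>) u y)))"

definition hardy_norm ::
  "('a::euclidean_space \<Rightarrow> complex) \<Rightarrow> real \<Rightarrow> (('a \<Rightarrow> complex) \<Rightarrow> complex) \<Rightarrow> ennreal" where
  "hardy_norm \<phi> p u = lp_norm p (nontangential_max \<phi> u)"

definition hardy_space ::
  "('a::euclidean_space \<Rightarrow> complex) \<Rightarrow> real \<Rightarrow> (('a \<Rightarrow> complex) \<Rightarrow> complex) set" where
  "hardy_space \<phi> p = {u. tempered u \<and> hardy_norm \<phi> p u < \<infinity>}"

text \<open>The extended operator acts on all of \<open>H\<^sup>p\<close>, whose elements need not be functions. Without the
  continuity clause an extension off the subspace \<open>H\<^sup>p \<inter> L\<^sup>2\<close> would be arbitrary; it also forces the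
  extension to depend, up to null sets, only on the values of a functional on Schwartz functions.\<close>

definition extends_bounded_Hp_Lp ::
  "('a::euclidean_space \<Rightarrow> complex) \<Rightarrow> real \<Rightarrow> (('a \<Rightarrow> complex) \<Rightarrow> 'a \<Rightarrow> ennreal) \<Rightarrow> bool" where
  "extends_bounded_Hp_Lp \<phi> p S \<longleftrightarrow>
     (\<exists>T :: (('a \<Rightarrow> complex) \<Rightarrow> complex) \<Rightarrow> 'a \<Rightarrow> real.
        (\<forall>f\<in>Lp_space 2. dist_of f \<in> hardy_space \<phi> p \<longrightarrow>
           (AE x in lebesgue. 0 \<le> T (dist_of f) x \<and> S f x = ennreal (T (dist_of f) x))) \<and>
        (\<forall>u\<in>hardy_space \<phi> p. T u \<in> Lp_space p) \<and>
        (\<exists>C::real. \<forall>u\<in>hardy_space \<phi> p. Lp_norm p (T u) \<le> ennreal C * hardy_norm \<phi> p u) \<and>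
        (\<forall>u\<in>hardy_space \<phi> p. \<forall>v. (\<forall>j::nat. v j \<in> hardy_space \<phi> p) \<longrightarrow>
           (\<lambda>j. hardy_norm \<phi> p (\<lambda>\<psi>. v j \<psi> - u \<psi>)) \<longlonglongrightarrow> 0 \<longrightarrow>
           (\<lambda>j. Lp_norm p (\<lambda>x. T (v j) x - T u x)) \<longlonglongrightarrow> 0))"

end

theory Submission
  imports Defs
begin

text \<open>Everything rests on the estimate \<open>\<integral>(S f)\<^sup>p \<le> C \<integral>N\<^sup>p\<close> for \<open>f \<in> L\<^sup>2\<close>, where \<open>N\<close> is the nontangential maximal
  function of \<open>f\<close>. Choose \<open>n / (n + \<delta>) < r < p\<close> and let \<open>M\<close> be the \<open>r\<close>-th root of the Hardy--Littlewood
  maximal function of \<open>N\<^sup>r\<close>. A molecule at scale \<open>s\<close>, that is, a function with the size and smoothness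
  of the kernels, is exhausted by subtracting its mollifications at scales decreasing geometrically;
  each mollified piece is paired with \<open>f\<close> through \<open>f * \<phi>\<^sub>t\<close>, which \<open>N\<close> controls, so that molecules of unit
  height near \<open>x\<close> pair with \<open>f\<close> to at most \<open>C s\<^sup>n M x\<close>. With this replacing atoms, a Calderon--Zygmund decomposition
  over a continuous family of balls in \<open>{M > \<alpha>}\<close> gives a distributional inequality, which is
  integrated in \<open>\<alpha>\<close>.

  Since \<open>S\<close> is sublinear, \<open>f \<mapsto> (S f)\<^sup>p\<close> is then Lipschitz from \<open>H\<^sup>p \<inter> L\<^sup>2\<close> into \<open>L\<^sup>1\<close>. It extends to the closure
  by completeness and to the rest of \<open>H\<^sup>p\<close> by a partition of unity as in Dugundji's theorem, so the density of
  \<open>L\<^sup>2\<close> in \<open>H\<^sup>p\<close> is not needed. The extended operator is the \<open>p\<close>-th root of this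
  extension, the map \<open>g \<mapsto> g\<^sup>1\<^sup>/\<^sup>p\<close> being continuous from \<open>L\<^sup>1\<close> into \<open>L\<^sup>p\<close>.\<close>

section \<open>Dyadic sums and powers of extended reals\<close>

text \<open>The obstacle is that the kernels are only Hoelder of order \<delta>, so they are not
  admissible test functions for a grand maximal function, and all that is known of f is f * \<phi>_t
  for one fixed \<phi>. Subtracting a mollification leaves a remainder that is small because of the
  Hoelder bound, but each subtraction may multiply the Hoelder constant by a factor 1 + a0, and
  pairing at a scale t below s costs (s / t)^(n (1/r - 1)). With scales s \<tau>^j the j-th term is
  of order ((1 + a0) \<tau>^\<epsilon>)^j, where \<epsilon> = \<delta> - n (1/r - 1). This
  \<epsilon> is positive exactly for r > n / (n + \<delta>), and then \<tau> can be taken so small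
  that the ratio is 1/2; r < p leaves room for the maximal theorem in L^(p/r). The continuous family
  of balls, indexed by their centres, makes the decomposition an integral: cancellation is used for
  each centre separately and Fubini replaces the bookkeeping of Whitney cubes. The operator is not
  linear, so bounded extension is not automatic. For p \<le> 1 the p-th power of the quasi-norm is a
  pseudometric, and this is why powers (S f)^p in L^1 are extended instead of S f itself.\<close>

lemma infsum_int_eq_nn_integral:
  fixes f :: "int \<Rightarrow> ennreal"
  shows "infsum f UNIV = (\<integral>\<^sup>+k. f k \<partial>count_space UNIV)"
proof (rule antisym)
  have S: "infsum f UNIV = (SUP F\<in>{F. finite F \<and> F \<subseteq> UNIV}. sum f F)"
    by (rule nonneg_infsum_complete) auto
  have fin: "sum f F = (\<integral>\<^sup>+k. f k * indicator F k \<partial>count_space UNIV)" if "finite F" for F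
    using that by (simp flip: nn_integral_count_space_indicator add: nn_integral_count_space_finite)
  show "infsum f UNIV \<le> (\<integral>\<^sup>+k. f k \<partial>count_space UNIV)"
    unfolding S by (intro SUP_least) (auto simp: fin intro!: nn_integral_mono split: split_indicator)
  have "(\<integral>\<^sup>+k. f k \<partial>count_space UNIV) = (\<integral>\<^sup>+k. (SUP n. f k * indicator {-int n..int n} k) \<partial>count_space UNIV)"
  proof (rule nn_integral_cong)
    fix k :: int
    show "f k = (SUP n. f k * indicator {-int n..int n} k)"
    proof (rule antisym)
      show "f k \<le> (SUP n. f k * indicator {-int n..int n} k)"
        by (rule SUP_upper2[of "nat \<bar>k\<bar>"]) (auto simp: indicator_def)
    qed (auto intro!: SUP_least split: split_indicator)
  qed
  also have "\<dots> = (SUP n. \<integral>\<^sup>+k. f k * indicator {-int n..int n} k \<partial>count_space UNIV)"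
    by (rule nn_integral_monotone_convergence_SUP)
       (auto simp: incseq_def le_fun_def split: split_indicator)
  also have "\<dots> \<le> infsum f UNIV"
    unfolding S by (intro SUP_least) (auto simp flip: fin intro!: SUP_upper)
  finally show "(\<integral>\<^sup>+k. f k \<partial>count_space UNIV) \<le> infsum f UNIV" .
qed

text \<open>The largest admissible index is \<open>\<lfloor>log 2 a\<rfloor>\<close>; counting
  downwards from it turns the sum into a geometric series of ratio 2^-p.\<close>

lemma nn_sum_dyadic_le:
  fixes a p :: real
  assumes "0 < a" "0 < p"
  shows "(\<integral>\<^sup>+k. ennreal (2 powr (real_of_int k * p)) * indicator {k. 2 powr real_of_int k \<le> a} k
      \<partial>count_space UNIV) \<le> ennreal (a powr p / (1 - 2 powr (-p)))"
proof -
  define m where "m = \<lfloor>log 2 a\<rfloor>"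
  have eq: "{k::int. 2 powr real_of_int k \<le> a} = {..m}"
    using assms by (auto simp: m_def le_floor_iff le_log_iff)
  have bij: "bij_betw (\<lambda>i::nat. m - int i) UNIV {..m}"
    by (rule bij_betwI[where g="\<lambda>k. nat (m - k)"]) auto
  have q: "2 powr (-p) < (1::real)" using assms by (simp add: powr_less_one)
  have sums: "(\<lambda>i::nat. 2 powr (m * p) * (2 powr (-p)) ^ i) sums (2 powr (m * p) * (1 / (1 - 2 powr (-p))))"
    using q by (intro sums_mult geometric_sums) auto
  have pw: "2 powr ((m - int i) * p) = 2 powr (m * p) * (2 powr (-p)) ^ i" for i
    by (simp add: powr_realpow[symmetric] powr_powr powr_add[symmetric] algebra_simps)
  have "(\<integral>\<^sup>+k. ennreal (2 powr (real_of_int k * p)) * indicator {k. 2 powr real_of_int k \<le> a} k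
      \<partial>count_space UNIV) = (\<integral>\<^sup>+k. ennreal (2 powr (real_of_int k * p)) \<partial>count_space {..m})"
    unfolding eq by (simp add: nn_integral_count_space_indicator)
  also have "\<dots> = (\<integral>\<^sup>+i. ennreal (2 powr (real_of_int (m - int i) * p)) \<partial>count_space UNIV)"
    by (rule nn_integral_bij_count_space[symmetric, OF bij])
  also have "\<dots> = (\<Sum>i. ennreal (2 powr (m * p) * (2 powr (-p)) ^ i))"
    unfolding pw by (rule nn_integral_count_space_nat)
  also have "\<dots> = ennreal (2 powr (m * p) * (1 / (1 - 2 powr (-p))))"
    using sums by (intro suminf_ennreal_eq) auto
  also have "\<dots> \<le> ennreal (a powr p / (1 - 2 powr (-p)))"
  proof (rule ennreal_leI)
    have "2 powr m \<le> a" using assms by (simp add: m_def le_log_iff[symmetric])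
    then have "2 powr (m * p) \<le> a powr p"
      using powr_mono2[of p "2 powr m" a] assms by (simp add: powr_powr)
    then show "2 powr (m * p) * (1 / (1 - 2 powr (-p))) \<le> a powr p / (1 - 2 powr (-p))"
      using q by (simp add: divide_right_mono)
  qed
  finally show ?thesis .
qed

lemma nn_sum_dyadic_ge:
  fixes a p :: real
  assumes "0 < a" "0 < p"
  shows "(\<integral>\<^sup>+k. ennreal (2 powr (- real_of_int k * p)) * indicator {k. a \<le> 2 powr real_of_int k} k
      \<partial>count_space UNIV) \<le> ennreal (a powr (-p) / (1 - 2 powr (-p)))"
proof -
  have bij: "bij_betw (\<lambda>k::int. -k) UNIV UNIV"
    by (rule bij_betwI[where g="\<lambda>k. -k"]) auto
  have "(\<integral>\<^sup>+k. ennreal (2 powr (- real_of_int k * p)) * indicator {k. a \<le> 2 powr real_of_int k} k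
      \<partial>count_space UNIV) = (\<integral>\<^sup>+k. ennreal (2 powr (- real_of_int (- k) * p)) * indicator {k. a \<le> 2 powr real_of_int k} (-k)
      \<partial>count_space UNIV)"
    by (rule nn_integral_bij_count_space[symmetric, OF bij])
  also have "\<dots> = (\<integral>\<^sup>+k. ennreal (2 powr (real_of_int k * p)) * indicator {k. 2 powr real_of_int k \<le> 1 / a} k
      \<partial>count_space UNIV)"
    using assms by (intro nn_integral_cong) (auto simp: powr_minus field_simps split: split_indicator)
  also have "\<dots> \<le> ennreal ((1 / a) powr p / (1 - 2 powr (-p)))"
    by (rule nn_sum_dyadic_le) (use assms in auto)
  finally show ?thesis using assms by (simp add: powr_divide powr_minus_divide)
qed

lemma ex_dyadic:
  fixes x :: real assumes "0 < x"
  shows "\<exists>k::int. 2 powr k < x \<and> x \<le> 2 powr (k + 1)"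
proof -
  define k where "k = \<lceil>log 2 x\<rceil> - 1"
  have "real_of_int k < log 2 x" "log 2 x \<le> real_of_int k + 1" unfolding k_def by linarith+
  then show ?thesis using assms by (intro exI[of _ k]) (auto simp: less_log_iff log_le_iff)
qed

section \<open>Powers of extended nonnegative reals and dyadic layer cakes\<close>

lemma ennpowr_ennreal [simp]: "0 \<le> a \<Longrightarrow> ennpowr (ennreal a) p = ennreal (a powr p)"
  by (simp add: ennpowr_def)

lemma ennpowr_top [simp]: "ennpowr top p = top"
  by (simp add: ennpowr_def)

lemma ennpowr_0 [simp]: "ennpowr 0 p = 0"
  by (simp add: ennpowr_def)

lemma ennpowr_measurable [measurable]: "(\<lambda>x. ennpowr x p) \<in> borel_measurable borel"
  unfolding ennpowr_def by measurable

lemma ennpowr_mono: "0 \<le> p \<Longrightarrow> a \<le> b \<Longrightarrow> ennpowr a p \<le> ennpowr b p"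
  by (cases a; cases b) (auto simp: powr_mono2 top_unique)

lemma ennpowr_ennpowr: "0 < p \<Longrightarrow> 0 < q \<Longrightarrow> ennpowr (ennpowr a p) q = ennpowr a (p * q)"
  by (cases a) (auto simp: powr_powr)

lemma ennpowr_1 [simp]: "ennpowr a 1 = a"
  by (cases a) auto

lemma ennpowr_eq_0_iff [simp]: "ennpowr a p = 0 \<longleftrightarrow> a = 0"
  by (cases a) (auto simp: )

lemma ennpowr_eq_top_iff [simp]: "ennpowr a p = top \<longleftrightarrow> a = top"
  by (cases a) (auto simp: )

lemma ennpowr_mult: "0 < p \<Longrightarrow> ennpowr (a * b) p = ennpowr a p * ennpowr b p"
  by (cases a; cases b) (auto simp: powr_mult ennreal_mult[symmetric] ennreal_mult_top ennreal_top_mult split: if_splits)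

lemma ennpowr_le_iff: "0 < p \<Longrightarrow> ennpowr a p \<le> ennpowr b p \<longleftrightarrow> a \<le> b"
  using ennpowr_mono[of "1/p" "ennpowr a p" "ennpowr b p"] ennpowr_mono[of p a b]
  by (auto simp: ennpowr_ennpowr)

lemma powr_add_le_real:
  fixes a b p :: real assumes "0 \<le> a" "0 \<le> b" "0 < p" "p \<le> 1"
  shows "(a + b) powr p \<le> a powr p + b powr p"
proof (cases "a + b = 0")
  case True then show ?thesis using assms by simp
next
  case False
  then have s: "a + b > 0" using assms by linarith
  have *: "x \<le> x powr p" if "0 \<le> x" "x \<le> 1" for x :: real
    using powr_mono'[of p 1 x] that assms by (cases "x = 0") auto
  have "1 = a/(a+b) + b/(a+b)" using s by (simp add: add_divide_distrib[symmetric])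
  also have "\<dots> \<le> (a/(a+b)) powr p + (b/(a+b)) powr p"
    using assms s by (intro add_mono *) auto
  also have "\<dots> = (a powr p + b powr p) / (a+b) powr p"
    using assms s by (simp add: powr_divide add_divide_distrib)
  finally show ?thesis using s by (simp add: field_simps)
qed

lemma ennpowr_add_le:
  "0 < p \<Longrightarrow> p \<le> 1 \<Longrightarrow> ennpowr (a + b) p \<le> ennpowr a p + ennpowr b p"
  by (cases a; cases b) (auto simp: powr_add_le_real ennreal_plus[symmetric] simp del: ennreal_plus)

text \<open>A discrete layer cake formula: the term of the largest k with 2^k < h already dominates
  h^p, hence the exponent k + 1. The strict inequality matches the open level sets of maximal
  functions.\<close>

lemma ennpowr_le_dyadic_sum:
  assumes p: "0 < p"
  shows "ennpowr h p \<le> (\<integral>\<^sup>+k. ennreal (2 powr (real_of_int (k + 1) * p)) * indicator {k. ennreal (2 powr real_of_int k) < h} k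
      \<partial>count_space UNIV)" (is "_ \<le> ?R")
proof (cases h)
  case (real x)
  show ?thesis
  proof (cases "x = 0")
    case True with real show ?thesis by simp
  next
    case False
    then obtain k :: int where k: "2 powr k < x" "x \<le> 2 powr (k + 1)" using ex_dyadic[of x] real by auto
    have "ennpowr h p \<le> ennreal (2 powr (real_of_int (k + 1) * p))"
      using k real p powr_mono2[of p x "2 powr (k + 1)"] by (auto simp: powr_powr intro!: ennreal_leI)
    also have "\<dots> = (\<integral>\<^sup>+j. ennreal (2 powr (real_of_int (j + 1) * p)) * indicator {k} j \<partial>count_space UNIV)"
      by (simp flip: nn_integral_count_space_indicator add: nn_integral_count_space_finite)
    also have "\<dots> \<le> ?R"
      using k real by (intro nn_integral_mono) (auto split: split_indicator simp: ennreal_less_iff)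
    finally show ?thesis .
  qed
next
  case top
  \<comment> \<open>For infinite h every term with k \<ge> 0 is at least 1, so the sum exceeds every
    natural number.\<close>
  have lb: "ennreal (real m) \<le> ?R" for m :: nat
  proof -
    have "ennreal (real m) = (\<integral>\<^sup>+j. indicator {0..<int m} j \<partial>count_space UNIV)"
      by (simp add: emeasure_count_space_finite ennreal_of_nat_eq_real_of_nat)
    also have "\<dots> \<le> ?R"
    proof (intro nn_integral_mono)
      fix j :: int
      have "1 \<le> 2 powr ((j + 1) * p)" if "0 \<le> j" using that p by (simp add: ge_one_powr_ge_zero)
      then show "indicator {0..<int m} j \<le> ennreal (2 powr (real_of_int (j + 1) * p)) * indicator {k. ennreal (2 powr real_of_int k) < h} j"
        using top by (auto split: split_indicator simp: ennreal_ge_1)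
    qed
    finally show ?thesis .
  qed
  have "?R = top"
  proof (rule ccontr)
    assume "?R \<noteq> top"
    then obtain m :: nat where "?R < of_nat m"
      using ennreal_Ex_less_of_nat[of ?R] by (auto simp: less_top)
    with lb[of m] show False by (simp add: ennreal_of_nat_eq_real_of_nat)
  qed
  then show ?thesis by simp
qed

lemma dyadic_sum_le_ennpowr:
  assumes p: "0 < p"
  shows "(\<integral>\<^sup>+k. ennreal (2 powr (real_of_int k * p)) * indicator {k. ennreal (2 powr real_of_int k) < h} k
      \<partial>count_space UNIV) \<le> ennreal (1 / (1 - 2 powr (-p))) * ennpowr h p"
proof -
  have q: "2 powr (-p) < (1::real)" using p by (simp add: powr_less_one)
  show ?thesis
  proof (cases h)
    case (real x)
    show ?thesis
    proof (cases "x = 0")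
      case True with real show ?thesis by (simp add: ennreal_less_iff)
    next
      case False
      have "(\<integral>\<^sup>+k. ennreal (2 powr (real_of_int k * p)) * indicator {k. ennreal (2 powr real_of_int k) < h} k \<partial>count_space UNIV)
        \<le> (\<integral>\<^sup>+k. ennreal (2 powr (real_of_int k * p)) * indicator {k. 2 powr real_of_int k \<le> x} k \<partial>count_space UNIV)"
        using real by (intro nn_integral_mono) (auto split: split_indicator simp: ennreal_less_iff)
      also have "\<dots> \<le> ennreal (x powr p / (1 - 2 powr (-p)))"
        using False real p by (intro nn_sum_dyadic_le) auto
      finally show ?thesis using real q by (simp add: ennreal_mult[symmetric])
    qed
  next
    case top with q p show ?thesis by (simp add: ennreal_mult_top)
  qed
qed

text \<open>Used with exponent 2 - p for the L^2 mass of f outside the level sets.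
  \<open>ennpowr\<close> sends infinity to infinity for negative exponents too, so the bound is
  trivial when h is infinite.\<close>

lemma dyadic_tail_sum_le_ennpowr:
  assumes p: "0 < p" and h: "h \<noteq> 0"
  shows "(\<integral>\<^sup>+k. ennreal (2 powr (- real_of_int k * p)) * indicator {k. h \<le> ennreal (2 powr real_of_int k)} k
      \<partial>count_space UNIV) \<le> ennreal (1 / (1 - 2 powr (-p))) * ennpowr h (-p)"
proof -
  have q: "2 powr (-p) < (1::real)" using p by (simp add: powr_less_one)
  show ?thesis
  proof (cases h)
    case (real x)
    then have "x > 0" using h by auto
    have "(\<integral>\<^sup>+k. ennreal (2 powr (- real_of_int k * p)) * indicator {k. h \<le> ennreal (2 powr real_of_int k)} k \<partial>count_space UNIV)
        \<le> (\<integral>\<^sup>+k. ennreal (2 powr (- real_of_int k * p)) * indicator {k. x \<le> 2 powr real_of_int k} k \<partial>count_space UNIV)"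
      using real by (intro nn_integral_mono) (auto split: split_indicator simp: ennreal_le_iff)
    also have "\<dots> \<le> ennreal (x powr (-p) / (1 - 2 powr (-p)))"
      using \<open>x > 0\<close> p by (intro nn_sum_dyadic_ge) auto
    finally show ?thesis using real q by (simp add: ennreal_mult[symmetric])
  next
    case top
    have "ennreal (1 / (1 - 2 powr (-p))) * ennpowr h (-p) = top"
      using q p by (simp add: top ennreal_mult_top)
    then show ?thesis by simp
  qed
qed

section \<open>The Hardy--Littlewood maximal function\<close>

text \<open>The uncentred maximal operator, so that superlevel sets are unions of open balls.
  Averages are normalised by the power of the radius instead of the volume; the factor
  \<open>unit_ball_vol\<close> reappears in the constants.\<close>

definition hl :: "('a::euclidean_space \<Rightarrow> ennreal) \<Rightarrow> 'a \<Rightarrow> ennreal" where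
  "hl g x = (SUP B\<in>{B. 0 < snd B \<and> x \<in> ball (fst B) (snd B)}.
     (\<integral>\<^sup>+y\<in>ball (fst B) (snd B). g y \<partial>lebesgue) / ennreal (snd B ^ DIM('a)))"

lemma ball_lebesgue [measurable]: "ball c r \<in> sets lebesgue"
  by simp

lemma ennreal_divide_le_iff':
  assumes "0 < c" shows "a / ennreal c \<le> h \<longleftrightarrow> a \<le> ennreal c * h"
  using assms by (cases a; cases h)
    (auto simp: divide_ennreal ennreal_mult[symmetric] ennreal_le_iff field_simps ennreal_mult_top ennreal_top_divide top_unique ennreal_mult_eq_top_iff)

lemma hl_ge_ball:
  fixes g :: "'a::euclidean_space \<Rightarrow> ennreal"
  assumes "0 < R" "x \<in> ball c R"
  shows "(\<integral>\<^sup>+y\<in>ball c R. g y \<partial>lebesgue) \<le> ennreal (R ^ DIM('a)) * hl g x"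
proof -
  have "(\<integral>\<^sup>+y\<in>ball c R. g y \<partial>lebesgue) / ennreal (R ^ DIM('a)) \<le> hl g x"
    unfolding hl_def using assms by (intro SUP_upper2[of "(c, R)"]) auto
  then show ?thesis using assms by (simp add: ennreal_divide_le_iff')
qed

lemma open_hl_greater: "open {x. t < hl g x}"
proof -
  have "{x. t < hl g x} = (\<Union>B\<in>{B. 0 < snd B \<and> t < (\<integral>\<^sup>+y\<in>ball (fst B) (snd B). g y \<partial>lebesgue) / ennreal (snd B ^ DIM('a))}.
    ball (fst B) (snd B))"
    unfolding hl_def by (intro set_eqI) (simp add: less_SUP_iff, blast)
  then show ?thesis by auto
qed

lemma hl_measurable [measurable]: "hl g \<in> borel_measurable borel"
  by (rule borel_measurableI_greater) (auto intro!: borel_open simp: open_hl_greater)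

lemma hl_measurable_lebesgue [measurable]: "hl g \<in> borel_measurable lebesgue"
  using hl_measurable[of g] by (simp add: measurable_completion)

text \<open>The Vitali selection of disjoint balls whose fivefold dilates cover the level set gives
  the factor 5^n. If the integral is infinite there is nothing to prove; otherwise it bounds the
  radii, as the covering lemma demands.\<close>

lemma hl_weak:
  fixes g :: "'a::euclidean_space \<Rightarrow> ennreal"
  assumes g [measurable]: "g \<in> borel_measurable lebesgue" and t: "0 < t"
  shows "emeasure lebesgue {x. ennreal t < hl g x} \<le>
    ennreal (unit_ball_vol (real DIM('a)) * 5 ^ DIM('a) / t) * (\<integral>\<^sup>+x. g x \<partial>lebesgue)"
proof (cases "(\<integral>\<^sup>+x. g x \<partial>lebesgue) = top")
  case True
  have "unit_ball_vol (real DIM('a)) > 0" by simp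
  then have "0 < unit_ball_vol (real DIM('a)) * 5 ^ DIM('a) / t" using t by simp
  then have "ennreal (unit_ball_vol (real DIM('a)) * 5 ^ DIM('a) / t) \<noteq> 0" by (simp only: ennreal_eq_0_iff not_le)
  then show ?thesis by (simp only: True ennreal_mult_top) simp
next
  case False
  let ?n = "DIM('a)" and ?v = "unit_ball_vol (real DIM('a))"
  define I where "I = enn2real (\<integral>\<^sup>+x. g x \<partial>lebesgue)"
  have I: "(\<integral>\<^sup>+x. g x \<partial>lebesgue) = ennreal I" "0 \<le> I" using False by (auto simp: I_def less_top)
  define K where "K = {B :: 'a \<times> real. 0 < snd B \<and>
    ennreal t < (\<integral>\<^sup>+y\<in>ball (fst B) (snd B). g y \<partial>lebesgue) / ennreal (snd B ^ ?n)}"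
  have eq: "{x. ennreal t < hl g x} = (\<Union>B\<in>K. ball (fst B) (snd B))"
    unfolding hl_def K_def by (intro set_eqI) (simp add: less_SUP_iff, blast)
  have small: "ennreal (snd B ^ ?n) \<le> ennreal (1 / t) * (\<integral>\<^sup>+y\<in>ball (fst B) (snd B). g y \<partial>lebesgue)"
    if "B \<in> K" for B
  proof -
    let ?J = "\<integral>\<^sup>+y\<in>ball (fst B) (snd B). g y \<partial>lebesgue"
    have "ennreal t * ennreal (snd B ^ ?n) \<le> ?J"
      using that ennreal_divide_le_iff'[of "snd B ^ ?n" ?J "ennreal t"]
      by (auto simp: K_def not_le mult.commute)
    then have "ennreal (1 / t) * (ennreal t * ennreal (snd B ^ ?n)) \<le> ennreal (1 / t) * ?J"
      by (rule mult_left_mono) auto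
    then show ?thesis using t that by (simp add: K_def ennreal_mult[symmetric] mult.assoc[symmetric])
  qed
  have bd: "0 < snd B \<and> snd B \<le> max 1 (I / t)" if "B \<in> K" for B
  proof -
    have "(\<integral>\<^sup>+y\<in>ball (fst B) (snd B). g y \<partial>lebesgue) \<le> ennreal I"
      unfolding I(1)[symmetric] by (intro nn_integral_mono) (auto split: split_indicator)
    then have "ennreal (1 / t) * (\<integral>\<^sup>+y\<in>ball (fst B) (snd B). g y \<partial>lebesgue) \<le> ennreal (1 / t) * ennreal I"
      by (rule mult_left_mono) auto
    then have "ennreal (snd B ^ ?n) \<le> ennreal (1 / t) * ennreal I"
      by (rule order_trans[OF small[OF that]])
    also have "\<dots> = ennreal (I / t)" using t I(2) by (simp add: ennreal_mult[symmetric])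
    finally have le: "snd B ^ ?n \<le> I / t" using t I(2) by (subst (asm) ennreal_le_iff) auto
    have pos: "0 < snd B" using that by (simp add: K_def)
    show ?thesis
    proof (cases "snd B \<le> 1")
      case False
      \<comment> \<open>A radius above 1 is at most its n-th power, hence at most I / t; this
        explains the bound max 1 (I / t).\<close>
      then have "snd B ^ 1 \<le> snd B ^ ?n" by (intro power_increasing) (auto simp: Suc_le_eq)
      with le pos show ?thesis by auto
    qed (use pos in auto)
  qed
  obtain C where C: "countable C" "C \<subseteq> K"
     "pairwise (\<lambda>i j. disjnt (ball (fst i) (snd i)) (ball (fst j) (snd j))) C"
     "(\<Union>B\<in>K. ball (fst B) (snd B)) \<subseteq> (\<Union>i\<in>C. ball (fst i) (5 * snd i))"
    by (rule Vitali_covering_lemma_balls[where S="\<Union>B\<in>K. ball (fst B) (snd B)" and a=fst and r=snd and K=K and B="max 1 (I / t)"])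
       (use bd in auto)
  have "emeasure lebesgue {x. ennreal t < hl g x} = (\<integral>\<^sup>+x. indicator {x. ennreal t < hl g x} x \<partial>lebesgue)"
    by simp
  also have "\<dots> \<le> (\<integral>\<^sup>+x. \<integral>\<^sup>+i. indicator (ball (fst i) (5 * snd i)) x \<partial>count_space C \<partial>lebesgue)"
  proof (rule nn_integral_mono)
    fix x
    show "indicator {x. ennreal t < hl g x} x \<le> (\<integral>\<^sup>+i. indicator (ball (fst i) (5 * snd i)) x \<partial>count_space C :: ennreal)"
    proof (cases "ennreal t < hl g x")
      case True
      with C(4) eq obtain i where i: "i \<in> C" "x \<in> ball (fst i) (5 * snd i)" by blast
      have "(\<integral>\<^sup>+j. indicator {i} j \<partial>count_space C) \<le> (\<integral>\<^sup>+i. indicator (ball (fst i) (5 * snd i)) x \<partial>count_space C :: ennreal)"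
        using i by (intro nn_integral_mono) (auto split: split_indicator)
      moreover have "(\<integral>\<^sup>+j. indicator {i} j \<partial>count_space C) = (1 :: ennreal)"
        using i by (simp add: emeasure_count_space_finite)
      ultimately show ?thesis using True by simp
    qed auto
  qed
  also have "\<dots> = (\<integral>\<^sup>+i. \<integral>\<^sup>+x. indicator (ball (fst i) (5 * snd i)) x \<partial>lebesgue \<partial>count_space C)"
    by (rule nn_integral_count_space_nn_integral) (use C in \<open>auto intro!: borel_measurable_indicator\<close>)
  also have "\<dots> \<le> (\<integral>\<^sup>+i. \<integral>\<^sup>+x. ennreal (?v * 5 ^ ?n / t) * (g x * indicator (ball (fst i) (snd i)) x) \<partial>lebesgue \<partial>count_space C)"
  proof (rule nn_integral_mono)
    fix i assume "i \<in> space (count_space C)"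
    then have i: "i \<in> K" using C by auto
    then have pos: "0 < snd i" by (simp add: K_def)
    have "(\<integral>\<^sup>+x. indicator (ball (fst i) (5 * snd i)) x \<partial>lebesgue) = ennreal (?v * 5 ^ ?n) * ennreal (snd i ^ ?n)"
      using pos by (simp add: emeasure_ball power_mult_distrib ennreal_mult[symmetric] mult.assoc)
    also have "\<dots> \<le> ennreal (?v * 5 ^ ?n) * (ennreal (1 / t) * (\<integral>\<^sup>+y\<in>ball (fst i) (snd i). g y \<partial>lebesgue))"
      by (intro mult_left_mono small i) auto
    also have "\<dots> = (\<integral>\<^sup>+x. ennreal (?v * 5 ^ ?n / t) * (g x * indicator (ball (fst i) (snd i)) x) \<partial>lebesgue)"
      using t by (subst nn_integral_cmult) (auto simp: mult.assoc[symmetric] ennreal_mult[symmetric])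
    finally show "(\<integral>\<^sup>+x. indicator (ball (fst i) (5 * snd i)) x \<partial>lebesgue) \<le> \<dots>" .
  qed
  also have "\<dots> = (\<integral>\<^sup>+x. \<integral>\<^sup>+i. ennreal (?v * 5 ^ ?n / t) * (g x * indicator (ball (fst i) (snd i)) x) \<partial>count_space C \<partial>lebesgue)"
    by (rule nn_integral_count_space_nn_integral[symmetric]) (use C in auto)
  also have "\<dots> \<le> (\<integral>\<^sup>+x. ennreal (?v * 5 ^ ?n / t) * g x \<partial>lebesgue)"
  proof (rule nn_integral_mono)
    fix x
    \<comment> \<open>By disjointness at most one selected ball contains x, so the indicators add up
      to at most 1.\<close>
    have sub: "\<exists>j. {i \<in> C. x \<in> ball (fst i) (snd i)} \<subseteq> {j}"
    proof (cases "\<exists>j\<in>C. x \<in> ball (fst j) (snd j)")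
      case True
      then obtain j where j: "j \<in> C" "x \<in> ball (fst j) (snd j)" by auto
      have "i = j" if "i \<in> C" "x \<in> ball (fst i) (snd i)" for i
        using C(3) j that unfolding pairwise_def disjnt_def by blast
      then show ?thesis by (intro exI[of _ j]) auto
    qed auto
    then obtain j where j: "{i \<in> C. x \<in> ball (fst i) (snd i)} \<subseteq> {j}" by auto
    have "(\<integral>\<^sup>+i. indicator (ball (fst i) (snd i)) x \<partial>count_space C :: ennreal) = (\<integral>\<^sup>+i. indicator {i \<in> C. x \<in> ball (fst i) (snd i)} i \<partial>count_space C)"
      by (intro nn_integral_cong) (auto split: split_indicator)
    also have "\<dots> = emeasure (count_space C) {i \<in> C. x \<in> ball (fst i) (snd i)}"
      by simp
    also have "\<dots> = of_nat (card {i \<in> C. x \<in> ball (fst i) (snd i)})"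
      by (rule emeasure_count_space_finite) (use j finite_subset in auto)
    also have "\<dots> \<le> 1" using card_mono[OF _ j] by simp
    finally have le: "(\<integral>\<^sup>+i. indicator (ball (fst i) (snd i)) x \<partial>count_space C :: ennreal) \<le> 1" .
    have "(\<integral>\<^sup>+i. ennreal (?v * 5 ^ ?n / t) * (g x * indicator (ball (fst i) (snd i)) x) \<partial>count_space C)
      = ennreal (?v * 5 ^ ?n / t) * (g x * (\<integral>\<^sup>+i. indicator (ball (fst i) (snd i)) x \<partial>count_space C))"
      by (simp only: nn_integral_cmult borel_measurable_count_space)
    also have "\<dots> \<le> ennreal (?v * 5 ^ ?n / t) * (g x * 1)"
      by (intro mult_left_mono le) auto
    finally show "(\<integral>\<^sup>+i. ennreal (?v * 5 ^ ?n / t) * (g x * indicator (ball (fst i) (snd i)) x) \<partial>count_space C)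
      \<le> ennreal (?v * 5 ^ ?n / t) * g x" by simp
  qed
  also have "\<dots> = ennreal (?v * 5 ^ ?n / t) * (\<integral>\<^sup>+x. g x \<partial>lebesgue)"
    by (rule nn_integral_cmult) auto
  finally show ?thesis .
qed

text \<open>The part of g below t / (2v), with v the volume of the unit ball, contributes at most t
  / 2 to the maximal function, because of the normalisation by the power of the radius. Only the
  part above that height enters the weak type bound, at level t / 2.\<close>

lemma hl_weak_truncated:
  fixes g :: "'a::euclidean_space \<Rightarrow> ennreal"
  assumes g [measurable]: "g \<in> borel_measurable lebesgue" and t: "0 < t"
  shows "emeasure lebesgue {x. ennreal t < hl g x} \<le>
    ennreal (2 * unit_ball_vol (real DIM('a)) * 5 ^ DIM('a) / t) *
    (\<integral>\<^sup>+x. g x * indicator {x. ennreal (t / (2 * unit_ball_vol (real DIM('a)))) < g x} x \<partial>lebesgue)"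
proof -
  let ?n = "DIM('a)" and ?v = "unit_ball_vol (real DIM('a))"
  have v: "?v > 0" by simp
  define g1 where "g1 = (\<lambda>x. g x * indicator {x. ennreal (t / (2 * ?v)) < g x} x)"
  have g1 [measurable]: "g1 \<in> borel_measurable lebesgue" unfolding g1_def by measurable
  have gle: "g x \<le> g1 x + ennreal (t / (2 * ?v))" for x
    unfolding g1_def by (auto split: split_indicator)
  have "hl g x \<le> hl g1 x + ennreal (t / 2)" for x
    unfolding hl_def[of g]
  proof (rule SUP_least)
    fix B :: "'a \<times> real" assume B: "B \<in> {B. 0 < snd B \<and> x \<in> ball (fst B) (snd B)}"
    let ?B = "ball (fst B) (snd B)"
    have [measurable]: "?B \<in> sets lebesgue" by simp
    have pos: "0 < snd B" using B by auto
    have "(\<integral>\<^sup>+y\<in>?B. g y \<partial>lebesgue) \<le> (\<integral>\<^sup>+y. g1 y * indicator ?B y + ennreal (t / (2 * ?v)) * indicator ?B y \<partial>lebesgue)"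
      using gle by (intro nn_integral_mono) (auto split: split_indicator)
    also have "\<dots> = (\<integral>\<^sup>+y\<in>?B. g1 y \<partial>lebesgue) + ennreal (t / (2 * ?v)) * emeasure lebesgue ?B"
      by (subst nn_integral_add) (auto simp: nn_integral_cmult_indicator)
    also have "\<dots> \<le> ennreal (snd B ^ ?n) * hl g1 x + ennreal (snd B ^ ?n) * ennreal (t / 2)"
      using B pos t v by (intro add_mono hl_ge_ball) (auto simp: emeasure_ball ennreal_mult[symmetric] field_simps)
    finally have *: "(\<integral>\<^sup>+y\<in>?B. g y \<partial>lebesgue) \<le> ennreal (snd B ^ ?n) * (hl g1 x + ennreal (t / 2))"
      by (simp add: distrib_left)
    show "(\<integral>\<^sup>+y\<in>?B. g y \<partial>lebesgue) / ennreal (snd B ^ ?n) \<le> hl g1 x + ennreal (t / 2)"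
      using pos by (intro divide_le_posI_ennreal *) auto
  qed
  moreover have "ennreal t = ennreal (t / 2) + ennreal (t / 2)" using t by (simp flip: ennreal_plus)
  ultimately have sub: "{x. ennreal t < hl g x} \<subseteq> {x. ennreal (t / 2) < hl g1 x}"
    by (smt (verit) Collect_mono_iff add_right_mono leD le_less_linear order.trans)
  have "emeasure lebesgue {x. ennreal t < hl g x} \<le> emeasure lebesgue {x. ennreal (t / 2) < hl g1 x}"
    by (rule emeasure_mono[OF sub]) (auto intro: borel_open simp: open_hl_greater)
  also have "\<dots> \<le> ennreal (?v * 5 ^ ?n / (t / 2)) * (\<integral>\<^sup>+x. g1 x \<partial>lebesgue)"
    by (rule hl_weak) (use t in auto)
  finally show ?thesis unfolding g1_def by (simp add: mult.commute mult.left_commute)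
qed

text \<open>Marcinkiewicz interpolation over dyadic levels: after exchanging sum and integral, g x
  meets the sum of 2^(k (q - 1)) over 2^k < 2 v g x, which is at most a multiple of (g x)^(q -
  1).\<close>

lemma hl_strong:
  fixes q :: real
  assumes q: "1 < q"
  shows "\<exists>C>0. \<forall>g::'a::euclidean_space \<Rightarrow> ennreal. g \<in> borel_measurable lebesgue \<longrightarrow>
    (\<integral>\<^sup>+x. ennpowr (hl g x) q \<partial>lebesgue) \<le> ennreal C * (\<integral>\<^sup>+x. ennpowr (g x) q \<partial>lebesgue)"
proof -
  let ?n = "DIM('a)" and ?v = "unit_ball_vol (real DIM('a))"
  define C0 where "C0 = 2 * ?v * 5 ^ ?n"
  define C1 where "C1 = 1 / (1 - 2 powr (-(q-1)))"
  define C where "C = 2 powr q * C0 * C1 * (2 * ?v) powr (q - 1)"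
  have v: "?v > 0" by simp
  have "2 powr (-(q-1)) < (1::real)" using q by (intro powr_less_one) auto
  then have C1: "C1 > 0" by (simp add: C1_def)
  have C0: "C0 > 0" by (simp add: C0_def)
  have C: "C > 0" unfolding C_def using C0 C1 v by (intro mult_pos_pos) (auto simp: less_imp_neq[THEN not_sym])
  have "(\<integral>\<^sup>+x. ennpowr (hl g x) q \<partial>lebesgue) \<le> ennreal C * (\<integral>\<^sup>+x. ennpowr (g x) q \<partial>lebesgue)"
    if g [measurable]: "g \<in> borel_measurable lebesgue" for g :: "'a \<Rightarrow> ennreal"
  proof -
    have "(\<integral>\<^sup>+x. ennpowr (hl g x) q \<partial>lebesgue) \<le>
       (\<integral>\<^sup>+x. (\<integral>\<^sup>+k. ennreal (2 powr (real_of_int (k + 1) * q)) * indicator {k. ennreal (2 powr real_of_int k) < hl g x} k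
      \<partial>count_space UNIV) \<partial>lebesgue)"
      using q by (intro nn_integral_mono ennpowr_le_dyadic_sum) auto
    also have "\<dots> = (\<integral>\<^sup>+x. (\<integral>\<^sup>+k. ennreal (2 powr (real_of_int (k + 1) * q)) * indicator {x. ennreal (2 powr real_of_int k) < hl g x} x
      \<partial>count_space UNIV) \<partial>lebesgue)"
      by (simp add: indicator_def)
    also have "\<dots> = (\<integral>\<^sup>+k. (\<integral>\<^sup>+x. ennreal (2 powr (real_of_int (k + 1) * q)) * indicator {x. ennreal (2 powr real_of_int k) < hl g x} x
      \<partial>lebesgue) \<partial>count_space UNIV)"
      by (rule nn_integral_count_space_nn_integral) auto
    also have "\<dots> = (\<integral>\<^sup>+k. ennreal (2 powr (real_of_int (k + 1) * q)) * emeasure lebesgue {x. ennreal (2 powr real_of_int k) < hl g x} \<partial>count_space UNIV)"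
      by (intro nn_integral_cong nn_integral_cmult_indicator) (auto intro: borel_open simp: open_hl_greater)
    also have "\<dots> \<le> (\<integral>\<^sup>+k. ennreal (2 powr (real_of_int (k + 1) * q)) * (ennreal (C0 / 2 powr real_of_int k) *
        (\<integral>\<^sup>+x. g x * indicator {x. ennreal (2 powr real_of_int k / (2 * ?v)) < g x} x \<partial>lebesgue)) \<partial>count_space UNIV)"
      unfolding C0_def by (intro nn_integral_mono mult_left_mono hl_weak_truncated) auto
    also have "\<dots> = (\<integral>\<^sup>+k. (\<integral>\<^sup>+x. ennreal (2 powr q * C0) * (g x * (ennreal (2 powr (real_of_int k * (q - 1))) *
          indicator {k. ennreal (2 powr real_of_int k) < ennreal (2 * ?v) * g x} k)) \<partial>lebesgue) \<partial>count_space UNIV)"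
    proof (rule nn_integral_cong)
      fix k :: int
      have ind: "ennreal (2 powr real_of_int k / (2 * ?v)) < g x \<longleftrightarrow> ennreal (2 powr real_of_int k) < ennreal (2 * ?v) * g x" for x
        using v by (cases "g x") (auto simp: ennreal_less_iff ennreal_mult[symmetric] field_simps ennreal_mult_eq_top_iff ennreal_top_mult less_imp_neq[THEN not_sym])
      have c: "2 powr (real_of_int (k + 1) * q) * (C0 / 2 powr real_of_int k) = 2 powr q * C0 * 2 powr (real_of_int k * (q - 1))"
        by (simp add: algebra_simps powr_add powr_diff)
      have "ennreal (2 powr (real_of_int (k + 1) * q)) * (ennreal (C0 / 2 powr real_of_int k) *
        (\<integral>\<^sup>+x. g x * indicator {x. ennreal (2 powr real_of_int k / (2 * ?v)) < g x} x \<partial>lebesgue))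
        = ennreal (2 powr q * C0 * 2 powr (real_of_int k * (q - 1))) *
        (\<integral>\<^sup>+x. g x * indicator {x. ennreal (2 powr real_of_int k / (2 * ?v)) < g x} x \<partial>lebesgue)"
        using C0 by (subst c[symmetric], subst ennreal_mult) (auto simp: mult.assoc)
      also have "\<dots> = (\<integral>\<^sup>+x. ennreal (2 powr q * C0 * 2 powr (real_of_int k * (q - 1))) *
        (g x * indicator {x. ennreal (2 powr real_of_int k / (2 * ?v)) < g x} x) \<partial>lebesgue)"
        by (rule nn_integral_cmult[symmetric]) auto
      also have "\<dots> = (\<integral>\<^sup>+x. ennreal (2 powr q * C0) * (g x * (ennreal (2 powr (real_of_int k * (q - 1))) *
          indicator {k. ennreal (2 powr real_of_int k) < ennreal (2 * ?v) * g x} k)) \<partial>lebesgue)"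
      proof (rule nn_integral_cong)
        fix x
        have indeq: "(indicator {x. ennreal (2 powr real_of_int k / (2 * ?v)) < g x} x :: ennreal)
          = indicator {k. ennreal (2 powr real_of_int k) < ennreal (2 * ?v) * g x} k"
          by (simp only: indicator_def mem_Collect_eq ind)
        show "ennreal (2 powr q * C0 * 2 powr (real_of_int k * (q - 1))) *
          (g x * indicator {x. ennreal (2 powr real_of_int k / (2 * ?v)) < g x} x) =
          ennreal (2 powr q * C0) * (g x * (ennreal (2 powr (real_of_int k * (q - 1))) *
          indicator {k. ennreal (2 powr real_of_int k) < ennreal (2 * ?v) * g x} k))"
          unfolding indeq using C0 by (subst ennreal_mult) (auto simp: mult_ac)
      qed
      finally show "ennreal (2 powr (real_of_int (k + 1) * q)) * (ennreal (C0 / 2 powr real_of_int k) *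
        (\<integral>\<^sup>+x. g x * indicator {x. ennreal (2 powr real_of_int k / (2 * ?v)) < g x} x \<partial>lebesgue)) = \<dots>" .
    qed
    also have "\<dots> = (\<integral>\<^sup>+x. (\<integral>\<^sup>+k. ennreal (2 powr q * C0) * (g x * (ennreal (2 powr (real_of_int k * (q - 1))) *
          indicator {k. ennreal (2 powr real_of_int k) < ennreal (2 * ?v) * g x} k)) \<partial>count_space UNIV) \<partial>lebesgue)"
      by (rule nn_integral_count_space_nn_integral[symmetric]) (auto simp: indicator_def)
    also have "\<dots> = (\<integral>\<^sup>+x. ennreal (2 powr q * C0) * (g x * (\<integral>\<^sup>+k. ennreal (2 powr (real_of_int k * (q - 1))) *
          indicator {k. ennreal (2 powr real_of_int k) < ennreal (2 * ?v) * g x} k \<partial>count_space UNIV)) \<partial>lebesgue)"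
      by (simp add: nn_integral_cmult)
    also have "\<dots> \<le> (\<integral>\<^sup>+x. ennreal (2 powr q * C0) * (g x * (ennreal C1 * ennpowr (ennreal (2 * ?v) * g x) (q - 1))) \<partial>lebesgue)"
      unfolding C1_def using q by (intro nn_integral_mono mult_left_mono dyadic_sum_le_ennpowr) auto
    also have "\<dots> = (\<integral>\<^sup>+x. ennreal C * ennpowr (g x) q \<partial>lebesgue)"
    proof (rule nn_integral_cong)
      fix x
      have "g x * ennpowr (g x) (q - 1) = ennpowr (g x) q"
      proof (cases "g x")
        case (real r)
        then show ?thesis by (cases "r = 0") (auto simp: ennreal_mult[symmetric] powr_diff)
      qed auto
      moreover have "ennpowr (ennreal (2 * ?v) * g x) (q - 1) = ennreal ((2 * ?v) powr (q - 1)) * ennpowr (g x) (q - 1)"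
        using q v by (subst ennpowr_mult) (auto simp del: ennreal_mult')
      moreover have "ennreal C = ennreal (2 powr q * C0) * (ennreal C1 * ennreal ((2 * ?v) powr (q - 1)))"
        using C0 C1 unfolding C_def by (simp only: ennreal_mult[symmetric] mult.assoc powr_ge_zero mult_nonneg_nonneg less_imp_le)
      ultimately show "ennreal (2 powr q * C0) * (g x * (ennreal C1 * ennpowr (ennreal (2 * ?v) * g x) (q - 1))) = ennreal C * ennpowr (g x) q"
        by (metis (no_types, lifting) mult.assoc mult.left_commute)
    qed
    also have "\<dots> = ennreal C * (\<integral>\<^sup>+x. ennpowr (g x) q \<partial>lebesgue)"
      by (rule nn_integral_cmult) auto
    finally show ?thesis .
  qed
  with C show ?thesis by blast
qed

section \<open>Pairing with molecules\<close>

definition wt :: "real \<Rightarrow> 'a::euclidean_space \<Rightarrow> real \<Rightarrow> 'a \<Rightarrow> real" where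
  "wt K c s y = (1 + norm (y - c) / s) powr (- K)"

lemma wt_measurable [measurable]: "wt K c s \<in> borel_measurable borel"
  unfolding wt_def by measurable

lemma wt_le_1: "0 < s \<Longrightarrow> 0 \<le> K \<Longrightarrow> wt K c s y \<le> 1"
  unfolding wt_def by (auto simp: powr_minus intro!: inverse_le_1_iff[THEN iffD2] ge_one_powr_ge_zero)

lemma wt_nonneg: "0 \<le> wt K c s y"
  unfolding wt_def by simp

text \<open>Peetre's inequality: 1 + |z - c| / s is at most the same expression at the shifted point
  times 1 + |w|, because t \<le> s. It lets a mollification at a scale below s keep the weight, at
  the price of a moment of the mollifier.\<close>

lemma wt_shift:
  assumes "0 < t" "t \<le> s" "0 \<le> K"
  shows "wt K c s (z + t *\<^sub>R w) \<le> wt K c s z * (1 + norm w) powr K"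
proof -
  have s: "0 < s" using assms by simp
  define A B D where "A = 1 + norm (z - c) / s" "B = 1 + norm (z + t *\<^sub>R w - c) / s" "D = 1 + norm w"
  have pos: "A > 0" "B > 0" "D > 0" using s by (auto simp: A_B_D_def intro!: add_pos_nonneg)
  have "norm (z - c) \<le> norm (z + t *\<^sub>R w - c) + t * norm w"
    using norm_triangle_ineq4[of "z + t *\<^sub>R w - c" "t *\<^sub>R w"] assms by (simp add: algebra_simps)
  then have "norm (z - c) / s \<le> (norm (z + t *\<^sub>R w - c) + t * norm w) / s"
    using s by (simp add: divide_right_mono)
  also have "\<dots> = norm (z + t *\<^sub>R w - c) / s + (t / s) * norm w" by (simp add: add_divide_distrib)
  also have "(t / s) * norm w \<le> 1 * norm w" using assms s by (intro mult_right_mono) auto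
  finally have "norm (z - c) / s \<le> norm (z + t *\<^sub>R w - c) / s + norm w" by simp
  moreover have "B * D = 1 + norm (z + t *\<^sub>R w - c) / s + norm w + norm (z + t *\<^sub>R w - c) / s * norm w"
    by (simp add: A_B_D_def distrib_left distrib_right)
  moreover have "norm (z + t *\<^sub>R w - c) / s * norm w \<ge> 0" using s by simp
  ultimately have "A \<le> B * D" unfolding A_B_D_def by linarith
  then have "A powr K \<le> B powr K * D powr K"
    using powr_mono2[of K A "B * D"] pos assms by (simp add: powr_mult)
  then have "B powr (-K) \<le> A powr (-K) * D powr K"
    using pos by (simp add: powr_minus field_simps)
  then show ?thesis by (simp add: wt_def A_B_D_def)
qed

lemma le_suminf: "f l \<le> (\<Sum>l. f l :: ennreal)"
  using sum_le_suminf[of f "{l}"] by simp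

text \<open>Spreads the weight over dyadic balls. The single index l with 2^l \<le> 1 + a < 2^(l+1)
  already dominates, and its ball has radius 2^(l+1).\<close>

lemma one_plus_powr_le_sum:
  fixes a K :: real
  assumes "0 \<le> a" "0 \<le> K"
  shows "ennreal ((1 + a) powr (-K)) \<le> (\<Sum>l. ennreal (2 powr (- (real l * K))) * indicator {l. a < 2 ^ (l + 1)} l)"
proof -
  have "\<exists>l::nat. 2 ^ l \<le> 1 + a \<and> 1 + a < 2 ^ (l + 1)"
  proof -
    define l where "l = nat \<lfloor>log 2 (1 + a)\<rfloor>"
    have "0 \<le> log 2 (1 + a)" using assms by simp
    then have "real l \<le> log 2 (1 + a)" "log 2 (1 + a) < real (l + 1)" unfolding l_def by linarith+
    then have "2 powr real l \<le> 1 + a" "1 + a < 2 powr real (l + 1)"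
      using assms by (simp_all add: le_log_iff log_less_iff)
    then show ?thesis by (auto simp only: powr_realpow zero_less_numeral)
  qed
  then obtain l :: nat where l: "2 ^ l \<le> 1 + a" "1 + a < 2 ^ (l + 1)" by auto
  have "(1 + a) powr (-K) \<le> (2 ^ l) powr (-K)"
    using l assms by (intro powr_mono2') auto
  also have "\<dots> = 2 powr (- (real l * K))"
    by (simp add: powr_realpow[symmetric] powr_powr)
  finally have "ennreal ((1 + a) powr (-K)) \<le> ennreal (2 powr (- (real l * K))) * indicator {l. a < 2 ^ (l + 1)} l"
    using l by (auto intro!: ennreal_leI simp: indicator_def)
  also have "\<dots> \<le> (\<Sum>l. ennreal (2 powr (- (real l * K))) * indicator {l. a < 2 ^ (l + 1)} l)"
    by (rule le_suminf)
  finally show ?thesis .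
qed

text \<open>The sum of the geometric series of ratio 2^-(K - n) in the next estimate; the factor 2^n
  is due to radii 2^(l+1) instead of 2^l.\<close>

definition wt_const :: "'a::euclidean_space itself \<Rightarrow> real \<Rightarrow> real" where
  "wt_const _ K = 2 ^ DIM('a) / (1 - 2 powr (- (K - DIM('a))))"

lemma wt_const_nonneg: "real DIM('a::euclidean_space) < K \<Longrightarrow> 0 \<le> wt_const TYPE('a) K"
  unfolding wt_const_def by (simp add: powr_le_one_le powr_less_one less_imp_le)

text \<open>On the ball of radius s 2^(l+1) the volume costs 2^(l n) while the weight gains 2^(-l
  K), so K > n makes the series converge. The hypothesis speaks of balls about c of radius at least
  s only, which is what a maximal function near c, though not at c, can control.\<close>

lemma nn_integral_wt_le:
  fixes c :: "'a::euclidean_space" and g :: "'a \<Rightarrow> ennreal"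
  assumes g [measurable]: "g \<in> borel_measurable lebesgue" and s: "0 < s" and K: "real DIM('a) < K"
    and A: "\<And>R. s \<le> R \<Longrightarrow> (\<integral>\<^sup>+y\<in>ball c R. g y \<partial>lebesgue) \<le> ennreal (R ^ DIM('a)) * A"
  shows "(\<integral>\<^sup>+y. ennreal (wt K c s y) * g y \<partial>lebesgue) \<le> ennreal (wt_const TYPE('a) K * s ^ DIM('a)) * A"
proof -
  let ?n = "DIM('a)"
  define e where "e = K - ?n"
  have e: "e > 0" using K by (simp add: e_def)
  have q: "2 powr (-e) < (1::real)" using e by (simp add: powr_less_one)
  have iff: "norm (y - c) / s < 2 ^ (l + 1) \<longleftrightarrow> y \<in> ball c (s * 2 ^ (l + 1))" for y l
    using s by (simp add: field_simps dist_norm norm_minus_commute)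
  have [measurable]: "ball c R \<in> sets lebesgue" for R by simp
  have "(\<integral>\<^sup>+y. ennreal (wt K c s y) * g y \<partial>lebesgue) \<le>
     (\<integral>\<^sup>+y. (\<Sum>l. ennreal (2 powr (- (real l * K))) * (g y * indicator (ball c (s * 2 ^ (l + 1))) y)) \<partial>lebesgue)"
  proof (rule nn_integral_mono)
    fix y
    have "ennreal (wt K c s y) \<le> (\<Sum>l. ennreal (2 powr (- (real l * K))) * indicator {l. norm (y - c) / s < 2 ^ (l + 1)} l)"
      unfolding wt_def using s K by (intro one_plus_powr_le_sum) auto
    then have "ennreal (wt K c s y) * g y \<le> (\<Sum>l. ennreal (2 powr (- (real l * K))) * indicator {l. norm (y - c) / s < 2 ^ (l + 1)} l) * g y"
      by (rule mult_right_mono) auto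
    also have "\<dots> = (\<Sum>l. ennreal (2 powr (- (real l * K))) * indicator {l. norm (y - c) / s < 2 ^ (l + 1)} l * g y)"
      by simp
    also have "\<dots> = (\<Sum>l. ennreal (2 powr (- (real l * K))) * (g y * indicator (ball c (s * 2 ^ (l + 1))) y))"
      by (simp only: indicator_def mem_Collect_eq iff mult_ac)
    finally show "ennreal (wt K c s y) * g y \<le> \<dots>" .
  qed
  also have "\<dots> = (\<Sum>l. \<integral>\<^sup>+y. ennreal (2 powr (- (real l * K))) * (g y * indicator (ball c (s * 2 ^ (l + 1))) y) \<partial>lebesgue)"
    by (rule nn_integral_suminf) measurable
  also have "\<dots> \<le> (\<Sum>l. ennreal (2 ^ ?n * s ^ ?n * (2 powr (-e)) ^ l) * A)"
  proof (intro suminf_le)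
    fix l
    have "(\<integral>\<^sup>+y. ennreal (2 powr (- (real l * K))) * (g y * indicator (ball c (s * 2 ^ (l + 1))) y) \<partial>lebesgue)
      = ennreal (2 powr (- (real l * K))) * (\<integral>\<^sup>+y\<in>ball c (s * 2 ^ (l + 1)). g y \<partial>lebesgue)"
      by (rule nn_integral_cmult) measurable
    also have "\<dots> \<le> ennreal (2 powr (- (real l * K))) * (ennreal ((s * 2 ^ (l + 1)) ^ ?n) * A)"
    proof (intro mult_left_mono A)
      show "s \<le> s * 2 ^ (l + 1)" using s by (simp add: mult_le_cancel_left1 one_le_power del: power_Suc)
    qed auto
    also have "\<dots> = ennreal (2 powr (- (real l * K)) * (s * 2 ^ (l + 1)) ^ ?n) * A"
      using s by (simp add: ennreal_mult mult.assoc)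
    also have "2 powr (- (real l * K)) * (s * 2 ^ (l + 1)) ^ ?n = 2 ^ ?n * s ^ ?n * (2 powr (-e)) ^ l"
    proof -
      have "2 powr (- (real l * K)) * (2 ^ l) ^ ?n = (2 powr (-e)) ^ l"
        by (simp add: e_def powr_realpow[symmetric] powr_powr powr_add[symmetric] algebra_simps)
      moreover have "(s * 2 ^ (l + 1)) ^ ?n = 2 ^ ?n * s ^ ?n * (2 ^ l) ^ ?n"
        by (simp add: power_mult_distrib)
      ultimately show ?thesis by (simp add: mult_ac)
    qed
    finally show "(\<integral>\<^sup>+y. ennreal (2 powr (- (real l * K))) * (g y * indicator (ball c (s * 2 ^ (l + 1))) y) \<partial>lebesgue)
      \<le> ennreal (2 ^ ?n * s ^ ?n * (2 powr (-e)) ^ l) * A" .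
  qed auto
  also have "\<dots> = (\<Sum>l. ennreal (2 ^ ?n * s ^ ?n * (2 powr (-e)) ^ l)) * A" by simp
  also have "(\<Sum>l. ennreal (2 ^ ?n * s ^ ?n * (2 powr (-e)) ^ l)) = ennreal (2 ^ ?n * s ^ ?n * (1 / (1 - 2 powr (-e))))"
    using q s by (intro suminf_ennreal_eq sums_mult geometric_sums) auto
  finally show ?thesis by (simp add: wt_const_def e_def mult_ac)
qed

lemma nn_integral_wt_finite:
  fixes c :: "'a::euclidean_space"
  assumes s: "0 < s" and K: "real DIM('a) < K"
  shows "(\<integral>\<^sup>+y. ennreal (wt K c s y) \<partial>lborel) \<le> ennreal (wt_const TYPE('a) K * unit_ball_vol (real DIM('a)) * s ^ DIM('a))"
proof -
  have "(\<integral>\<^sup>+y. ennreal (wt K c s y) * 1 \<partial>lebesgue) \<le> ennreal (wt_const TYPE('a) K * s ^ DIM('a)) * ennreal (unit_ball_vol (real DIM('a)))"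
    using s K by (intro nn_integral_wt_le) (auto simp: emeasure_ball ennreal_mult[symmetric] mult.commute)
  then show ?thesis using s wt_const_nonneg[OF K]
    by (simp add: nn_integral_completion ennreal_mult[symmetric] mult_ac)
qed

lemma integrable_wt:
  fixes c :: "'a::euclidean_space"
  assumes s: "0 < s" and K: "real DIM('a) < K"
  shows "integrable lborel (wt K c s)"
proof (rule integrableI_nonneg)
  show "(\<integral>\<^sup>+y. ennreal (wt K c s y) \<partial>lborel) < \<infinity>"
    using nn_integral_wt_finite[OF s K, of c] by (simp add: le_less_trans[OF _ ennreal_less_top])
qed (auto simp: wt_nonneg)

section \<open>Molecules: size and Hoelder bounds with a common weight\<close>

definition holder_wt :: "real \<Rightarrow> real \<Rightarrow> 'a::euclidean_space \<Rightarrow> real \<Rightarrow> real \<Rightarrow> ('a \<Rightarrow> complex) \<Rightarrow> bool" where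
  "holder_wt \<delta> K c s B \<eta> \<longleftrightarrow> (\<forall>z z'. cmod (\<eta> z - \<eta> z') \<le> B * (norm (z - z') / s) powr \<delta> * (wt K c s z + wt K c s z'))"

text \<open>Decaying weights replace compact support: mollification with \<open>\<phi>0\<close>
  destroys compact support but preserves these bounds at every scale up to s.\<close>

definition mol :: "real \<Rightarrow> real \<Rightarrow> 'a::euclidean_space \<Rightarrow> real \<Rightarrow> real \<Rightarrow> ('a \<Rightarrow> complex) \<Rightarrow> bool" where
  "mol \<delta> K c s B \<eta> \<longleftrightarrow> (\<forall>z. cmod (\<eta> z) \<le> B * wt K c s z) \<and> holder_wt \<delta> K c s B \<eta>"

text \<open>Supplies the Borel measurability of molecules and of the kernels in their second
  variable.\<close>

lemma holder_wt_continuous: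
  fixes \<eta> :: "'a::euclidean_space \<Rightarrow> complex"
  assumes h: "holder_wt \<delta> K c s B \<eta>" and s: "0 < s" and K: "0 \<le> K" and d: "0 < \<delta>"
  shows "continuous_on UNIV \<eta>"
proof (clarsimp simp: continuous_on_def)
  fix x
  have B: "cmod (\<eta> z - \<eta> x) \<le> 2 * \<bar>B\<bar> * (norm (z - x) / s) powr \<delta>" for z
  proof -
    have "cmod (\<eta> z - \<eta> x) \<le> B * (norm (z - x) / s) powr \<delta> * (wt K c s z + wt K c s x)"
      using h by (simp add: holder_wt_def)
    also have "\<dots> \<le> \<bar>B\<bar> * (norm (z - x) / s) powr \<delta> * (1 + 1)"
      by (intro mult_mono add_mono wt_le_1 s K) (auto simp: wt_nonneg)
    finally show ?thesis by simp
  qed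
  have "((\<lambda>z. 2 * \<bar>B\<bar> * (norm (z - x) / s) powr \<delta>) \<longlongrightarrow> 2 * \<bar>B\<bar> * (norm (x - x) / s) powr \<delta>) (at x)"
    using d s by (intro tendsto_intros tendsto_powr') auto
  then have lim: "((\<lambda>z. 2 * \<bar>B\<bar> * (norm (z - x) / s) powr \<delta>) \<longlongrightarrow> 0) (at x)" by simp
  have "((\<lambda>z. \<eta> z - \<eta> x) \<longlongrightarrow> 0) (at x)"
    by (rule Lim_null_comparison[OF always_eventually lim]) (rule allI, rule B)
  then show "(\<eta> \<longlongrightarrow> \<eta> x) (at x)" by (rule Lim_null[THEN iffD2])
qed

text \<open>On the support |z - c| / s \<le> 2, so the weight is at least 3^-K. The Hoelder bound is
  demanded only when the first point is in the support: two points off the support have difference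
  0, and the remaining case follows by symmetry.\<close>

lemma mol_compact_support:
  fixes \<eta> :: "'a::euclidean_space \<Rightarrow> complex"
  assumes s: "0 < s" and K: "0 \<le> K" and B: "0 \<le> B"
    and supp: "\<And>z. \<eta> z \<noteq> 0 \<Longrightarrow> norm (z - c) \<le> 2 * s"
    and bd: "\<And>z. cmod (\<eta> z) \<le> B"
    and hol: "\<And>z z'. \<eta> z \<noteq> 0 \<Longrightarrow> cmod (\<eta> z - \<eta> z') \<le> B * (norm (z - z') / s) powr \<delta>"
  shows "mol \<delta> K c s (3 powr K * B) \<eta>"
proof -
  have w: "1 \<le> 3 powr K * wt K c s z" if "\<eta> z \<noteq> 0" for z
  proof -
    have "3 powr (-K) \<le> wt K c s z"
      unfolding wt_def using supp[OF that] s K by (intro powr_mono2') (auto simp: field_simps intro: add_pos_nonneg)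
    then show ?thesis by (simp add: powr_minus field_simps)
  qed
  have 1: "cmod (\<eta> z) \<le> 3 powr K * B * wt K c s z" for z
  proof (cases "\<eta> z = 0")
    case False
    then have "B * 1 \<le> B * (3 powr K * wt K c s z)" using w B by (intro mult_left_mono) auto
    with bd[of z] show ?thesis by (simp add: mult_ac)
  next
    case True
    then show ?thesis using B wt_nonneg[of K c s z] by simp
  qed
  have 2: "cmod (\<eta> z - \<eta> z') \<le> 3 powr K * B * (norm (z - z') / s) powr \<delta> * (wt K c s z + wt K c s z')" if "\<eta> z \<noteq> 0" for z z'
  proof -
    have "cmod (\<eta> z - \<eta> z') \<le> B * (norm (z - z') / s) powr \<delta> * 1"
      using hol[OF that, of z'] by simp
    also have "\<dots> \<le> B * (norm (z - z') / s) powr \<delta> * (3 powr K * (wt K c s z + wt K c s z'))"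
      using w[OF that] B wt_nonneg[of K c s z']
      by (intro mult_left_mono) (auto simp: distrib_left intro: add_increasing2)
    also have "\<dots> = 3 powr K * B * (norm (z - z') / s) powr \<delta> * (wt K c s z + wt K c s z')"
      by (simp only: mult_ac)
    finally show ?thesis .
  qed
  have "cmod (\<eta> z - \<eta> z') \<le> 3 powr K * B * (norm (z - z') / s) powr \<delta> * (wt K c s z + wt K c s z')" for z z'
  proof (cases "\<eta> z = 0")
    case True
    show ?thesis
    proof (cases "\<eta> z' = 0")
      case True
      have "0 \<le> 3 powr K * B * (norm (z - z') / s) powr \<delta> * (wt K c s z + wt K c s z')"
        using B by (intro mult_nonneg_nonneg add_nonneg_nonneg wt_nonneg) auto
      with True \<open>\<eta> z = 0\<close> show ?thesis by simp
    next
      case False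
      from 2[OF this, of z] show ?thesis by (simp add: norm_minus_commute add.commute)
    qed
  qed (rule 2)
  with 1 show ?thesis by (auto simp: mol_def holder_wt_def)
qed

section \<open>Mollification of molecules at scales up to their own\<close>

lemma lborel_affine_integral:
  fixes g :: "'a::euclidean_space \<Rightarrow> 'b::{banach, second_countable_topology}"
  assumes c: "c \<noteq> 0" and g [measurable]: "g \<in> borel_measurable borel"
  shows "integrable lborel (\<lambda>x. g (b + c *\<^sub>R x)) \<longleftrightarrow> integrable lborel g"
    and "(LINT x|lborel. g x) = \<bar>c\<bar> ^ DIM('a) *\<^sub>R (LINT x|lborel. g (b + c *\<^sub>R x))"
proof -
  let ?D = "density (distr lborel borel (\<lambda>x. b + c *\<^sub>R x)) (\<lambda>_. ennreal (\<bar>c\<bar> ^ DIM('a)))"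
  have L: "lborel = ?D" by (rule lborel_affine[OF c])
  have "integrable lborel g \<longleftrightarrow> integrable ?D g" by (rule arg_cong[OF L])
  then show "integrable lborel (\<lambda>x. g (b + c *\<^sub>R x)) \<longleftrightarrow> integrable lborel g"
  proof -
    have "integrable lborel (\<lambda>x. g (b + c *\<^sub>R x))" if "integrable lborel (\<lambda>x. \<bar>c\<bar> ^ DIM('a) *\<^sub>R g (b + c *\<^sub>R x))"
      using Bochner_Integration.integrable_scaleR_right[OF that, of "inverse (\<bar>c\<bar> ^ DIM('a))"] c by simp
    then show "integrable lborel g \<longleftrightarrow> integrable ?D g \<Longrightarrow> ?thesis"
      by (auto simp add: integrable_density integrable_distr_eq)
  qed
  have "(LINT x|lborel. g x) = (LINT x|?D. g x)" by (rule arg_cong[OF L])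
  then show "(LINT x|lborel. g x) = \<bar>c\<bar> ^ DIM('a) *\<^sub>R (LINT x|lborel. g (b + c *\<^sub>R x))"
    by (simp add: integral_density integral_distr)
qed

lemma power_powr_swap: "0 < (x::real) \<Longrightarrow> (x ^ j) powr b = (x powr b) ^ j"
  by (simp add: powr_realpow[symmetric] powr_powr mult.commute)

text \<open>\<open>\<phi>0\<close> will be the test function divided by its integral. Of the moment
  of order K + 1, K pays for shifting the weight and 1 for |w|^\<delta>. The inequality n < r (n +
  \<delta>) carries the lower bound on p, as r is chosen below p.\<close>

locale approx_kernel =
  fixes \<phi>0 :: "'a::euclidean_space \<Rightarrow> complex" and K \<delta> r :: real
  assumes phi_meas [measurable]: "\<phi>0 \<in> borel_measurable borel"
    and phi_int: "integrable lborel (\<lambda>w. cmod (\<phi>0 w) * (1 + norm w) powr (K + 1))"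
    and phi_one: "(LINT w|lborel. \<phi>0 w) = 1"
    and delta: "0 < \<delta>" "\<delta> \<le> 1"
    and r: "real DIM('a) < r * (real DIM('a) + \<delta>)" "r \<le> 1"
    and K: "real DIM('a) + \<delta> \<le> K"
begin

definition "a0 = (LINT w|lborel. cmod (\<phi>0 w) * (1 + norm w) powr (K + 1))"
text \<open>\<open>Pt t\<close> is the transpose of the convolution f * \<phi>_t, which is
  \<open>ut f t\<close>: pairing f with \<open>Pt t h\<close> only sees
  \<open>ut f t\<close>.\<close>

definition "Pt t h z = (LINT w|lborel. \<phi>0 w * h (z + t *\<^sub>R w))"
definition "ut f t y = (LINT w|lborel. f (y - t *\<^sub>R w) * \<phi>0 w)"

text \<open>The remainder after j subtractions. What is removed at stage j is the mollification of
  the current remainder, so its pairing with f is a pairing of \<open>ut f (\<tau> ^ j * s)\<close>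
  with that remainder. This takes the place of a Calderon reproducing formula and works with one
  fixed mollifier of integral 1.\<close>

primrec eta :: "real \<Rightarrow> real \<Rightarrow> ('a \<Rightarrow> complex) \<Rightarrow> nat \<Rightarrow> 'a \<Rightarrow> complex" where
  "eta \<tau> s \<eta> 0 = \<eta>"
| "eta \<tau> s \<eta> (Suc j) = (\<lambda>z. eta \<tau> s \<eta> j z - Pt (\<tau> ^ j * s) (eta \<tau> s \<eta> j) z)"

lemma K_pos: "0 < K" "real DIM('a) < K" "0 \<le> K"
  using K delta by (auto intro: less_le_trans[of 0 "real DIM('a) + \<delta>"] add_pos_pos)

lemma r_pos: "0 < r"
  using r(1) delta by (metis add_nonneg_nonneg less_eq_real_def mult_nonpos_nonneg not_le of_nat_0_le_iff order.trans)

text \<open>All estimates on \<open>Pt\<close> reduce to this one: an integrand growing at most like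
  (1 + |w|)^(K + 1) costs a factor \<open>a0\<close>.\<close>

lemma phi_F:
  assumes F [measurable]: "F \<in> borel_measurable borel" and B: "\<And>w. cmod (F w) \<le> B * (1 + norm w) powr (K + 1)"
  shows "integrable lborel (\<lambda>w. \<phi>0 w * F w)" "cmod (LINT w|lborel. \<phi>0 w * F w) \<le> B * a0"
proof -
  have i: "integrable lborel (\<lambda>w. B * (cmod (\<phi>0 w) * (1 + norm w) powr (K + 1)))"
    using phi_int by simp
  have le: "cmod (\<phi>0 w * F w) \<le> B * (cmod (\<phi>0 w) * (1 + norm w) powr (K + 1))" for w
    using mult_left_mono[OF B[of w], of "cmod (\<phi>0 w)"] by (simp add: norm_mult mult_ac)
  show I: "integrable lborel (\<lambda>w. \<phi>0 w * F w)"
    by (rule Bochner_Integration.integrable_bound[OF i]) (auto intro!: AE_I2 order_trans[OF le] )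
  have "cmod (LINT w|lborel. \<phi>0 w * F w) \<le> (LINT w|lborel. B * (cmod (\<phi>0 w) * (1 + norm w) powr (K + 1)))"
    by (rule order_trans[OF integral_norm_bound integral_mono[OF integrable_norm[OF I] i]]) (rule le)
  also have "\<dots> = B * a0" by (simp add: a0_def)
  finally show "cmod (LINT w|lborel. \<phi>0 w * F w) \<le> B * a0" .
qed

lemma phi_integrable: "integrable lborel \<phi>0"
  using phi_F(1)[of "\<lambda>_. 1" 1] K_pos by (simp add: ge_one_powr_ge_zero)

lemma a0_ge_1: "1 \<le> a0"
  using phi_F(2)[of "\<lambda>_. 1" 1] K_pos by (simp add: ge_one_powr_ge_zero phi_one)

lemma Pt_measurable [measurable]:
  assumes [measurable]: "h \<in> borel_measurable borel" shows "Pt t h \<in> borel_measurable borel"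
  unfolding Pt_def by measurable

lemma eta_measurable [measurable]: "\<eta> \<in> borel_measurable borel \<Longrightarrow> eta \<tau> s \<eta> j \<in> borel_measurable borel"
  by (induction j) auto

lemma wt_shift': "0 < t \<Longrightarrow> t \<le> s \<Longrightarrow> wt K c s (z + t *\<^sub>R w) \<le> wt K c s z * (1 + norm w) powr (K + 1)"
  by (rule order_trans[OF wt_shift[where K=K]]) (use K_pos in \<open>auto intro!: mult_left_mono powr_mono wt_nonneg\<close>)

lemma Pt_bound:
  assumes h [measurable]: "h \<in> borel_measurable borel" and t: "0 < t" "t \<le> s" and B: "0 \<le> B"
    and bd: "\<And>z. cmod (h z) \<le> B * wt K c s z"
  shows "integrable lborel (\<lambda>w. \<phi>0 w * h (z + t *\<^sub>R w))" "cmod (Pt t h z) \<le> B * wt K c s z * a0"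
proof -
  have le: "cmod (h (z + t *\<^sub>R w)) \<le> (B * wt K c s z) * (1 + norm w) powr (K + 1)" for w
  proof -
    have "cmod (h (z + t *\<^sub>R w)) \<le> B * wt K c s (z + t *\<^sub>R w)" by (rule bd)
    also have "\<dots> \<le> B * (wt K c s z * (1 + norm w) powr (K + 1))"
      by (intro mult_left_mono wt_shift' t B)
    finally show ?thesis by (simp add: mult.assoc)
  qed
  show "integrable lborel (\<lambda>w. \<phi>0 w * h (z + t *\<^sub>R w))" by (rule phi_F(1)[OF _ le]) measurable
  show "cmod (Pt t h z) \<le> B * wt K c s z * a0" unfolding Pt_def by (rule phi_F(2)[OF _ le]) measurable
qed

lemma Pt_holder:
  assumes h [measurable]: "h \<in> borel_measurable borel" and t: "0 < t" "t \<le> s" and B: "0 \<le> B" "0 \<le> B'"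
    and bd: "\<And>z. cmod (h z) \<le> B' * wt K c s z" and hol: "holder_wt \<delta> K c s B h"
  shows "holder_wt \<delta> K c s (B * a0) (Pt t h)"
  unfolding holder_wt_def
proof (intro allI)
  fix z z'
  let ?D = "B * (norm (z - z') / s) powr \<delta> * (wt K c s z + wt K c s z')"
  have le: "cmod (h (z + t *\<^sub>R w) - h (z' + t *\<^sub>R w)) \<le> ?D * (1 + norm w) powr (K + 1)" for w
  proof -
    have "cmod (h (z + t *\<^sub>R w) - h (z' + t *\<^sub>R w)) \<le>
      B * (norm (z - z') / s) powr \<delta> * (wt K c s (z + t *\<^sub>R w) + wt K c s (z' + t *\<^sub>R w))"
      using hol[unfolded holder_wt_def, rule_format, of "z + t *\<^sub>R w" "z' + t *\<^sub>R w"] by simp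
    also have "\<dots> \<le> B * (norm (z - z') / s) powr \<delta> *
       (wt K c s z * (1 + norm w) powr (K + 1) + wt K c s z' * (1 + norm w) powr (K + 1))"
      using B by (intro mult_left_mono add_mono wt_shift' t) auto
    finally show ?thesis by (simp add: algebra_simps)
  qed
  have "Pt t h z - Pt t h z' = (LINT w|lborel. \<phi>0 w * (h (z + t *\<^sub>R w) - h (z' + t *\<^sub>R w)))"
    unfolding Pt_def using Pt_bound(1)[OF h t B(2) bd]
    by (subst Bochner_Integration.integral_diff[symmetric]) (auto simp: algebra_simps)
  moreover have "cmod \<dots> \<le> ?D * a0" by (rule phi_F(2)[OF _ le]) measurable
  ultimately show "cmod (Pt t h z - Pt t h z') \<le> B * a0 * (norm (z - z') / s) powr \<delta> * (wt K c s z + wt K c s z')"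
    by (simp add: mult_ac)
qed

text \<open>Since \<open>\<phi>0\<close> has integral 1, the difference is an average of increments
  h z - h (z + t w), each small of order (t / s)^\<delta>. All the gain in the iteration comes from
  here.\<close>

lemma Pt_approx:
  assumes h [measurable]: "h \<in> borel_measurable borel" and t: "0 < t" "t \<le> s" and B: "0 \<le> B" "0 \<le> B'"
    and bd: "\<And>z. cmod (h z) \<le> B' * wt K c s z" and hol: "holder_wt \<delta> K c s B h"
  shows "cmod (h z - Pt t h z) \<le> 2 * B * a0 * (t / s) powr \<delta> * wt K c s z"
proof -
  have s: "s > 0" using t by simp
  have le: "cmod (h z - h (z + t *\<^sub>R w)) \<le> (2 * B * (t / s) powr \<delta> * wt K c s z) * (1 + norm w) powr (K + 1)" for w
  proof -
    let ?q = "1 + norm w"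
    have "cmod (h z - h (z + t *\<^sub>R w)) \<le>
      B * (norm (z - (z + t *\<^sub>R w)) / s) powr \<delta> * (wt K c s z + wt K c s (z + t *\<^sub>R w))"
      using hol[unfolded holder_wt_def, rule_format, of z "z + t *\<^sub>R w"] by simp
    also have "\<dots> = B * ((t / s) powr \<delta> * norm w powr \<delta>) * (wt K c s z + wt K c s (z + t *\<^sub>R w))"
      using t s by (simp add: powr_mult[symmetric])
    also have "\<dots> \<le> B * ((t / s) powr \<delta> * ?q) * (wt K c s z * ?q powr K + wt K c s z * ?q powr K)"
    proof (intro mult_mono add_mono)
      \<comment> \<open>The additional power of 1 + |w| in the moment condition is spent here, using
        \<delta> \<le> 1.\<close>
      show "norm w powr \<delta> \<le> ?q"
        using powr_mono2[of \<delta> "norm w" ?q] powr_mono[of \<delta> 1 ?q] delta by simp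
      show "wt K c s z \<le> wt K c s z * ?q powr K"
        using mult_left_mono[OF ge_one_powr_ge_zero[of ?q K] wt_nonneg[of K c s z]] K_pos by simp
      show "wt K c s (z + t *\<^sub>R w) \<le> wt K c s z * ?q powr K" by (rule wt_shift) (use t K_pos in auto)
    qed (use B in \<open>auto simp: wt_nonneg\<close>)
    also have "\<dots> = (2 * B * (t / s) powr \<delta> * wt K c s z) * (?q * ?q powr K)" by simp
    also have "?q * ?q powr K = ?q powr (K + 1)" by (simp add: powr_add add_nonneg_eq_0_iff)
    finally show ?thesis .
  qed
  have "h z - Pt t h z = (LINT w|lborel. \<phi>0 w * h z) - (LINT w|lborel. \<phi>0 w * h (z + t *\<^sub>R w))"
    unfolding Pt_def by (simp add: phi_one)
  also have "\<dots> = (LINT w|lborel. \<phi>0 w * (h z - h (z + t *\<^sub>R w)))"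
    using Pt_bound(1)[OF h t B(2) bd, of z] phi_integrable
    by (subst Bochner_Integration.integral_diff[symmetric]) (auto simp: algebra_simps)
  finally have "cmod (h z - Pt t h z) = cmod \<dots>" by simp
  also have "\<dots> \<le> 2 * B * (t / s) powr \<delta> * wt K c s z * a0" by (rule phi_F(2)[OF _ le]) measurable
  finally show ?thesis by (simp add: mult_ac)
qed

text \<open>Two different rates: the Hoelder constant relative to scale s may grow by 1 + a0 in
  every step, while the size of the next remainder is that constant times (\<tau>^j)^\<delta>. The
  factor \<tau>^-\<delta> makes up for the index shift between step j and remainder j + 1.\<close>

lemma eta_bounds:
  assumes \<eta> [measurable]: "\<eta> \<in> borel_measurable borel" and mol: "mol \<delta> K c s B \<eta>"
    and s: "0 < s" and B: "0 \<le> B" and \<tau>: "0 < \<tau>" "\<tau> < 1"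
  shows "holder_wt \<delta> K c s (B * (1 + a0) ^ j) (eta \<tau> s \<eta> j) \<and>
    (\<forall>z. cmod (eta \<tau> s \<eta> j z) \<le> 2 * a0 * B * \<tau> powr (- \<delta>) * ((1 + a0) * \<tau> powr \<delta>) ^ j * wt K c s z)"
proof (induction j)
  case 0
  have "1 \<le> \<tau> powr (- \<delta>)" using \<tau> delta by (simp add: powr_minus one_le_inverse_iff powr_le1)
  then have "B * 1 \<le> B * (2 * a0 * \<tau> powr (- \<delta>))"
    using a0_ge_1 B mult_mono[of 1 "2 * a0" 1 "\<tau> powr (- \<delta>)"] by (intro mult_left_mono) auto
  then have "B * wt K c s z \<le> 2 * a0 * B * \<tau> powr (- \<delta>) * wt K c s z" for z
    by (intro mult_right_mono wt_nonneg) (simp add: mult_ac)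
  with mol show ?case by (auto simp: mol_def intro: order_trans)
next
  case (Suc j)
  let ?h = "eta \<tau> s \<eta> j" and ?t = "\<tau> ^ j * s"
  let ?B = "B * (1 + a0) ^ j" and ?B' = "2 * a0 * B * \<tau> powr (- \<delta>) * ((1 + a0) * \<tau> powr \<delta>) ^ j"
  have t: "0 < ?t" "?t \<le> s" using \<tau> s by (auto simp: mult_le_cancel_right1 power_le_one)
  have B1: "0 \<le> ?B" "0 \<le> ?B'" using B a0_ge_1 by auto
  have h [measurable]: "?h \<in> borel_measurable borel" by simp
  have bd: "\<And>z. cmod (?h z) \<le> ?B' * wt K c s z" and hol: "holder_wt \<delta> K c s ?B ?h" using Suc by auto
  have "holder_wt \<delta> K c s (?B * (1 + a0)) (\<lambda>z. ?h z - Pt ?t ?h z)"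
    unfolding holder_wt_def
  proof (intro allI)
    fix z z'
    let ?X = "(norm (z - z') / s) powr \<delta> * (wt K c s z + wt K c s z')"
    have "cmod (?h z - ?h z') \<le> ?B * ?X" using hol by (simp add: holder_wt_def mult.assoc)
    moreover have "cmod (Pt ?t ?h z - Pt ?t ?h z') \<le> ?B * a0 * ?X"
      using Pt_holder[OF h t B1 bd hol] by (simp add: holder_wt_def mult.assoc)
    moreover have "cmod ((?h z - Pt ?t ?h z) - (?h z' - Pt ?t ?h z')) \<le> cmod (?h z - ?h z') + cmod (Pt ?t ?h z - Pt ?t ?h z')"
      using norm_triangle_ineq4[of "?h z - ?h z'" "Pt ?t ?h z - Pt ?t ?h z'"] by (simp add: algebra_simps)
    ultimately show "cmod ((?h z - Pt ?t ?h z) - (?h z' - Pt ?t ?h z')) \<le>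
        ?B * (1 + a0) * (norm (z - z') / s) powr \<delta> * (wt K c s z + wt K c s z')"
      by (simp add: algebra_simps)
  qed
  moreover have "cmod (?h z - Pt ?t ?h z) \<le> 2 * a0 * B * \<tau> powr (- \<delta>) * ((1 + a0) * \<tau> powr \<delta>) ^ Suc j * wt K c s z" for z
  proof -
    have "cmod (?h z - Pt ?t ?h z) \<le> 2 * ?B * a0 * (?t / s) powr \<delta> * wt K c s z"
      by (rule Pt_approx[OF h t B1 bd hol])
    also have "(?t / s) powr \<delta> = (\<tau> powr \<delta>) ^ j" using s \<tau> by (simp add: power_powr_swap)
    also have "2 * ?B * a0 * (\<tau> powr \<delta>) ^ j * wt K c s z \<le> (2 * ?B * a0 * (\<tau> powr \<delta>) ^ j * wt K c s z) * (1 + a0)"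
    proof -
      have "0 \<le> 2 * ?B * a0 * (\<tau> powr \<delta>) ^ j * wt K c s z"
        using B B1 a0_ge_1 by (intro mult_nonneg_nonneg wt_nonneg) auto
      then show ?thesis using a0_ge_1 by (simp add: mult_le_cancel_left1)
    qed
    also have "\<dots> = 2 * a0 * B * (\<tau> powr (- \<delta>) * \<tau> powr \<delta>) * (1 + a0) * ((1 + a0) ^ j * (\<tau> powr \<delta>) ^ j) * wt K c s z"
      using \<tau> by (simp add: powr_add[symmetric])
    also have "\<dots> = 2 * a0 * B * \<tau> powr (- \<delta>) * ((1 + a0) * \<tau> powr \<delta>) ^ Suc j * wt K c s z"
      by (simp add: power_mult_distrib)
    finally show ?thesis .
  qed
  ultimately show ?case by (simp add: mult_ac)
qed

end

section \<open>Pairing square integrable functions with mollifications\<close>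

lemma sq_integrable_mult:
  fixes f g :: "'a \<Rightarrow> complex"
  assumes [measurable]: "f \<in> borel_measurable M" "g \<in> borel_measurable M"
    and "integrable M (\<lambda>x. (cmod (f x))\<^sup>2)" "integrable M (\<lambda>x. (cmod (g x))\<^sup>2)"
  shows "integrable M (\<lambda>x. f x * g x)"
    and "(LINT x|M. cmod (f x * g x)) \<le> ((LINT x|M. (cmod (f x))\<^sup>2) + (LINT x|M. (cmod (g x))\<^sup>2)) / 2"
proof -
  have i: "integrable M (\<lambda>x. ((cmod (f x))\<^sup>2 + (cmod (g x))\<^sup>2) / 2)" using assms by simp
  have le: "cmod (f x * g x) \<le> ((cmod (f x))\<^sup>2 + (cmod (g x))\<^sup>2) / 2" for x
    using sum_squares_bound[of "cmod (f x)" "cmod (g x)"] by (simp add: norm_mult)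
  show I: "integrable M (\<lambda>x. f x * g x)"
  proof (rule Bochner_Integration.integrable_bound[OF i])
    show "AE x in M. cmod (f x * g x) \<le> norm (((cmod (f x))\<^sup>2 + (cmod (g x))\<^sup>2) / 2)"
      unfolding real_norm_def by (intro AE_I2 order_trans[OF le abs_ge_self])
  qed measurable
  show "(LINT x|M. cmod (f x * g x)) \<le> ((LINT x|M. (cmod (f x))\<^sup>2) + (LINT x|M. (cmod (g x))\<^sup>2)) / 2"
    using integral_mono[OF integrable_norm[OF I] i le] assms by simp
qed

lemma wt_measurable_lebesgue [measurable]: "wt K c s \<in> borel_measurable lebesgue"
  by (simp add: measurable_completion)

lemma wt_square: "(wt K c s y)\<^sup>2 = wt (2 * K) c s y"
  by (simp add: wt_def power2_eq_square powr_add[symmetric])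

lemma integrable_wt_square:
  fixes c :: "'a::euclidean_space"
  assumes "0 < s" "real DIM('a) < K"
  shows "integrable lborel (\<lambda>y. (wt K c s y)\<^sup>2)"
  unfolding wt_square by (rule integrable_wt) (use assms in auto)

lemma bounded_by_wt_sq_integrable:
  fixes h :: "'a::euclidean_space \<Rightarrow> complex"
  assumes [measurable]: "h \<in> borel_measurable borel" and "0 < s" "real DIM('a) < K"
    and bd: "\<And>z. cmod (h z) \<le> B * wt K c s z"
  shows "integrable lborel (\<lambda>y. (cmod (h y))\<^sup>2)"
proof (rule Bochner_Integration.integrable_bound)
  show "integrable lborel (\<lambda>y. B\<^sup>2 * (wt K c s y)\<^sup>2)"
    using integrable_wt_square[of s K c] assms by simp
  have "(cmod (h y))\<^sup>2 \<le> B\<^sup>2 * (wt K c s y)\<^sup>2" for y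
    using power_mono[OF bd[of y], of 2] by (simp add: power_mult_distrib)
  then show "AE y in lborel. norm ((cmod (h y))\<^sup>2) \<le> norm (B\<^sup>2 * (wt K c s y)\<^sup>2)" by simp
qed simp

lemma translate_integrable:
  fixes g :: "'a::euclidean_space \<Rightarrow> 'b::{banach, second_countable_topology}"
  assumes [measurable]: "g \<in> borel_measurable borel"
  shows "integrable lborel (\<lambda>x. g (x + b)) \<longleftrightarrow> integrable lborel g"
    and "(LINT x|lborel. g (x + b)) = (LINT x|lborel. g x)"
  using lborel_affine_integral[of 1 g b] by (simp_all add: add.commute)

context approx_kernel
begin

text \<open>Both double integrals converge absolutely because f and h are square integrable and
  translations preserve the L^2 norm. The substitution y = z + t w then moves the mollifier from h
  to f.\<close>

lemma Fubini_pairing: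
  assumes [measurable]: "f \<in> borel_measurable borel" "h \<in> borel_measurable borel"
    and f2: "integrable lborel (\<lambda>x. (cmod (f x))\<^sup>2)" and h2: "integrable lborel (\<lambda>x. (cmod (h x))\<^sup>2)"
  shows "integrable lborel (\<lambda>z. f z * Pt t h z)"
    and "(LINT z|lborel. f z * Pt t h z) = (LINT y|lborel. ut f t y * h y)"
    and "integrable lborel (\<lambda>y. ut f t y * h y)"
proof -
  let ?M = "((LINT x|lborel. (cmod (f x))\<^sup>2) + (LINT x|lborel. (cmod (h x))\<^sup>2)) / 2"
  have tr: "integrable lborel (\<lambda>z. (cmod (g (z + b)))\<^sup>2)" "(LINT z|lborel. (cmod (g (z + b)))\<^sup>2) = (LINT x|lborel. (cmod (g x))\<^sup>2)"
    if [measurable]: "g \<in> borel_measurable borel" and "integrable lborel (\<lambda>x. (cmod (g x))\<^sup>2)" for g :: "'a \<Rightarrow> complex" and b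
    using translate_integrable[of "\<lambda>x. (cmod (g x))\<^sup>2" b] that by auto
  have F1: "integrable (lborel \<Otimes>\<^sub>M lborel) (\<lambda>(w, y). \<phi>0 w * (f (y - t *\<^sub>R w) * h y))"
  proof (rule lborel_pair.Fubini_integrable)
    show "(\<lambda>(w, y). \<phi>0 w * (f (y - t *\<^sub>R w) * h y)) \<in> borel_measurable (lborel \<Otimes>\<^sub>M lborel)" by measurable
    have b: "integrable lborel (\<lambda>y. f (y - t *\<^sub>R w) * h y)" "(LINT y|lborel. cmod (f (y - t *\<^sub>R w) * h y)) \<le> ?M" for w
      using sq_integrable_mult[of "\<lambda>y. f (y + (- t *\<^sub>R w))" lborel h] tr[OF _ f2, of "- t *\<^sub>R w"] h2 by auto
    show "AE w in lborel. integrable lborel (\<lambda>y. case (w, y) of (w, y) \<Rightarrow> \<phi>0 w * (f (y - t *\<^sub>R w) * h y))"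
      using b by simp
    show "integrable lborel (\<lambda>w. LINT y|lborel. norm (case (w, y) of (w, y) \<Rightarrow> \<phi>0 w * (f (y - t *\<^sub>R w) * h y)))"
    proof (rule Bochner_Integration.integrable_bound)
      show "integrable lborel (\<lambda>w. ?M * cmod (\<phi>0 w))" using phi_integrable by simp
      show "AE w in lborel. norm (LINT y|lborel. norm (case (w, y) of (w, y) \<Rightarrow> \<phi>0 w * (f (y - t *\<^sub>R w) * h y))) \<le> norm (?M * cmod (\<phi>0 w))"
      proof (rule AE_I2)
        fix w
        have "norm (LINT y|lborel. norm (case (w, y) of (w, y) \<Rightarrow> \<phi>0 w * (f (y - t *\<^sub>R w) * h y)))
          = cmod (\<phi>0 w) * (LINT y|lborel. cmod (f (y - t *\<^sub>R w) * h y))"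
          by (simp add: norm_mult)
        also have "\<dots> \<le> cmod (\<phi>0 w) * ?M" by (intro mult_left_mono b) auto
        also have "\<dots> \<le> norm (?M * cmod (\<phi>0 w))" by (simp add: abs_mult mult.commute mult_left_mono)
        finally show "norm (LINT y|lborel. norm (case (w, y) of (w, y) \<Rightarrow> \<phi>0 w * (f (y - t *\<^sub>R w) * h y))) \<le> norm (?M * cmod (\<phi>0 w))" .
      qed
    qed measurable
  qed
  have F2: "integrable (lborel \<Otimes>\<^sub>M lborel) (\<lambda>(w, z). \<phi>0 w * (f z * h (z + t *\<^sub>R w)))"
  proof (rule lborel_pair.Fubini_integrable)
    show "(\<lambda>(w, z). \<phi>0 w * (f z * h (z + t *\<^sub>R w))) \<in> borel_measurable (lborel \<Otimes>\<^sub>M lborel)" by measurable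
    have b: "integrable lborel (\<lambda>z. f z * h (z + t *\<^sub>R w))" "(LINT z|lborel. cmod (f z * h (z + t *\<^sub>R w))) \<le> ?M" for w
      using sq_integrable_mult[of f lborel "\<lambda>y. h (y + (t *\<^sub>R w))"] tr[OF _ h2, of "t *\<^sub>R w"] f2 by auto
    show "AE w in lborel. integrable lborel (\<lambda>z. case (w, z) of (w, z) \<Rightarrow> \<phi>0 w * (f z * h (z + t *\<^sub>R w)))"
      using b by simp
    show "integrable lborel (\<lambda>w. LINT z|lborel. norm (case (w, z) of (w, z) \<Rightarrow> \<phi>0 w * (f z * h (z + t *\<^sub>R w))))"
    proof (rule Bochner_Integration.integrable_bound)
      show "integrable lborel (\<lambda>w. ?M * cmod (\<phi>0 w))" using phi_integrable by simp
      show "AE w in lborel. norm (LINT z|lborel. norm (case (w, z) of (w, z) \<Rightarrow> \<phi>0 w * (f z * h (z + t *\<^sub>R w)))) \<le> norm (?M * cmod (\<phi>0 w))"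
      proof (rule AE_I2)
        fix w
        have "norm (LINT z|lborel. norm (case (w, z) of (w, z) \<Rightarrow> \<phi>0 w * (f z * h (z + t *\<^sub>R w))))
          = cmod (\<phi>0 w) * (LINT z|lborel. cmod (f z * h (z + t *\<^sub>R w)))"
          by (simp add: norm_mult)
        also have "\<dots> \<le> cmod (\<phi>0 w) * ?M" by (intro mult_left_mono b) auto
        also have "\<dots> \<le> norm (?M * cmod (\<phi>0 w))" by (simp add: abs_mult mult.commute mult_left_mono)
        finally show "norm (LINT z|lborel. norm (case (w, z) of (w, z) \<Rightarrow> \<phi>0 w * (f z * h (z + t *\<^sub>R w)))) \<le> norm (?M * cmod (\<phi>0 w))" .
      qed
    qed measurable
  qed
  have e1: "(LINT w|lborel. \<phi>0 w * (f z * h (z + t *\<^sub>R w))) = f z * Pt t h z" for z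
    unfolding Pt_def by (subst integral_mult_right_zero[symmetric]) (simp only: mult_ac)
  have e2: "(LINT w|lborel. \<phi>0 w * (f (y - t *\<^sub>R w) * h y)) = ut f t y * h y" for y
    unfolding ut_def by (subst integral_mult_left_zero[symmetric]) (simp only: mult_ac)
  show "integrable lborel (\<lambda>z. f z * Pt t h z)"
    using lborel_pair.integrable_snd[OF F2] by (simp add: e1)
  show "integrable lborel (\<lambda>y. ut f t y * h y)"
    using lborel_pair.integrable_snd[OF F1] by (simp add: e2)
  have "(LINT z|lborel. f z * Pt t h z) = (LINT z|lborel. LINT w|lborel. \<phi>0 w * (f z * h (z + t *\<^sub>R w)))"
    by (simp add: e1)
  also have "\<dots> = (LINT w|lborel. LINT z|lborel. \<phi>0 w * (f z * h (z + t *\<^sub>R w)))"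
    by (rule lborel_pair.Fubini_integral[OF F2])
  also have "\<dots> = (LINT w|lborel. LINT y|lborel. \<phi>0 w * (f (y - t *\<^sub>R w) * h y))"
  proof (rule Bochner_Integration.integral_cong[OF refl])
    fix w
    show "(LINT z|lborel. \<phi>0 w * (f z * h (z + t *\<^sub>R w))) = (LINT y|lborel. \<phi>0 w * (f (y - t *\<^sub>R w) * h y))"
      using translate_integrable(2)[of "\<lambda>z. \<phi>0 w * (f z * h (z + t *\<^sub>R w))" "- t *\<^sub>R w", symmetric] by simp
  qed
  also have "\<dots> = (LINT y|lborel. LINT w|lborel. \<phi>0 w * (f (y - t *\<^sub>R w) * h y))"
    by (rule lborel_pair.Fubini_integral[OF F1, symmetric])
  finally show "(LINT z|lborel. f z * Pt t h z) = (LINT y|lborel. ut f t y * h y)"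
    by (simp add: e2)
qed

text \<open>The number 21 arises because the point x at which the maximal function is evaluated lies
  within 20 s of c, so that balls about c of radius at least 21 s contain x. The first factor
  belongs to the pointwise bound raised to 1/r - 1, the others to the integral of the remaining
  weight.\<close>

definition "C2 = (21 ^ DIM('a) / unit_ball_vol (real DIM('a))) powr (1 / r - 1) *
  wt_const TYPE('a) (K - real DIM('a) * (1 / r - 1)) * 21 ^ DIM('a)"

text \<open>The pointwise bound on |u|^(1 - r) grows like (1 + |y - c| / s)^(n (1/r - 1)); this
  exponent is taken from K and more than n must be left for integrability.\<close>

lemma Kn: "real DIM('a) < K - real DIM('a) * (1 / r - 1)"
proof -
  have "real DIM('a) / r < real DIM('a) + \<delta>" using r r_pos by (simp add: field_simps)
  then show ?thesis using K by (simp add: algebra_simps)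
qed

lemma C2_nonneg: "0 \<le> C2"
  unfolding C2_def using wt_const_nonneg[OF Kn] by (intro mult_nonneg_nonneg) auto

text \<open>Bounding only part of \<open>u\<^sub>t\<close> by its supremum, and the rest by \<open>N\<close> itself, makes the loss
  \<open>(s / t) powr (n / r - n)\<close> instead of \<open>(s / t) powr (n / r)\<close>; this is where the range of \<open>p\<close> comes from.\<close>

lemma pairing_bound:
  fixes N :: "'a \<Rightarrow> ennreal"
  assumes [measurable]: "N \<in> borel_measurable lebesgue"
    and nt: "\<And>x y. norm (x - y) \<le> t \<Longrightarrow> ennreal (cmod (u y)) \<le> N x"
    and t: "0 < t" "t \<le> s" and x: "dist x c \<le> 20 * s"
    and A: "hl (\<lambda>y. ennpowr (N y) r) x = ennreal A" "0 \<le> A"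
  shows "(\<integral>\<^sup>+y. ennreal (cmod (u y) * wt K c s y) \<partial>lborel) \<le>
    ennreal (C2 * s ^ DIM('a) * (s / t) powr (real DIM('a) * (1 / r - 1)) * A powr (1 / r))"
proof -
  let ?n = "DIM('a)" and ?v = "unit_ball_vol (real DIM('a))" and ?g = "\<lambda>y. ennpowr (N y) r"
  define \<beta> where "\<beta> = 1 / r - 1"
  define D where "D = 21 ^ ?n / ?v * (s / t) ^ ?n * A"
  have s: "0 < s" using t by simp
  have v: "0 < ?v" by simp
  have b: "0 \<le> \<beta>" using r r_pos by (simp add: \<beta>_def)
  have D: "0 \<le> D" using s t A v by (simp add: D_def)
  have upper: "(\<integral>\<^sup>+y\<in>ball c R. ?g y \<partial>lebesgue) \<le> ennreal (R ^ ?n) * ennreal A" if "20 * s < R" for R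
    using hl_ge_ball[of R x c ?g] that s x by (simp add: A dist_commute)
  \<comment> \<open>Every z in the ball of radius t about y has y in its cone, so N z \<ge> |u y|.
    Integrating N^r over that ball, which lies in a ball about c containing x, brings in the maximal
    function and the loss (s / t)^n.\<close>
  have pt: "cmod (u y) powr r \<le> D * (1 + norm (y - c) / s) ^ ?n" for y
  proof -
    define R where "R = 21 * s * (1 + norm (y - c) / s)"
    have R1: "R = 21 * s + 21 * norm (y - c)" using s by (simp add: R_def field_simps)
    have "ennreal (cmod (u y) powr r * (?v * t ^ ?n)) = (\<integral>\<^sup>+z\<in>ball y t. ennreal (cmod (u y) powr r) \<partial>lebesgue)"
      using t v by (simp add: nn_integral_cmult_indicator emeasure_ball ennreal_mult)
    also have "\<dots> \<le> (\<integral>\<^sup>+z\<in>ball c R. ?g z \<partial>lebesgue)"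
    proof (intro nn_integral_mono)
      fix z
      show "ennreal (cmod (u y) powr r) * indicator (ball y t) z \<le> ?g z * indicator (ball c R) z"
      proof (cases "z \<in> ball y t")
        case True
        then have "ennreal (cmod (u y)) \<le> N z" by (intro nt) (auto simp: dist_norm norm_minus_commute)
        then have "ennpowr (ennreal (cmod (u y))) r \<le> ?g z" using r_pos by (intro ennpowr_mono) auto
        moreover have "z \<in> ball c R"
        proof -
          have "dist c z \<le> norm (y - c) + dist y z" using dist_triangle[of c z y] by (simp add: dist_norm norm_minus_commute)
          also have "\<dots> < norm (y - c) + s" using True t by auto
          also have "\<dots> \<le> R" using s norm_ge_zero[of "y - c"] unfolding R1 by linarith
          finally show ?thesis by simp
        qed
        ultimately show ?thesis using True by simp
      qed simp
    qed
    also have "\<dots> \<le> ennreal (R ^ ?n) * ennreal A"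
      using s norm_ge_zero[of "y - c"] by (intro upper) (unfold R1, linarith)
    also have "\<dots> = ennreal (R ^ ?n * A)" using A by (simp add: ennreal_mult'')
    finally have "cmod (u y) powr r * (?v * t ^ ?n) \<le> R ^ ?n * A"
      using A R1 s by (subst (asm) ennreal_le_iff) auto
    then have "cmod (u y) powr r \<le> R ^ ?n * A / (?v * t ^ ?n)"
      using v t by (simp add: pos_le_divide_eq)
    also have "\<dots> = D * (1 + norm (y - c) / s) ^ ?n"
      unfolding R_def D_def by (simp add: power_mult_distrib power_divide)
    finally show ?thesis .
  qed
  \<comment> \<open>With \<beta> = 1/r - 1 the modulus factors as (|u|^r)^\<beta> |u|^r; the growth
    in y of the bound on the first factor is absorbed by lowering the decay of the weight from K to
    K - n \<beta>.\<close>
  have pt2: "cmod (u y) * wt K c s y \<le> D powr \<beta> * (wt (K - ?n * \<beta>) c s y * cmod (u y) powr r)" for y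
  proof -
    let ?q = "1 + norm (y - c) / s"
    have q: "0 < ?q" using s by (intro add_pos_nonneg) auto
    have "cmod (u y) = (cmod (u y) powr r) powr \<beta> * cmod (u y) powr r"
      using r_pos by (cases "u y = 0") (auto simp: powr_powr powr_add[symmetric] \<beta>_def algebra_simps)
    also have "\<dots> \<le> (D * ?q ^ ?n) powr \<beta> * cmod (u y) powr r"
      by (intro powr_mono2 mult_right_mono pt b) auto
    also have "(D * ?q ^ ?n) powr \<beta> = D powr \<beta> * ?q powr (?n * \<beta>)"
      using D q by (simp add: powr_mult powr_powr powr_realpow[symmetric])
    finally have "cmod (u y) \<le> D powr \<beta> * ?q powr (?n * \<beta>) * cmod (u y) powr r" .
    then have "cmod (u y) * wt K c s y \<le> D powr \<beta> * ?q powr (?n * \<beta>) * cmod (u y) powr r * wt K c s y"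
      by (rule mult_right_mono) (rule wt_nonneg)
    also have "\<dots> = D powr \<beta> * (wt (K - ?n * \<beta>) c s y * cmod (u y) powr r)"
      using q by (simp add: wt_def powr_add[symmetric] algebra_simps)
    finally show ?thesis .
  qed
  have "(\<integral>\<^sup>+y. ennreal (cmod (u y) * wt K c s y) \<partial>lborel) \<le>
     (\<integral>\<^sup>+y. ennreal (D powr \<beta>) * (ennreal (wt (K - ?n * \<beta>) c s y) * ?g y) \<partial>lebesgue)"
    unfolding nn_integral_completion
  proof (rule nn_integral_mono)
    fix y
    have "ennpowr (ennreal (cmod (u y))) r \<le> ?g y"
      using t r_pos by (intro ennpowr_mono nt) auto
    then have "ennreal (cmod (u y) powr r) \<le> ?g y" by simp
    then have "ennreal (D powr \<beta>) * (ennreal (wt (K - ?n * \<beta>) c s y) * ennreal (cmod (u y) powr r))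
      \<le> ennreal (D powr \<beta>) * (ennreal (wt (K - ?n * \<beta>) c s y) * ?g y)"
      by (intro mult_left_mono) auto
    moreover have "ennreal (cmod (u y) * wt K c s y) \<le> ennreal (D powr \<beta>) * (ennreal (wt (K - ?n * \<beta>) c s y) * ennreal (cmod (u y) powr r))"
      using pt2[of y] by (simp add: ennreal_mult[symmetric] wt_nonneg ennreal_leI)
    ultimately show "ennreal (cmod (u y) * wt K c s y) \<le> ennreal (D powr \<beta>) * (ennreal (wt (K - ?n * \<beta>) c s y) * ?g y)"
      by (rule order_trans[rotated])
  qed
  also have "\<dots> = ennreal (D powr \<beta>) * (\<integral>\<^sup>+y. ennreal (wt (K - ?n * \<beta>) c s y) * ?g y \<partial>lebesgue)"
    by (rule nn_integral_cmult) measurable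
  also have "\<dots> \<le> ennreal (D powr \<beta>) * (ennreal (wt_const TYPE('a) (K - ?n * \<beta>) * s ^ ?n) * ennreal (21 ^ ?n * A))"
  proof (intro mult_left_mono nn_integral_wt_le)
    show "real ?n < K - real ?n * \<beta>" using Kn by (simp add: \<beta>_def)
    fix R assume R: "s \<le> R"
    have "(\<integral>\<^sup>+y\<in>ball c R. ?g y \<partial>lebesgue) \<le> (\<integral>\<^sup>+y\<in>ball c (21 * R). ?g y \<partial>lebesgue)"
      using R s by (intro nn_integral_mono) (auto split: split_indicator)
    also have "\<dots> \<le> ennreal ((21 * R) ^ ?n) * ennreal A"
      using R s by (intro upper) auto
    also have "\<dots> = ennreal (R ^ ?n) * ennreal (21 ^ ?n * A)"
      using R s A by (simp add: ennreal_mult[symmetric] power_mult_distrib mult_ac)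
    finally show "(\<integral>\<^sup>+y\<in>ball c R. ?g y \<partial>lebesgue) \<le> ennreal (R ^ ?n) * ennreal (21 ^ ?n * A)" .
  qed (use s in auto)
  also have "\<dots> = ennreal (D powr \<beta> * (wt_const TYPE('a) (K - ?n * \<beta>) * s ^ ?n * (21 ^ ?n * A)))"
    using wt_const_nonneg[OF Kn] s A by (simp add: ennreal_mult[symmetric] \<beta>_def)
  also have "D powr \<beta> * (wt_const TYPE('a) (K - ?n * \<beta>) * s ^ ?n * (21 ^ ?n * A)) =
    C2 * s ^ ?n * (s / t) powr (real ?n * \<beta>) * (A powr \<beta> * A)"
  proof -
    have st: "0 < s / t" using s t by simp
    have "((s / t) ^ ?n) powr \<beta> = (s / t) powr (real ?n * \<beta>)"
      by (subst powr_realpow[OF st, symmetric]) (simp only: powr_powr)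
    moreover have "D powr \<beta> = (21 ^ ?n / ?v) powr \<beta> * ((s / t) ^ ?n) powr \<beta> * A powr \<beta>"
      unfolding D_def using v st A(2) by (simp only: powr_mult)
    ultimately show ?thesis unfolding C2_def \<beta>_def[symmetric] by (simp only: mult_ac)
  qed
  also have "A powr \<beta> * A = A powr (1 / r)"
    using A(2) by (cases "A = 0") (auto simp: \<beta>_def powr_diff)
  finally show ?thesis by (simp add: \<beta>_def)
qed

text \<open>The net gain: \<delta> from Hoelder regularity minus the loss n (1/r - 1) of
  \<open>pairing_bound\<close>.\<close>

definition "\<epsilon>0 = \<delta> - real DIM('a) * (1 / r - 1)"
text \<open>The solution of (1 + a0) \<tau>^\<epsilon>0 = 1/2.\<close>

definition "\<tau>0 = (1 / (2 * (1 + a0))) powr (1 / \<epsilon>0)"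
text \<open>The constant 2 a0 \<tau>0^-\<delta> in the size of the remainders times C2, doubled by a
  geometric series of ratio 1/2.\<close>

definition "C3 = 4 * a0 * \<tau>0 powr (- \<delta>) * C2"

lemma eps0: "0 < \<epsilon>0" "\<epsilon>0 \<le> \<delta>"
proof -
  have "real DIM('a) / r < real DIM('a) + \<delta>" using r r_pos by (simp add: field_simps)
  then show "0 < \<epsilon>0" by (simp add: \<epsilon>0_def algebra_simps)
  have "0 \<le> 1 / r - 1" using r r_pos by simp
  then show "\<epsilon>0 \<le> \<delta>" by (simp add: \<epsilon>0_def)
qed

lemma tau0: "0 < \<tau>0" "\<tau>0 < 1" "(1 + a0) * \<tau>0 powr \<epsilon>0 = 1 / 2" "(1 + a0) * \<tau>0 powr \<delta> \<le> 1 / 2"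
proof -
  have a: "0 < 1 / (2 * (1 + a0))" "1 / (2 * (1 + a0)) < 1" using a0_ge_1 by auto
  show 1: "0 < \<tau>0" using a0_ge_1 by (simp add: \<tau>0_def)
  show 2: "\<tau>0 < 1" unfolding \<tau>0_def
    using powr_less_mono2[of "1 / \<epsilon>0" "1 / (2 * (1 + a0))" 1] a eps0 by simp
  have "\<tau>0 powr \<epsilon>0 = 1 / (2 * (1 + a0))" using eps0 a0_ge_1 by (simp add: \<tau>0_def powr_powr)
  then show 3: "(1 + a0) * \<tau>0 powr \<epsilon>0 = 1 / 2" using a0_ge_1 by simp
  have "\<tau>0 powr \<delta> \<le> \<tau>0 powr \<epsilon>0" using 1 2 eps0 by (intro powr_mono') auto
  then have "(1 + a0) * \<tau>0 powr \<delta> \<le> (1 + a0) * \<tau>0 powr \<epsilon>0" using a0_ge_1 by (intro mult_left_mono) auto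
  with 3 show "(1 + a0) * \<tau>0 powr \<delta> \<le> 1 / 2" by simp
qed

lemma C3_nonneg: "0 \<le> C3"
  unfolding C3_def using C2_nonneg a0_ge_1 by (intro mult_nonneg_nonneg) auto

text \<open>Telescoping: f paired with remainder j equals \<open>ut f\<close> at scale \<tau>0^j s
  paired with remainder j, plus f paired with remainder j + 1. The j-th term carries (1 + a0)^j
  \<tau>0^(j \<delta>) from the size and \<tau>0^(-j n (1/r - 1)) from \<open>pairing_bound\<close>,
  in all 2^-j. Square integrability of f gives convergence of the integrals and the vanishing of the
  last remainder, and does not enter the constant.\<close>

lemma mol_pairing_bound:
  fixes N :: "'a \<Rightarrow> ennreal"
  assumes N: "N \<in> borel_measurable lebesgue"
    and f [measurable]: "f \<in> borel_measurable borel" and f2: "integrable lborel (\<lambda>x. (cmod (f x))\<^sup>2)"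
    and nt: "\<And>t x y. 0 < t \<Longrightarrow> norm (x - y) \<le> t \<Longrightarrow> ennreal (cmod (ut f t y)) \<le> N x"
    and mol: "mol \<delta> K c s B \<eta>" and B: "0 \<le> B" and s: "0 < s" and x: "dist x c \<le> 20 * s"
    and A: "hl (\<lambda>y. ennpowr (N y) r) x = ennreal A" "0 \<le> A"
  shows "cmod (LINT z|lborel. f z * \<eta> z) \<le> C3 * B * s ^ DIM('a) * A powr (1 / r)"
proof -
  let ?n = "DIM('a)"
  define b where "b = real ?n * (1 / r - 1)"
  define Q where "Q = 2 * a0 * B * \<tau>0 powr (- \<delta>)"
  define q where "q = (1 + a0) * \<tau>0 powr \<delta>"
  let ?e = "eta \<tau>0 s \<eta>" and ?t = "\<lambda>j. \<tau>0 ^ j * s"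
  have Q: "0 \<le> Q" using B a0_ge_1 by (simp add: Q_def)
  have q: "0 \<le> q" "q < 1" "q \<le> 1 / 2" using tau0 a0_ge_1 by (auto simp: q_def)
  have \<eta> [measurable]: "\<eta> \<in> borel_measurable borel"
    using holder_wt_continuous[of \<delta> K c s B \<eta>] mol s delta K_pos by (auto simp: mol_def intro: borel_measurable_continuous_onI)
  have t: "0 < ?t j" "?t j \<le> s" for j using tau0 s by (auto simp: mult_le_cancel_right1 power_le_one)
  have bd: "cmod (?e j z) \<le> Q * q ^ j * wt K c s z" for j z
    using eta_bounds[OF \<eta> mol s B tau0(1,2), of j] by (simp add: Q_def q_def)
  have e2: "integrable lborel (\<lambda>y. (cmod (?e j y))\<^sup>2)" for j
    by (rule bounded_by_wt_sq_integrable[OF _ s K_pos(2) bd]) measurable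
  have I: "integrable lborel (\<lambda>z. f z * ?e j z)" for j
    by (rule sq_integrable_mult(1)[OF _ _ f2 e2]) measurable
  have step: "(LINT z|lborel. f z * ?e j z) = (LINT y|lborel. ut f (?t j) y * ?e j y) + (LINT z|lborel. f z * ?e (Suc j) z)" for j
  proof -
    have "(LINT z|lborel. f z * ?e (Suc j) z) = (LINT z|lborel. f z * ?e j z - f z * Pt (?t j) (?e j) z)"
      by (simp add: right_diff_distrib)
    also have "\<dots> = (LINT z|lborel. f z * ?e j z) - (LINT z|lborel. f z * Pt (?t j) (?e j) z)"
      using I[of j] Fubini_pairing(1)[OF f _ f2 e2, of j "?t j"] by (intro Bochner_Integration.integral_diff) auto
    also have "(LINT z|lborel. f z * Pt (?t j) (?e j) z) = (LINT y|lborel. ut f (?t j) y * ?e j y)"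
      by (rule Fubini_pairing(2)[OF f _ f2 e2]) measurable
    finally show ?thesis by simp
  qed
  have tel: "(LINT z|lborel. f z * \<eta> z) = (\<Sum>j<J. LINT y|lborel. ut f (?t j) y * ?e j y) + (LINT z|lborel. f z * ?e J z)" for J
  proof (induction J)
    case (Suc J)
    then show ?case using step[of J] by simp
  qed simp
  define V where "V = Q * C2 * s ^ ?n * A powr (1 / r)"
  have V: "0 \<le> V" unfolding V_def using Q C2_nonneg s by (intro mult_nonneg_nonneg) auto
  have trm: "cmod (LINT y|lborel. ut f (?t j) y * ?e j y) \<le> V * (1 / 2) ^ j" for j
  proof -
    have ij: "integrable lborel (\<lambda>y. ut f (?t j) y * ?e j y)"
      by (rule Fubini_pairing(3)[OF f _ f2 e2]) measurable
    have "ennreal (cmod (LINT y|lborel. ut f (?t j) y * ?e j y)) \<le> (\<integral>\<^sup>+y. ennreal (norm (ut f (?t j) y * ?e j y)) \<partial>lborel)"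
      by (rule integral_norm_bound_ennreal[OF ij])
    also have "\<dots> \<le> (\<integral>\<^sup>+y. ennreal (Q * q ^ j) * ennreal (cmod (ut f (?t j) y) * wt K c s y) \<partial>lborel)"
    proof (rule nn_integral_mono)
      fix y
      have "norm (ut f (?t j) y * ?e j y) \<le> cmod (ut f (?t j) y) * (Q * q ^ j * wt K c s y)"
        by (simp only: norm_mult) (intro mult_left_mono bd norm_ge_zero)
      also have "\<dots> = (Q * q ^ j) * (cmod (ut f (?t j) y) * wt K c s y)" by simp
      finally show "ennreal (norm (ut f (?t j) y * ?e j y)) \<le> ennreal (Q * q ^ j) * ennreal (cmod (ut f (?t j) y) * wt K c s y)"
        using Q q by (simp add: ennreal_mult[symmetric] wt_nonneg ennreal_leI)
    qed
    also have "\<dots> = ennreal (Q * q ^ j) * (\<integral>\<^sup>+y. ennreal (cmod (ut f (?t j) y) * wt K c s y) \<partial>lborel)"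
      unfolding ut_def by (rule nn_integral_cmult) measurable
    also have "\<dots> \<le> ennreal (Q * q ^ j) * ennreal (C2 * s ^ ?n * (s / ?t j) powr b * A powr (1 / r))"
      unfolding b_def by (intro mult_left_mono pairing_bound[OF N _ t x A] nt t) auto
    also have "\<dots> = ennreal (V * (q ^ j * (s / ?t j) powr b))"
      using Q q C2_nonneg s by (simp add: ennreal_mult[symmetric] V_def mult_ac)
    also have "q ^ j * (s / ?t j) powr b = (1 / 2) ^ j"
    proof -
      have "s / ?t j = (1 / \<tau>0) ^ j" using s by (simp add: power_one_over)
      then have "(s / ?t j) powr b = (\<tau>0 powr (- b)) ^ j"
        using tau0(1) by (simp add: power_powr_swap powr_minus_divide powr_divide)
      then have "q ^ j * (s / ?t j) powr b = ((1 + a0) * (\<tau>0 powr \<delta> * \<tau>0 powr (- b))) ^ j"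
        by (simp add: q_def power_mult_distrib)
      also have "\<tau>0 powr \<delta> * \<tau>0 powr (- b) = \<tau>0 powr \<epsilon>0"
        by (simp add: powr_add[symmetric] \<epsilon>0_def b_def)
      finally show ?thesis by (simp only: tau0(3))
    qed
    finally show ?thesis using V by (subst (asm) ennreal_le_iff) auto
  qed
  \<comment> \<open>The last remainder has size q^J times the weight with q < 1, and |f| times the
    weight is integrable because both are square integrable.\<close>
  have le: "cmod (LINT z|lborel. f z * \<eta> z) \<le> 2 * V + q ^ J * (Q * (LINT z|lborel. cmod (f z) * wt K c s z))" for J
  proof -
    have wi: "integrable lborel (\<lambda>z. f z * complex_of_real (wt K c s z))"
      using integrable_wt_square[OF s K_pos(2), of c]
      by (intro sq_integrable_mult(1)[OF _ _ f2]) auto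
    have wi': "integrable lborel (\<lambda>z. cmod (f z) * wt K c s z)"
      using integrable_norm[OF wi] by (simp add: norm_mult wt_nonneg)
    have "cmod (LINT z|lborel. f z * ?e J z) \<le> (LINT z|lborel. cmod (f z * ?e J z))"
      by (rule integral_norm_bound)
    also have "\<dots> \<le> (LINT z|lborel. (q ^ J * Q) * (cmod (f z) * wt K c s z))"
    proof (rule integral_mono)
      fix z
      have "cmod (f z * ?e J z) \<le> cmod (f z) * (Q * q ^ J * wt K c s z)"
        by (simp only: norm_mult) (intro mult_left_mono bd norm_ge_zero)
      then show "cmod (f z * ?e J z) \<le> (q ^ J * Q) * (cmod (f z) * wt K c s z)" by (simp only: mult_ac)
    qed (use I[of J] wi' in auto)
    also have "\<dots> = q ^ J * (Q * (LINT z|lborel. cmod (f z) * wt K c s z))" by (simp add: mult.assoc)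
    finally have 1: "cmod (LINT z|lborel. f z * ?e J z) \<le> \<dots>" .
    have "cmod (\<Sum>j<J. LINT y|lborel. ut f (?t j) y * ?e j y) \<le> (\<Sum>j<J. V * (1 / 2) ^ j)"
      by (rule order_trans[OF norm_sum sum_mono]) (rule trm)
    also have "\<dots> = V * (\<Sum>j<J. (1 / 2) ^ j)" by (simp add: sum_distrib_left)
    also have "\<dots> \<le> V * 2"
      using V by (intro mult_left_mono) (simp_all add: sum_gp_strict)
    finally show ?thesis using 1 norm_triangle_ineq[of "\<Sum>j<J. LINT y|lborel. ut f (?t j) y * ?e j y" "LINT z|lborel. f z * ?e J z"]
      by (subst tel[of J]) linarith
  qed
  have "(\<lambda>J. 2 * V + q ^ J * (Q * (LINT z|lborel. cmod (f z) * wt K c s z))) \<longlonglongrightarrow> 2 * V + 0 * (Q * (LINT z|lborel. cmod (f z) * wt K c s z))"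
    using q by (intro tendsto_intros LIMSEQ_power_zero) auto
  then have "cmod (LINT z|lborel. f z * \<eta> z) \<le> 2 * V"
    using le by (intro LIMSEQ_le_const[where a="cmod (LINT z|lborel. f z * \<eta> z)"]) auto
  also have "2 * V = C3 * B * s ^ ?n * A powr (1 / r)" by (simp add: V_def Q_def C3_def mult_ac)
  finally show ?thesis .
qed

end

section \<open>Tents and differentiation of integrals\<close>

definition tent :: "'a::euclidean_space \<Rightarrow> real" where
  "tent v = max 0 (1 - norm v)"

definition tent_const :: "'a::euclidean_space itself \<Rightarrow> real" where
  "tent_const _ = (LINT v|lborel. tent (v :: 'a))"

lemma tent_measurable [measurable]: "tent \<in> borel_measurable borel"
  unfolding tent_def by measurable

lemma tent_bounds: "0 \<le> tent v" "tent v \<le> 1" "tent v \<le> indicator (ball 0 1) v"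
  by (auto simp: tent_def indicator_def)

lemma tent_nonzero: "tent v \<noteq> 0 \<Longrightarrow> norm v < 1"
  by (auto simp: tent_def)

lemma tent_lipschitz: "\<bar>tent v - tent w\<bar> \<le> norm (v - w)"
  using norm_triangle_ineq3[of v w] by (auto simp: tent_def max_def abs_le_iff)

lemma integrable_ball_indicator: "integrable lborel (indicator (ball c R) :: 'a::euclidean_space \<Rightarrow> real)"
  using emeasure_lborel_ball_finite[of c R] by simp

lemma integrable_tent: "integrable lborel (tent :: 'a::euclidean_space \<Rightarrow> real)"
  by (rule Bochner_Integration.integrable_bound[OF integrable_ball_indicator[of 0 1]])
     (auto simp: tent_bounds intro!: AE_I2 order_trans[OF tent_bounds(3)])

lemma tent_const_pos: "0 < tent_const TYPE('a::euclidean_space)"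
proof -
  have "1/2 * measure lborel (ball (0::'a) (1/2)) = (LINT v|lborel. 1/2 * indicator (ball (0::'a) (1/2)) v)"
    by simp
  also have "\<dots> \<le> tent_const TYPE('a)"
    unfolding tent_const_def
  proof (rule integral_mono[OF _ integrable_tent])
    show "integrable lborel (\<lambda>v. 1/2 * indicator (ball (0::'a) (1/2)) v :: real)"
      by (intro integrable_mult_right integrable_ball_indicator)
  qed (auto simp: tent_def indicator_def)
  finally have "1/2 * measure lborel (ball (0::'a) (1/2)) \<le> tent_const TYPE('a)" .
  moreover have "0 < measure lborel (ball (0::'a) (1/2))" by simp
  ultimately show ?thesis by linarith
qed

lemma scaled_tent:
  fixes x :: "'a::euclidean_space"
  assumes s: "0 < s"
  shows "integrable lborel (\<lambda>z. tent ((1 / s) *\<^sub>R (z - x)))"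
    and "(LINT z|lborel. tent ((1 / s) *\<^sub>R (z - x))) = tent_const TYPE('a) * s ^ DIM('a)"
proof -
  have eq: "(\<lambda>v. tent ((1 / s) *\<^sub>R (x + s *\<^sub>R v - x))) = tent" using s by (auto simp: fun_eq_iff)
  have m: "(\<lambda>z. tent ((1 / s) *\<^sub>R (z - x))) \<in> borel_measurable borel" by measurable
  show "integrable lborel (\<lambda>z. tent ((1 / s) *\<^sub>R (z - x)))"
    using lborel_affine_integral(1)[of s "\<lambda>z. tent ((1 / s) *\<^sub>R (z - x))" x] s m integrable_tent unfolding eq by blast
  show "(LINT z|lborel. tent ((1 / s) *\<^sub>R (z - x))) = tent_const TYPE('a) * s ^ DIM('a)"
    using lborel_affine_integral(2)[of s "\<lambda>z. tent ((1 / s) *\<^sub>R (z - x))" x] s m unfolding eq by (simp add: tent_const_def)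
qed

text \<open>Enlarge A to an open U of nearly the same measure. The functions min 1 (j dist(x, - U))
  increase to the indicator of U, and Scheffe's lemma turns this into convergence in L^1.\<close>

lemma continuous_approx_indicator:
  fixes A :: "'a::euclidean_space set"
  assumes A: "A \<in> sets lborel" "emeasure lborel A < \<infinity>" and e: "0 < e"
  shows "\<exists>g::'a \<Rightarrow> real. continuous_on UNIV g \<and> integrable lborel g \<and>
    (\<integral>\<^sup>+x. ennreal (norm (indicator A x - g x)) \<partial>lborel) < ennreal e"
proof -
  have "A \<in> lmeasurable" using A by (auto simp: fmeasurable_def)
  then obtain U where U: "open U" "A \<subseteq> U" "U - A \<in> lmeasurable" "emeasure lebesgue (U - A) < ennreal (e / 2)"
    using sets_lebesgue_outer_open[of A "e / 2"] e by (auto simp: fmeasurable_def)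
  have Um: "U \<in> sets borel" using U by simp
  have "emeasure lborel U \<le> emeasure lborel A + emeasure lborel (U - A)"
    using A Um by (subst plus_emeasure) (auto intro!: emeasure_mono)
  also have "\<dots> < \<infinity>" using A U Um by (auto simp: fmeasurable_def ennreal_add_less_top)
  finally have Uf: "emeasure lborel U < \<infinity>" .
  have Ui: "integrable lborel (indicator U :: 'a \<Rightarrow> real)" using Uf Um by simp
  \<comment> \<open>\<open>infdist\<close> to the empty set is 0, so U = UNIV is treated
    separately.\<close>
  define g where "g = (\<lambda>(j::nat) x. if U = UNIV then 1 else min 1 (real j * infdist x (- U)))"
  have gc: "continuous_on UNIV (g j)" for j
    unfolding g_def by (cases "U = UNIV") (auto intro!: continuous_intros)
  then have gm [measurable]: "g j \<in> borel_measurable borel" for j by (rule borel_measurable_continuous_onI)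
  have gb: "0 \<le> g j x" "g j x \<le> indicator U x" for j x
    using infdist_nonneg[of x "- U"] by (auto simp: g_def indicator_def)
  have gi: "integrable lborel (g j)" for j
    by (rule Bochner_Integration.integrable_bound[OF Ui]) (auto intro!: AE_I2 simp: gb)
  have lim: "(\<lambda>j. g j x) \<longlonglongrightarrow> indicator U x" for x
  proof (cases "x \<in> U \<and> U \<noteq> UNIV")
    case True
    then have pos: "0 < infdist x (- U)"
      using infdist_pos_not_in_closed[of "- U" x] U by auto
    obtain J :: nat where J: "1 / infdist x (- U) < real J" using reals_Archimedean2 by blast
    have "g j x = 1" if "J \<le> j" for j
    proof -
      have "1 / infdist x (- U) < real j" using J that by linarith
      then have "1 < real j * infdist x (- U)" using pos by (simp add: field_simps)
      then show ?thesis by (auto simp: g_def)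
    qed
    then have "eventually (\<lambda>j. g j x = indicator U x) sequentially"
      using True by (auto simp: eventually_sequentially)
    then show ?thesis by (rule tendsto_eventually)
  next
    case False
    then have "g j x = indicator U x" for j by (auto simp: g_def indicator_def)
    then show ?thesis by simp
  qed
  have "(\<lambda>j. \<integral>\<^sup>+x. ennreal (norm (g j x - indicator U x)) \<partial>lborel) \<longlonglongrightarrow> 0"
  proof (rule Scheffe_lemma2)
    show "(\<integral>\<^sup>+ x. ennreal (norm (g j x)) \<partial>lborel) \<le> (\<integral>\<^sup>+ x. ennreal (norm (indicator U x :: real)) \<partial>lborel)" for j
      using gb by (intro nn_integral_mono ennreal_leI) auto
  qed (use Ui lim in auto)
  then have "eventually (\<lambda>j. (\<integral>\<^sup>+x. ennreal (norm (g j x - indicator U x)) \<partial>lborel) < ennreal (e / 2)) sequentially"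
    using e by (intro order_tendstoD(2)) auto
  then obtain j where j: "(\<integral>\<^sup>+x. ennreal (norm (g j x - indicator U x)) \<partial>lborel) < ennreal (e / 2)"
    by (auto simp: eventually_sequentially)
  have "(\<integral>\<^sup>+x. ennreal (norm (indicator A x - g j x)) \<partial>lborel) \<le>
     (\<integral>\<^sup>+x. indicator (U - A) x + ennreal (norm (g j x - indicator U x)) \<partial>lborel)"
  proof (rule nn_integral_mono)
    fix x
    have "norm (indicator A x - g j x) \<le> indicator (U - A) x + norm (g j x - indicator U x)"
      using U(2) by (auto simp: indicator_def)
    then have "ennreal (norm (indicator A x - g j x)) \<le> ennreal (indicator (U - A) x + norm (g j x - indicator U x))"
      by (rule ennreal_leI)
    also have "\<dots> = indicator (U - A) x + ennreal (norm (g j x - indicator U x))"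
      by (subst ennreal_plus) (auto simp: ennreal_indicator)
    finally show "ennreal (norm (indicator A x - g j x)) \<le> \<dots>" .
  qed
  also have "\<dots> = emeasure lborel (U - A) + (\<integral>\<^sup>+x. ennreal (norm (g j x - indicator U x)) \<partial>lborel)"
    using A Um by (subst nn_integral_add) auto
  also have "\<dots> < ennreal (e / 2) + ennreal (e / 2)"
    using U(4) A Um j by (intro add_strict_mono) auto
  also have "\<dots> = ennreal e" using e by (simp flip: ennreal_plus)
  finally show ?thesis using gc gi by blast
qed

lemma continuous_approx_L1:
  fixes f :: "'a::euclidean_space \<Rightarrow> complex"
  assumes f: "integrable lborel f" and e: "0 < e"
  shows "\<exists>g. continuous_on UNIV g \<and> integrable lborel g \<and>
    (\<integral>\<^sup>+x. ennreal (norm (f x - g x)) \<partial>lborel) < ennreal e"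
  using f e
proof (induction f arbitrary: e rule: integrable_induct)
  case (base A c)
  show ?case
  proof (cases "c = 0")
    case True
    then show ?thesis using base by (intro exI[of _ "\<lambda>_. 0"]) auto
  next
    case False
    then have c: "0 < cmod c" by simp
    obtain g :: "'a \<Rightarrow> real" where g: "continuous_on UNIV g" "integrable lborel g"
      "(\<integral>\<^sup>+x. ennreal (norm (indicator A x - g x)) \<partial>lborel) < ennreal (e / cmod c)"
      using continuous_approx_indicator[of A "e / cmod c"] base c by auto
    have [measurable]: "A \<in> sets borel" "g \<in> borel_measurable borel" using base g(1) by (auto intro: borel_measurable_continuous_onI)
    have "(\<integral>\<^sup>+x. ennreal (norm (indicator A x *\<^sub>R c - g x *\<^sub>R c)) \<partial>lborel) =
       (\<integral>\<^sup>+x. ennreal (cmod c) * ennreal (norm (indicator A x - g x)) \<partial>lborel)"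
      by (intro nn_integral_cong) (simp flip: scaleR_diff_left add: ennreal_mult'[symmetric] mult.commute)
    also have "\<dots> = ennreal (cmod c) * (\<integral>\<^sup>+x. ennreal (norm (indicator A x - g x)) \<partial>lborel)"
      by (rule nn_integral_cmult) measurable
    also have "\<dots> < ennreal (cmod c) * ennreal (e / cmod c)"
      using c g(3) by (intro ennreal_mult_strict_left_mono) auto
    also have "\<dots> = ennreal e" using c by (simp flip: ennreal_mult')
    finally show ?thesis using g by (intro exI[of _ "\<lambda>x. g x *\<^sub>R c"]) (auto intro!: continuous_intros)
  qed
next
  case (add f1 f2)
  obtain g1 where g1: "continuous_on UNIV g1" "integrable lborel g1"
    "(\<integral>\<^sup>+x. ennreal (norm (f1 x - g1 x)) \<partial>lborel) < ennreal (e / 2)" using add.IH(1)[of "e / 2"] add.prems by auto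
  obtain g2 where g2: "continuous_on UNIV g2" "integrable lborel g2"
    "(\<integral>\<^sup>+x. ennreal (norm (f2 x - g2 x)) \<partial>lborel) < ennreal (e / 2)" using add.IH(2)[of "e / 2"] add.prems by auto
  have [measurable]: "f1 \<in> borel_measurable borel" "f2 \<in> borel_measurable borel" "g1 \<in> borel_measurable borel" "g2 \<in> borel_measurable borel"
    using add.hyps g1 g2 by (auto dest: borel_measurable_integrable)
  have "(\<integral>\<^sup>+x. ennreal (norm (f1 x + f2 x - (g1 x + g2 x))) \<partial>lborel) \<le>
     (\<integral>\<^sup>+x. ennreal (norm (f1 x - g1 x)) + ennreal (norm (f2 x - g2 x)) \<partial>lborel)"
    by (intro nn_integral_mono) (simp flip: ennreal_plus add: ennreal_leI norm_diff_triangle_ineq)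
  also have "\<dots> = (\<integral>\<^sup>+x. ennreal (norm (f1 x - g1 x)) \<partial>lborel) + (\<integral>\<^sup>+x. ennreal (norm (f2 x - g2 x)) \<partial>lborel)"
    by (rule nn_integral_add) measurable
  also have "\<dots> < ennreal (e / 2) + ennreal (e / 2)" using g1 g2 by (intro add_strict_mono) auto
  also have "\<dots> = ennreal e" using add.prems by (simp flip: ennreal_plus)
  finally show ?case using g1 g2 by (intro exI[of _ "\<lambda>x. g1 x + g2 x"]) (auto intro!: continuous_intros)
next
  case (lim f s)
  have [measurable]: "f \<in> borel_measurable borel" "s i \<in> borel_measurable borel" for i
    using lim.hyps by (auto dest: borel_measurable_integrable)
  have "(\<lambda>i. \<integral>\<^sup>+x. ennreal (norm (s i x - f x)) \<partial>lborel) \<longlonglongrightarrow> 0"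
  proof (rule Scheffe_lemma1)
    have i0: "(\<lambda>i. LINT x|lborel. norm (s i x)) \<longlonglongrightarrow> (LINT x|lborel. norm (f x))"
    proof (rule integral_dominated_convergence[where w="\<lambda>x. 2 * norm (f x)"])
      show "AE x in lborel. (\<lambda>i. norm (s i x)) \<longlonglongrightarrow> norm (f x)" using lim by (intro AE_I2 tendsto_norm) auto
      show "AE x in lborel. norm (norm (s i x)) \<le> 2 * norm (f x)" for i using lim by (intro AE_I2) auto
      show "integrable lborel (\<lambda>x. 2 * norm (f x))" using lim.hyps by auto
    qed auto
    then have "(\<lambda>i. ennreal (LINT x|lborel. norm (s i x))) \<longlonglongrightarrow> ennreal (LINT x|lborel. norm (f x))"
      by (rule tendsto_ennrealI)
    moreover have "(\<integral>\<^sup>+x. ennreal (norm (h x)) \<partial>lborel) = ennreal (LINT x|lborel. norm (h x))" if "integrable lborel h" for h :: "'a \<Rightarrow> complex"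
      using that by (intro nn_integral_eq_integral) auto
    ultimately have "(\<lambda>i. \<integral>\<^sup>+x. ennreal (norm (s i x)) \<partial>lborel) \<longlonglongrightarrow> (\<integral>\<^sup>+x. ennreal (norm (f x)) \<partial>lborel)"
      using lim.hyps by simp
    then show "limsup (\<lambda>i. \<integral>\<^sup>+x. ennreal (norm (s i x)) \<partial>lborel) \<le> (\<integral>\<^sup>+x. ennreal (norm (f x)) \<partial>lborel)"
      by (simp add: lim_imp_Limsup)
  qed (use lim.hyps in auto)
  then have "eventually (\<lambda>i. (\<integral>\<^sup>+x. ennreal (norm (s i x - f x)) \<partial>lborel) < ennreal (e / 2)) sequentially"
    using lim.prems by (intro order_tendstoD(2)) auto
  then obtain i where i: "(\<integral>\<^sup>+x. ennreal (norm (s i x - f x)) \<partial>lborel) < ennreal (e / 2)"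
    by (auto simp: eventually_sequentially)
  obtain g where g: "continuous_on UNIV g" "integrable lborel g"
    "(\<integral>\<^sup>+x. ennreal (norm (s i x - g x)) \<partial>lborel) < ennreal (e / 2)" using lim.IH[of "e / 2" i] lim.prems by auto
  have [measurable]: "g \<in> borel_measurable borel" using g by (auto dest: borel_measurable_integrable)
  have "(\<integral>\<^sup>+x. ennreal (norm (f x - g x)) \<partial>lborel) \<le>
     (\<integral>\<^sup>+x. ennreal (norm (s i x - f x)) + ennreal (norm (s i x - g x)) \<partial>lborel)"
  proof (intro nn_integral_mono)
    fix x
    have "norm (f x - g x) \<le> norm (s i x - f x) + norm (s i x - g x)"
      using norm_triangle_ineq4[of "s i x - g x" "s i x - f x"] by (simp add: add.commute)
    then show "ennreal (norm (f x - g x)) \<le> ennreal (norm (s i x - f x)) + ennreal (norm (s i x - g x))"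
      by (simp flip: ennreal_plus add: ennreal_leI)
  qed
  also have "\<dots> = (\<integral>\<^sup>+x. ennreal (norm (s i x - f x)) \<partial>lborel) + (\<integral>\<^sup>+x. ennreal (norm (s i x - g x)) \<partial>lborel)"
    by (rule nn_integral_add) measurable
  also have "\<dots> < ennreal (e / 2) + ennreal (e / 2)" using g i by (intro add_strict_mono) auto
  also have "\<dots> = ennreal e" using lim.prems by (simp flip: ennreal_plus)
  finally show ?case using g by blast
qed

text \<open>At small scales the tent average of a continuous function is within e of its value at
  the centre, so scales below 1 determine the bound.\<close>

lemma continuous_tent_average_bound:
  fixes g :: "'a::euclidean_space \<Rightarrow> complex"
  assumes g: "continuous_on UNIV g" "integrable lborel g"
    and bd: "\<And>s. 0 < s \<Longrightarrow> s < 1 \<Longrightarrow> cmod (LINT z|lborel. g z * complex_of_real (tent ((1 / s) *\<^sub>R (z - x)))) \<le> tent_const TYPE('a) * s ^ DIM('a) * m"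
  shows "cmod (g x) \<le> m"
proof (rule field_le_epsilon)
  fix e :: real assume e: "0 < e"
  have [measurable]: "g \<in> borel_measurable borel" using g(1) by (rule borel_measurable_continuous_onI)
  obtain d where d: "0 < d" "\<And>z. dist z x < d \<Longrightarrow> dist (g z) (g x) < e"
    using g(1) e unfolding continuous_on_iff by (metis UNIV_I)
  define s where "s = min (d / 2) (1 / 2)"
  have s: "0 < s" "s < 1" "s < d" using d by (auto simp: s_def)
  let ?t = "\<lambda>z. tent ((1 / s) *\<^sub>R (z - x))" and ?I = "tent_const TYPE('a) * s ^ DIM('a)"
  have I: "0 < ?I" using s tent_const_pos[where 'a='a] by simp
  have i1: "integrable lborel (\<lambda>z. g z * complex_of_real (?t z))"
    by (rule Bochner_Integration.integrable_bound[OF g(2)])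
       (auto simp: norm_mult tent_bounds mult_left_le)
  have i2: "integrable lborel (\<lambda>z. g x * complex_of_real (?t z))"
    using scaled_tent(1)[OF s(1), of x] by simp
  have "cmod (g x) * ?I = cmod (LINT z|lborel. g x * complex_of_real (?t z))"
    using scaled_tent(2)[OF s(1), of x] s tent_const_pos[where 'a='a] by (simp add: norm_mult norm_power)
  also have "\<dots> = cmod ((LINT z|lborel. g z * complex_of_real (?t z)) - (LINT z|lborel. (g z - g x) * complex_of_real (?t z)))"
    using i1 i2 by (subst Bochner_Integration.integral_diff[symmetric]) (auto simp: algebra_simps)
  also have "\<dots> \<le> cmod (LINT z|lborel. g z * complex_of_real (?t z)) + cmod (LINT z|lborel. (g z - g x) * complex_of_real (?t z))"
    by (rule norm_triangle_ineq4)
  also have "cmod (LINT z|lborel. (g z - g x) * complex_of_real (?t z)) \<le> (LINT z|lborel. e * ?t z)"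
  proof (rule order_trans[OF integral_norm_bound integral_mono])
    fix z
    show "norm ((g z - g x) * complex_of_real (?t z)) \<le> e * ?t z"
    proof (cases "?t z = 0")
      case False
      then have "norm (z - x) < s" using tent_nonzero[OF False] s by simp
      then have "dist (g z) (g x) < e" using s by (intro d) (simp add: dist_norm)
      then show ?thesis by (simp add: norm_mult tent_bounds dist_norm mult_right_mono)
    qed simp
  qed (use i1 i2 scaled_tent(1)[OF s(1), of x] in \<open>auto simp: left_diff_distrib\<close>)
  also have "(LINT z|lborel. e * ?t z) = e * ?I" using scaled_tent(2)[OF s(1), of x] by simp
  also have "cmod (LINT z|lborel. g z * complex_of_real (?t z)) \<le> ?I * m" by (rule bd) (use s in auto)
  finally have "cmod (g x) * ?I \<le> (m + e) * ?I" by (simp add: algebra_simps)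
  then show "cmod (g x) \<le> m + e" using I by (simp only: mult_le_cancel_right)
qed

lemma sets_lebesgue_less :
  fixes g h :: "'a::euclidean_space \<Rightarrow> ennreal"
  assumes [measurable]: "g \<in> borel_measurable lebesgue" "h \<in> borel_measurable lebesgue"
  shows "{x. g x < h x} \<in> sets lebesgue"
proof -
  have "{x \<in> space lebesgue. g x < h x} \<in> sets lebesgue" by measurable
  then show ?thesis by simp
qed

text \<open>Lebesgue differentiation in the form of an inequality. Let g be continuous and e-close
  to f in L^1, and d = |f - g|. Off the sets where hl d > T l or d > l, with T the integral of the
  tent, the tent averages give |g| \<le> M + l and hence |f| \<le> M + 2 l. The weak type inequality
  and Markov's inequality bound the exceptional sets by a multiple of e.\<close>

lemma AE_le_of_tent_averages:
  fixes f :: "'a::euclidean_space \<Rightarrow> complex" and M :: "'a \<Rightarrow> ennreal"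
  assumes f: "integrable lborel f" and M [measurable]: "M \<in> borel_measurable lebesgue"
    and bd: "\<And>x s. 0 < s \<Longrightarrow> s < 1 \<Longrightarrow> ennreal (cmod (LINT z|lborel. f z * complex_of_real (tent ((1 / s) *\<^sub>R (z - x)))))
      \<le> ennreal (tent_const TYPE('a) * s ^ DIM('a)) * M x"
  shows "AE x in lebesgue. ennreal (cmod (f x)) \<le> M x"
proof -
  let ?T = "tent_const TYPE('a)" and ?n = "DIM('a)" and ?v = "unit_ball_vol (real DIM('a))"
  have T: "0 < ?T" by (rule tent_const_pos)
  have fm [measurable]: "f \<in> borel_measurable borel" using f by auto
  have fml [measurable]: "f \<in> borel_measurable lebesgue" by (simp add: measurable_completion)
  have null: "emeasure lebesgue {x. M x + ennreal (2 * l) < ennreal (cmod (f x))} = 0" if l: "0 < l" for l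
  proof -
    let ?E = "{x. M x + ennreal (2 * l) < ennreal (cmod (f x))}"
    define C where "C = ?v * 5 ^ ?n / (?T * l) + 1 / l"
    have v: "0 < ?v" by simp
    have C: "0 < C" unfolding C_def using T l v by (intro add_pos_pos divide_pos_pos mult_pos_pos) auto
    have le: "emeasure lebesgue ?E \<le> ennreal (C * e)" if e: "0 < e" for e
    proof -
      obtain g where g: "continuous_on UNIV g" "integrable lborel g"
        "(\<integral>\<^sup>+x. ennreal (norm (f x - g x)) \<partial>lborel) < ennreal e" using continuous_approx_L1[OF f e] by auto
      have [measurable]: "g \<in> borel_measurable borel" using g by auto
      define d where "d = (\<lambda>x. ennreal (norm (f x - g x)))"
      have dm [measurable]: "d \<in> borel_measurable lebesgue" unfolding d_def by (intro measurable_completion) measurable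
      have di: "(\<integral>\<^sup>+x. d x \<partial>lebesgue) \<le> ennreal e" using g(3) unfolding nn_integral_completion d_def by simp
      have sub: "?E \<subseteq> {x. ennreal (?T * l) < hl d x} \<union> {x. ennreal l < d x}"
      proof (rule subsetI, rule ccontr)
        fix x assume x: "x \<in> ?E" "x \<notin> {x. ennreal (?T * l) < hl d x} \<union> {x. ennreal l < d x}"
        then have hd: "hl d x \<le> ennreal (?T * l)" and dx: "d x \<le> ennreal l" by (auto simp: not_less)
        have "M x < top" using x(1) by (cases "M x") auto
        then obtain m where m: "M x = ennreal m" "0 \<le> m" by (cases "M x") auto
        have "cmod (g x) \<le> m + l"
        proof (rule continuous_tent_average_bound[OF g(1,2)])
          fix s :: real assume s: "0 < s" "s < 1"
          let ?t = "\<lambda>z. tent ((1 / s) *\<^sub>R (z - x))"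
          have ti: "integrable lborel (\<lambda>z. h z * complex_of_real (?t z))" if "integrable lborel h" for h
            by (rule Bochner_Integration.integrable_bound[OF that])
               (use that in \<open>auto simp: norm_mult tent_bounds mult_left_le\<close>)
          have "ennreal (cmod (LINT z|lborel. (f z - g z) * complex_of_real (?t z))) \<le>
             (\<integral>\<^sup>+z. ennreal (norm ((f z - g z) * complex_of_real (?t z))) \<partial>lborel)"
            by (rule integral_norm_bound_ennreal) (use ti[of "\<lambda>z. f z - g z"] f g in auto)
          also have "\<dots> \<le> (\<integral>\<^sup>+z\<in>ball x s. d z \<partial>lebesgue)"
            unfolding nn_integral_completion
          proof (rule nn_integral_mono)
            fix z
            show "ennreal (norm ((f z - g z) * complex_of_real (?t z))) \<le> d z * indicator (ball x s) z"
            proof (cases "?t z = 0")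
              case False
              then have "norm (z - x) < s" using tent_nonzero[OF False] s by simp
              then show ?thesis unfolding d_def using s
                by (auto simp: norm_mult tent_bounds dist_norm norm_minus_commute intro!: ennreal_leI mult_left_le)
            qed simp
          qed
          also have "\<dots> \<le> ennreal (s ^ ?n) * hl d x" using s by (intro hl_ge_ball) auto
          also have "\<dots> \<le> ennreal (s ^ ?n) * ennreal (?T * l)" by (intro mult_left_mono hd) auto
          also have "\<dots> = ennreal (?T * s ^ ?n * l)" using s T l by (simp add: ennreal_mult[symmetric] mult_ac)
          finally have 1: "cmod (LINT z|lborel. (f z - g z) * complex_of_real (?t z)) \<le> ?T * s ^ ?n * l"
            using s T l by (subst (asm) ennreal_le_iff) auto
          have "ennreal (cmod (LINT z|lborel. f z * complex_of_real (?t z))) \<le> ennreal (?T * s ^ ?n * m)"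
            using bd[OF s, of x] s T m by (simp add: ennreal_mult)
          then have 2: "cmod (LINT z|lborel. f z * complex_of_real (?t z)) \<le> ?T * s ^ ?n * m"
            using s T m by (subst (asm) ennreal_le_iff) auto
          have "(LINT z|lborel. g z * complex_of_real (?t z)) =
            (LINT z|lborel. f z * complex_of_real (?t z)) - (LINT z|lborel. (f z - g z) * complex_of_real (?t z))"
            using ti[OF f] ti[OF g(2)] by (simp add: left_diff_distrib)
          also have "cmod \<dots> \<le> ?T * s ^ ?n * m + ?T * s ^ ?n * l"
            by (rule norm_triangle_le_diff) (use 1 2 in simp)
          finally show "cmod (LINT z|lborel. g z * complex_of_real (?t z)) \<le> ?T * s ^ ?n * (m + l)"
            by (simp add: distrib_left)
        qed
        moreover have "cmod (f x - g x) \<le> l" using dx l by (simp add: d_def)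
        ultimately have "cmod (f x) \<le> m + 2 * l" using norm_triangle_sub[of "f x" "g x"] by linarith
        then have "ennreal (cmod (f x)) \<le> M x + ennreal (2 * l)"
          using m l by (simp flip: ennreal_plus add: ennreal_leI)
        with x(1) show False by auto
      qed
      have "emeasure lebesgue ?E \<le> emeasure lebesgue ({x. ennreal (?T * l) < hl d x} \<union> {x. ennreal l < d x})"
        by (rule emeasure_mono[OF sub]) (intro sets.Un sets_lebesgue_less borel_measurable_const hl_measurable_lebesgue dm)
      also have "\<dots> \<le> emeasure lebesgue {x. ennreal (?T * l) < hl d x} + emeasure lebesgue {x. ennreal l < d x}"
        by (rule emeasure_subadditive) (intro sets_lebesgue_less borel_measurable_const hl_measurable_lebesgue dm)+
      also have "\<dots> \<le> ennreal (?v * 5 ^ ?n / (?T * l)) * ennreal e + ennreal (1 / l) * ennreal e"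
      proof (rule add_mono)
        have "emeasure lebesgue {x. ennreal (?T * l) < hl d x} \<le> ennreal (?v * 5 ^ ?n / (?T * l)) * (\<integral>\<^sup>+x. d x \<partial>lebesgue)"
          by (rule hl_weak) (use T l in auto)
        also have "\<dots> \<le> ennreal (?v * 5 ^ ?n / (?T * l)) * ennreal e" by (intro mult_left_mono di) auto
        finally show "emeasure lebesgue {x. ennreal (?T * l) < hl d x} \<le> \<dots>" .
        have "emeasure lebesgue {x. ennreal l < d x} \<le> emeasure lebesgue ({x\<in>UNIV. 1 \<le> ennreal (1 / l) * d x})"
        proof (rule emeasure_mono)
          show "{x. ennreal l < d x} \<subseteq> {x\<in>UNIV. 1 \<le> ennreal (1 / l) * d x}"
          proof
            fix x assume "x \<in> {x. ennreal l < d x}"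
            then have "ennreal (1 / l) * ennreal l \<le> ennreal (1 / l) * d x" by (intro mult_left_mono) auto
            then show "x \<in> {x\<in>UNIV. 1 \<le> ennreal (1 / l) * d x}" using l by (simp add: ennreal_mult[symmetric])
          qed
          have "{x\<in>space lebesgue. 1 \<le> ennreal (1 / l) * d x} \<in> sets lebesgue" by measurable
          then show "{x\<in>UNIV. 1 \<le> ennreal (1 / l) * d x} \<in> sets lebesgue" by simp
        qed
        also have "\<dots> \<le> ennreal (1 / l) * (\<integral>\<^sup>+x. d x * indicator UNIV x \<partial>lebesgue)"
          using nn_integral_Markov_inequality[where u=d and M=lebesgue and A=UNIV and c="ennreal (1 / l)"] by simp
        also have "\<dots> \<le> ennreal (1 / l) * ennreal e" using di by (intro mult_left_mono) auto
        finally show "emeasure lebesgue {x. ennreal l < d x} \<le> \<dots>" .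
      qed
      also have "\<dots> = ennreal (C * e)"
        using T l v e by (simp add: C_def distrib_right ennreal_mult[symmetric] ennreal_plus[symmetric] del: ennreal_plus)
      finally show ?thesis .
    qed
    show ?thesis
    proof (rule ccontr)
      assume "emeasure lebesgue ?E \<noteq> 0"
      moreover have fin: "emeasure lebesgue ?E \<le> ennreal C" using le[of 1] by simp
      ultimately obtain y where y: "emeasure lebesgue ?E = ennreal y" "0 < y"
        by (cases "emeasure lebesgue ?E") (auto simp: top_unique)
      \<comment> \<open>A positive measure y contradicts the bound at e = y / (2 C).\<close>
      have "ennreal y \<le> ennreal (C * (y / (2 * C)))" using le[of "y / (2 * C)"] y C by simp
      then have "y \<le> C * (y / (2 * C))" using y C by (subst (asm) ennreal_le_iff) auto
      then show False using y C by simp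
    qed
  qed
  have "AE x in lebesgue. \<forall>j. \<not> (M x + ennreal (2 * (1 / real (Suc j))) < ennreal (cmod (f x)))"
  proof (subst AE_all_countable, rule allI)
    fix j
    have "{x. M x + ennreal (2 * (1 / real (Suc j))) < ennreal (cmod (f x))} \<in> null_sets lebesgue"
      using null[of "1 / real (Suc j)"] by (intro null_setsI sets_lebesgue_less) measurable
    from AE_not_in[OF this] show "AE x in lebesgue. \<not> (M x + ennreal (2 * (1 / real (Suc j))) < ennreal (cmod (f x)))"
      by simp
  qed
  then show ?thesis
  proof eventually_elim
    case (elim x)
    show ?case
    proof (cases "M x")
      case (real m)
      have "cmod (f x) \<le> m + e" if e: "0 < e" for e
      proof -
        obtain j where j: "inverse (real (Suc j)) < e / 2" using reals_Archimedean[of "e / 2"] e by auto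
        have "ennreal (cmod (f x)) \<le> ennreal m + ennreal (2 * (1 / real (Suc j)))"
          using elim real by (auto simp: not_less)
        then have "cmod (f x) \<le> m + 2 * (1 / real (Suc j))"
          using real by (simp add: ennreal_plus[symmetric] del: ennreal_plus)
        with j show ?thesis by (simp add: inverse_eq_divide)
      qed
      then have "cmod (f x) \<le> m" by (rule field_le_epsilon)
      then show ?thesis using real by (simp add: ennreal_leI)
    qed simp
  qed
qed

context approx_kernel
begin

text \<open>The summand 1 keeps the constant positive, so that its product with an infinite maximal
  function is infinite.\<close>

definition "C4 = C3 * 3 powr K / tent_const TYPE('a) + 1"

text \<open>A tent of scale s about x is a molecule, so \<open>mol_pairing_bound\<close> controls
  the tent averages of f at x. This takes the place of almost everywhere convergence of f * \<phi>_t
  and is what bounds the L^2 mass of f outside the level sets.\<close>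

lemma AE_le_maximal:
  fixes N :: "'a \<Rightarrow> ennreal"
  assumes N [measurable]: "N \<in> borel_measurable lebesgue"
    and f [measurable]: "f \<in> borel_measurable borel" and f2: "integrable lborel (\<lambda>x. (cmod (f x))\<^sup>2)"
    and nt: "\<And>t x y. 0 < t \<Longrightarrow> norm (x - y) \<le> t \<Longrightarrow> ennreal (cmod (ut f t y)) \<le> N x"
  shows "AE x in lebesgue. ennreal (cmod (f x)) \<le> ennreal C4 * ennpowr (hl (\<lambda>y. ennpowr (N y) r) x) (1 / r)"
proof -
  let ?M = "\<lambda>x. ennpowr (hl (\<lambda>y. ennpowr (N y) r) x) (1 / r)" and ?T = "tent_const TYPE('a)"
  have T: "0 < ?T" by (rule tent_const_pos)
  have "0 \<le> C3 * 3 powr K / ?T" using T C3_nonneg by simp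
  then have C4: "0 < C4" unfolding C4_def by linarith
  have "C3 * 3 powr K \<le> C3 * 3 powr K + ?T" using T by linarith
  also have "\<dots> = C4 * ?T" using T unfolding C4_def distrib_right by simp
  finally have C4': "C3 * 3 powr K \<le> C4 * ?T" .
  \<comment> \<open>f is only square integrable, so it is cut to balls to become integrable. Radius
    R + 1 leaves the averages at points of norm below R unchanged, since s < 1; elsewhere the bound
    is infinite.\<close>
  define fR where "fR = (\<lambda>(R::nat) z. f z * indicator (ball 0 (real R + 1)) z)"
  have "AE x in lebesgue. ennreal (cmod (fR R x)) \<le> (if x \<in> ball 0 (real R) then ennreal C4 * ?M x else top)" for R
  proof (rule AE_le_of_tent_averages)
    have sq: "(\<lambda>x. (cmod (indicator (ball (0::'a) (real R + 1)) x))\<^sup>2) = indicator (ball 0 (real R + 1))"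
      by (auto simp: indicator_def fun_eq_iff)
    have "integrable lborel (\<lambda>x. (cmod (indicator (ball (0::'a) (real R + 1)) x))\<^sup>2)"
      unfolding sq by (rule integrable_ball_indicator)
    then show "integrable lborel (fR R)"
      unfolding fR_def by (intro sq_integrable_mult(1)[OF _ _ f2]) (simp_all add: borel_measurable_indicator)
    show "(\<lambda>x. if x \<in> ball 0 (real R) then ennreal C4 * ?M x else top) \<in> borel_measurable lebesgue"
      by measurable
    fix x :: 'a and s :: real assume s: "0 < s" "s < 1"
    let ?t = "\<lambda>z. tent ((1 / s) *\<^sub>R (z - x))"
    show "ennreal (cmod (LINT z|lborel. fR R z * complex_of_real (?t z)))
      \<le> ennreal (?T * s ^ DIM('a)) * (if x \<in> ball 0 (real R) then ennreal C4 * ?M x else top)"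
    proof (cases "x \<in> ball 0 (real R) \<and> hl (\<lambda>y. ennpowr (N y) r) x \<noteq> top")
      case False
      have "ennreal (?T * s ^ DIM('a)) \<noteq> 0" "ennreal C4 \<noteq> 0" using T s C4 by (auto simp: not_le)
      then show ?thesis using False by (auto simp: ennreal_mult_eq_top_iff ennreal_mult_top)
    next
      case True
      then obtain A where A: "hl (\<lambda>y. ennpowr (N y) r) x = ennreal A" "0 \<le> A"
        by (cases "hl (\<lambda>y. ennpowr (N y) r) x") auto
      have eq: "fR R z * complex_of_real (?t z) = f z * complex_of_real (?t z)" for z
      proof (cases "?t z = 0")
        case False
        then have "norm (z - x) < s" using tent_nonzero[OF False] s by simp
        then have "norm z < real R + 1" using True s norm_triangle_sub[of z x] by simp
        then show ?thesis by (simp add: fR_def)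
      qed simp
      have mol: "mol \<delta> K x s (3 powr K * 1) (\<lambda>z. complex_of_real (?t z))"
      proof (rule mol_compact_support)
        fix z assume "complex_of_real (?t z) \<noteq> 0"
        then have "?t z \<noteq> 0" by simp
        from tent_nonzero[OF this] show "norm (z - x) \<le> 2 * s" using s by simp
      next
        fix z z' :: 'a
        let ?d = "norm (z - z') / s"
        have "\<bar>?t z - ?t z'\<bar> \<le> norm ((1 / s) *\<^sub>R (z - x) - (1 / s) *\<^sub>R (z' - x))" by (rule tent_lipschitz)
        also have "\<dots> = ?d" using s by (simp flip: scaleR_diff_right)
        finally have 1: "\<bar>?t z - ?t z'\<bar> \<le> ?d" .
        have 2: "\<bar>?t z - ?t z'\<bar> \<le> 1" using tent_bounds[of "(1 / s) *\<^sub>R (z - x)"] tent_bounds[of "(1 / s) *\<^sub>R (z' - x)"] by linarith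
        have "\<bar>?t z - ?t z'\<bar> \<le> ?d powr \<delta>"
        proof (cases "?d \<le> 1")
          case True
          have "?d powr 1 \<le> ?d powr \<delta>" using True s delta by (intro powr_mono') auto
          then show ?thesis using 1 s by simp
        next
          case False
          then have "1 \<le> ?d powr \<delta>" using delta by (intro ge_one_powr_ge_zero) auto
          with 2 show ?thesis by linarith
        qed
        then show "cmod (complex_of_real (?t z) - complex_of_real (?t z')) \<le> 1 * ?d powr \<delta>"
          by (simp flip: of_real_diff)
      next
        fix z show "cmod (complex_of_real (?t z)) \<le> 1"
          using tent_bounds(1,2)[of "(1 / s) *\<^sub>R (z - x)"] by (simp only: norm_of_real abs_of_nonneg)
      qed (use s K_pos in auto)
      have "cmod (LINT z|lborel. f z * complex_of_real (?t z)) \<le> C3 * (3 powr K * 1) * s ^ DIM('a) * A powr (1 / r)"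
        by (rule mol_pairing_bound[OF N f f2 nt mol _ s(1) _ A]) (use s in auto)
      also have "\<dots> \<le> (C4 * ?T) * s ^ DIM('a) * A powr (1 / r)"
        using s C4' by (intro mult_right_mono) auto
      also have "\<dots> = (?T * s ^ DIM('a)) * (C4 * A powr (1 / r))" by simp
      finally show ?thesis using True A C4 T s by (simp add: eq ennreal_mult[symmetric] ennreal_leI)
    qed
  qed
  then have "AE x in lebesgue. \<forall>R. ennreal (cmod (fR R x)) \<le> (if x \<in> ball 0 (real R) then ennreal C4 * ?M x else top)"
    by (simp add: AE_all_countable)
  then show ?thesis
  proof eventually_elim
    case (elim x)
    obtain R :: nat where "norm x < real R" using reals_Archimedean2 by blast
    then show ?case using elim[rule_format, of R] by (simp add: fR_def)
  qed
qed

end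

section \<open>Calderon--Zygmund decomposition\<close>

lemma power_diff_le_unit:
  fixes x y :: real
  assumes "0 \<le> x" "x \<le> 1" "0 \<le> y" "y \<le> 1"
  shows "\<bar>x ^ n - y ^ n\<bar> \<le> real n * \<bar>x - y\<bar>"
  using norm_power_diff[of x y n] assms by simp

lemma unit_ball_vol_nonzero [simp]: "unit_ball_vol (real n) \<noteq> 0"
  by (rule less_imp_neq[THEN not_sym]) simp

locale cz_region =
  fixes \<Omega> :: "'a::euclidean_space set"
  assumes open_Om: "open \<Omega>" and ne: "- \<Omega> \<noteq> {}"
begin

text \<open>A fraction of the distance to the complement: small enough that radii of overlapping
  balls are comparable within factors 20/19 and 21/20, while some point outside \<Omega> is still
  within 20 radii, the distance allowed in the pairing estimate.\<close>

definition "rho z = infdist z (- \<Omega>) / 20"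
text \<open>A continuous analogue of a Whitney partition of unity, with the centre w as index. As
  the radius depends on z and not on w, the integral over w is the same constant for every z in
  \<Omega>, without dividing by a sum. Outside \<Omega> the denominator is 0 and so is the
  value.\<close>

definition "pu w z = tent ((1 / rho z) *\<^sub>R (w - z)) / rho z ^ DIM('a)"
text \<open>Here the radius is that of w, so that the integral in z is 1, which is what cancellation
  in z requires.\<close>

definition "avg w z = (if dist w z < rho w then 1 / (unit_ball_vol (real DIM('a)) * rho w ^ DIM('a)) else 0)"

lemma rho_nonneg: "0 \<le> rho z"
  by (simp add: rho_def infdist_nonneg)

lemma rho_lip: "\<bar>rho z - rho w\<bar> \<le> norm (z - w) / 20"
  using infdist_triangle_abs[of z "- \<Omega>" w] by (simp add: rho_def dist_norm diff_divide_distrib[symmetric])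

lemma rho_measurable [measurable]: "rho \<in> borel_measurable borel"
  unfolding rho_def by (intro borel_measurable_continuous_onI continuous_intros) auto

lemma rho_pos_iff: "0 < rho z \<longleftrightarrow> z \<in> \<Omega>"
  using in_closed_iff_infdist_zero[of "- \<Omega>" z] open_Om ne infdist_nonneg[of z "- \<Omega>"]
  by (auto simp: rho_def less_le)

lemma rho_le_dist: "x \<notin> \<Omega> \<Longrightarrow> 20 * rho w \<le> norm (x - w)"
  using infdist_le[of x "- \<Omega>" w] by (simp add: rho_def dist_norm norm_minus_commute)

lemma rho_attained: "\<exists>x. x \<notin> \<Omega> \<and> dist x w = 20 * rho w"
proof -
  obtain x where "x \<in> - \<Omega>" "infdist w (- \<Omega>) = dist w x"
    using infdist_attains_inf[of "- \<Omega>" w] open_Om ne by auto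
  then show ?thesis by (auto simp: rho_def dist_commute)
qed

lemma pu_measurable [measurable]: "(\<lambda>(w, z). pu w z) \<in> borel_measurable (borel \<Otimes>\<^sub>M borel)"
  unfolding pu_def by measurable

lemma avg_measurable [measurable]: "(\<lambda>(w, z). avg w z) \<in> borel_measurable (borel \<Otimes>\<^sub>M borel)"
  unfolding avg_def by measurable

lemma pu_nonneg: "0 \<le> pu w z"
  by (simp add: pu_def tent_bounds rho_nonneg)

lemma avg_nonneg: "0 \<le> avg w z"
  by (simp add: avg_def rho_nonneg)

text \<open>On the support |z - w| < rho z, and \<open>rho\<close> has Lipschitz constant 1/20,
  hence rho w lies between 19/20 and 21/20 of rho z.\<close>

lemma pu_support:
  assumes "pu w z \<noteq> 0"
  shows "z \<in> \<Omega>" "w \<in> \<Omega>" "norm (z - w) < rho z" "rho z \<le> 20 / 19 * rho w" "rho w \<le> 21 / 20 * rho z" "norm (z - w) \<le> 2 * rho w"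
proof -
  have "rho z \<noteq> 0" using assms by (auto simp: pu_def)
  then have p: "0 < rho z" using rho_nonneg[of z] by simp
  then show "z \<in> \<Omega>" by (simp add: rho_pos_iff)
  have "tent ((1 / rho z) *\<^sub>R (w - z)) \<noteq> 0" using assms by (auto simp: pu_def)
  from tent_nonzero[OF this] show n: "norm (z - w) < rho z"
    using p by (simp add: norm_minus_commute pos_divide_less_eq)
  show 1: "rho z \<le> 20 / 19 * rho w" and 2: "rho w \<le> 21 / 20 * rho z" using rho_lip[of z w] n by linarith+
  show "norm (z - w) \<le> 2 * rho w" using n 1 rho_nonneg[of w] by linarith
  have "0 < rho w" using 1 p by simp
  then show "w \<in> \<Omega>" by (simp add: rho_pos_iff)
qed

lemma inverse_power_le:
  assumes "0 < a" "a \<le> 2 * b"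
  shows "1 / b ^ n \<le> 2 ^ n / (a ^ n :: real)"
proof -
  have "a ^ n \<le> (2 * b) ^ n" using assms by (intro power_mono) auto
  then show ?thesis using assms by (simp add: power_mult_distrib field_simps)
qed

lemma pu_le: "pu w z \<le> 2 ^ DIM('a) / rho w ^ DIM('a)"
proof (cases "pu w z = 0")
  case True then show ?thesis by (simp add: rho_nonneg)
next
  case False
  have "pu w z \<le> 1 / rho z ^ DIM('a)"
    unfolding pu_def using rho_nonneg by (intro divide_right_mono tent_bounds) auto
  also have "\<dots> \<le> 2 ^ DIM('a) / rho w ^ DIM('a)"
    using pu_support[OF False] rho_pos_iff[of w] by (intro inverse_power_le) auto
  finally show ?thesis .
qed

text \<open>The n comes from the variation of rho z^-n, the 3 from that of the argument of the tent;
  2^n compares radii.\<close>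

definition "LL = 2 ^ DIM('a) * (real DIM('a) + 3)"

text \<open>Both the argument of the tent and the normalisation vary with z through
  \<open>rho z\<close>, so the difference is split in two. The restriction |z - z'| < rho w keeps
  \<open>rho z'\<close> bounded below by half of \<open>rho w\<close>.\<close>

lemma pu_lipschitz:
  assumes nz: "pu w z \<noteq> 0" and d: "norm (z - z') < rho w"
  shows "\<bar>pu w z - pu w z'\<bar> \<le> LL / rho w ^ DIM('a) * (norm (z - z') / rho w)"
proof -
  let ?n = "DIM('a)" and ?d = "norm (z - z')" and ?R = "rho w"
  define s s' where "s = rho z" and "s' = rho z'"
  define t t' where "t = tent ((1 / s) *\<^sub>R (w - z))" and "t' = tent ((1 / s') *\<^sub>R (w - z'))"
  note S = pu_support[OF nz]
  have R: "0 < ?R" using S(2) by (simp add: rho_pos_iff)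
  have s: "?R \<le> 2 * s" "0 < s" using S R unfolding s_def by auto
  have "\<bar>s' - ?R\<bar> \<le> norm (z' - w) / 20" unfolding s'_def by (rule rho_lip)
  also have "norm (z' - w) \<le> 3 * ?R" using S(6) d norm_triangle_ineq[of "z' - z" "z - w"] by (simp add: norm_minus_commute)
  finally have "\<bar>s' - ?R\<bar> \<le> 3 * ?R / 20" by simp
  then have s': "?R \<le> 2 * s'" "0 < s'" using R by linarith+
  have ss: "\<bar>1 / s - 1 / s'\<bar> \<le> ?d / (5 * ?R\<^sup>2)"
  proof -
    have "1 / s - 1 / s' = (s' - s) / (s * s')" using s s' by (simp add: diff_frac_eq)
    then have "\<bar>1 / s - 1 / s'\<bar> = \<bar>s' - s\<bar> / (s * s')" using s s' by (simp add: abs_mult)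
    also have "\<dots> \<le> (?d / 20) / (?R / 2 * (?R / 2))"
    proof (rule frac_le)
      show "\<bar>s' - s\<bar> \<le> ?d / 20" unfolding s_def s'_def using rho_lip[of z' z] by (simp add: norm_minus_commute)
      show "?R / 2 * (?R / 2) \<le> s * s'" using s s' R by (intro mult_mono) auto
    qed (use R in auto)
    also have "\<dots> = ?d / (5 * ?R\<^sup>2)" by (simp add: power2_eq_square)
    finally show ?thesis .
  qed
  have p: "\<bar>1 / s ^ ?n - 1 / s' ^ ?n\<bar> \<le> 2 ^ ?n / ?R ^ ?n * (real ?n * (?d / ?R))"
  proof -
    \<comment> \<open>Rescaling moves the two quantities into [0, 1], where n-th powers are
      Lipschitz with constant n.\<close>
    define x y where "x = ?R / (2 * s)" and "y = ?R / (2 * s')"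
    have xy: "0 \<le> x" "x \<le> 1" "0 \<le> y" "y \<le> 1" using s s' R by (auto simp: x_def y_def)
    have "1 / s ^ ?n - 1 / s' ^ ?n = 2 ^ ?n / ?R ^ ?n * (x ^ ?n - y ^ ?n)"
      using R s s' by (simp add: x_def y_def power_divide power_mult_distrib field_simps)
    then have "\<bar>1 / s ^ ?n - 1 / s' ^ ?n\<bar> = 2 ^ ?n / ?R ^ ?n * \<bar>x ^ ?n - y ^ ?n\<bar>"
      using R by (simp add: abs_mult)
    also have "\<dots> \<le> 2 ^ ?n / ?R ^ ?n * (real ?n * \<bar>x - y\<bar>)"
      using R by (intro mult_left_mono power_diff_le_unit xy) auto
    also have "\<bar>x - y\<bar> = ?R / 2 * \<bar>1 / s - 1 / s'\<bar>"
    proof -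
      have "x - y = ?R / 2 * (1 / s - 1 / s')" by (simp add: x_def y_def algebra_simps)
      then have "\<bar>x - y\<bar> = \<bar>?R / 2\<bar> * \<bar>1 / s - 1 / s'\<bar>" by (simp only: abs_mult)
      then show ?thesis using R by simp
    qed
    also have "2 ^ ?n / ?R ^ ?n * (real ?n * (?R / 2 * \<bar>1 / s - 1 / s'\<bar>)) \<le> 2 ^ ?n / ?R ^ ?n * (real ?n * (?R / 2 * (?d / (5 * ?R\<^sup>2))))"
      using R by (intro mult_left_mono ss) auto
    also have "?R / 2 * (?d / (5 * ?R\<^sup>2)) = (?d / ?R) / 10" using R by (simp add: power2_eq_square)
    also have "2 ^ ?n / ?R ^ ?n * (real ?n * ((?d / ?R) / 10)) \<le> 2 ^ ?n / ?R ^ ?n * (real ?n * (?d / ?R))"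
      using R by (intro mult_left_mono) (auto simp: field_simps)
    finally show ?thesis .
  qed
  have t: "\<bar>t - t'\<bar> \<le> 3 * (?d / ?R)"
  proof -
    have "\<bar>t - t'\<bar> \<le> norm ((1 / s) *\<^sub>R (w - z) - (1 / s') *\<^sub>R (w - z'))" unfolding t_def t'_def by (rule tent_lipschitz)
    also have "(1 / s) *\<^sub>R (w - z) - (1 / s') *\<^sub>R (w - z') = (1 / s - 1 / s') *\<^sub>R (w - z) + (1 / s') *\<^sub>R (z' - z)"
      by (simp add: algebra_simps)
    also have "norm \<dots> \<le> \<bar>1 / s - 1 / s'\<bar> * norm (w - z) + 1 / s' * ?d"
      using norm_triangle_ineq[of "(1 / s - 1 / s') *\<^sub>R (w - z)" "(1 / s') *\<^sub>R (z' - z)"] s' by (simp add: norm_minus_commute)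
    also have "\<dots> \<le> ?d / (5 * ?R\<^sup>2) * (2 * ?R) + 2 / ?R * ?d"
    proof (intro add_mono mult_mono ss)
      show "norm (w - z) \<le> 2 * ?R" using S(6) by (simp add: norm_minus_commute)
      show "1 / s' \<le> 2 / ?R" using s' R by (simp add: field_simps)
    qed (use R in auto)
    also have "\<dots> = 12 / 5 * (?d / ?R)" using R by (simp add: power2_eq_square field_simps)
    also have "\<dots> \<le> 3 * (?d / ?R)" using R by (intro mult_right_mono) auto
    finally show ?thesis .
  qed
  have "pu w z - pu w z' = t * (1 / s ^ ?n - 1 / s' ^ ?n) + (t - t') * (1 / s' ^ ?n)"
    by (simp add: pu_def t_def t'_def s_def s'_def algebra_simps diff_divide_distrib)
  then have "\<bar>pu w z - pu w z'\<bar> \<le> \<bar>t\<bar> * \<bar>1 / s ^ ?n - 1 / s' ^ ?n\<bar> + \<bar>t - t'\<bar> * \<bar>1 / s' ^ ?n\<bar>"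
    by (metis abs_mult abs_triangle_ineq)
  also have "\<dots> \<le> 1 * (2 ^ ?n / ?R ^ ?n * (real ?n * (?d / ?R))) + 3 * (?d / ?R) * (2 ^ ?n / ?R ^ ?n)"
  proof (intro add_mono mult_mono p t)
    show "\<bar>t\<bar> \<le> 1" using tent_bounds(1,2)[of "(1 / s) *\<^sub>R (w - z)"] by (simp add: t_def)
    show "\<bar>1 / s' ^ ?n\<bar> \<le> 2 ^ ?n / ?R ^ ?n" using inverse_power_le[OF R s'(1), of ?n] s' by simp
  qed (use R in auto)
  also have "\<dots> = LL / ?R ^ ?n * (?d / ?R)"
  proof -
    have "1 * (P / Q * (m * X)) + 3 * X * (P / Q) = P * (m + 3) / Q * X" for P Q X m :: real
      by (simp add: distrib_left distrib_right add_divide_distrib mult_ac)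
    then show ?thesis unfolding LL_def .
  qed
  finally show ?thesis .
qed

lemma pu_integral:
  assumes "z \<in> \<Omega>"
  shows "integrable lborel (\<lambda>w. pu w z)" "(LINT w|lborel. pu w z) = tent_const TYPE('a)"
proof -
  have r: "0 < rho z" using assms by (simp add: rho_pos_iff)
  show "integrable lborel (\<lambda>w. pu w z)"
    unfolding pu_def by (intro integrable_divide_zero scaled_tent(1) r)
  show "(LINT w|lborel. pu w z) = tent_const TYPE('a)"
    unfolding pu_def using scaled_tent(2)[OF r, of z] r by simp
qed

lemma pu_outside: "z \<notin> \<Omega> \<Longrightarrow> pu w z = 0"
  using pu_support(1) by blast

lemma avg_support:
  assumes "avg w z \<noteq> 0"
  shows "z \<in> \<Omega>" "norm (z - w) < rho w" "rho w \<le> 20 / 19 * rho z" "rho z \<le> 21 / 20 * rho w"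
proof -
  show n: "norm (z - w) < rho w" using assms by (auto simp: avg_def dist_norm norm_minus_commute split: if_splits)
  show 1: "rho w \<le> 20 / 19 * rho z" and "rho z \<le> 21 / 20 * rho w" using rho_lip[of z w] n by linarith+
  have "0 < rho w" using n norm_ge_zero[of "z - w"] by linarith
  then have "0 < rho z" using 1 by simp
  then show "z \<in> \<Omega>" by (simp add: rho_pos_iff)
qed

lemma avg_le: "avg w z \<le> 2 ^ DIM('a) / (unit_ball_vol (real DIM('a)) * rho z ^ DIM('a)) * indicator (ball z (2 * rho z)) w"
proof (cases "avg w z = 0")
  case True
  have "0 \<le> 2 ^ DIM('a) / (unit_ball_vol (real DIM('a)) * rho z ^ DIM('a))" by (simp add: rho_nonneg)
  then show ?thesis using True by (simp add: indicator_def)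
next
  case False
  note S = avg_support[OF False]
  have z: "0 < rho z" using S(1) by (simp add: rho_pos_iff)
  have "avg w z = 1 / unit_ball_vol (real DIM('a)) * (1 / rho w ^ DIM('a))" using False by (auto simp: avg_def split: if_splits)
  also have "\<dots> \<le> 1 / unit_ball_vol (real DIM('a)) * (2 ^ DIM('a) / rho z ^ DIM('a))"
    using S z by (intro mult_left_mono inverse_power_le) auto
  finally have "avg w z \<le> 2 ^ DIM('a) / (unit_ball_vol (real DIM('a)) * rho z ^ DIM('a))" by simp
  moreover have "w \<in> ball z (2 * rho z)" using S z by (auto simp: dist_norm)
  ultimately show ?thesis by simp
qed

text \<open>One factor 2^n compares the radii at w and z, the other is due to the ball of radius 2
  rho z which contains every w that contributes.\<close>

lemma avg_nn_integral: "(\<integral>\<^sup>+w. ennreal (avg w z) \<partial>lborel) \<le> ennreal (4 ^ DIM('a))"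
proof (cases "rho z = 0")
  case True
  then have "avg w z = 0" for w using avg_support(1)[of w z] rho_pos_iff[of z] by auto
  then show ?thesis by simp
next
  case False
  let ?v = "unit_ball_vol (real DIM('a))" and ?n = "DIM('a)"
  have z: "0 < rho z" using False rho_nonneg[of z] by simp
  have v: "0 < ?v" by simp
  have "(\<integral>\<^sup>+w. ennreal (avg w z) \<partial>lborel) \<le> (\<integral>\<^sup>+w. ennreal (2 ^ ?n / (?v * rho z ^ ?n)) * indicator (ball z (2 * rho z)) w \<partial>lborel)"
  proof (rule nn_integral_mono)
    fix w
    have "ennreal (avg w z) \<le> ennreal (2 ^ ?n / (?v * rho z ^ ?n) * indicator (ball z (2 * rho z)) w)"
      by (rule ennreal_leI) (rule avg_le)
    then show "ennreal (avg w z) \<le> ennreal (2 ^ ?n / (?v * rho z ^ ?n)) * indicator (ball z (2 * rho z)) w"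
      by (cases "w \<in> ball z (2 * rho z)") auto
  qed
  also have "\<dots> = ennreal (2 ^ ?n / (?v * rho z ^ ?n)) * ennreal (?v * (2 * rho z) ^ ?n)"
    using z by (subst nn_integral_cmult_indicator) (auto simp: emeasure_ball)
  also have "\<dots> = ennreal (4 ^ ?n)"
  proof -
    have "2 ^ ?n / (?v * rho z ^ ?n) * (?v * (2 * rho z) ^ ?n) = 2 ^ ?n * 2 ^ ?n"
      using z v by (simp add: power_mult_distrib)
    also have "\<dots> = (4::real) ^ ?n" by (simp flip: power_mult_distrib)
    finally show ?thesis using z v by (simp flip: ennreal_mult)
  qed
  finally show ?thesis .
qed

lemma avg_integrable: "integrable lborel (\<lambda>w. avg w z)" "(LINT w|lborel. avg w z) \<le> 4 ^ DIM('a)"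
proof -
  show i: "integrable lborel (\<lambda>w. avg w z)"
    by (rule integrableI_nonneg) (auto simp: avg_nonneg intro!: le_less_trans[OF avg_nn_integral])
  have "ennreal (LINT w|lborel. avg w z) \<le> ennreal (4 ^ DIM('a))"
    using avg_nn_integral[of z] i by (subst (asm) nn_integral_eq_integral) (auto simp: avg_nonneg)
  then show "(LINT w|lborel. avg w z) \<le> 4 ^ DIM('a)" by (subst (asm) ennreal_le_iff) auto
qed

lemma avg_integral_one:
  assumes "w \<in> \<Omega>"
  shows "integrable lborel (avg w)" "(LINT z|lborel. avg w z) = 1"
proof -
  let ?v = "unit_ball_vol (real DIM('a))"
  have w: "0 < rho w" using assms by (simp add: rho_pos_iff)
  have v: "0 < ?v" by simp
  have eq: "avg w z = 1 / (?v * rho w ^ DIM('a)) * indicator (ball w (rho w)) z" for z by (simp add: avg_def indicator_def)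
  show "integrable lborel (avg w)"
    unfolding eq[abs_def] by (intro integrable_mult_right integrable_ball_indicator)
  have "(LINT z|lborel. avg w z) = 1 / (?v * rho w ^ DIM('a)) * measure lborel (ball w (rho w))"
    unfolding eq by simp
  also have "\<dots> = 1" using w v by (simp add: content_ball)
  finally show "(LINT z|lborel. avg w z) = 1" .
qed

text \<open>2 * 2^n serves pairs of points at distance at least rho w, and 2^n + LL the closer
  ones.\<close>

definition "CL = 2 * 2 ^ DIM('a) + LL"

text \<open>\<open>pu w\<close> localises h to the ball of radius 2 rho w. If |z - z'| \<ge> rho w,
  the Hoelder bound follows from the size; otherwise z' stays in the ball of radius 3 rho w, where h
  is controlled, and the difference of products splits as in the product rule.\<close>

lemma pu_cut_mol:
  assumes w: "w \<in> \<Omega>" and D: "0 \<le> D" and \<delta>: "0 < \<delta>" "\<delta> \<le> 1" and K: "0 \<le> K"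
    and hb: "\<And>z. norm (z - w) \<le> 3 * rho w \<Longrightarrow> cmod (h z) \<le> D"
    and hh: "\<And>z z'. norm (z - w) \<le> 3 * rho w \<Longrightarrow> norm (z' - w) \<le> 3 * rho w \<Longrightarrow>
      cmod (h z - h z') \<le> D * (norm (z - z') / rho w) powr \<delta>"
  shows "mol \<delta> K w (rho w) (3 powr K * (CL * D / rho w ^ DIM('a))) (\<lambda>z. complex_of_real (pu w z) * h z)"
proof (rule mol_compact_support)
  let ?n = "DIM('a)" and ?R = "rho w"
  show R: "0 < ?R" using w by (simp add: rho_pos_iff)
  have LL: "0 \<le> LL" by (simp add: LL_def)
  show "0 \<le> CL * D / rho w ^ DIM('a)" using R D LL by (simp add: CL_def)
  have b: "cmod (complex_of_real (pu w z) * h z) \<le> 2 ^ ?n / ?R ^ ?n * D" for z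
  proof (cases "pu w z = 0")
    case False
    then have "norm (z - w) \<le> 3 * ?R" using pu_support(6)[of w z] R by auto
    then show ?thesis using hb[of z] pu_le[of w z] pu_nonneg[of w z] R
      by (simp only: norm_mult norm_of_real abs_of_nonneg) (intro mult_mono, auto)
  qed (use R D in auto)
  have "2 ^ ?n / ?R ^ ?n * D \<le> CL * D / ?R ^ ?n"
    using R D LL by (simp add: CL_def divide_right_mono mult_right_mono)
  then show "cmod (complex_of_real (pu w z) * h z) \<le> CL * D / ?R ^ ?n" for z
    using b[of z] by linarith
  fix z assume nz: "complex_of_real (pu w z) * h z \<noteq> 0"
  then have pz: "pu w z \<noteq> 0" by auto
  then show "norm (z - w) \<le> 2 * ?R" by (rule pu_support)
  then have z3: "norm (z - w) \<le> 3 * ?R" using R by linarith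
  fix z'
  let ?d = "norm (z - z')"
  show "cmod (complex_of_real (pu w z) * h z - complex_of_real (pu w z') * h z') \<le> CL * D / ?R ^ ?n * (?d / ?R) powr \<delta>"
  proof (cases "?d < ?R")
    case True
    have z3': "norm (z' - w) \<le> 3 * ?R"
      using \<open>norm (z - w) \<le> 2 * ?R\<close> True norm_triangle_ineq[of "z' - z" "z - w"] by (simp add: norm_minus_commute)
    have dd: "?d / ?R \<le> (?d / ?R) powr \<delta>"
      using powr_mono'[of \<delta> 1 "?d / ?R"] True R \<delta> by simp
    have "complex_of_real (pu w z) * h z - complex_of_real (pu w z') * h z' =
      complex_of_real (pu w z) * (h z - h z') + complex_of_real (pu w z - pu w z') * h z'"
      by (simp add: algebra_simps)
    then have "cmod (complex_of_real (pu w z) * h z - complex_of_real (pu w z') * h z') \<le>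
      pu w z * cmod (h z - h z') + \<bar>pu w z - pu w z'\<bar> * cmod (h z')"
      by (metis norm_triangle_ineq norm_mult norm_of_real abs_of_nonneg pu_nonneg)
    also have "\<dots> \<le> 2 ^ ?n / ?R ^ ?n * (D * (?d / ?R) powr \<delta>) + LL / ?R ^ ?n * (?d / ?R) * D"
      using R LL by (intro add_mono mult_mono pu_le hh z3 z3' pu_lipschitz[OF pz True] hb) (auto simp: pu_nonneg)
    also have "\<dots> \<le> 2 ^ ?n / ?R ^ ?n * (D * (?d / ?R) powr \<delta>) + LL / ?R ^ ?n * (?d / ?R) powr \<delta> * D"
      using R LL D by (intro add_left_mono mult_right_mono mult_left_mono dd) auto
    also have "\<dots> \<le> CL * D / ?R ^ ?n * (?d / ?R) powr \<delta>"
    proof -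
      have "(2 ^ ?n + LL) * (D / ?R ^ ?n * (?d / ?R) powr \<delta>) \<le> CL * (D / ?R ^ ?n * (?d / ?R) powr \<delta>)"
        using R D by (intro mult_right_mono mult_nonneg_nonneg) (auto simp: CL_def)
      moreover have "2 ^ ?n / ?R ^ ?n * (D * (?d / ?R) powr \<delta>) + LL / ?R ^ ?n * (?d / ?R) powr \<delta> * D =
        (2 ^ ?n + LL) * (D / ?R ^ ?n * (?d / ?R) powr \<delta>)"
        unfolding distrib_right by simp
      ultimately show ?thesis by simp
    qed
    finally show ?thesis .
  next
    case False
    then have 1: "1 \<le> (?d / ?R) powr \<delta>" using R \<delta> by (intro ge_one_powr_ge_zero) auto
    have "cmod (complex_of_real (pu w z) * h z - complex_of_real (pu w z') * h z') \<le> 2 ^ ?n / ?R ^ ?n * D + 2 ^ ?n / ?R ^ ?n * D"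
      by (rule order_trans[OF norm_triangle_ineq4 add_mono[OF b b]])
    also have "\<dots> = 2 * 2 ^ ?n * D / ?R ^ ?n" by simp
    also have "\<dots> \<le> CL * D / ?R ^ ?n"
      using R D LL by (intro divide_right_mono mult_right_mono) (auto simp: CL_def)
    also have "\<dots> = CL * D / ?R ^ ?n * 1" by simp
    also have "\<dots> \<le> CL * D / ?R ^ ?n * (?d / ?R) powr \<delta>"
      using R D LL by (intro mult_left_mono 1) (auto simp: CL_def)
    finally show ?thesis .
  qed
qed (rule K)

end

text \<open>\<open>H1\<close> is the form in which the maximal function enters: molecules with a
  point outside \<Omega> within 20 radii of their centre pair with f as if f had height \<alpha>. On
  a level set it is discharged by \<open>mol_pairing_bound\<close>.\<close>

locale cz_function = cz_region \<Omega> for \<Omega> :: "'a::euclidean_space set" +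
  fixes f :: "'a \<Rightarrow> complex" and \<alpha> C3 \<delta> K :: real
  assumes f_meas [measurable]: "f \<in> borel_measurable borel"
    and f2: "integrable lborel (\<lambda>x. (cmod (f x))\<^sup>2)"
    and alpha: "0 < \<alpha>" and delta: "0 < \<delta>" "\<delta> \<le> 1" and K: "0 \<le> K" and C3: "0 \<le> C3"
    and fin: "emeasure lborel \<Omega> < \<infinity>"
    and H1: "\<And>c s B \<eta> x. mol \<delta> K c s B \<eta> \<Longrightarrow> 0 \<le> B \<Longrightarrow> 0 < s \<Longrightarrow> x \<notin> \<Omega> \<Longrightarrow> dist x c \<le> 20 * s \<Longrightarrow>
      cmod (LINT z|lborel. f z * \<eta> z) \<le> C3 * B * s ^ DIM('a) * \<alpha>"
begin

definition "\<kappa> = tent_const TYPE('a)"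
text \<open>The mean of f over the piece at w. Inside \<Omega> there is no pointwise control of f,
  so the mean is estimated through \<open>H1\<close>, applied to \<open>pu w\<close> as a
  molecule.\<close>

definition "aw w = (LINT z|lborel. f z * complex_of_real (pu w z)) / complex_of_real \<kappa>"
definition "Ca = C3 * 3 powr K * CL / \<kappa>"
text \<open>Inside \<Omega> the piece f pu(w, .) / \<kappa> is replaced by its integral
  \<open>aw w\<close> times a uniform density on the ball of w, and the result is superposed over
  all w. \<open>bad\<close> is then the superposition of the differences, each of integral
  0.\<close>

definition "good z = (if z \<in> \<Omega> then (LINT w|lborel. aw w * complex_of_real (avg w z)) else f z)"
definition "bad z = f z - good z"

lemma kappa: "0 < \<kappa>" unfolding \<kappa>_def by (rule tent_const_pos)

lemma CL_nonneg: "0 \<le> CL" by (simp add: CL_def LL_def)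

lemma Ca_nonneg: "0 \<le> Ca"
  unfolding Ca_def using C3 CL_nonneg kappa by simp

lemma Om_measurable [measurable]: "\<Omega> \<in> sets borel"
  using open_Om by simp

lemma aw_measurable [measurable]: "aw \<in> borel_measurable borel"
  unfolding aw_def by measurable

lemma good_measurable [measurable]: "good \<in> borel_measurable borel"
  unfolding good_def by measurable

lemma bad_measurable [measurable]: "bad \<in> borel_measurable borel"
  unfolding bad_def by measurable

text \<open>The required point outside \<Omega> is a nearest point of the complement, at distance
  exactly 20 rho w from w.\<close>

lemma pu_test:
  assumes w: "w \<in> \<Omega>" and D: "0 \<le> D"
    and hb: "\<And>z. norm (z - w) \<le> 3 * rho w \<Longrightarrow> cmod (h z) \<le> D"
    and hh: "\<And>z z'. norm (z - w) \<le> 3 * rho w \<Longrightarrow> norm (z' - w) \<le> 3 * rho w \<Longrightarrow>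
      cmod (h z - h z') \<le> D * (norm (z - z') / rho w) powr \<delta>"
  shows "cmod (LINT z|lborel. f z * (complex_of_real (pu w z) * h z)) \<le> \<kappa> * Ca * D * \<alpha>"
proof -
  obtain x where x: "x \<notin> \<Omega>" "dist x w = 20 * rho w" using rho_attained by blast
  have R: "0 < rho w" using w by (simp add: rho_pos_iff)
  have "cmod (LINT z|lborel. f z * (complex_of_real (pu w z) * h z)) \<le>
     C3 * (3 powr K * (CL * D / rho w ^ DIM('a))) * rho w ^ DIM('a) * \<alpha>"
    using x R D CL_nonneg by (intro H1[OF pu_cut_mol[OF w D delta K hb hh]]) auto
  also have "\<dots> = \<kappa> * Ca * D * \<alpha>" using R kappa by (simp add: Ca_def)
  finally show ?thesis .
qed

lemma aw_outside: "w \<notin> \<Omega> \<Longrightarrow> aw w = 0"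
  using pu_support(2) by (auto simp: aw_def intro!: integral_eq_zero_AE AE_I2)

lemma aw_le: "cmod (aw w) \<le> Ca * \<alpha>"
proof (cases "w \<in> \<Omega>")
  case True
  have "cmod (LINT z|lborel. f z * (complex_of_real (pu w z) * 1)) \<le> \<kappa> * Ca * 1 * \<alpha>"
    by (rule pu_test[OF True]) auto
  then show ?thesis using kappa by (simp add: aw_def norm_divide field_simps)
next
  case False
  then show ?thesis using aw_outside Ca_nonneg alpha by simp
qed

lemma good_le: "z \<in> \<Omega> \<Longrightarrow> cmod (good z) \<le> Ca * \<alpha> * 4 ^ DIM('a)"
proof -
  assume z: "z \<in> \<Omega>"
  have "cmod (LINT w|lborel. aw w * complex_of_real (avg w z)) \<le> (LINT w|lborel. Ca * \<alpha> * avg w z)"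
  proof (rule order_trans[OF integral_norm_bound integral_mono])
    show i: "integrable lborel (\<lambda>w. Ca * \<alpha> * avg w z)" using avg_integrable(1) by simp
    show le: "cmod (aw w * complex_of_real (avg w z)) \<le> Ca * \<alpha> * avg w z" for w
      using mult_right_mono[OF aw_le avg_nonneg] by (simp add: norm_mult avg_nonneg)
    show "integrable lborel (\<lambda>w. cmod (aw w * complex_of_real (avg w z)))"
      by (rule Bochner_Integration.integrable_bound[OF i]) (use le in \<open>auto intro!: AE_I2 intro: order_trans[OF _ abs_ge_self]\<close>)
  qed
  also have "\<dots> = Ca * \<alpha> * (LINT w|lborel. avg w z)" by simp
  also have "\<dots> \<le> Ca * \<alpha> * 4 ^ DIM('a)"
    using Ca_nonneg alpha by (intro mult_left_mono avg_integrable) auto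
  finally show ?thesis using z by (simp add: good_def)
qed

lemma good_nn:
  "(\<integral>\<^sup>+z. ennreal ((cmod (good z))\<^sup>2) \<partial>lborel) \<le>
    ennreal ((Ca * \<alpha> * 4 ^ DIM('a))\<^sup>2) * emeasure lborel \<Omega> + (\<integral>\<^sup>+z. ennreal ((cmod (f z))\<^sup>2) * indicator (- \<Omega>) z \<partial>lborel)"
proof -
  have "(\<integral>\<^sup>+z. ennreal ((cmod (good z))\<^sup>2) \<partial>lborel) \<le>
    (\<integral>\<^sup>+z. ennreal ((Ca * \<alpha> * 4 ^ DIM('a))\<^sup>2) * indicator \<Omega> z + ennreal ((cmod (f z))\<^sup>2) * indicator (- \<Omega>) z \<partial>lborel)"
  proof (rule nn_integral_mono)
    fix z
    show "ennreal ((cmod (good z))\<^sup>2) \<le> ennreal ((Ca * \<alpha> * 4 ^ DIM('a))\<^sup>2) * indicator \<Omega> z + ennreal ((cmod (f z))\<^sup>2) * indicator (- \<Omega>) z"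
    proof (cases "z \<in> \<Omega>")
      case True
      have "(cmod (good z))\<^sup>2 \<le> (Ca * \<alpha> * 4 ^ DIM('a))\<^sup>2" by (rule power_mono[OF good_le[OF True]]) simp
      then show ?thesis using True by (simp add: ennreal_leI)
    qed (simp add: good_def)
  qed
  also have "\<dots> = (\<integral>\<^sup>+z. ennreal ((Ca * \<alpha> * 4 ^ DIM('a))\<^sup>2) * indicator \<Omega> z \<partial>lborel) + (\<integral>\<^sup>+z. ennreal ((cmod (f z))\<^sup>2) * indicator (- \<Omega>) z \<partial>lborel)"
    by (rule nn_integral_add) measurable
  also have "(\<integral>\<^sup>+z. ennreal ((Ca * \<alpha> * 4 ^ DIM('a))\<^sup>2) * indicator \<Omega> z \<partial>lborel) = ennreal ((Ca * \<alpha> * 4 ^ DIM('a))\<^sup>2) * emeasure lborel \<Omega>"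
    by (rule nn_integral_cmult_indicator) measurable
  finally show ?thesis .
qed

lemma good_sq_integrable: "integrable lborel (\<lambda>z. (cmod (good z))\<^sup>2)"
proof (rule integrableI_nonneg)
  have "(\<integral>\<^sup>+z. ennreal ((cmod (f z))\<^sup>2) * indicator (- \<Omega>) z \<partial>lborel) \<le> (\<integral>\<^sup>+z. ennreal ((cmod (f z))\<^sup>2) \<partial>lborel)"
    by (intro nn_integral_mono) (auto simp: indicator_def)
  also have "\<dots> < \<infinity>" using f2 by (subst nn_integral_eq_integral) auto
  finally have "ennreal ((Ca * \<alpha> * 4 ^ DIM('a))\<^sup>2) * emeasure lborel \<Omega> + (\<integral>\<^sup>+z. ennreal ((cmod (f z))\<^sup>2) * indicator (- \<Omega>) z \<partial>lborel) < \<infinity>"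
    using fin by (simp add: ennreal_mult_less_top)
  then show "(\<integral>\<^sup>+z. ennreal ((cmod (good z))\<^sup>2) \<partial>lborel) < \<infinity>" using good_nn by (rule le_less_trans[rotated])
qed auto

lemma bad_sq_integrable: "integrable lborel (\<lambda>z. (cmod (bad z))\<^sup>2)"
proof (rule Bochner_Integration.integrable_bound)
  show "integrable lborel (\<lambda>z. 2 * (cmod (f z))\<^sup>2 + 2 * (cmod (good z))\<^sup>2)" using f2 good_sq_integrable by simp
  have "(cmod (bad z))\<^sup>2 \<le> 2 * (cmod (f z))\<^sup>2 + 2 * (cmod (good z))\<^sup>2" for z
  proof -
    have "(cmod (bad z))\<^sup>2 \<le> (cmod (f z) + cmod (good z))\<^sup>2"
      unfolding bad_def by (intro power_mono norm_triangle_ineq4) auto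
    also have "\<dots> \<le> 2 * (cmod (f z))\<^sup>2 + 2 * (cmod (good z))\<^sup>2"
      using sum_squares_bound[of "cmod (f z)" "cmod (good z)"] by (simp add: power2_sum)
    finally show ?thesis .
  qed
  then show "AE z in lborel. norm ((cmod (bad z))\<^sup>2) \<le> norm (2 * (cmod (f z))\<^sup>2 + 2 * (cmod (good z))\<^sup>2)"
    by (intro AE_I2) auto
qed measurable

text \<open>Fubini makes the pairing an integral over w of pieces with mean zero in z, so h may be
  replaced by h - h w. The two halves of a piece are then bounded by \<open>pu_test\<close> and by
  \<open>aw_le\<close>, each giving Ca \<alpha> D w. The radius 3 rho w covers the supports of
  \<open>pu w\<close> and \<open>avg w\<close> and is the one used in
  \<open>pu_cut_mol\<close>.\<close>

lemma bad_pairing: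
  assumes h [measurable]: "h \<in> borel_measurable borel" and h1: "integrable lborel h"
    and h2: "integrable lborel (\<lambda>z. (cmod (h z))\<^sup>2)"
    and D: "\<And>w. 0 \<le> D w" and [measurable]: "D \<in> borel_measurable borel"
    and hb: "\<And>w z. w \<in> \<Omega> \<Longrightarrow> norm (z - w) \<le> 3 * rho w \<Longrightarrow> cmod (h z - h w) \<le> D w"
    and hh: "\<And>w z z'. w \<in> \<Omega> \<Longrightarrow> norm (z - w) \<le> 3 * rho w \<Longrightarrow> norm (z' - w) \<le> 3 * rho w \<Longrightarrow>
      cmod (h z - h z') \<le> D w * (norm (z - z') / rho w) powr \<delta>"
  shows "ennreal (cmod (LINT z|lborel. h z * bad z)) \<le> (\<integral>\<^sup>+w. ennreal (2 * Ca * \<alpha> * D w) * indicator \<Omega> w \<partial>lborel)"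
proof -
  define F where "F = (\<lambda>z w. h z * (f z * complex_of_real (pu w z) / complex_of_real \<kappa> - aw w * complex_of_real (avg w z)))"
  have Fm [measurable]: "(\<lambda>(z, w). F z w) \<in> borel_measurable (borel \<Otimes>\<^sub>M borel)"
  proof -
    have "(\<lambda>p. case (snd p, fst p) of (w, z) \<Rightarrow> pu w z) \<in> borel_measurable (borel \<Otimes>\<^sub>M borel)"
      "(\<lambda>p. case (snd p, fst p) of (w, z) \<Rightarrow> avg w z) \<in> borel_measurable (borel \<Otimes>\<^sub>M borel)"
      by (rule measurable_compose[OF _ pu_measurable] measurable_compose[OF _ avg_measurable]; measurable)+
    then have [measurable]: "(\<lambda>p. pu (snd p) (fst p)) \<in> borel_measurable (borel \<Otimes>\<^sub>M borel)"
      "(\<lambda>p. avg (snd p) (fst p)) \<in> borel_measurable (borel \<Otimes>\<^sub>M borel)" by simp_all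
    show ?thesis unfolding F_def case_prod_beta by measurable
  qed
  have ai: "integrable lborel (\<lambda>w. aw w * complex_of_real (avg w z))" for z
  proof (rule Bochner_Integration.integrable_bound)
    show "integrable lborel (\<lambda>w. Ca * \<alpha> * avg w z)" using avg_integrable(1) by simp
    have "cmod (aw w * complex_of_real (avg w z)) \<le> Ca * \<alpha> * avg w z" for w
      using mult_right_mono[OF aw_le avg_nonneg] by (simp add: norm_mult avg_nonneg)
    then show "AE w in lborel. norm (aw w * complex_of_real (avg w z)) \<le> norm (Ca * \<alpha> * avg w z)"
      unfolding real_norm_def by (intro AE_I2 order_trans[OF _ abs_ge_self])
  qed measurable
  have pi: "integrable lborel (\<lambda>w. pu w z)" "(LINT w|lborel. pu w z) = (if z \<in> \<Omega> then \<kappa> else 0)" for z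
    using pu_integral[of z] pu_outside[of z] by (cases "z \<in> \<Omega>"; simp add: \<kappa>_def)+
  have Fi: "integrable lborel (\<lambda>w. F z w)" for z
    unfolding F_def using ai[of z] pi(1)[of z] by auto
  have F1: "(LINT w|lborel. F z w) = h z * bad z" for z
  proof -
    have "(LINT w|lborel. F z w) = h z * ((LINT w|lborel. f z * complex_of_real (pu w z) / complex_of_real \<kappa>) - (LINT w|lborel. aw w * complex_of_real (avg w z)))"
      unfolding F_def using ai[of z] pi(1)[of z] by (subst integral_mult_right_zero, subst Bochner_Integration.integral_diff) auto
    also have "(LINT w|lborel. f z * complex_of_real (pu w z) / complex_of_real \<kappa>) = (if z \<in> \<Omega> then f z else 0)"
      using pi(2)[of z] kappa by simp
    also have "(if z \<in> \<Omega> then f z else 0) - (LINT w|lborel. aw w * complex_of_real (avg w z)) = bad z"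
    proof (cases "z \<in> \<Omega>")
      case False
      then have "avg w z = 0" for w using avg_support(1) by blast
      then show ?thesis using False by (simp add: bad_def good_def)
    qed (simp add: bad_def good_def)
    finally show ?thesis .
  qed
  have "integrable (lborel \<Otimes>\<^sub>M lborel) (\<lambda>(z, w). F z w)"
  proof (rule lborel_pair.Fubini_integrable)
    show "(\<lambda>(z, w). F z w) \<in> borel_measurable (lborel \<Otimes>\<^sub>M lborel)" using Fm by (simp cong: measurable_cong_sets add: lborel_prod)
    show "AE z in lborel. integrable lborel (\<lambda>w. case (z, w) of (z, w) \<Rightarrow> F z w)" using Fi by simp
    have hf: "integrable lborel (\<lambda>z. h z * f z)" by (rule sq_integrable_mult(1)[OF _ _ h2 f2]) measurable
    show "integrable lborel (\<lambda>z. LINT w|lborel. norm (case (z, w) of (z, w) \<Rightarrow> F z w))"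
    proof (rule Bochner_Integration.integrable_bound)
      show "integrable lborel (\<lambda>z. cmod (h z * f z) + cmod (h z) * (Ca * \<alpha> * 4 ^ DIM('a)))"
        using hf h1 by auto
      show "AE z in lborel. norm (LINT w|lborel. norm (case (z, w) of (z, w) \<Rightarrow> F z w)) \<le>
        norm (cmod (h z * f z) + cmod (h z) * (Ca * \<alpha> * 4 ^ DIM('a)))"
      proof (rule AE_I2)
        fix z
        have "norm (LINT w|lborel. norm (case (z, w) of (z, w) \<Rightarrow> F z w)) = (LINT w|lborel. cmod (F z w))" by simp
        also have "\<dots> \<le> (LINT w|lborel. cmod (h z * f z) / \<kappa> * pu w z + cmod (h z) * (Ca * \<alpha>) * avg w z)"
        proof (rule integral_mono)
          show "integrable lborel (\<lambda>w. cmod (h z * f z) / \<kappa> * pu w z + cmod (h z) * (Ca * \<alpha>) * avg w z)"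
            using pi(1)[of z] avg_integrable(1)[of z] by auto
          fix w
          have "cmod (F z w) \<le> cmod (h z * (f z * complex_of_real (pu w z) / complex_of_real \<kappa>)) + cmod (h z * (aw w * complex_of_real (avg w z)))"
            unfolding F_def right_diff_distrib by (rule norm_triangle_ineq4)
          also have "\<dots> = cmod (h z * f z) / \<kappa> * pu w z + cmod (h z) * cmod (aw w) * avg w z"
            using kappa by (simp add: norm_mult norm_divide pu_nonneg avg_nonneg)
          also have "\<dots> \<le> cmod (h z * f z) / \<kappa> * pu w z + cmod (h z) * (Ca * \<alpha>) * avg w z"
            by (intro add_left_mono mult_right_mono mult_left_mono aw_le avg_nonneg) auto
          finally show "cmod (F z w) \<le> \<dots>" .
        qed (use Fi in auto)
        also have "\<dots> = cmod (h z * f z) / \<kappa> * (LINT w|lborel. pu w z) + cmod (h z) * (Ca * \<alpha>) * (LINT w|lborel. avg w z)"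
          using pi(1)[of z] avg_integrable(1)[of z] by simp
        also have "\<dots> \<le> cmod (h z * f z) / \<kappa> * \<kappa> + cmod (h z) * (Ca * \<alpha>) * 4 ^ DIM('a)"
          using kappa Ca_nonneg alpha pi(2)[of z] avg_integrable(2)[of z] by (intro add_mono mult_left_mono) auto
        also have "\<dots> = cmod (h z * f z) + cmod (h z) * (Ca * \<alpha> * 4 ^ DIM('a))" using kappa by simp
        also have "\<dots> \<le> norm (cmod (h z * f z) + cmod (h z) * (Ca * \<alpha> * 4 ^ DIM('a)))" by (simp only: real_norm_def abs_ge_self)
        finally show "norm (LINT w|lborel. norm (case (z, w) of (z, w) \<Rightarrow> F z w)) \<le>
          norm (cmod (h z * f z) + cmod (h z) * (Ca * \<alpha> * 4 ^ DIM('a)))" .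
      qed
    qed measurable
  qed
  from lborel_pair.Fubini_integral[OF this] lborel_pair.integrable_snd[OF this]
  have Fub: "(LINT z|lborel. h z * bad z) = (LINT w|lborel. LINT z|lborel. F z w)"
    and Iw: "integrable lborel (\<lambda>w. LINT z|lborel. F z w)" by (simp_all add: F1)
  have inner: "cmod (LINT z|lborel. F z w) \<le> 2 * Ca * \<alpha> * D w * indicator \<Omega> w" for w
  proof (cases "w \<in> \<Omega>")
    case False
    have p: "pu w z = 0" for z using pu_support(2) False by blast
    have "F z w = 0" for z by (simp add: F_def p aw_outside[OF False])
    then show ?thesis using False by simp
  next
    case True
    let ?h = "\<lambda>z. h z - h w"
    have R: "0 < rho w" using True by (simp add: rho_pos_iff)
    have pb: "cmod (complex_of_real (pu w z)) \<le> 2 ^ DIM('a) / rho w ^ DIM('a) * indicator (ball w (3 * rho w)) z" for z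
    proof (cases "pu w z = 0")
      case False
      then have "z \<in> ball w (3 * rho w)" using pu_support(6)[of w z] R by (auto simp: dist_norm norm_minus_commute)
      then show ?thesis using pu_le[of w z] by (simp add: pu_nonneg)
    qed (use R in \<open>simp add: indicator_def\<close>)
    have "integrable lborel (\<lambda>z. (cmod (complex_of_real (pu w z)))\<^sup>2)"
    proof (rule Bochner_Integration.integrable_bound)
      show "integrable lborel (\<lambda>z. (2 ^ DIM('a) / rho w ^ DIM('a))\<^sup>2 * indicator (ball w (3 * rho w)) z)"
        by (intro integrable_mult_right integrable_ball_indicator)
      have "(cmod (complex_of_real (pu w z)))\<^sup>2 \<le> (2 ^ DIM('a) / rho w ^ DIM('a))\<^sup>2 * indicator (ball w (3 * rho w)) z" for z
        using power_mono[OF pb[of z], of 2] by (cases "dist w z < 3 * rho w") simp_all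
      then show "AE z in lborel. norm ((cmod (complex_of_real (pu w z)))\<^sup>2) \<le> norm ((2 ^ DIM('a) / rho w ^ DIM('a))\<^sup>2 * indicator (ball w (3 * rho w)) z)"
        by (intro AE_I2) simp
    qed measurable
    then have fp: "integrable lborel (\<lambda>z. f z * complex_of_real (pu w z))"
      by (intro sq_integrable_mult(1)[OF _ _ f2]) auto
    have hpu: "integrable lborel (\<lambda>z. f z * (complex_of_real (pu w z) * ?h z))"
    proof (rule Bochner_Integration.integrable_bound)
      show "integrable lborel (\<lambda>z. f z * complex_of_real (pu w z) * complex_of_real (D w))" using fp by simp
      have "cmod (f z * (complex_of_real (pu w z) * ?h z)) \<le> cmod (f z * complex_of_real (pu w z) * complex_of_real (D w))" for z
      proof (cases "pu w z = 0")
        case False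
        then have "cmod (?h z) \<le> D w" using pu_support(6)[of w z] R by (intro hb[OF True]) auto
        then show ?thesis using D[of w] by (simp add: norm_mult mult_left_mono mult.assoc)
      qed simp
      then show "AE z in lborel. norm (f z * (complex_of_real (pu w z) * ?h z)) \<le> norm (f z * complex_of_real (pu w z) * complex_of_real (D w))" by simp
    qed measurable
    have hav: "cmod (complex_of_real (avg w z) * ?h z) \<le> avg w z * D w" for z
    proof (cases "avg w z = 0")
      case False
      then have "cmod (?h z) \<le> D w" using avg_support(2)[of w z] R by (intro hb[OF True]) auto
      then show ?thesis by (simp add: norm_mult avg_nonneg mult_left_mono)
    qed simp
    note av = avg_integral_one[OF True]
    have havi: "integrable lborel (\<lambda>z. complex_of_real (avg w z) * ?h z)"
      by (rule Bochner_Integration.integrable_bound[of _ "\<lambda>z. avg w z * D w"])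
         (use av hav in \<open>auto intro!: AE_I2 intro: order_trans[OF _ abs_ge_self]\<close>)
    \<comment> \<open>The value h w is split off; its coefficient integrates to aw w - aw w = 0, by
      the definition of \<open>aw\<close> and because \<open>avg w\<close> has integral 1.\<close>
    have "F z w = (1 / complex_of_real \<kappa>) * (f z * (complex_of_real (pu w z) * ?h z)) - aw w * (complex_of_real (avg w z) * ?h z)
       + h w * ((1 / complex_of_real \<kappa>) * (f z * complex_of_real (pu w z)) - aw w * complex_of_real (avg w z))" for z
      by (simp add: F_def algebra_simps)
    then have "(LINT z|lborel. F z w) = (1 / complex_of_real \<kappa>) * (LINT z|lborel. f z * (complex_of_real (pu w z) * ?h z)) - aw w * (LINT z|lborel. complex_of_real (avg w z) * ?h z)
       + h w * ((1 / complex_of_real \<kappa>) * (LINT z|lborel. f z * complex_of_real (pu w z)) - aw w * (LINT z|lborel. complex_of_real (avg w z)))"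
      using hpu havi fp av(1) by simp
    also have "(1 / complex_of_real \<kappa>) * (LINT z|lborel. f z * complex_of_real (pu w z)) - aw w * (LINT z|lborel. complex_of_real (avg w z)) = 0"
      using av(2) by (simp add: aw_def)
    finally have "(LINT z|lborel. F z w) = (1 / complex_of_real \<kappa>) * (LINT z|lborel. f z * (complex_of_real (pu w z) * ?h z)) - aw w * (LINT z|lborel. complex_of_real (avg w z) * ?h z)"
      by simp
    then have "cmod (LINT z|lborel. F z w) \<le> cmod ((1 / complex_of_real \<kappa>) * (LINT z|lborel. f z * (complex_of_real (pu w z) * ?h z))) + cmod (aw w * (LINT z|lborel. complex_of_real (avg w z) * ?h z))"
      by (simp only: norm_triangle_ineq4)
    also have "\<dots> = (1 / \<kappa>) * cmod (LINT z|lborel. f z * (complex_of_real (pu w z) * ?h z)) + cmod (aw w) * cmod (LINT z|lborel. complex_of_real (avg w z) * ?h z)"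
      using kappa by (simp add: norm_mult norm_divide)
    also have "\<dots> \<le> (1 / \<kappa>) * (\<kappa> * Ca * D w * \<alpha>) + Ca * \<alpha> * D w"
    proof (intro add_mono mult_mono aw_le)
      show "cmod (LINT z|lborel. f z * (complex_of_real (pu w z) * ?h z)) \<le> \<kappa> * Ca * D w * \<alpha>"
        by (rule pu_test[OF True D]) (use hb[OF True] hh[OF True] in auto)
      have "cmod (LINT z|lborel. complex_of_real (avg w z) * ?h z) \<le> (LINT z|lborel. avg w z * D w)"
        by (rule order_trans[OF integral_norm_bound integral_mono]) (use havi av hav in auto)
      also have "\<dots> = D w" using av by simp
      finally show "cmod (LINT z|lborel. complex_of_real (avg w z) * ?h z) \<le> D w" .
    qed (use kappa Ca_nonneg alpha in auto)
    also have "\<dots> = 2 * Ca * \<alpha> * D w * indicator \<Omega> w" using kappa True by simp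
    finally show ?thesis .
  qed
  have "ennreal (cmod (LINT z|lborel. h z * bad z)) \<le> (\<integral>\<^sup>+w. ennreal (cmod (LINT z|lborel. F z w)) \<partial>lborel)"
    unfolding Fub by (rule integral_norm_bound_ennreal[OF Iw])
  also have "\<dots> \<le> (\<integral>\<^sup>+w. ennreal (2 * Ca * \<alpha> * D w) * indicator \<Omega> w \<partial>lborel)"
  proof (rule nn_integral_mono)
    fix w
    show "ennreal (cmod (LINT z|lborel. F z w)) \<le> ennreal (2 * Ca * \<alpha> * D w) * indicator \<Omega> w"
      using ennreal_leI[OF inner[of w]] by (cases "w \<in> \<Omega>") auto
  qed
  finally show ?thesis .
qed

end

section \<open>The square function estimate\<close>

lemma ennpowr_less_top_iff [simp]: "ennpowr a p < top \<longleftrightarrow> a < top"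
  by (simp add: less_top[symmetric])

text \<open>The l^2 norm is at most the l^1 norm: each term is at most the total A, so the squares
  add up to at most A * A. For the bad part the l^1 sum over scales converges and can be exchanged
  with integrals.\<close>

lemma infsum_le_square:
  fixes a :: "int \<Rightarrow> ennreal"
  shows "ennpowr (\<Sum>\<^sub>\<infinity>k. a k * a k) (1 / 2) \<le> (\<integral>\<^sup>+k. a k \<partial>count_space UNIV)"
proof -
  let ?A = "\<integral>\<^sup>+k. a k \<partial>count_space UNIV"
  have "a k \<le> ?A" for k
    using nn_integral_ge_point[of k UNIV a] by simp
  then have "(\<integral>\<^sup>+k. a k * a k \<partial>count_space UNIV) \<le> (\<integral>\<^sup>+k. a k * ?A \<partial>count_space UNIV)"
    by (intro nn_integral_mono mult_left_mono) auto
  also have "\<dots> = ?A * ?A" by (simp add: nn_integral_multc)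
  finally have "(\<Sum>\<^sub>\<infinity>k. a k * a k) \<le> ?A * ?A" by (simp add: infsum_int_eq_nn_integral)
  then have "ennpowr (\<Sum>\<^sub>\<infinity>k. a k * a k) (1 / 2) \<le> ennpowr (?A * ?A) (1 / 2)" by (intro ennpowr_mono) auto
  also have "\<dots> = ?A"
    by (cases ?A) (auto simp: ennreal_mult[symmetric] powr_half_sqrt)
  finally show ?thesis .
qed

lemma ennpowr_2_half: "ennpowr (ennpowr a 2) (1 / 2) = a" "ennpowr (ennpowr a (1 / 2)) 2 = a"
  by (simp_all add: ennpowr_ennpowr)

lemma ennpowr_2: "ennpowr (ennreal x) 2 = ennreal (x\<^sup>2)" if "0 \<le> x"
  using that by (simp add: powr_numeral)

text \<open>Minkowski's inequality on finite sets of scales, followed by a supremum. Infinite terms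
  on the right are set aside, which allows real arithmetic.\<close>

lemma l2_triangle:
  fixes a b :: "int \<Rightarrow> complex"
  shows "ennpowr (\<Sum>\<^sub>\<infinity>k. ennreal ((cmod (a k + b k))\<^sup>2)) (1 / 2) \<le>
    ennpowr (\<Sum>\<^sub>\<infinity>k. ennreal ((cmod (a k))\<^sup>2)) (1 / 2) + ennpowr (\<Sum>\<^sub>\<infinity>k. ennreal ((cmod (b k))\<^sup>2)) (1 / 2)"
    (is "_ \<le> ?A + ?B")
proof (cases "?A = top \<or> ?B = top")
  case False
  then obtain A B where AB: "?A = ennreal A" "0 \<le> A" "?B = ennreal B" "0 \<le> B"
    by (cases ?A; cases ?B) auto
  have part: "L2_set (\<lambda>k. cmod (c k)) F \<le> X"
    if X: "ennpowr (\<Sum>\<^sub>\<infinity>k. ennreal ((cmod (c k))\<^sup>2)) (1 / 2) = ennreal X" "0 \<le> X" and F: "finite F" for c :: "int \<Rightarrow> complex" and X F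
  proof -
    have "ennreal (\<Sum>k\<in>F. (cmod (c k))\<^sup>2) = (\<Sum>k\<in>F. ennreal ((cmod (c k))\<^sup>2))" by (simp add: sum_ennreal)
    also have "\<dots> \<le> (\<Sum>\<^sub>\<infinity>k. ennreal ((cmod (c k))\<^sup>2))"
      by (subst nonneg_infsum_complete) (use F in \<open>auto intro!: SUP_upper\<close>)
    also have "\<dots> = ennpowr (ennreal X) 2" using X(1) ennpowr_2_half(2) by metis
    also have "\<dots> = ennreal (X\<^sup>2)" by (rule ennpowr_2[OF X(2)])
    finally have "(\<Sum>k\<in>F. (cmod (c k))\<^sup>2) \<le> X\<^sup>2" by (subst (asm) ennreal_le_iff) auto
    then have "sqrt (\<Sum>k\<in>F. (cmod (c k))\<^sup>2) \<le> sqrt (X\<^sup>2)" by (rule real_sqrt_le_mono)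
    then show ?thesis using X(2) by (simp add: L2_set_def)
  qed
  have "(\<Sum>\<^sub>\<infinity>k. ennreal ((cmod (a k + b k))\<^sup>2)) \<le> ennreal ((A + B)\<^sup>2)"
  proof (subst nonneg_infsum_complete, simp, rule SUP_least)
    fix F :: "int set" assume "F \<in> {F. finite F \<and> F \<subseteq> UNIV}"
    then have F: "finite F" by simp
    have "L2_set (\<lambda>k. cmod (a k + b k)) F \<le> L2_set (\<lambda>k. cmod (a k) + cmod (b k)) F"
      by (intro L2_set_mono norm_triangle_ineq) auto
    also have "\<dots> \<le> L2_set (\<lambda>k. cmod (a k)) F + L2_set (\<lambda>k. cmod (b k)) F" by (rule L2_set_triangle_ineq)
    also have "\<dots> \<le> A + B" by (intro add_mono part AB F)
    finally have "(L2_set (\<lambda>k. cmod (a k + b k)) F)\<^sup>2 \<le> (A + B)\<^sup>2" by (intro power_mono) auto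
    then have "(\<Sum>k\<in>F. (cmod (a k + b k))\<^sup>2) \<le> (A + B)\<^sup>2" by (simp add: L2_set_def sum_nonneg)
    then show "(\<Sum>k\<in>F. ennreal ((cmod (a k + b k))\<^sup>2)) \<le> ennreal ((A + B)\<^sup>2)" by (simp add: sum_ennreal ennreal_leI)
  qed
  then have "ennpowr (\<Sum>\<^sub>\<infinity>k. ennreal ((cmod (a k + b k))\<^sup>2)) (1 / 2) \<le> ennpowr (ennpowr (ennreal (A + B)) 2) (1 / 2)"
    unfolding ennpowr_2[OF add_nonneg_nonneg[OF AB(2,4)]] by (intro ennpowr_mono) simp_all
  then show ?thesis using AB by (simp add: ennpowr_2_half)
qed auto

section \<open>Kernels, their decay and the sum over scales\<close>

lemma Lp_space_2_iff:
  fixes f :: "'a::euclidean_space \<Rightarrow> complex"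
  assumes "f \<in> borel_measurable borel"
  shows "f \<in> Lp_space 2 \<longleftrightarrow> integrable lborel (\<lambda>x. (cmod (f x))\<^sup>2)"
proof -
  have "Lp_norm 2 f = ennpowr (\<integral>\<^sup>+x. ennreal ((cmod (f x))\<^sup>2) \<partial>lborel) (1 / 2)"
    by (simp add: Lp_norm_def lp_norm_def nn_integral_completion powr_numeral)
  then show ?thesis
    using assms by (auto simp: Lp_space_def measurable_completion integrable_iff_bounded less_top)
qed

lemma Lambda_lborel:
  assumes "f \<in> borel_measurable borel" "lam k x \<in> borel_measurable borel"
  shows "Lambda lam k f x = (LINT y|lborel. lam k x y * f y)"
  unfolding Lambda_def using assms by (intro integral_completion) auto

locale lpso_op =
  fixes lam :: "int \<Rightarrow> 'a::euclidean_space \<Rightarrow> 'a \<Rightarrow> complex" and CL0 \<delta> CS :: real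
  assumes CL0: "0 \<le> CL0" and CS: "0 \<le> CS" and delta0: "0 < \<delta>" "\<delta> \<le> 1"
    and size: "\<And>k x y. cmod (lam k x y) \<le> CL0 * Phi (DIM('a) + 2 * \<delta>) k (x - y)"
    and smooth: "\<And>k x y y'. cmod (lam k x y - lam k x y') \<le>
             CL0 * norm (y - y') powr \<delta> * 2 powr (real_of_int k * \<delta>) *
             (Phi (DIM('a) + 2 * \<delta>) k (x - y) + Phi (DIM('a) + 2 * \<delta>) k (x - y'))"
    and L2: "\<And>f. f \<in> Lp_space 2 \<Longrightarrow> square_fun lam f \<in> borel_measurable lebesgue \<and>
       lp_norm 2 (square_fun lam f) \<le> ennreal CS * Lp_norm 2 f"
begin

text \<open>Identifies the decay of the kernels with the weight centred at x of scale 2^-k, so that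
  the estimates for weights apply.\<close>

lemma Phi_wt: "Phi K k (x - y) = 2 powr (real_of_int k * real DIM('a)) * wt K x (2 powr (- real_of_int k)) (y :: 'a)"
proof -
  have "2 powr real_of_int k * norm (x - y) = norm (y - x) / 2 powr (- real_of_int k)"
    by (simp add: powr_minus norm_minus_commute divide_inverse mult.commute)
  then show ?thesis by (simp only: Phi_def wt_def)
qed

text \<open>Hoelder continuity in the second variable gives Borel measurability. A weight of
  exponent 0 is constantly 1, so an unweighted Hoelder bound is enough.\<close>

lemma lam_measurable [measurable]: "lam k x \<in> borel_measurable borel"
proof -
  let ?s = "2 powr (- real_of_int k)" and ?B = "CL0 * 2 powr (real_of_int k * real DIM('a))"
  have P: "Phi (real DIM('a) + 2 * \<delta>) k (x - y) \<le> 2 powr (real_of_int k * real DIM('a))" for y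
    unfolding Phi_wt using wt_le_1[of ?s "(real DIM('a) + 2 * \<delta>)" x y] delta0 by (simp add: mult_left_le)
  have "holder_wt \<delta> 0 x ?s ?B (lam k x)"
    unfolding holder_wt_def
  proof (intro allI)
    fix z z'
    have "cmod (lam k x z - lam k x z') \<le> CL0 * norm (z - z') powr \<delta> * 2 powr (real_of_int k * \<delta>) *
             (Phi (real DIM('a) + 2 * \<delta>) k (x - z) + Phi (real DIM('a) + 2 * \<delta>) k (x - z'))" by (rule smooth)
    also have "\<dots> \<le> CL0 * norm (z - z') powr \<delta> * 2 powr (real_of_int k * \<delta>) *
      (2 powr (real_of_int k * real DIM('a)) + 2 powr (real_of_int k * real DIM('a)))"
      using CL0 by (intro mult_left_mono add_mono P) auto
    also have "\<dots> = ?B * (norm (z - z') / ?s) powr \<delta> * (1 + 1)"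
      by (simp add: powr_divide powr_powr powr_minus_divide powr_mult)
    also have "1 + 1 = wt 0 x ?s z + wt 0 x ?s z'" by (simp add: wt_def add_nonneg_eq_0_iff)
    finally show "cmod (lam k x z - lam k x z') \<le> ?B * (norm (z - z') / ?s) powr \<delta> * (wt 0 x ?s z + wt 0 x ?s z')" .
  qed
  then have "continuous_on UNIV (lam k x)" by (rule holder_wt_continuous) (use delta0 in auto)
  then show ?thesis by (rule borel_measurable_continuous_onI)
qed

lemma lam_wt: "cmod (lam k x y) \<le> CL0 * 2 powr (real_of_int k * real DIM('a)) * wt (real DIM('a) + 2 * \<delta>) x (2 powr (- real_of_int k)) y"
  using size[of k x y] by (simp add: Phi_wt)

lemma lam_integrable: "integrable lborel (lam k x)"
proof (rule Bochner_Integration.integrable_bound)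
  show "integrable lborel (\<lambda>y. CL0 * 2 powr (real_of_int k * real DIM('a)) * wt (real DIM('a) + 2 * \<delta>) x (2 powr (- real_of_int k)) y)"
    using integrable_wt[of "2 powr (- real_of_int k)" "(real DIM('a) + 2 * \<delta>)" x] delta0 by simp
  show "AE y in lborel. norm (lam k x y) \<le> norm (CL0 * 2 powr (real_of_int k * real DIM('a)) * wt (real DIM('a) + 2 * \<delta>) x (2 powr (- real_of_int k)) y)"
    unfolding real_norm_def by (intro AE_I2 order_trans[OF lam_wt abs_ge_self])
qed measurable

lemma lam_sq_integrable: "integrable lborel (\<lambda>y. (cmod (lam k x y))\<^sup>2)"
  by (rule bounded_by_wt_sq_integrable[OF _ _ _ lam_wt]) (use delta0 in auto)

lemma lam_f_integrable:
  "f \<in> borel_measurable borel \<Longrightarrow> integrable lborel (\<lambda>y. (cmod (f y))\<^sup>2) \<Longrightarrow> integrable lborel (\<lambda>y. lam k x y * f y)"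
  by (rule sq_integrable_mult(1)) (auto simp: lam_sq_integrable)

lemma square_fun_add:
  assumes [measurable]: "f \<in> borel_measurable borel" "g \<in> borel_measurable borel"
    and "integrable lborel (\<lambda>y. (cmod (f y))\<^sup>2)" "integrable lborel (\<lambda>y. (cmod (g y))\<^sup>2)"
  shows "square_fun lam (\<lambda>y. f y + g y) x \<le> square_fun lam f x + square_fun lam g x"
proof -
  have "Lambda lam k (\<lambda>y. f y + g y) x = Lambda lam k f x + Lambda lam k g x" for k
    using lam_f_integrable[of f k x] lam_f_integrable[of g k x] assms
    by (simp add: Lambda_lborel distrib_left)
  then show ?thesis unfolding square_fun_def by (simp only: l2_triangle)
qed

lemma square_fun_le_sum: "square_fun lam f x \<le> (\<integral>\<^sup>+k. ennreal (cmod (Lambda lam k f x)) \<partial>count_space UNIV)"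
proof -
  have "ennreal ((cmod (Lambda lam k f x))\<^sup>2) = ennreal (cmod (Lambda lam k f x)) * ennreal (cmod (Lambda lam k f x))" for k
    by (simp add: ennreal_mult[symmetric] power2_eq_square)
  then show ?thesis unfolding square_fun_def using infsum_le_square[of "\<lambda>k. ennreal (cmod (Lambda lam k f x))"] by simp
qed

lemma square_fun_L2:
  assumes "f \<in> borel_measurable borel" "integrable lborel (\<lambda>y. (cmod (f y))\<^sup>2)"
  shows "square_fun lam f \<in> borel_measurable lebesgue"
    and "(\<integral>\<^sup>+x. ennpowr (square_fun lam f x) 2 \<partial>lebesgue) \<le> ennreal (CS\<^sup>2) * (\<integral>\<^sup>+x. ennreal ((cmod (f x))\<^sup>2) \<partial>lborel)"
proof -
  have f: "f \<in> Lp_space 2" using assms by (simp add: Lp_space_2_iff)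
  show "square_fun lam f \<in> borel_measurable lebesgue" using L2[OF f] by simp
  have N: "Lp_norm 2 f = ennpowr (\<integral>\<^sup>+x. ennreal ((cmod (f x))\<^sup>2) \<partial>lborel) (1 / 2)"
    by (simp add: Lp_norm_def lp_norm_def nn_integral_completion powr_numeral)
  have "ennpowr (\<integral>\<^sup>+x. ennpowr (square_fun lam f x) 2 \<partial>lebesgue) (1 / 2) \<le> ennreal CS * ennpowr (\<integral>\<^sup>+x. ennreal ((cmod (f x))\<^sup>2) \<partial>lborel) (1 / 2)"
    using L2[OF f] unfolding N by (simp add: lp_norm_def)
  then have "ennpowr (ennpowr (\<integral>\<^sup>+x. ennpowr (square_fun lam f x) 2 \<partial>lebesgue) (1 / 2)) 2 \<le>
     ennpowr (ennreal CS * ennpowr (\<integral>\<^sup>+x. ennreal ((cmod (f x))\<^sup>2) \<partial>lborel) (1 / 2)) 2"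
    by (intro ennpowr_mono) auto
  then show "(\<integral>\<^sup>+x. ennpowr (square_fun lam f x) 2 \<partial>lebesgue) \<le> ennreal (CS\<^sup>2) * (\<integral>\<^sup>+x. ennreal ((cmod (f x))\<^sup>2) \<partial>lborel)"
    using CS by (simp add: ennpowr_2_half ennpowr_mult powr_numeral)
qed

text \<open>The two geometric series come from the scales with 2^k R \<le> 1 (exponent \<delta>) and
  from the others (exponent \<delta> / 2); the first factors are the integral of a weight of decay n
  + \<delta> / 2.\<close>

definition "C6 = wt_const TYPE('a) (real DIM('a) + \<delta> / 2) * unit_ball_vol (real DIM('a)) *
  (1 / (1 - 2 powr (- \<delta>)) + 1 / (1 - 2 powr (- (\<delta> / 2))))"

lemma powr_2_lt_1: "0 < a \<Longrightarrow> 2 powr (- a) < (1 :: real)"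
  by (simp add: powr_less_one)

lemma C6_nonneg: "0 \<le> C6"
  unfolding C6_def using powr_2_lt_1[of \<delta>] powr_2_lt_1[of "\<delta> / 2"] delta0 wt_const_nonneg[where 'a='a, of "real DIM('a) + \<delta> / 2"]
  by (intro mult_nonneg_nonneg add_nonneg_nonneg) auto

text \<open>The decay n + 2 \<delta> is split into n + \<delta> / 2, which is integrable in x, and 3
  \<delta> / 2, which is evaluated at distance R. What is left behaves like (2^k R)^\<delta> for 2^k
  R \<le> 1 and like (2^k R)^(-\<delta> / 2) otherwise, so the sum over k is bounded independently
  of R. This is where decay beyond n + \<delta> is used.\<close>

lemma far_sum:
  fixes w :: 'a
  assumes R: "0 < R" and A: "A \<in> sets borel" "\<And>x. x \<in> A \<Longrightarrow> R \<le> norm (x - w)"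
  shows "(\<integral>\<^sup>+k. (\<integral>\<^sup>+x\<in>A. ennreal ((2 powr real_of_int k * R) powr \<delta> * Phi (real DIM('a) + 2 * \<delta>) k (x - w)) \<partial>lborel) \<partial>count_space UNIV) \<le> ennreal C6"
proof -
  let ?n = "real DIM('a)"
  define K where "K = ?n + \<delta> / 2"
  define W where "W = wt_const TYPE('a) K * unit_ball_vol ?n"
  have K: "?n < K" using delta0 by (simp add: K_def)
  have W: "0 \<le> W" unfolding W_def using wt_const_nonneg[OF K] by (intro mult_nonneg_nonneg) auto
  define g where "g = (\<lambda>k::int. (2 powr real_of_int k * R) powr \<delta> * (1 + 2 powr real_of_int k * R) powr (- (3 * \<delta> / 2)))"
  have g0: "0 \<le> g k" for k by (simp add: g_def)
  have inner: "(\<integral>\<^sup>+x\<in>A. ennreal ((2 powr real_of_int k * R) powr \<delta> * Phi (real DIM('a) + 2 * \<delta>) k (x - w)) \<partial>lborel) \<le> ennreal W * ennreal (g k)" for k :: int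
  proof -
    let ?s = "2 powr (- real_of_int k)" and ?t = "2 powr real_of_int k"
    have st: "0 < ?s" by simp
    have "(\<integral>\<^sup>+x\<in>A. ennreal ((?t * R) powr \<delta> * Phi (real DIM('a) + 2 * \<delta>) k (x - w)) \<partial>lborel) \<le>
      (\<integral>\<^sup>+x. ennreal (g k * ?t powr ?n) * ennreal (wt K w ?s x) \<partial>lborel)"
    proof (rule nn_integral_mono)
      fix x
      show "ennreal ((?t * R) powr \<delta> * Phi (real DIM('a) + 2 * \<delta>) k (x - w)) * indicator A x \<le> ennreal (g k * ?t powr ?n) * ennreal (wt K w ?s x)"
      proof (cases "x \<in> A")
        case True
        let ?q = "1 + ?t * norm (x - w)"
        have q: "1 + ?t * R \<le> ?q" using A(2)[OF True] by simp
        have q0: "0 < 1 + ?t * R" using R by (intro add_pos_nonneg) auto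
        have "Phi (real DIM('a) + 2 * \<delta>) k (x - w) = ?t powr ?n * (?q powr (- (3 * \<delta> / 2)) * ?q powr (- K))"
          by (simp add: Phi_def powr_powr powr_add[symmetric] K_def algebra_simps)
        also have "?q powr (- K) = wt K w ?s x"
          using Phi_wt[of K k x w]
          by (simp add: wt_def powr_minus divide_inverse mult.commute)
        also have "?t powr ?n * (?q powr (- (3 * \<delta> / 2)) * wt K w ?s x) \<le> ?t powr ?n * ((1 + ?t * R) powr (- (3 * \<delta> / 2)) * wt K w ?s x)"
          using q q0 delta0 by (intro mult_left_mono mult_right_mono powr_mono2' wt_nonneg) auto
        finally have "Phi (real DIM('a) + 2 * \<delta>) k (x - w) \<le> ?t powr ?n * ((1 + ?t * R) powr (- (3 * \<delta> / 2)) * wt K w ?s x)"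
          .
        then have "(?t * R) powr \<delta> * Phi (real DIM('a) + 2 * \<delta>) k (x - w) \<le> (?t * R) powr \<delta> * (?t powr ?n * ((1 + ?t * R) powr (- (3 * \<delta> / 2)) * wt K w ?s x))"
          by (intro mult_left_mono) auto
        also have "\<dots> = (g k * ?t powr ?n) * wt K w ?s x" by (simp add: g_def)
        finally show ?thesis using True g0[of k] by (simp add: ennreal_mult[symmetric] wt_nonneg ennreal_leI)
      qed simp
    qed
    also have "\<dots> = ennreal (g k * ?t powr ?n) * (\<integral>\<^sup>+x. ennreal (wt K w ?s x) \<partial>lborel)"
      by (rule nn_integral_cmult) measurable
    also have "\<dots> \<le> ennreal (g k * ?t powr ?n) * ennreal (wt_const TYPE('a) K * unit_ball_vol ?n * ?s ^ DIM('a))"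
      by (intro mult_left_mono nn_integral_wt_finite K) auto
    also have "\<dots> = ennreal (g k * ?t powr ?n * (W * ?s ^ DIM('a)))"
      unfolding W_def using g0[of k] wt_const_nonneg[OF K] by (simp add: ennreal_mult)
    also have "g k * ?t powr ?n * (W * ?s ^ DIM('a)) = W * g k"
    proof -
      have "?t powr ?n * ?s ^ DIM('a) = 1"
        by (simp add: powr_realpow[symmetric] powr_powr powr_add[symmetric])
      then have "g k * W * (?t powr ?n * ?s ^ DIM('a)) = g k * W" by simp
      then show ?thesis by (simp only: mult_ac)
    qed
    finally show ?thesis using W g0[of k] by (simp add: ennreal_mult)
  qed
  have gle: "ennreal (g k) \<le> ennreal (R powr \<delta>) * (ennreal (2 powr (real_of_int k * \<delta>)) * indicator {k. 2 powr real_of_int k \<le> 1 / R} k)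
     + ennreal (R powr (- (\<delta> / 2))) * (ennreal (2 powr (- real_of_int k * (\<delta> / 2))) * indicator {k. 1 / R \<le> 2 powr real_of_int k} k)" for k
  proof (cases "2 powr real_of_int k \<le> 1 / R")
    case True
    have "(1 + 2 powr real_of_int k * R) powr (- (3 * \<delta> / 2)) \<le> 1"
      using R delta0 by (simp add: powr_minus inverse_le_1_iff ge_one_powr_ge_zero)
    then have "g k \<le> (2 powr real_of_int k * R) powr \<delta> * 1" unfolding g_def by (intro mult_left_mono) auto
    also have "\<dots> = R powr \<delta> * 2 powr (real_of_int k * \<delta>)" by (simp add: powr_mult powr_powr)
    finally have "ennreal (g k) \<le> ennreal (R powr \<delta>) * ennreal (2 powr (real_of_int k * \<delta>))"
      by (simp add: ennreal_mult[symmetric] ennreal_leI)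
    then show ?thesis using True by (intro order_trans[OF _ add_increasing2]) auto
  next
    case False
    let ?x = "2 powr real_of_int k * R"
    have x: "0 < ?x" using R by simp
    have "(1 + ?x) powr (- (3 * \<delta> / 2)) \<le> ?x powr (- (3 * \<delta> / 2))"
      using x delta0 by (intro powr_mono2') auto
    then have "g k \<le> ?x powr \<delta> * ?x powr (- (3 * \<delta> / 2))" unfolding g_def by (intro mult_left_mono) auto
    also have "\<dots> = ?x powr (- (\<delta> / 2))" by (simp add: powr_add[symmetric])
    also have "\<dots> = R powr (- (\<delta> / 2)) * 2 powr (- real_of_int k * (\<delta> / 2))" by (simp add: powr_mult powr_powr)
    finally have "ennreal (g k) \<le> ennreal (R powr (- (\<delta> / 2))) * ennreal (2 powr (- real_of_int k * (\<delta> / 2)))"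
      by (simp add: ennreal_mult[symmetric] ennreal_leI)
    then show ?thesis using False by auto
  qed
  have "(\<integral>\<^sup>+k. (\<integral>\<^sup>+x\<in>A. ennreal ((2 powr real_of_int k * R) powr \<delta> * Phi (real DIM('a) + 2 * \<delta>) k (x - w)) \<partial>lborel) \<partial>count_space UNIV)
    \<le> (\<integral>\<^sup>+k. ennreal W * ennreal (g k) \<partial>count_space UNIV)"
    by (intro nn_integral_mono inner)
  also have "\<dots> = ennreal W * (\<integral>\<^sup>+k. ennreal (g k) \<partial>count_space UNIV)" by (simp add: nn_integral_cmult)
  also have "(\<integral>\<^sup>+k. ennreal (g k) \<partial>count_space UNIV) \<le> 
    (\<integral>\<^sup>+k. ennreal (R powr \<delta>) * (ennreal (2 powr (real_of_int k * \<delta>)) * indicator {k. 2 powr real_of_int k \<le> 1 / R} k)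
     + ennreal (R powr (- (\<delta> / 2))) * (ennreal (2 powr (- real_of_int k * (\<delta> / 2))) * indicator {k. 1 / R \<le> 2 powr real_of_int k} k) \<partial>count_space UNIV)"
    by (intro nn_integral_mono gle)
  also have "\<dots> = ennreal (R powr \<delta>) * (\<integral>\<^sup>+k. ennreal (2 powr (real_of_int k * \<delta>)) * indicator {k. 2 powr real_of_int k \<le> 1 / R} k \<partial>count_space UNIV)
     + ennreal (R powr (- (\<delta> / 2))) * (\<integral>\<^sup>+k. ennreal (2 powr (- real_of_int k * (\<delta> / 2))) * indicator {k. 1 / R \<le> 2 powr real_of_int k} k \<partial>count_space UNIV)"
    by (simp add: nn_integral_add nn_integral_cmult)
  also have "\<dots> \<le> ennreal (R powr \<delta>) * ennreal ((1 / R) powr \<delta> / (1 - 2 powr (- \<delta>)))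
     + ennreal (R powr (- (\<delta> / 2))) * ennreal ((1 / R) powr (- (\<delta> / 2)) / (1 - 2 powr (- (\<delta> / 2))))"
    using R delta0 by (intro add_mono mult_left_mono nn_sum_dyadic_le nn_sum_dyadic_ge) auto
  also have "\<dots> = ennreal (1 / (1 - 2 powr (- \<delta>)) + 1 / (1 - 2 powr (- (\<delta> / 2))))"
  proof -
    have "R powr \<delta> * ((1 / R) powr \<delta> / (1 - 2 powr (- \<delta>))) = 1 / (1 - 2 powr (- \<delta>))"
      "R powr (- (\<delta> / 2)) * ((1 / R) powr (- (\<delta> / 2)) / (1 - 2 powr (- (\<delta> / 2)))) = 1 / (1 - 2 powr (- (\<delta> / 2)))"
      using R by (simp_all add: powr_divide)
    moreover have "0 < 1 - 2 powr (- \<delta>)" "0 < 1 - 2 powr (- (\<delta> / 2))" using powr_2_lt_1[of \<delta>] powr_2_lt_1[of "\<delta> / 2"] delta0 by auto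
    ultimately show ?thesis
      by (subst (1 2) ennreal_mult[symmetric]) (auto simp flip: ennreal_plus)
  qed
  finally have "(\<integral>\<^sup>+k. (\<integral>\<^sup>+x\<in>A. ennreal ((2 powr real_of_int k * R) powr \<delta> * Phi (real DIM('a) + 2 * \<delta>) k (x - w)) \<partial>lborel) \<partial>count_space UNIV)
    \<le> ennreal W * ennreal (1 / (1 - 2 powr (- \<delta>)) + 1 / (1 - 2 powr (- (\<delta> / 2))))"
    by (simp add: mult_left_mono)
  also have "\<dots> = ennreal C6"
    using W powr_2_lt_1[of \<delta>] powr_2_lt_1[of "\<delta> / 2"] delta0
    by (subst ennreal_mult[symmetric]) (auto simp: C6_def W_def K_def)
  finally show ?thesis .
qed

end

section \<open>Good and bad parts under the square function\<close>

lemma emeasure_le_nn_integral: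
  assumes "A \<in> sets M" "\<And>x. x \<in> A \<Longrightarrow> 1 \<le> F x"
  shows "emeasure M A \<le> (\<integral>\<^sup>+x. F x \<partial>M)"
proof -
  have "emeasure M A = (\<integral>\<^sup>+x. indicator A x \<partial>M)" using assms by simp
  also have "\<dots> \<le> (\<integral>\<^sup>+x. F x \<partial>M)"
    using assms(2) by (intro nn_integral_mono) (auto simp: indicator_def)
  finally show ?thesis .
qed

context lpso_op
begin

text \<open>6 = 2 * 3: there are two terms \<open>Phi\<close> in the smoothness condition, and
  3^\<delta> \<le> 3 for points at distance up to 3 rho w. The power of 2 is that of
  \<open>Phi_far\<close>.\<close>

definition "CD = 6 * 2 powr (real DIM('a) + 2 * \<delta>) * CL0"
text \<open>1 stands for \<Omega> itself, the second summand for the good part on \<Omega> in L^2,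
  the third for the bad part off \<Omega> in L^1. The argument c takes the place of
  \<open>Ca\<close>, which belongs to another locale.\<close>

definition "C7 c = 1 + CS\<^sup>2 * (c * 4 ^ DIM('a))\<^sup>2 + 2 * c * CD * C6"

lemma CD_nonneg: "0 \<le> CD"
  using CL0 by (simp add: CD_def)

end

locale lpso_cz = lpso_op lam CL0 \<delta> CS + cz_function \<Omega> f \<alpha> C3 \<delta> K
  for lam :: "int \<Rightarrow> 'a::euclidean_space \<Rightarrow> 'a \<Rightarrow> complex" and CL0 \<delta> CS and \<Omega> :: "'a set" and f \<alpha> C3 K
begin

definition "G k x w = 2 * Ca * \<alpha> * (CD * ((2 powr real_of_int k * rho w) powr \<delta> * Phi (real DIM('a) + 2 * \<delta>) k (x - w)))"

lemma Phi_nonneg: "0 \<le> Phi N k x"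
  by (simp add: Phi_def)

text \<open>As |x - w| \<ge> 20 rho w and |z - w| \<le> 3 rho w, the distance from x to w is at most
  twice that from x to z.\<close>

lemma Phi_far:
  assumes x: "x \<notin> \<Omega>" and z: "norm (z - w) \<le> 3 * rho w"
  shows "Phi (real DIM('a) + 2 * \<delta>) k (x - z) \<le> 2 powr (real DIM('a) + 2 * \<delta>) * Phi (real DIM('a) + 2 * \<delta>) k (x - w)"
proof -
  let ?t = "2 powr real_of_int k" and ?N = "real DIM('a) + 2 * \<delta>"
  have "norm (x - w) \<le> norm (x - z) + norm (z - w)" using norm_triangle_ineq[of "x - z" "z - w"] by simp
  then have "norm (x - w) \<le> 2 * norm (x - z)" using z rho_le_dist[OF x, of w] rho_nonneg[of w] by linarith
  then have "?t * norm (x - w) \<le> ?t * (2 * norm (x - z))" by (intro mult_left_mono) auto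
  then have "?t * norm (x - w) \<le> 2 * (?t * norm (x - z))" by (simp only: mult_ac)
  moreover have "(1 + a) / 2 \<le> 1 + b" if "a \<le> 2 * b" for a b :: real using that by simp
  ultimately have le: "(1 + ?t * norm (x - w)) / 2 \<le> 1 + ?t * norm (x - z)" by blast
  have q: "0 < 1 + ?t * norm (x - w)" by (intro add_pos_nonneg) auto
  have "(1 + ?t * norm (x - z)) powr (- ?N) \<le> ((1 + ?t * norm (x - w)) / 2) powr (- ?N)"
    using le q delta by (intro powr_mono2') auto
  also have "\<dots> = 2 powr ?N * (1 + ?t * norm (x - w)) powr (- ?N)"
  proof -
    have "(q / 2) powr (- N) = 2 powr N * q powr (- N)" for q N :: real
      by (simp only: powr_divide powr_minus_divide) simp
    then show ?thesis .
  qed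
  finally show ?thesis by (simp add: Phi_def mult_left_mono mult.left_commute)
qed

text \<open>\<open>bad_pairing\<close> with the kernel as test function. D w bounds the oscillation
  of the kernel near w: regularity contributes (2^k rho w)^\<delta>, and \<open>Phi_far\<close>
  allows the size to be evaluated at w.\<close>

lemma Lambda_bad:
  assumes x: "x \<notin> \<Omega>"
  shows "ennreal (cmod (Lambda lam k bad x)) \<le> (\<integral>\<^sup>+w. ennreal (G k x w) * indicator \<Omega> w \<partial>lborel)"
proof -
  let ?N = "real DIM('a) + 2 * \<delta>"
  let ?D = "\<lambda>w. CD * ((2 powr real_of_int k * rho w) powr \<delta> * Phi ?N k (x - w))"
  let ?P = "\<lambda>w. Phi ?N k (x - w)" and ?A = "2 powr ?N"
  have A: "1 \<le> ?A" using delta by (intro ge_one_powr_ge_zero) auto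
  have P0: "0 \<le> ?P w" for w by (rule Phi_nonneg)
  have split: "(2 powr real_of_int k * rho w) powr \<delta> = rho w powr \<delta> * 2 powr (real_of_int k * \<delta>)" for w
    by (simp add: powr_mult powr_powr)
  \<comment> \<open>Division by 3 reserves the factor 3^\<delta> \<le> 3 for the comparison of a
    point with w, at distance up to 3 rho w.\<close>
  have gen: "cmod (lam k x z - lam k x z') \<le> CD * (norm (z - z') powr \<delta> * 2 powr (real_of_int k * \<delta>) * ?P w) / 3"
    if "norm (z - w) \<le> 3 * rho w" "norm (z' - w) \<le> 3 * rho w" for w z z'
  proof -
    have "cmod (lam k x z - lam k x z') \<le> CL0 * norm (z - z') powr \<delta> * 2 powr (real_of_int k * \<delta>) * (?P z + ?P z')"
      by (rule smooth)
    also have "\<dots> \<le> CL0 * norm (z - z') powr \<delta> * 2 powr (real_of_int k * \<delta>) * (?A * ?P w + ?A * ?P w)"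
      using CL0 that by (intro mult_left_mono add_mono Phi_far x) auto
    finally show ?thesis by (simp add: CD_def)
  qed
  have "ennreal (cmod (LINT z|lborel. lam k x z * bad z)) \<le> (\<integral>\<^sup>+w. ennreal (2 * Ca * \<alpha> * ?D w) * indicator \<Omega> w \<partial>lborel)"
  proof (rule bad_pairing[OF lam_measurable lam_integrable lam_sq_integrable])
    show "0 \<le> ?D w" for w using CD_nonneg P0 by simp
    show "?D \<in> borel_measurable borel" unfolding Phi_def by measurable
    fix w z assume w: "w \<in> \<Omega>" and z: "norm (z - w) \<le> 3 * rho w"
    have R: "0 < rho w" using w by (simp add: rho_pos_iff)
    have "cmod (lam k x z - lam k x w) \<le> CD * (norm (z - w) powr \<delta> * 2 powr (real_of_int k * \<delta>) * ?P w) / 3"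
      using R z by (intro gen) auto
    also have "\<dots> \<le> CD * ((3 * rho w powr \<delta>) * 2 powr (real_of_int k * \<delta>) * ?P w) / 3"
    proof (intro divide_right_mono mult_left_mono mult_right_mono)
      have "norm (z - w) powr \<delta> \<le> (3 * rho w) powr \<delta>" using z delta by (intro powr_mono2) auto
      also have "\<dots> = 3 powr \<delta> * rho w powr \<delta>" by (simp add: powr_mult)
      also have "\<dots> \<le> 3 powr 1 * rho w powr \<delta>" using delta by (intro mult_right_mono powr_mono) auto
      finally show "norm (z - w) powr \<delta> \<le> 3 * rho w powr \<delta>" by simp
    qed (use CD_nonneg P0 in auto)
    finally show "cmod (lam k x z - lam k x w) \<le> ?D w" by (simp add: split)
    fix z' assume z': "norm (z' - w) \<le> 3 * rho w"
    have "cmod (lam k x z - lam k x z') \<le> CD * (norm (z - z') powr \<delta> * 2 powr (real_of_int k * \<delta>) * ?P w) / 3"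
      by (rule gen[OF z z'])
    also have "\<dots> \<le> CD * (norm (z - z') powr \<delta> * 2 powr (real_of_int k * \<delta>) * ?P w)"
      using CD_nonneg P0[of w] by simp
    also have "\<dots> = ?D w * (norm (z - z') / rho w) powr \<delta>"
      using R by (simp add: split powr_divide)
    finally show "cmod (lam k x z - lam k x z') \<le> ?D w * (norm (z - z') / rho w) powr \<delta>" .
  qed
  then show ?thesis by (simp add: Lambda_lborel G_def)
qed

text \<open>Tonelli puts the integral over w outermost. For fixed w all points outside \<Omega> are
  farther than rho w from w, and \<open>far_sum\<close> with R = rho w bounds the sum over k and the
  integral over x together by a constant; integrating over w gives the measure of \<Omega>.\<close>

lemma bad_L1:
  "(\<integral>\<^sup>+x\<in>-\<Omega>. square_fun lam bad x \<partial>lebesgue) \<le> ennreal (2 * Ca * \<alpha> * (CD * C6)) * emeasure lborel \<Omega>"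
proof -
  let ?N = "real DIM('a) + 2 * \<delta>"
  let ?c = "2 * Ca * \<alpha> * CD"
  have c: "0 \<le> ?c" using Ca_nonneg CD_nonneg alpha by simp
  have Gm [measurable]: "(\<lambda>(x, w). G k x w) \<in> borel_measurable (borel \<Otimes>\<^sub>M borel)" for k
    unfolding G_def Phi_def by measurable
  have "(\<integral>\<^sup>+x\<in>-\<Omega>. square_fun lam bad x \<partial>lebesgue) \<le>
     (\<integral>\<^sup>+x. \<integral>\<^sup>+k. \<integral>\<^sup>+w. ennreal (G k x w) * indicator \<Omega> w * indicator (- \<Omega>) x \<partial>lborel \<partial>count_space UNIV \<partial>lborel)"
    unfolding nn_integral_completion
  proof (rule nn_integral_mono)
    fix x
    show "square_fun lam bad x * indicator (- \<Omega>) x \<le>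
      (\<integral>\<^sup>+k. \<integral>\<^sup>+w. ennreal (G k x w) * indicator \<Omega> w * indicator (- \<Omega>) x \<partial>lborel \<partial>count_space UNIV)"
    proof (cases "x \<in> \<Omega>")
      case False
      have "square_fun lam bad x \<le> (\<integral>\<^sup>+k. ennreal (cmod (Lambda lam k bad x)) \<partial>count_space UNIV)"
        by (rule square_fun_le_sum)
      also have "\<dots> \<le> (\<integral>\<^sup>+k. \<integral>\<^sup>+w. ennreal (G k x w) * indicator \<Omega> w \<partial>lborel \<partial>count_space UNIV)"
        by (intro nn_integral_mono Lambda_bad False)
      finally show ?thesis using False by simp
    qed simp
  qed
  also have "\<dots> = (\<integral>\<^sup>+k. \<integral>\<^sup>+x. \<integral>\<^sup>+w. ennreal (G k x w) * indicator \<Omega> w * indicator (- \<Omega>) x \<partial>lborel \<partial>lborel \<partial>count_space UNIV)"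
    by (rule nn_integral_count_space_nn_integral) (auto simp: case_prod_beta)
  also have "\<dots> = (\<integral>\<^sup>+k. \<integral>\<^sup>+w. \<integral>\<^sup>+x. ennreal (G k x w) * indicator \<Omega> w * indicator (- \<Omega>) x \<partial>lborel \<partial>lborel \<partial>count_space UNIV)"
  proof (rule nn_integral_cong)
    fix k :: int
    show "(\<integral>\<^sup>+x. \<integral>\<^sup>+w. ennreal (G k x w) * indicator \<Omega> w * indicator (- \<Omega>) x \<partial>lborel \<partial>lborel) =
      (\<integral>\<^sup>+w. \<integral>\<^sup>+x. ennreal (G k x w) * indicator \<Omega> w * indicator (- \<Omega>) x \<partial>lborel \<partial>lborel)"
      using lborel_pair.Fubini[of "\<lambda>(x, w). ennreal (G k x w) * indicator \<Omega> w * indicator (- \<Omega>) x"] by simp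
  qed
  also have "\<dots> = (\<integral>\<^sup>+w. \<integral>\<^sup>+k. \<integral>\<^sup>+x. ennreal (G k x w) * indicator \<Omega> w * indicator (- \<Omega>) x \<partial>lborel \<partial>count_space UNIV \<partial>lborel)"
    by (rule nn_integral_count_space_nn_integral[symmetric]) auto
  also have "\<dots> \<le> (\<integral>\<^sup>+w. ennreal (?c * C6) * indicator \<Omega> w \<partial>lborel)"
  proof (rule nn_integral_mono)
    fix w
    show "(\<integral>\<^sup>+k. \<integral>\<^sup>+x. ennreal (G k x w) * indicator \<Omega> w * indicator (- \<Omega>) x \<partial>lborel \<partial>count_space UNIV) \<le> ennreal (?c * C6) * indicator \<Omega> w"
    proof (cases "w \<in> \<Omega>")
      case True
      then have R: "0 < rho w" by (simp add: rho_pos_iff)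
      define H where "H = (\<lambda>k x. ennreal ((2 powr real_of_int k * rho w) powr \<delta> * Phi ?N k (x - w)))"
      have Hm [measurable]: "H k \<in> borel_measurable borel" for k unfolding H_def Phi_def by measurable
      have Geq: "ennreal (G k x w) = ennreal ?c * H k x" for k x
      proof -
        have "G k x w = ?c * ((2 powr real_of_int k * rho w) powr \<delta> * Phi ?N k (x - w))"
          by (simp only: G_def mult.assoc)
        then show ?thesis using ennreal_mult[OF c mult_nonneg_nonneg[OF powr_ge_zero Phi_nonneg]] by (simp only: H_def)
      qed
      have "(\<integral>\<^sup>+k. \<integral>\<^sup>+x. ennreal (G k x w) * indicator \<Omega> w * indicator (- \<Omega>) x \<partial>lborel \<partial>count_space UNIV) =
        (\<integral>\<^sup>+k. \<integral>\<^sup>+x. ennreal ?c * (H k x * indicator (- \<Omega>) x) \<partial>lborel \<partial>count_space UNIV)"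
        by (simp only: Geq mult.assoc indicator_simps(1)[OF True] mult_1_left)
      also have "\<dots> = ennreal ?c * (\<integral>\<^sup>+k. (\<integral>\<^sup>+x\<in>-\<Omega>. H k x \<partial>lborel) \<partial>count_space UNIV)"
      proof -
        have "(\<integral>\<^sup>+x. ennreal ?c * (H k x * indicator (- \<Omega>) x) \<partial>lborel) = ennreal ?c * (\<integral>\<^sup>+x\<in>-\<Omega>. H k x \<partial>lborel)" for k
          by (rule nn_integral_cmult) measurable
        then show ?thesis by (simp only: nn_integral_cmult borel_measurable_count_space)
      qed
      also have "\<dots> \<le> ennreal ?c * ennreal C6"
        unfolding H_def
      proof (intro mult_left_mono far_sum R)
        show "- \<Omega> \<in> sets borel" by measurable
        show "rho w \<le> norm (x - w)" if "x \<in> - \<Omega>" for x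
          using rho_le_dist[of x w] that rho_nonneg[of w] by auto
      qed auto
      finally show ?thesis using True c C6_nonneg by (simp add: ennreal_mult)
    qed simp
  qed
  also have "\<dots> = ennreal (?c * C6) * emeasure lborel \<Omega>" by (rule nn_integral_cmult_indicator) simp
  finally show ?thesis by (simp add: mult.assoc)
qed

text \<open>\<Omega> is simply counted. The good part is treated by Chebyshev's inequality in L^2 on
  the whole space, the bad part by Chebyshev's inequality in L^1 off \<Omega>. The L^2 mass of f off
  \<Omega> is kept on the right, to be summed over the levels.\<close>

lemma distribution_bound:
  "emeasure lebesgue {x. ennreal (2 * \<alpha>) < square_fun lam f x} \<le>
    ennreal (C7 Ca) * emeasure lborel \<Omega> + ennreal (CS\<^sup>2 / \<alpha>\<^sup>2) * (\<integral>\<^sup>+z. ennreal ((cmod (f z))\<^sup>2) * indicator (- \<Omega>) z \<partial>lborel)"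
proof -
  let ?S = "square_fun lam" and ?F = "\<integral>\<^sup>+z. ennreal ((cmod (f z))\<^sup>2) * indicator (- \<Omega>) z \<partial>lborel"
  have [measurable]: "?S good \<in> borel_measurable lebesgue" "?S bad \<in> borel_measurable lebesgue"
    by (simp_all add: square_fun_L2 good_sq_integrable bad_sq_integrable)
  have Oml [measurable]: "\<Omega> \<in> sets lebesgue" using open_Om by simp
  have 1: "{x. ennreal \<alpha> < ?S good x} \<in> sets lebesgue" "{x. ennreal \<alpha> < ?S bad x} \<in> sets lebesgue"
    by (intro sets_lebesgue_less; measurable)+
  have sub: "{x. ennreal (2 * \<alpha>) < ?S f x} \<subseteq> \<Omega> \<union> ({x. ennreal \<alpha> < ?S good x} \<union> ({x. ennreal \<alpha> < ?S bad x} - \<Omega>))"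
  proof (rule subsetI, rule ccontr)
    fix x assume x: "x \<in> {x. ennreal (2 * \<alpha>) < ?S f x}"
      "x \<notin> \<Omega> \<union> ({x. ennreal \<alpha> < ?S good x} \<union> ({x. ennreal \<alpha> < ?S bad x} - \<Omega>))"
    have "?S f x = ?S (\<lambda>y. good y + bad y) x" by (simp add: bad_def)
    also have "\<dots> \<le> ?S good x + ?S bad x"
      by (rule square_fun_add) (auto simp: good_sq_integrable bad_sq_integrable)
    also have "\<dots> \<le> ennreal \<alpha> + ennreal \<alpha>" using x(2) by (intro add_mono) (auto simp: not_less)
    also have "\<dots> = ennreal (2 * \<alpha>)" using alpha by (simp flip: ennreal_plus)
    finally show False using x(1) by simp
  qed
  have "emeasure lebesgue {x. ennreal (2 * \<alpha>) < ?S f x} \<le>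
    emeasure lebesgue (\<Omega> \<union> ({x. ennreal \<alpha> < ?S good x} \<union> ({x. ennreal \<alpha> < ?S bad x} - \<Omega>)))"
    using 1 Oml by (intro emeasure_mono[OF sub] sets.Un sets.Diff)
  also have "\<dots> \<le> emeasure lebesgue \<Omega> + emeasure lebesgue ({x. ennreal \<alpha> < ?S good x} \<union> ({x. ennreal \<alpha> < ?S bad x} - \<Omega>))"
    using 1 Oml by (intro emeasure_subadditive sets.Un sets.Diff)
  also have "\<dots> \<le> emeasure lebesgue \<Omega> + (emeasure lebesgue {x. ennreal \<alpha> < ?S good x} + emeasure lebesgue ({x. ennreal \<alpha> < ?S bad x} - \<Omega>))"
    using 1 Oml by (intro add_left_mono emeasure_subadditive sets.Un sets.Diff)
  finally have total: "emeasure lebesgue {x. ennreal (2 * \<alpha>) < ?S f x} \<le> \<dots>" .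
  have om: "emeasure lebesgue \<Omega> = emeasure lborel \<Omega>" by simp
  have part1: "emeasure lebesgue {x. ennreal \<alpha> < ?S good x} \<le> ennreal (CS\<^sup>2 * (Ca * 4 ^ DIM('a))\<^sup>2) * emeasure lborel \<Omega> + ennreal (CS\<^sup>2 / \<alpha>\<^sup>2) * ?F"
  proof -
    have "emeasure lebesgue {x. ennreal \<alpha> < ?S good x} \<le> (\<integral>\<^sup>+x. ennreal (1 / \<alpha>\<^sup>2) * ennpowr (?S good x) 2 \<partial>lebesgue)"
    proof (rule emeasure_le_nn_integral[OF 1(1)])
      fix x assume "x \<in> {x. ennreal \<alpha> < ?S good x}"
      then have "ennpowr (ennreal \<alpha>) 2 \<le> ennpowr (?S good x) 2" by (intro ennpowr_mono) auto
      then have "ennreal (1 / \<alpha>\<^sup>2) * ennreal (\<alpha>\<^sup>2) \<le> ennreal (1 / \<alpha>\<^sup>2) * ennpowr (?S good x) 2"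
        using alpha by (intro mult_left_mono) (auto simp: powr_numeral)
      then show "1 \<le> ennreal (1 / \<alpha>\<^sup>2) * ennpowr (?S good x) 2" using alpha by (simp flip: ennreal_mult)
    qed
    also have "\<dots> = ennreal (1 / \<alpha>\<^sup>2) * (\<integral>\<^sup>+x. ennpowr (?S good x) 2 \<partial>lebesgue)"
      by (rule nn_integral_cmult) measurable
    also have "\<dots> \<le> ennreal (1 / \<alpha>\<^sup>2) * (ennreal (CS\<^sup>2) * (ennreal ((Ca * \<alpha> * 4 ^ DIM('a))\<^sup>2) * emeasure lborel \<Omega> + ?F))"
      by (intro mult_left_mono order_trans[OF square_fun_L2(2)[OF good_measurable good_sq_integrable]] good_nn) auto
    also have "\<dots> = ennreal (1 / \<alpha>\<^sup>2 * CS\<^sup>2 * (Ca * \<alpha> * 4 ^ DIM('a))\<^sup>2) * emeasure lborel \<Omega> + ennreal (1 / \<alpha>\<^sup>2 * CS\<^sup>2) * ?F"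
    proof -
      have "ennreal c1 * (ennreal c2 * (ennreal c3 * X + Y)) = ennreal (c1 * c2 * c3) * X + ennreal (c1 * c2) * Y"
        if "0 \<le> c1" "0 \<le> c2" "0 \<le> c3" for c1 c2 c3 X Y
        using that by (simp add: distrib_left ennreal_mult mult.assoc)
      then show ?thesis by simp
    qed
    also have "1 / \<alpha>\<^sup>2 * CS\<^sup>2 * (Ca * \<alpha> * 4 ^ DIM('a))\<^sup>2 = CS\<^sup>2 * (Ca * 4 ^ DIM('a))\<^sup>2"
      using alpha by (simp add: power_mult_distrib)
    finally show ?thesis by simp
  qed
  have part2: "emeasure lebesgue ({x. ennreal \<alpha> < ?S bad x} - \<Omega>) \<le> ennreal (2 * Ca * CD * C6) * emeasure lborel \<Omega>"
  proof -
    have "emeasure lebesgue ({x. ennreal \<alpha> < ?S bad x} - \<Omega>) \<le> (\<integral>\<^sup>+x. ennreal (1 / \<alpha>) * (?S bad x * indicator (- \<Omega>) x) \<partial>lebesgue)"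
    proof (rule emeasure_le_nn_integral)
      show "{x. ennreal \<alpha> < ?S bad x} - \<Omega> \<in> sets lebesgue" using 1 Oml by (intro sets.Diff)
      fix x assume "x \<in> {x. ennreal \<alpha> < ?S bad x} - \<Omega>"
      then have "ennreal (1 / \<alpha>) * ennreal \<alpha> \<le> ennreal (1 / \<alpha>) * (?S bad x * indicator (- \<Omega>) x)"
        by (intro mult_left_mono) auto
      then show "1 \<le> ennreal (1 / \<alpha>) * (?S bad x * indicator (- \<Omega>) x)" using alpha by (simp flip: ennreal_mult)
    qed
    also have "\<dots> = ennreal (1 / \<alpha>) * (\<integral>\<^sup>+x\<in>-\<Omega>. ?S bad x \<partial>lebesgue)"
      by (rule nn_integral_cmult) (intro borel_measurable_times_ennreal borel_measurable_indicator; simp)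
    also have "\<dots> \<le> ennreal (1 / \<alpha>) * (ennreal (2 * Ca * \<alpha> * (CD * C6)) * emeasure lborel \<Omega>)"
      by (intro mult_left_mono bad_L1) auto
    also have "\<dots> = ennreal (1 / \<alpha> * (2 * Ca * \<alpha> * (CD * C6))) * emeasure lborel \<Omega>"
      using alpha Ca_nonneg CD_nonneg C6_nonneg by (subst mult.assoc[symmetric], subst ennreal_mult[symmetric]) auto
    also have "1 / \<alpha> * (2 * Ca * \<alpha> * (CD * C6)) = 2 * Ca * CD * C6" using alpha by simp
    finally show ?thesis .
  qed
  have "emeasure lebesgue {x. ennreal (2 * \<alpha>) < ?S f x} \<le> emeasure lborel \<Omega> +
    (ennreal (CS\<^sup>2 * (Ca * 4 ^ DIM('a))\<^sup>2) * emeasure lborel \<Omega> + ennreal (CS\<^sup>2 / \<alpha>\<^sup>2) * ?F + ennreal (2 * Ca * CD * C6) * emeasure lborel \<Omega>)"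
    by (rule order_trans[OF total]) (unfold om, intro add_left_mono add_mono part1 part2)
  also have "\<dots> = ennreal (C7 Ca) * emeasure lborel \<Omega> + ennreal (CS\<^sup>2 / \<alpha>\<^sup>2) * ?F"
  proof -
    have "ennreal (C7 Ca) = 1 + ennreal (CS\<^sup>2 * (Ca * 4 ^ DIM('a))\<^sup>2) + ennreal (2 * Ca * CD * C6)"
      unfolding C7_def using Ca_nonneg CD_nonneg C6_nonneg by (simp add: ennreal_plus)
    moreover have "X + (e1 * X + Y + e2 * X) = (1 + e1 + e2) * X + Y" for X Y e1 e2 :: ennreal
      unfolding distrib_right mult_1_left by (simp only: ac_simps)
    ultimately show ?thesis by simp
  qed
  finally show ?thesis .
qed

end

section \<open>Integration of the distributional inequality over the levels\<close>

lemma less_ennpowr_iff: "0 < r \<Longrightarrow> t < ennpowr a (1 / r) \<longleftrightarrow> ennpowr t r < a"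
  using ennpowr_le_iff[of r "ennpowr a (1 / r)" t] by (simp add: ennpowr_ennpowr not_le[symmetric])

locale lpso_hardy = approx_kernel \<phi>0 K \<delta> r + lpso_op lam CL0 \<delta> CS
  for \<phi>0 :: "'a::euclidean_space \<Rightarrow> complex" and K \<delta> r and lam :: "int \<Rightarrow> 'a \<Rightarrow> 'a \<Rightarrow> complex" and CL0 CS
begin

text \<open>\<open>Ca\<close> depends on C3 and K but not on the set, the function or the level;
  naming it here gives one constant for all level sets.\<close>

definition "Cz = cz_function.Ca TYPE('a) C3 K"

text \<open>The first summand collects the measures of the level sets, the second the L^2 mass of f
  outside them; its geometric series has ratio 2^-(2 - p).\<close>

definition "C9 p = 2 powr p * C7 Cz / (1 - 2 powr (- p)) + 2 powr p * CS\<^sup>2 * C4\<^sup>2 / (1 - 2 powr (- (2 - p)))"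

text \<open>Integrability of M^p gives the level sets finite measure, hence a non-empty complement,
  as the decomposition demands. After summation over the levels 2^k, at a point x the indices with
  2^k < M x contribute a multiple of M^p, and the others |f|^2 M^(p - 2), which
  \<open>AE_le_maximal\<close> bounds by a multiple of M^p.\<close>

lemma square_fun_le_maximal_aux:
  fixes f :: "'a \<Rightarrow> complex" and N :: "'a \<Rightarrow> ennreal"
  assumes p: "0 < p" "p < 2"
    and f [measurable]: "f \<in> borel_measurable borel" and f2: "integrable lborel (\<lambda>x. (cmod (f x))\<^sup>2)"
    and N [measurable]: "N \<in> borel_measurable lebesgue"
    and nt: "\<And>t x y. 0 < t \<Longrightarrow> norm (x - y) \<le> t \<Longrightarrow> ennreal (cmod (ut f t y)) \<le> N x"
    and M: "M = (\<lambda>x. ennpowr (hl (\<lambda>y. ennpowr (N y) r) x) (1 / r))"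
    and fin: "(\<integral>\<^sup>+x. ennpowr (M x) p \<partial>lebesgue) < \<infinity>"
    and C7: "0 \<le> C7 Cz"
  shows "(\<integral>\<^sup>+x. ennpowr (square_fun lam f x) p \<partial>lebesgue) \<le> ennreal (2 powr p * C9 p) * (\<integral>\<^sup>+x. ennpowr (M x) p \<partial>lebesgue)"
proof -
  let ?S = "square_fun lam f"
  have Mm [measurable]: "M \<in> borel_measurable lebesgue" unfolding M by measurable
  have Sm [measurable]: "?S \<in> borel_measurable lebesgue" by (rule square_fun_L2[OF f f2])
  have fl [measurable]: "f \<in> borel_measurable lebesgue" by (simp add: measurable_completion)
  define Q1 Q2 where "Q1 = 1 / (1 - 2 powr (- p))" and "Q2 = 1 / (1 - 2 powr (- (2 - p)))"
  have Q: "0 \<le> Q1" "0 \<le> Q2" unfolding Q1_def Q2_def using powr_2_lt_1[of p] powr_2_lt_1[of "2 - p"] p by auto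
  define E where "E = (\<lambda>k::int. {x. ennreal (2 powr real_of_int k) < M x})"
  have Eopen: "open (E k)" for k
    unfolding E_def M less_ennpowr_iff[OF r_pos] by (rule open_hl_greater)
  have Em [measurable]: "E k \<in> sets lebesgue" "E k \<in> sets borel" for k using Eopen[of k] by auto
  have q1: "2 powr (- p) < (1::real)" "2 powr (- (2 - p)) < (1::real)" using powr_2_lt_1[of p] powr_2_lt_1[of "2 - p"] p by auto
  have Efin: "emeasure lborel (E k) < \<infinity>" for k
  proof -
    let ?c = "ennreal (2 powr (- (real_of_int k * p)))"
    have "emeasure lebesgue (E k) \<le> (\<integral>\<^sup>+x. ?c * ennpowr (M x) p \<partial>lebesgue)"
    proof (rule emeasure_le_nn_integral)
      fix x assume "x \<in> E k"
      then have "ennpowr (ennreal (2 powr real_of_int k)) p \<le> ennpowr (M x) p"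
        using p by (intro ennpowr_mono) (auto simp: E_def)
      then have "?c * ennreal (2 powr (real_of_int k * p)) \<le> ?c * ennpowr (M x) p"
        by (intro mult_left_mono) (auto simp: powr_powr)
      then show "1 \<le> ?c * ennpowr (M x) p" by (simp add: ennreal_mult[symmetric] powr_add[symmetric])
    qed (rule Em)
    also have "\<dots> = ?c * (\<integral>\<^sup>+x. ennpowr (M x) p \<partial>lebesgue)" by (rule nn_integral_cmult) measurable
    also have "\<dots> < \<infinity>" using fin by (simp add: ennreal_mult_less_top)
    finally show ?thesis by simp
  qed
  have Ene: "- E k \<noteq> {}" for k
  proof
    assume "- E k = {}"
    then have "E k = UNIV" by auto
    with Efin[of k] show False by simp
  qed
  have dist: "emeasure lebesgue {x. ennreal (2 * 2 powr real_of_int k) < ?S x} \<le>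
    ennreal (C7 Cz) * emeasure lborel (E k) + ennreal (CS\<^sup>2 / (2 powr real_of_int k)\<^sup>2) * (\<integral>\<^sup>+z. ennreal ((cmod (f z))\<^sup>2) * indicator (- E k) z \<partial>lborel)" for k
  proof -
    interpret cz: lpso_cz lam CL0 \<delta> CS "E k" f "2 powr real_of_int k" C3 K
    proof unfold_locales
      fix c s B \<eta> x
      assume mol: "mol \<delta> K c s B \<eta>" "0 \<le> B" "0 < s" "x \<notin> E k" "dist x c \<le> 20 * s"
      have "ennpowr (ennreal (2 powr real_of_int k)) r \<ge> hl (\<lambda>y. ennpowr (N y) r) x"
        using mol(4) unfolding E_def M less_ennpowr_iff[OF r_pos] by (simp add: not_less)
      then have le: "hl (\<lambda>y. ennpowr (N y) r) x \<le> ennreal ((2 powr real_of_int k) powr r)" by simp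
      then obtain A where A: "hl (\<lambda>y. ennpowr (N y) r) x = ennreal A" "0 \<le> A"
        by (cases "hl (\<lambda>y. ennpowr (N y) r) x") (auto simp: top_unique)
      have "A \<le> (2 powr real_of_int k) powr r" using le A by (simp add: ennreal_le_iff)
      then have "A powr (1 / r) \<le> ((2 powr real_of_int k) powr r) powr (1 / r)" using A r_pos by (intro powr_mono2) auto
      also have "\<dots> = 2 powr real_of_int k" using r_pos by (simp add: powr_powr)
      finally have Ale: "A powr (1 / r) \<le> 2 powr real_of_int k" .
      have "cmod (LINT z|lborel. f z * \<eta> z) \<le> C3 * B * s ^ DIM('a) * A powr (1 / r)"
        by (rule mol_pairing_bound[OF N f f2 nt mol(1,2,3,5) A])
      also have "\<dots> \<le> C3 * B * s ^ DIM('a) * 2 powr real_of_int k"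
        using C3_nonneg mol by (intro mult_left_mono Ale) auto
      finally show "cmod (LINT z|lborel. f z * \<eta> z) \<le> C3 * B * s ^ DIM('a) * 2 powr real_of_int k" .
    qed (use Eopen Ene Efin f f2 delta K_pos C3_nonneg in auto)
    show ?thesis using cz.distribution_bound by (simp only: Cz_def)
  qed
  have AEf: "AE x in lebesgue. ennreal (cmod (f x)) \<le> ennreal C4 * M x"
    unfolding M by (rule AE_le_maximal[OF N f f2 nt])
  have C4: "0 \<le> C4" unfolding C4_def using C3_nonneg tent_const_pos[where 'a='a] by (intro add_nonneg_nonneg divide_nonneg_nonneg mult_nonneg_nonneg) auto
  \<comment> \<open>The distributional inequality with \<alpha> = 2^k concerns S f > 2 \<alpha>, so
    half of S f is compared with the dyadic levels.\<close>
  let ?h = "\<lambda>x. ennreal (1 / 2) * ?S x"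
  let ?a = "\<lambda>k x. ennreal (2 powr (real_of_int (k + 1) * p)) * (ennreal (C7 Cz) * indicator (E k) x + ennreal (CS\<^sup>2 / (2 powr real_of_int k)\<^sup>2) * (ennreal ((cmod (f x))\<^sup>2) * indicator (- E k) x))"
  have "(\<integral>\<^sup>+x. ennpowr (?h x) p \<partial>lebesgue) \<le>
     (\<integral>\<^sup>+x. (\<integral>\<^sup>+k. ennreal (2 powr (real_of_int (k + 1) * p)) * indicator {k. ennreal (2 powr real_of_int k) < ?h x} k \<partial>count_space UNIV) \<partial>lebesgue)"
    by (intro nn_integral_mono ennpowr_le_dyadic_sum p)
  also have "\<dots> = (\<integral>\<^sup>+x. (\<integral>\<^sup>+k. ennreal (2 powr (real_of_int (k + 1) * p)) * indicator {x. ennreal (2 * 2 powr real_of_int k) < ?S x} x \<partial>count_space UNIV) \<partial>lebesgue)"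
  proof -
    have "ennreal (2 powr real_of_int k) < ?h x \<longleftrightarrow> ennreal (2 * 2 powr real_of_int k) < ?S x" for k x
    proof (cases "?S x")
      case (real s)
      have "ennreal (1 / 2) * ennreal s = ennreal (s / 2)" using real by (subst ennreal_mult[symmetric]) auto
      then show ?thesis unfolding real by (simp only:) (auto simp: ennreal_less_iff)
    next
      case top
      have "ennreal (1 / 2) * top = top" by (simp add: ennreal_mult_eq_top_iff)
      then show ?thesis unfolding top by (simp only:) simp
    qed
    then show ?thesis by (simp only: indicator_def mem_Collect_eq)
  qed
  also have "\<dots> = (\<integral>\<^sup>+k. (\<integral>\<^sup>+x. ennreal (2 powr (real_of_int (k + 1) * p)) * indicator {x. ennreal (2 * 2 powr real_of_int k) < ?S x} x \<partial>lebesgue) \<partial>count_space UNIV)"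
    by (rule nn_integral_count_space_nn_integral) (auto intro!: borel_measurable_times_ennreal borel_measurable_indicator sets_lebesgue_less)
  also have "\<dots> = (\<integral>\<^sup>+k. ennreal (2 powr (real_of_int (k + 1) * p)) * emeasure lebesgue {x. ennreal (2 * 2 powr real_of_int k) < ?S x} \<partial>count_space UNIV)"
    by (intro nn_integral_cong nn_integral_cmult_indicator sets_lebesgue_less) auto
  also have "\<dots> \<le> (\<integral>\<^sup>+k. ennreal (2 powr (real_of_int (k + 1) * p)) * (ennreal (C7 Cz) * emeasure lborel (E k) + ennreal (CS\<^sup>2 / (2 powr real_of_int k)\<^sup>2) * (\<integral>\<^sup>+z. ennreal ((cmod (f z))\<^sup>2) * indicator (- E k) z \<partial>lborel)) \<partial>count_space UNIV)"
    by (intro nn_integral_mono mult_left_mono dist) auto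
  also have "\<dots> = (\<integral>\<^sup>+k. (\<integral>\<^sup>+x. ?a k x \<partial>lebesgue) \<partial>count_space UNIV)"
  proof (rule nn_integral_cong)
    fix k :: int
    let ?c1 = "ennreal (C7 Cz)" and ?c2 = "ennreal (CS\<^sup>2 / (2 powr real_of_int k)\<^sup>2)"
    have "(\<integral>\<^sup>+x. ?a k x \<partial>lebesgue) = ennreal (2 powr (real_of_int (k + 1) * p)) * (\<integral>\<^sup>+x. ?c1 * indicator (E k) x + ?c2 * (ennreal ((cmod (f x))\<^sup>2) * indicator (- E k) x) \<partial>lebesgue)"
      by (rule nn_integral_cmult) measurable
    also have "(\<integral>\<^sup>+x. ?c1 * indicator (E k) x + ?c2 * (ennreal ((cmod (f x))\<^sup>2) * indicator (- E k) x) \<partial>lebesgue) =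
      (\<integral>\<^sup>+x. ?c1 * indicator (E k) x \<partial>lebesgue) + (\<integral>\<^sup>+x. ?c2 * (ennreal ((cmod (f x))\<^sup>2) * indicator (- E k) x) \<partial>lebesgue)"
      by (rule nn_integral_add) measurable
    also have "(\<integral>\<^sup>+x. ?c1 * indicator (E k) x \<partial>lebesgue) = ?c1 * emeasure lborel (E k)"
      by (subst nn_integral_cmult_indicator) (auto intro: Em)
    also have "(\<integral>\<^sup>+x. ?c2 * (ennreal ((cmod (f x))\<^sup>2) * indicator (- E k) x) \<partial>lebesgue) = ?c2 * (\<integral>\<^sup>+x. ennreal ((cmod (f x))\<^sup>2) * indicator (- E k) x \<partial>lborel)"
      by (subst nn_integral_cmult) (auto simp: nn_integral_completion)
    finally show "ennreal (2 powr (real_of_int (k + 1) * p)) * (?c1 * emeasure lborel (E k) + ?c2 * (\<integral>\<^sup>+z. ennreal ((cmod (f z))\<^sup>2) * indicator (- E k) z \<partial>lborel)) = (\<integral>\<^sup>+x. ?a k x \<partial>lebesgue)"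
      by simp
  qed
  also have "\<dots> = (\<integral>\<^sup>+x. (\<integral>\<^sup>+k. ?a k x \<partial>count_space UNIV) \<partial>lebesgue)"
    by (rule nn_integral_count_space_nn_integral[symmetric]) auto
  also have "\<dots> \<le> (\<integral>\<^sup>+x. ennreal (C9 p) * ennpowr (M x) p \<partial>lebesgue)"
  proof (rule nn_integral_mono_AE, use AEf in eventually_elim)
    fix x assume fx: "ennreal (cmod (f x)) \<le> ennreal C4 * M x"
    let ?s1 = "\<integral>\<^sup>+k. ennreal (2 powr (real_of_int k * p)) * indicator {k. ennreal (2 powr real_of_int k) < M x} k \<partial>count_space UNIV"
    let ?s2 = "\<integral>\<^sup>+k. ennreal (2 powr (- real_of_int k * (2 - p))) * indicator {k. M x \<le> ennreal (2 powr real_of_int k)} k \<partial>count_space UNIV"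
    let ?c1 = "ennreal (2 powr p * C7 Cz)" and ?c2 = "ennreal (2 powr p * CS\<^sup>2)" and ?F = "ennreal ((cmod (f x))\<^sup>2)"
    have "?a k x = ?c1 * (ennreal (2 powr (real_of_int k * p)) * indicator {k. ennreal (2 powr real_of_int k) < M x} k) +
      ?c2 * ?F * (ennreal (2 powr (- real_of_int k * (2 - p))) * indicator {k. M x \<le> ennreal (2 powr real_of_int k)} k)" for k
    proof (cases "x \<in> E k")
      case True
      have e: "2 powr (real_of_int (k + 1) * p) = 2 powr p * 2 powr (real_of_int k * p)"
        by (simp add: powr_add[symmetric] algebra_simps)
      have "?a k x = ennreal (2 powr (real_of_int (k + 1) * p)) * ennreal (C7 Cz)" using True by simp
      also have "\<dots> = ennreal (2 powr p * C7 Cz) * ennreal (2 powr (real_of_int k * p))"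
        unfolding e using C7 by (simp add: ennreal_mult mult_ac)
      finally show ?thesis using True by (simp add: E_def not_le[symmetric])
    next
      case False
      have e: "2 powr (real_of_int (k + 1) * p) * (CS\<^sup>2 / (2 powr real_of_int k)\<^sup>2) = 2 powr p * CS\<^sup>2 * 2 powr (- real_of_int k * (2 - p))"
      proof -
        have e1: "(2 powr real_of_int k)\<^sup>2 = 2 powr (2 * real_of_int k)" by (simp add: power2_eq_square powr_add[symmetric])
        have e2: "2 powr (real_of_int (k + 1) * p) / 2 powr (2 * real_of_int k) = 2 powr p * 2 powr (- real_of_int k * (2 - p))"
          by (simp add: powr_add[symmetric] powr_diff[symmetric] algebra_simps)
        have "2 powr (real_of_int (k + 1) * p) * (CS\<^sup>2 / (2 powr real_of_int k)\<^sup>2) = CS\<^sup>2 * (2 powr (real_of_int (k + 1) * p) / 2 powr (2 * real_of_int k))"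
          unfolding e1 by (simp only: times_divide_eq_right mult.commute)
        then show ?thesis unfolding e2 by (simp only: mult_ac)
      qed
      have "?a k x = ennreal (2 powr (real_of_int (k + 1) * p)) * (ennreal (CS\<^sup>2 / (2 powr real_of_int k)\<^sup>2) * ?F)"
        using False by simp
      also have "\<dots> = ennreal (2 powr (real_of_int (k + 1) * p) * (CS\<^sup>2 / (2 powr real_of_int k)\<^sup>2)) * ?F"
        by (subst mult.assoc[symmetric], subst ennreal_mult[symmetric]) auto
      also have "\<dots> = ?c2 * ?F * ennreal (2 powr (- real_of_int k * (2 - p)))"
        unfolding e by (subst ennreal_mult) (auto simp: mult_ac)
      finally show ?thesis using False by (simp add: E_def not_less)
    qed
    then have b0: "(\<integral>\<^sup>+k. ?a k x \<partial>count_space UNIV) = ?c1 * ?s1 + ?c2 * ?F * ?s2"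
      by (simp only: nn_integral_add nn_integral_cmult borel_measurable_count_space)
    have b1: "?c1 * ?s1 \<le> ?c1 * (ennreal Q1 * ennpowr (M x) p)"
      unfolding Q1_def by (intro mult_left_mono dyadic_sum_le_ennpowr p) auto
    have b2: "?c2 * ?F * ?s2 \<le> ?c2 * (ennreal (C4\<^sup>2 * Q2) * ennpowr (M x) p)"
    proof -
      have "?F * ?s2 \<le> ennreal (C4\<^sup>2 * Q2) * ennpowr (M x) p"
      proof (cases "M x")
        case top
        \<comment> \<open>No dyadic level reaches an infinite maximal function, so the tail sum is
          empty.\<close>
        then have "?s2 = 0" by (simp add: top_unique)
        then show ?thesis by simp
      next
        case (real m)
        show ?thesis
        proof (cases "m = 0")
          case True
          \<comment> \<open>Here the tail sum runs over all levels and diverges; the factor f x = 0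
            removes it.\<close>
          then have "f x = 0" using fx real by simp
          then show ?thesis by simp
        next
          case False
          then have m: "0 < m" using real by simp
          have "cmod (f x) \<le> C4 * m" using fx real C4 by (simp add: ennreal_mult[symmetric] ennreal_le_iff)
          then have "(cmod (f x))\<^sup>2 \<le> (C4 * m)\<^sup>2" by (intro power_mono) auto
          then have F: "?F \<le> ennreal ((C4 * m)\<^sup>2)" by (rule ennreal_leI)
          have s2: "?s2 \<le> ennreal Q2 * ennpowr (M x) (- (2 - p))"
            unfolding Q2_def using p real m by (intro dyadic_tail_sum_le_ennpowr) auto
          have "?F * ?s2 \<le> ennreal ((C4 * m)\<^sup>2) * (ennreal Q2 * ennpowr (M x) (- (2 - p)))"
            by (intro mult_mono F s2) auto
          also have "\<dots> = ennreal ((C4 * m)\<^sup>2 * (Q2 * m powr (- (2 - p))))"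
          proof -
            have "ennreal X * (ennreal Q2 * ennreal Z) = ennreal (X * (Q2 * Z))" if "0 \<le> X" "0 \<le> Z" for X Z
              using that Q by (simp add: ennreal_mult)
            then show ?thesis using real by simp
          qed
          also have "(C4 * m)\<^sup>2 * (Q2 * m powr (- (2 - p))) = C4\<^sup>2 * Q2 * m powr p"
          proof -
            have "m\<^sup>2 = m powr 2" using m by (simp add: powr_numeral)
            then have "m\<^sup>2 * m powr (- (2 - p)) = m powr p" by (simp only: powr_add[symmetric]) simp
            then have "C4\<^sup>2 * Q2 * (m\<^sup>2 * m powr (- (2 - p))) = C4\<^sup>2 * Q2 * m powr p" by simp
            then show ?thesis by (simp only: power_mult_distrib mult_ac)
          qed
          also have "ennreal (C4\<^sup>2 * Q2 * m powr p) = ennreal (C4\<^sup>2 * Q2) * ennpowr (M x) p"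
            using real Q by (subst ennreal_mult) auto
          finally show ?thesis .
        qed
      qed
      then show ?thesis by (subst mult.assoc) (rule mult_left_mono, auto)
    qed
    have b3: "?c1 * (ennreal Q1 * ennpowr (M x) p) + ?c2 * (ennreal (C4\<^sup>2 * Q2) * ennpowr (M x) p) = ennreal (C9 p) * ennpowr (M x) p"
    proof -
      have "ennreal (C9 p) = ?c1 * ennreal Q1 + ?c2 * ennreal (C4\<^sup>2 * Q2)"
      proof -
        have "C9 p = 2 powr p * C7 Cz * Q1 + 2 powr p * CS\<^sup>2 * (C4\<^sup>2 * Q2)" by (simp add: C9_def Q1_def Q2_def)
        then show ?thesis using Q C7 by (simp add: ennreal_mult)
      qed
      then show ?thesis by (simp only: distrib_right mult.assoc)
    qed
    show "(\<integral>\<^sup>+k. ?a k x \<partial>count_space UNIV) \<le> ennreal (C9 p) * ennpowr (M x) p"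
      unfolding b0 b3[symmetric] by (rule add_mono[OF b1 b2])
  qed
  also have "\<dots> = ennreal (C9 p) * (\<integral>\<^sup>+x. ennpowr (M x) p \<partial>lebesgue)" by (rule nn_integral_cmult) measurable
  finally have main: "(\<integral>\<^sup>+x. ennpowr (?h x) p \<partial>lebesgue) \<le> \<dots>" .
  have "ennpowr (?S x) p = ennreal (2 powr p) * ennpowr (?h x) p" for x
  proof -
    have "ennreal (2 powr p) * ennpowr (ennreal (1 / 2)) p = ennreal (2 powr p * (1 / 2) powr p)"
      by (subst ennpowr_ennreal, simp, subst ennreal_mult) auto
    also have "2 powr p * (1 / 2) powr p = 1" by (simp only: powr_mult[symmetric]) simp
    finally have "ennreal (2 powr p) * ennpowr (ennreal (1 / 2)) p = 1" by simp
    then show ?thesis unfolding ennpowr_mult[OF p(1)] mult.assoc[symmetric] by simp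
  qed
  then have "(\<integral>\<^sup>+x. ennpowr (?S x) p \<partial>lebesgue) = ennreal (2 powr p) * (\<integral>\<^sup>+x. ennpowr (?h x) p \<partial>lebesgue)"
    by (simp add: nn_integral_cmult)
  also have "\<dots> \<le> ennreal (2 powr p) * (ennreal (C9 p) * (\<integral>\<^sup>+x. ennpowr (M x) p \<partial>lebesgue))"
    by (intro mult_left_mono main) auto
  finally show ?thesis by (simp add: ennreal_mult' mult.assoc)
qed

text \<open>Nonnegativity of \<open>Ca\<close> is proved inside a locale; the zero function over the
  empty set is an instance from which it can be exported.\<close>

lemma C7_Cz_nonneg: "0 \<le> C7 Cz"
proof -
  have "cz_function {} (\<lambda>_. 0) 1 C3 \<delta> K"
    by unfold_locales (use delta K_pos C3_nonneg in auto)
  then have "0 \<le> Cz" unfolding Cz_def by (rule cz_function.Ca_nonneg)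
  then show ?thesis unfolding C7_def using CD_nonneg C6_nonneg by (intro add_nonneg_nonneg mult_nonneg_nonneg) auto
qed

text \<open>The maximal theorem with exponent p / r > 1, applied to N^r, leads back from M to N;
  this is why r is strictly below p.\<close>

lemma square_fun_le_maximal:
  assumes p: "r < p" "p \<le> 1"
  shows "\<exists>C>0. \<forall>f N. f \<in> borel_measurable borel \<longrightarrow> integrable lborel (\<lambda>x. (cmod (f x))\<^sup>2) \<longrightarrow>
    N \<in> borel_measurable lebesgue \<longrightarrow> (\<forall>t>0. \<forall>x y. norm (x - y) \<le> t \<longrightarrow> ennreal (cmod (ut f t y)) \<le> N x) \<longrightarrow>
    (\<integral>\<^sup>+x. ennpowr (square_fun lam f x) p \<partial>lebesgue) \<le> ennreal C * (\<integral>\<^sup>+x. ennpowr (N x) p \<partial>lebesgue)"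
proof -
  have p0: "0 < p" "p < 2" using p r_pos by auto
  have "1 < p / r" using p r_pos by simp
  from hl_strong[OF this] obtain Ch where Ch: "0 < Ch"
    "\<And>g::'a \<Rightarrow> ennreal. g \<in> borel_measurable lebesgue \<Longrightarrow> (\<integral>\<^sup>+x. ennpowr (hl g x) (p / r) \<partial>lebesgue) \<le> ennreal Ch * (\<integral>\<^sup>+x. ennpowr (g x) (p / r) \<partial>lebesgue)"
    by blast
  have q1: "2 powr (- p) < (1::real)" "2 powr (- (2 - p)) < (1::real)" using powr_2_lt_1[of p] powr_2_lt_1[of "2 - p"] p0 by auto
  have C9: "0 \<le> C9 p" unfolding C9_def using q1 C7_Cz_nonneg by (intro add_nonneg_nonneg divide_nonneg_nonneg mult_nonneg_nonneg) auto
  \<comment> \<open>The summand 1 keeps C positive, so that the bound is trivial when N^p has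
    infinite integral.\<close>
  define C where "C = 2 powr p * C9 p * Ch + 1"
  have C: "0 < C" using C9 Ch by (auto simp: C_def intro!: add_nonneg_pos mult_nonneg_nonneg)
  have key: "(\<integral>\<^sup>+x. ennpowr (square_fun lam f x) p \<partial>lebesgue) \<le> ennreal C * (\<integral>\<^sup>+x. ennpowr (N x) p \<partial>lebesgue)"
    if f: "f \<in> borel_measurable borel" "integrable lborel (\<lambda>x. (cmod (f x))\<^sup>2)"
      and N [measurable]: "N \<in> borel_measurable lebesgue"
      and nt: "\<And>t x y. 0 < t \<Longrightarrow> norm (x - y) \<le> t \<Longrightarrow> ennreal (cmod (ut f t y)) \<le> N x" for f N
  proof (cases "(\<integral>\<^sup>+x. ennpowr (N x) p \<partial>lebesgue) = top")
    case True
    then show ?thesis using C by (simp add: ennreal_mult_top)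
  next
    case False
    define M where "M = (\<lambda>x. ennpowr (hl (\<lambda>y. ennpowr (N y) r) x) (1 / r))"
    have "(\<integral>\<^sup>+x. ennpowr (M x) p \<partial>lebesgue) = (\<integral>\<^sup>+x. ennpowr (hl (\<lambda>y. ennpowr (N y) r) x) (p / r) \<partial>lebesgue)"
      using r_pos p0 by (simp add: M_def ennpowr_ennpowr)
    also have "\<dots> \<le> ennreal Ch * (\<integral>\<^sup>+x. ennpowr (ennpowr (N x) r) (p / r) \<partial>lebesgue)"
      by (rule Ch(2)) measurable
    also have "(\<integral>\<^sup>+x. ennpowr (ennpowr (N x) r) (p / r) \<partial>lebesgue) = (\<integral>\<^sup>+x. ennpowr (N x) p \<partial>lebesgue)"
      using r_pos p0 by (simp add: ennpowr_ennpowr)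
    finally have MN: "(\<integral>\<^sup>+x. ennpowr (M x) p \<partial>lebesgue) \<le> ennreal Ch * (\<integral>\<^sup>+x. ennpowr (N x) p \<partial>lebesgue)" .
    also have "\<dots> < \<infinity>" using False by (simp add: ennreal_mult_less_top less_top)
    finally have fin: "(\<integral>\<^sup>+x. ennpowr (M x) p \<partial>lebesgue) < \<infinity>" .
    have "(\<integral>\<^sup>+x. ennpowr (square_fun lam f x) p \<partial>lebesgue) \<le> ennreal (2 powr p * C9 p) * (\<integral>\<^sup>+x. ennpowr (M x) p \<partial>lebesgue)"
      by (rule square_fun_le_maximal_aux[OF p0 f N nt M_def fin C7_Cz_nonneg])
    also have "\<dots> \<le> ennreal (2 powr p * C9 p) * (ennreal Ch * (\<integral>\<^sup>+x. ennpowr (N x) p \<partial>lebesgue))"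
      by (intro mult_left_mono MN) auto
    also have "\<dots> = ennreal (2 powr p * C9 p * Ch) * (\<integral>\<^sup>+x. ennpowr (N x) p \<partial>lebesgue)"
      using C9 Ch by (simp add: ennreal_mult mult.assoc)
    also have "\<dots> \<le> ennreal C * (\<integral>\<^sup>+x. ennpowr (N x) p \<partial>lebesgue)"
      by (intro mult_right_mono ennreal_leI) (auto simp: C_def)
    finally show ?thesis .
  qed
  show ?thesis
  proof (intro exI[of _ C] conjI C allI impI)
    fix f :: "'a \<Rightarrow> complex" and N :: "'a \<Rightarrow> ennreal"
    assume "f \<in> borel_measurable borel" "integrable lborel (\<lambda>x. (cmod (f x))\<^sup>2)" "N \<in> borel_measurable lebesgue"
      and nt: "\<forall>t>0. \<forall>x y. norm (x - y) \<le> t \<longrightarrow> ennreal (cmod (ut f t y)) \<le> N x"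
    then show "(\<integral>\<^sup>+x. ennpowr (square_fun lam f x) p \<partial>lebesgue) \<le> ennreal C * (\<integral>\<^sup>+x. ennpowr (N x) p \<partial>lebesgue)"
      by (intro key) simp_all
  qed
qed

end

section \<open>Schwartz functions and the nontangential maximal function\<close>

text \<open>Members of \<open>Lp_space\<close> are Lebesgue measurable, whereas Fubini and affine
  substitutions are carried out on \<open>lborel\<close>. Changing f on a null set alters neither
  its square function nor its maximal function.\<close>

lemma complex_borel_representative:
  fixes f :: "'a::euclidean_space \<Rightarrow> complex"
  assumes f [measurable]: "f \<in> borel_measurable lebesgue"
  obtains f' where "f' \<in> borel_measurable borel" "AE x in lebesgue. f x = f' x"
proof -
  have "(\<lambda>x. Re (f x)) \<in> borel_measurable lebesgue" "(\<lambda>x. Im (f x)) \<in> borel_measurable lebesgue" by measurable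
  then obtain a b where ab: "a \<in> borel_measurable lborel" "AE x in lborel. Re (f x) = a x"
    "b \<in> borel_measurable lborel" "AE x in lborel. Im (f x) = b x"
    using completion_ex_borel_measurable_real by metis
  have [measurable]: "a \<in> borel_measurable borel" "b \<in> borel_measurable borel" using ab by simp_all
  have "AE x in lebesgue. f x = Complex (a x) (b x)"
    using AE_completion[OF ab(2)] AE_completion[OF ab(4)] by eventually_elim (simp add: complex_eq_iff)
  moreover have "(\<lambda>x. Complex (a x) (b x)) \<in> borel_measurable borel"
    unfolding Complex_eq by measurable
  ultimately show ?thesis by (rule that[rotated])
qed

text \<open>An uncountable union of closed balls may fail to be Borel. But every point of the union
  lies in arbitrarily small closed balls contained in it, so by Vitali's theorem countably many of
  these cover all but a null set.\<close>

lemma Union_cball_lebesgue: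
  fixes a :: "'i \<Rightarrow> 'a::euclidean_space"
  assumes r: "\<And>i. i \<in> I \<Longrightarrow> 0 < r i"
  shows "(\<Union>i\<in>I. cball (a i) (r i)) \<in> sets lebesgue"
proof -
  define S where "S = (\<Union>i\<in>I. cball (a i) (r i))"
  define K where "K = {B :: 'a \<times> real. 0 < snd B \<and> cball (fst B) (snd B) \<subseteq> S}"
  obtain C where C: "countable C" "C \<subseteq> K" "negligible (S - (\<Union>i\<in>C. cball (fst i) (snd i)))"
  proof (rule Vitali_covering_theorem_cballs[where a=fst and r=snd and K=K and S=S])
    fix x and d :: real assume x: "x \<in> S" and d: "0 < d"
    then obtain i where i: "i \<in> I" "x \<in> cball (a i) (r i)" by (auto simp: S_def)
    have ri: "0 < r i" using r i by blast
    define s where "s = min (r i) (d / 2)"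
    \<comment> \<open>Moving from x towards the centre by the fraction s / r i gives the centre of a
      ball of radius s that contains x and stays inside the given ball, even for x on its
      boundary.\<close>
    define b where "b = x + (s / r i) *\<^sub>R (a i - x)"
    have s: "0 < s" "s < d" "s \<le> r i" using ri d by (auto simp: s_def)
    have nx: "norm (a i - x) \<le> r i" using i by (simp add: dist_norm)
    have "dist b x = s / r i * norm (a i - x)" using s ri by (simp add: b_def dist_norm)
    also have "\<dots> \<le> s / r i * r i" using s ri nx by (intro mult_left_mono) auto
    finally have bx: "dist b x \<le> s" using ri by simp
    have "a i - b = (1 - s / r i) *\<^sub>R (a i - x)" by (simp add: b_def algebra_simps)
    then have "dist (a i) b = (1 - s / r i) * norm (a i - x)" using s ri by (simp add: dist_norm)
    also have "\<dots> \<le> (1 - s / r i) * r i" using s ri nx by (intro mult_left_mono) auto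
    also have "\<dots> = r i - s" using ri by (simp add: algebra_simps)
    finally have "cball b s \<subseteq> cball (a i) (r i)" by (auto intro: order_trans[OF dist_triangle])
       (metis add.commute add_mono_thms_linordered_semiring(1) diff_add_cancel dist_triangle order_trans)
    then have "(b, s) \<in> K" using s i by (auto simp: K_def S_def)
    then show "\<exists>i. i \<in> K \<and> x \<in> cball (fst i) (snd i) \<and> snd i < d"
      using bx s by (intro exI[of _ "(b, s)"]) auto
  qed (auto simp: K_def)
  have "S = (\<Union>i\<in>C. cball (fst i) (snd i)) \<union> (S - (\<Union>i\<in>C. cball (fst i) (snd i)))"
    using C(2) by (auto simp: K_def)
  moreover have "(\<Union>i\<in>C. cball (fst i) (snd i)) \<in> sets lebesgue"
    using C(1) by (intro sets.countable_UN') auto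
  moreover have "S - (\<Union>i\<in>C. cball (fst i) (snd i)) \<in> sets lebesgue"
    using C(3) by (rule negligible_imp_sets)
  ultimately show ?thesis unfolding S_def[symmetric] by (metis sets.Un)
qed

text \<open>The cones are closed, so a superlevel set is the union of the closed balls of radius t
  about those y at which the convolution at scale t exceeds the level.\<close>

lemma nontangential_max_measurable [measurable]:
  "nontangential_max \<phi> u \<in> borel_measurable lebesgue"
proof (rule borel_measurableI_greater)
  fix c
  let ?F = "\<lambda>(t, y). ennreal (cmod (dist_conv (dilate t \<phi>) u y))"
  have "{x. c < nontangential_max \<phi> u x} = (\<Union>i\<in>{i. 0 < fst i \<and> c < ?F i}. cball (snd i) (fst i))"
    by (auto simp: nontangential_max_def less_SUP_iff dist_norm norm_minus_commute) blast+
  also have "\<dots> \<in> sets lebesgue" by (rule Union_cball_lebesgue) auto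
  finally show "{x \<in> space lebesgue. c < nontangential_max \<phi> u x} \<in> sets lebesgue" by simp
qed

lemma nontangential_max_ge:
  assumes "0 < t" "norm (x - y) \<le> t"
  shows "ennreal (cmod (dist_conv (dilate t \<phi>) u y)) \<le> nontangential_max \<phi> u x"
  unfolding nontangential_max_def using assms by (intro SUP_upper2[of t] SUP_upper2[of y]) auto

section \<open>Schwartz functions and convolution with their dilates\<close>

lemma schwartz_continuous: "schwartz \<phi> \<Longrightarrow> continuous_on UNIV \<phi>"
  unfolding schwartz_def
  by (drule spec[of _ "[]"]) (auto intro: differentiable_imp_continuous_within simp: continuous_on_eq_continuous_within)

lemma schwartz_decay:
  fixes \<phi> :: "'a::euclidean_space \<Rightarrow> complex"
  assumes "schwartz \<phi>"
  obtains B where "0 \<le> B" "\<And>x. cmod (\<phi> x) \<le> B * (1 + norm x) powr (- real m)"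
proof -
  have "bdd_above (range (\<lambda>x. (1 + norm x) ^ m * cmod (\<phi> x)))"
    using assms unfolding schwartz_def by (auto dest!: spec[of _ "[]"])
  then obtain B where B: "\<And>x. (1 + norm x) ^ m * cmod (\<phi> x) \<le> B"
    by (auto simp: bdd_above_def)
  have "0 \<le> B" by (rule order_trans[OF _ B[of 0]]) simp
  moreover have "cmod (\<phi> x) \<le> B * (1 + norm x) powr (- real m)" for x
  proof -
    have q: "0 < 1 + norm x" by (intro add_pos_nonneg) auto
    show ?thesis using B[of x] q by (simp add: powr_minus powr_realpow field_simps)
  qed
  ultimately show ?thesis by (rule that)
qed

lemma schwartz_sq_integrable_dilate:
  fixes \<phi> :: "'a::euclidean_space \<Rightarrow> complex"
  assumes \<phi>: "schwartz \<phi>" and t: "0 < t"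
  shows "integrable lborel (\<lambda>z. (cmod (dilate t \<phi> (y - z)))\<^sup>2)"
proof -
  obtain B where B: "0 \<le> B" "\<And>x. cmod (\<phi> x) \<le> B * (1 + norm x) powr (- real (DIM('a) + 1))"
    using schwartz_decay[OF \<phi>] by blast
  have [measurable]: "\<phi> \<in> borel_measurable borel" by (intro borel_measurable_continuous_onI schwartz_continuous \<phi>)
  have "cmod (dilate t \<phi> (y - z)) \<le> (1 / t ^ DIM('a) * B) * wt (real (DIM('a) + 1)) y t z" for z
  proof -
    have "cmod (dilate t \<phi> (y - z)) \<le> 1 / t ^ DIM('a) * (B * (1 + norm ((1 / t) *\<^sub>R (y - z))) powr (- real (DIM('a) + 1)))"
      using t mult_left_mono[OF B(2)[of "(1 / t) *\<^sub>R (y - z)"], of "1 / t ^ DIM('a)"] by (simp add: dilate_def)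
    also have "norm ((1 / t) *\<^sub>R (y - z)) = norm (z - y) / t" using t by (simp add: norm_minus_commute)
    finally show ?thesis by (simp add: wt_def)
  qed
  from bounded_by_wt_sq_integrable[OF _ t _ this] show ?thesis by (simp add: dilate_def)
qed

context
  fixes \<phi> :: "'a::euclidean_space \<Rightarrow> complex"
  assumes \<phi>: "schwartz \<phi>"
begin

lemma phi_borel [measurable]: "\<phi> \<in> borel_measurable borel"
  by (intro borel_measurable_continuous_onI schwartz_continuous \<phi>)

lemma dilate_borel [measurable]: "dilate t \<phi> \<in> borel_measurable borel"
  unfolding dilate_def by measurable

lemma dist_conv_cong_AE:
  assumes "f \<in> borel_measurable lebesgue" "g \<in> borel_measurable lebesgue" "AE x in lebesgue. f x = g x"
  shows "dist_conv (dilate t \<phi>) (dist_of f) y = dist_conv (dilate t \<phi>) (dist_of g) y"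
proof -
  have [measurable]: "(\<lambda>z. dilate t \<phi> (y - z)) \<in> borel_measurable lebesgue"
    by (intro measurable_completion) measurable
  show ?thesis
    unfolding dist_conv_def dist_of_def using assms by (intro integral_cong_AE) auto
qed

lemma nontangential_max_cong_AE:
  assumes "f \<in> borel_measurable lebesgue" "g \<in> borel_measurable lebesgue" "AE x in lebesgue. f x = g x"
  shows "nontangential_max \<phi> (dist_of f) = nontangential_max \<phi> (dist_of g)"
  unfolding nontangential_max_def dist_conv_cong_AE[OF assms] by simp

lemma dist_conv_borel:
  assumes [measurable]: "f \<in> borel_measurable borel"
  shows "dist_conv (dilate t \<phi>) (dist_of f) y = (LINT z|lborel. f z * dilate t \<phi> (y - z))"
  unfolding dist_conv_def dist_of_def by (intro integral_completion) measurable

lemma dist_conv_integrable: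
  assumes "f \<in> borel_measurable borel" "integrable lborel (\<lambda>x. (cmod (f x))\<^sup>2)" "0 < t"
  shows "integrable lborel (\<lambda>z. f z * dilate t \<phi> (y - z))"
  using assms schwartz_sq_integrable_dilate[OF \<phi>, of t y] by (intro sq_integrable_mult(1)) auto

text \<open>\<open>dist_of\<close> takes the value 0 on a test function whose product with f is not
  integrable, so it need not be additive in f on all functions. It is additive on the translated
  dilates that enter the maximal function, since these are square integrable.\<close>

lemma nontangential_max_diff:
  assumes f: "f \<in> borel_measurable borel" "integrable lborel (\<lambda>x. (cmod (f x))\<^sup>2)"
    and g: "g \<in> borel_measurable borel" "integrable lborel (\<lambda>x. (cmod (g x))\<^sup>2)"
  shows "nontangential_max \<phi> (dist_of (\<lambda>x. f x - g x)) = nontangential_max \<phi> (\<lambda>\<psi>. dist_of f \<psi> - dist_of g \<psi>)"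
proof -
  have "dist_conv (dilate t \<phi>) (dist_of (\<lambda>x. f x - g x)) y = dist_conv (dilate t \<phi>) (\<lambda>\<psi>. dist_of f \<psi> - dist_of g \<psi>) y"
    if "0 < t" for t y
  proof -
    have "dist_conv (dilate t \<phi>) (dist_of (\<lambda>x. f x - g x)) y = (LINT z|lborel. f z * dilate t \<phi> (y - z) - g z * dilate t \<phi> (y - z))"
      using f g by (subst dist_conv_borel) (auto simp: left_diff_distrib)
    also have "\<dots> = dist_conv (dilate t \<phi>) (dist_of f) y - dist_conv (dilate t \<phi>) (dist_of g) y"
      using f g that by (simp add: dist_conv_borel dist_conv_integrable)
    finally show ?thesis by (simp add: dist_conv_def)
  qed
  then show ?thesis
    unfolding nontangential_max_def by (intro ext SUP_cong) (auto cong: SUP_cong)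
qed

end

lemma Lp_space_2_representative:
  fixes f :: "'a::euclidean_space \<Rightarrow> complex"
  assumes "f \<in> Lp_space 2"
  obtains f' where "f' \<in> borel_measurable borel" "AE x in lebesgue. f x = f' x"
    "integrable lborel (\<lambda>x. (cmod (f' x))\<^sup>2)" "f \<in> borel_measurable lebesgue" "f' \<in> borel_measurable lebesgue"
proof -
  have f: "f \<in> borel_measurable lebesgue" "Lp_norm 2 f < \<infinity>" using assms by (auto simp: Lp_space_def)
  obtain f' where f': "f' \<in> borel_measurable borel" "AE x in lebesgue. f x = f' x"
    using complex_borel_representative[OF f(1)] .
  have f'l: "f' \<in> borel_measurable lebesgue" using f' by (simp add: measurable_completion)
  have "Lp_norm 2 f' = Lp_norm 2 f"
    unfolding Lp_norm_def lp_norm_def using f'(2)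
    by (intro arg_cong[where f="\<lambda>a. ennpowr a _"] nn_integral_cong_AE) auto
  then have "f' \<in> Lp_space 2" using f f'l by (simp add: Lp_space_def)
  then have "integrable lborel (\<lambda>x. (cmod (f' x))\<^sup>2)" using Lp_space_2_iff[OF f'(1)] by simp
  with f' f'l f show ?thesis by (intro that) auto
qed

section \<open>The square function is controlled by the Hardy norm\<close>

context lpso_op
begin

lemma square_fun_cong_AE:
  assumes "f \<in> borel_measurable lebesgue" "g \<in> borel_measurable lebesgue" "AE x in lebesgue. f x = g x"
  shows "square_fun lam f = square_fun lam g"
proof -
  have "Lambda lam k f x = Lambda lam k g x" for k x
  proof -
    have [measurable]: "lam k x \<in> borel_measurable lebesgue" by (simp add: measurable_completion)
    show ?thesis unfolding Lambda_def using assms by (intro integral_cong_AE) auto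
  qed
  then show ?thesis unfolding square_fun_def by simp
qed

text \<open>The parameters are fixed here: r is the midpoint of n / (n + \<delta>) and p, K = n +
  \<delta>, and \<open>\<phi>0\<close> is \<phi> divided by its integral c, so that the maximal
  function is rescaled by 1 / |c|.\<close>

theorem square_fun_hardy_bound:
  fixes \<phi> :: "'a \<Rightarrow> complex"
  assumes \<phi>: "schwartz \<phi>" and nz: "(LINT x|lebesgue. \<phi> x) \<noteq> 0"
    and p: "real DIM('a) / (real DIM('a) + \<delta>) < p" "p \<le> 1"
  shows "\<exists>C>0. \<forall>f\<in>Lp_space 2. (\<integral>\<^sup>+x. ennpowr (square_fun lam f x) p \<partial>lebesgue) \<le>
    ennreal C * (\<integral>\<^sup>+x. ennpowr (nontangential_max \<phi> (dist_of f) x) p \<partial>lebesgue)"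
proof -
  let ?n = "real DIM('a)"
  define r where "r = (?n / (?n + \<delta>) + p) / 2"
  define K where "K = ?n + \<delta>"
  define c where "c = (LINT x|lborel. \<phi> x)"
  define \<phi>0 where "\<phi>0 = (\<lambda>x. \<phi> x / c)"
  have [measurable]: "\<phi> \<in> borel_measurable borel" by (rule phi_borel[OF \<phi>])
  have c: "c \<noteq> 0" using nz by (simp add: c_def integral_completion)
  have nd: "0 < ?n + \<delta>" using delta0 by simp
  have r: "?n / (?n + \<delta>) < r" "r < p" "r \<le> 1"
  proof -
    have "a < (a + p) / 2" "(a + p) / 2 < p" "(a + p) / 2 \<le> 1" if "a < p" for a using that p(2) by auto
    from this[OF p(1)] show "?n / (?n + \<delta>) < r" "r < p" "r \<le> 1" by (simp_all only: r_def)
  qed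
  have rp: "r < p" using r by simp
  have r0: "0 < r" using r(1) nd by (auto intro: le_less_trans[of 0 "?n / (?n + \<delta>)"])
  \<comment> \<open>Enough decay of \<phi> to leave an integrable weight of exponent n + 1 after the
    moment of order K + 1 is taken.\<close>
  obtain m :: nat where m: "K + 1 + (?n + 1) \<le> real m" using real_arch_simple by blast
  obtain B where B: "0 \<le> B" "\<And>x. cmod (\<phi> x) \<le> B * (1 + norm x) powr (- real m)"
    using schwartz_decay[OF \<phi>, of m] by blast
  interpret lpso_hardy \<phi>0 K \<delta> r lam CL0 CS
  proof unfold_locales
    show "\<phi>0 \<in> borel_measurable borel" unfolding \<phi>0_def by measurable
    show "integrable lborel (\<lambda>w. cmod (\<phi>0 w) * (1 + norm w) powr (K + 1))"
    proof (rule Bochner_Integration.integrable_bound)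
      show "integrable lborel (\<lambda>w::'a. B / cmod c * wt (?n + 1) 0 1 w)"
        using integrable_wt[of 1 "?n + 1" "0::'a"] by simp
      have "cmod (\<phi>0 w) * (1 + norm w) powr (K + 1) \<le> B / cmod c * wt (?n + 1) 0 1 w" for w
      proof -
        have "cmod (\<phi>0 w) * (1 + norm w) powr (K + 1) \<le> (B * (1 + norm w) powr (- real m)) / cmod c * (1 + norm w) powr (K + 1)"
          unfolding \<phi>0_def norm_divide by (intro mult_right_mono divide_right_mono B) auto
        also have "\<dots> = B / cmod c * (1 + norm w) powr (- real m + (K + 1))"
          by (simp only: powr_add) simp
        also have "\<dots> \<le> B / cmod c * (1 + norm w) powr (- (?n + 1))"
          using m B by (intro mult_left_mono powr_mono) auto
        finally show ?thesis by (simp add: wt_def)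
      qed
      then show "AE w in lborel. norm (cmod (\<phi>0 w) * (1 + norm w) powr (K + 1)) \<le> norm (B / cmod c * wt (?n + 1) 0 1 w)"
        using B by (intro AE_I2) (simp add: wt_nonneg abs_mult)
    qed (simp add: \<phi>0_def)
    show "(LINT w|lborel. \<phi>0 w) = 1" using c by (simp add: \<phi>0_def c_def[symmetric])
    show "?n < r * (?n + \<delta>)" using r(1) nd by (simp add: field_simps)
  qed (use delta0 r in \<open>auto simp: K_def\<close>)
  obtain C where C: "0 < C" and key: "\<And>f N. f \<in> borel_measurable borel \<Longrightarrow> integrable lborel (\<lambda>x. (cmod (f x))\<^sup>2) \<Longrightarrow>
    N \<in> borel_measurable lebesgue \<Longrightarrow> (\<forall>t>0. \<forall>x y. norm (x - y) \<le> t \<longrightarrow> ennreal (cmod (ut f t y)) \<le> N x) \<Longrightarrow>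
    (\<integral>\<^sup>+x. ennpowr (square_fun lam f x) p \<partial>lebesgue) \<le> ennreal C * (\<integral>\<^sup>+x. ennpowr (N x) p \<partial>lebesgue)"
    using square_fun_le_maximal[OF rp p(2)] by metis
  define C' where "C' = C * (1 / cmod c) powr p"
  have "(\<integral>\<^sup>+x. ennpowr (square_fun lam f x) p \<partial>lebesgue) \<le>
    ennreal C' * (\<integral>\<^sup>+x. ennpowr (nontangential_max \<phi> (dist_of f) x) p \<partial>lebesgue)" if f: "f \<in> Lp_space 2" for f
  proof -
    obtain f' where f': "f' \<in> borel_measurable borel" "AE x in lebesgue. f x = f' x"
      "integrable lborel (\<lambda>x. (cmod (f' x))\<^sup>2)" "f \<in> borel_measurable lebesgue" "f' \<in> borel_measurable lebesgue"
      using Lp_space_2_representative[OF f] .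
    note [measurable] = f'(1)
    have eqs: "square_fun lam f = square_fun lam f'" "nontangential_max \<phi> (dist_of f) = nontangential_max \<phi> (dist_of f')"
      using square_fun_cong_AE[OF f'(4,5,2)] nontangential_max_cong_AE[OF \<phi> f'(4,5,2)] by auto
    define N where "N = (\<lambda>x. ennreal (1 / cmod c) * nontangential_max \<phi> (dist_of f') x)"
    have "(\<integral>\<^sup>+x. ennpowr (square_fun lam f' x) p \<partial>lebesgue) \<le> ennreal C * (\<integral>\<^sup>+x. ennpowr (N x) p \<partial>lebesgue)"
    proof (rule key[OF f'(1,3)])
      show "N \<in> borel_measurable lebesgue" unfolding N_def by measurable
      show "\<forall>t>0. \<forall>x y. norm (x - y) \<le> t \<longrightarrow> ennreal (cmod (ut f' t y)) \<le> N x"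
      proof (intro allI impI)
        fix t :: real and x y :: 'a assume t: "0 < t" and xy: "norm (x - y) \<le> t"
        let ?g = "\<lambda>z. f' z * dilate t \<phi> (y - z)"
        have gm: "?g \<in> borel_measurable borel" using dilate_borel[OF \<phi>, of t] by measurable
        \<comment> \<open>Substitution z = y - t w; the Jacobian t^n cancels the normalisation of
          the dilate.\<close>
        have "dist_conv (dilate t \<phi>) (dist_of f') y = \<bar>- t\<bar> ^ DIM('a) *\<^sub>R (LINT w|lborel. ?g (y + (- t) *\<^sub>R w))"
          using t lborel_affine_integral(2)[OF _ gm, of "- t" y] by (simp add: dist_conv_borel[OF \<phi>])
        also have "\<dots> = (LINT w|lborel. \<bar>- t\<bar> ^ DIM('a) *\<^sub>R ?g (y + (- t) *\<^sub>R w))" by simp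
        also have "\<dots> = (LINT w|lborel. c * (f' (y - t *\<^sub>R w) * \<phi>0 w))"
          using t c by (intro Bochner_Integration.integral_cong) (auto simp: dilate_def \<phi>0_def scaleR_conv_of_real)
        also have "\<dots> = c * ut f' t y" unfolding ut_def by simp
        finally have e: "ut f' t y = dist_conv (dilate t \<phi>) (dist_of f') y / c" using c by simp
        have "ennreal (cmod (ut f' t y)) = ennreal (1 / cmod c) * ennreal (cmod (dist_conv (dilate t \<phi>) (dist_of f') y))"
          unfolding e by (simp add: norm_divide ennreal_mult'[symmetric])
        also have "\<dots> \<le> N x" unfolding N_def by (intro mult_left_mono nontangential_max_ge t xy) auto
        finally show "ennreal (cmod (ut f' t y)) \<le> N x" .
      qed
    qed
    also have "(\<integral>\<^sup>+x. ennpowr (N x) p \<partial>lebesgue) = (\<integral>\<^sup>+x. ennreal ((1 / cmod c) powr p) * ennpowr (nontangential_max \<phi> (dist_of f') x) p \<partial>lebesgue)"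
      using r0 rp unfolding N_def by (subst ennpowr_mult) auto
    also have "\<dots> = ennreal ((1 / cmod c) powr p) * (\<integral>\<^sup>+x. ennpowr (nontangential_max \<phi> (dist_of f') x) p \<partial>lebesgue)"
      by (rule nn_integral_cmult) measurable
    finally show ?thesis unfolding eqs C'_def using C by (simp add: ennreal_mult mult.assoc)
  qed
  moreover have "0 < C'" using C c by (simp add: C'_def)
  ultimately show ?thesis by blast
qed

end

section \<open>Extension from subsets of pseudometric spaces\<close>

lemma finite_has_max_wrt:
  assumes "well_order_on D r" "finite A" "A \<noteq> {}" "A \<subseteq> D"
  shows "\<exists>m\<in>A. \<forall>t\<in>A. (t, m) \<in> r"
  using assms(2-4)
proof (induction A rule: finite_ne_induct)
  case (singleton x)
  then show ?case using assms(1) by (auto simp: well_order_on_def linear_order_on_def partial_order_on_def preorder_on_def refl_on_def)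
next
  case (insert x F)
  then obtain m where m: "m \<in> F" "\<forall>t\<in>F. (t, m) \<in> r" by auto
  have lin: "refl_on D r" "trans r" "total_on D r"
    using assms(1) by (auto simp: well_order_on_def linear_order_on_def partial_order_on_def preorder_on_def)
  have D: "x \<in> D" "m \<in> D" using insert m by auto
  then have "(x, m) \<in> r \<or> (m, x) \<in> r" using lin by (cases "x = m") (auto simp: total_on_def refl_on_def)
  then show ?case
  proof
    assume "(x, m) \<in> r" with m show ?thesis by auto
  next
    assume mx: "(m, x) \<in> r"
    have "(t, x) \<in> r" if "t \<in> F" for t using m(2) that mx lin(2) by (meson transD)
    moreover have "(x, x) \<in> r" using lin(1) D by (auto simp: refl_on_def)
    ultimately show ?thesis by auto
  qed
qed

lemma nn_integral_count_space_le:
  fixes f :: "'a \<Rightarrow> real"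
  assumes "\<And>x. 0 \<le> f x" and le: "\<And>F. finite F \<Longrightarrow> F \<subseteq> A \<Longrightarrow> sum f F \<le> B"
  shows "(\<integral>\<^sup>+x. ennreal (f x) \<partial>count_space A) \<le> ennreal B"
proof -
  have s: "Infinite_Set_Sum.abs_summable_on f A" by (rule abs_summable_finite_sumsI[of A f B]) (use assms in auto)
  have "(\<integral>\<^sup>+x. ennreal (f x) \<partial>count_space A) = ennreal (infsetsum f A)"
    using s assms(1) unfolding infsetsum_def abs_summable_on_def by (intro nn_integral_eq_integral) auto
  also have "\<dots> = (SUP F\<in>{F. finite F \<and> F \<subseteq> A}. ennreal (sum f F))"
    by (rule infsetsum_nonneg_is_SUPREMUM_ennreal[OF s assms(1)])
  also have "\<dots> \<le> ennreal B" by (intro SUP_least ennreal_leI le) auto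
  finally show ?thesis .
qed

text \<open>X will be the Hardy space and D the functionals induced by L^2 functions. Only a
  pseudometric is available, as functionals that agree on the relevant test functions have distance
  0.\<close>

locale pseudometric_with_subset =
  fixes d :: "'u \<Rightarrow> 'u \<Rightarrow> real" and X D :: "'u set"
  assumes d_nonneg: "u \<in> X \<Longrightarrow> v \<in> X \<Longrightarrow> 0 \<le> d u v"
    and d_self: "u \<in> X \<Longrightarrow> d u u = 0"
    and d_sym: "u \<in> X \<Longrightarrow> v \<in> X \<Longrightarrow> d u v = d v u"
    and d_tri: "u \<in> X \<Longrightarrow> v \<in> X \<Longrightarrow> w \<in> X \<Longrightarrow> d u w \<le> d u v + d v w"
    and DX: "D \<subseteq> X" and Dne: "D \<noteq> {}"
begin

definition "wo = (SOME r. well_order_on D r)"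
definition "dD u = (INF s\<in>D. d u s)"
definition "preds s = {t \<in> D. (t, s) \<in> wo \<and> t \<noteq> s}"
text \<open>Vanishes unless s is within twice the distance from u to D, so that only points of D
  comparably close to u count. Its supremum over s is \<open>dD u\<close>.\<close>

definition "bump s u = max 0 (2 * dD u - d u s)"
text \<open>0 is inserted so that the supremum over an empty set of predecessors is 0.\<close>

definition "bsup s u = Sup (insert 0 ((\<lambda>t. bump t u) ` preds s))"
definition "inc s u = max 0 (bump s u - bsup s u)"

lemma wo: "well_order_on D wo"
  unfolding wo_def using well_order_on by (rule someI_ex)

lemma wo_props: "trans wo" "antisym wo" "total_on D wo" "wf (wo - Id)"
  using wo by (auto simp: well_order_on_def linear_order_on_def partial_order_on_def preorder_on_def)

lemma DX': "s \<in> D \<Longrightarrow> s \<in> X" using DX by auto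

lemma bdd: "u \<in> X \<Longrightarrow> bdd_below (d u ` D)"
  using d_nonneg DX' by (intro bdd_belowI[of _ 0]) auto

lemma dD_le: "u \<in> X \<Longrightarrow> s \<in> D \<Longrightarrow> dD u \<le> d u s"
  unfolding dD_def by (intro cINF_lower bdd)

lemma dD_nonneg: "u \<in> X \<Longrightarrow> 0 \<le> dD u"
  unfolding dD_def using Dne d_nonneg DX' by (intro cINF_greatest) auto

lemma dD_approx: "u \<in> X \<Longrightarrow> 0 < e \<Longrightarrow> \<exists>s\<in>D. d u s < dD u + e"
  using cINF_less_iff[OF Dne bdd, of u "dD u + e"] unfolding dD_def by simp

lemma dD_lip1: assumes "u \<in> X" "v \<in> X" shows "dD u \<le> dD v + d u v"
proof -
  have "dD u - d u v \<le> dD v"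
    unfolding dD_def[of v]
  proof (rule cINF_greatest[OF Dne])
    fix s assume s: "s \<in> D"
    have "dD u \<le> d u s" by (rule dD_le) (use assms s in auto)
    also have "\<dots> \<le> d u v + d v s" by (rule d_tri) (use assms s DX' in auto)
    finally show "dD u - d u v \<le> d v s" by simp
  qed
  then show ?thesis by simp
qed

lemma dD_lip: "u \<in> X \<Longrightarrow> v \<in> X \<Longrightarrow> \<bar>dD u - dD v\<bar> \<le> d u v"
  using dD_lip1[of u v] dD_lip1[of v u] d_sym[of u v] by auto

lemma bump_le: "u \<in> X \<Longrightarrow> s \<in> D \<Longrightarrow> bump s u \<le> dD u"
  using dD_le[of u s] dD_nonneg[of u] by (auto simp: bump_def)

lemma bump_lip:
  assumes "u \<in> X" "v \<in> X" "s \<in> D"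
  shows "\<bar>bump s u - bump s v\<bar> \<le> 3 * d u v"
proof -
  have "d u s \<le> d u v + d v s" "d v s \<le> d v u + d u s" using assms DX' by (auto intro: d_tri)
  then show ?thesis using dD_lip[of u v] d_sym[of u v] assms by (auto simp: bump_def max_def)
qed

lemma bsup_bdd: "u \<in> X \<Longrightarrow> bdd_above (insert 0 ((\<lambda>t. bump t u) ` preds s))"
  using bump_le dD_nonneg by (intro bdd_aboveI[of _ "dD u"]) (auto simp: preds_def)

lemma bsup_upper: "u \<in> X \<Longrightarrow> t \<in> preds s \<Longrightarrow> bump t u \<le> bsup s u"
  unfolding bsup_def by (intro cSup_upper bsup_bdd) auto

lemma bsup_nonneg: "u \<in> X \<Longrightarrow> 0 \<le> bsup s u"
  unfolding bsup_def by (intro cSup_upper bsup_bdd) auto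

lemma bsup_least: "0 \<le> B \<Longrightarrow> (\<And>t. t \<in> preds s \<Longrightarrow> bump t u \<le> B) \<Longrightarrow> bsup s u \<le> B"
  unfolding bsup_def by (rule cSup_least) auto

lemma bsup_lip1:
  assumes "u \<in> X" "v \<in> X" shows "bsup s u \<le> bsup s v + 3 * d u v"
proof (rule bsup_least)
  show "0 \<le> bsup s v + 3 * d u v" using bsup_nonneg d_nonneg assms by (simp add: add_nonneg_nonneg)
  fix t assume t: "t \<in> preds s"
  then have "t \<in> D" by (simp add: preds_def)
  then show "bump t u \<le> bsup s v + 3 * d u v"
    using bump_lip[OF assms, of t] bsup_upper[OF assms(2) t] by linarith
qed

text \<open>A supremum of functions with a common Lipschitz constant keeps that constant, so 6 does
  not depend on s or on the number of predecessors; continuity of each weight follows.\<close>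

lemma inc_lip: "u \<in> X \<Longrightarrow> v \<in> X \<Longrightarrow> s \<in> D \<Longrightarrow> \<bar>inc s u - inc s v\<bar> \<le> 6 * d u v"
  using bump_lip[of u v s] bsup_lip1[of u v s] bsup_lip1[of v u s] d_sym[of u v] d_nonneg[of u v]
  by (auto simp: inc_def max_def)

lemma inc_nonneg: "0 \<le> inc s u" by (simp add: inc_def)

lemma inc_support: "u \<in> X \<Longrightarrow> inc s u \<noteq> 0 \<Longrightarrow> d u s \<le> 2 * dD u"
  using bsup_nonneg[of u s] by (auto simp: inc_def bump_def max_def split: if_splits)

text \<open>Induction on the finite set, removing its last element m in the well-ordering. If the
  increment at m is positive, the other elements are predecessors of m, their increments add up to
  at most \<open>bsup m u\<close> by the induction hypothesis with this bound, and the total is at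
  most \<open>bump m u\<close>.\<close>

lemma inc_sum_le:
  assumes u: "u \<in> X" and A: "finite A" "A \<subseteq> D" and B: "0 \<le> B" "\<And>s. s \<in> A \<Longrightarrow> bump s u \<le> B"
  shows "(\<Sum>s\<in>A. inc s u) \<le> B"
  using A B
proof (induction "card A" arbitrary: A B rule: less_induct)
  case less
  show ?case
  proof (cases "A = {}")
    case True with less show ?thesis by simp
  next
    case False
    obtain m where m: "m \<in> A" "\<forall>t\<in>A. (t, m) \<in> wo"
      using finite_has_max_wrt[OF wo less.prems(1) False less.prems(2)] by auto
    have sum: "(\<Sum>s\<in>A. inc s u) = inc m u + (\<Sum>s\<in>A - {m}. inc s u)"
      using less.prems m by (simp add: sum.remove)
    have card: "card (A - {m}) < card A" using less.prems(1) m(1) by (rule card_Diff1_less)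
    show ?thesis
    proof (cases "inc m u = 0")
      case True
      have "(\<Sum>s\<in>A - {m}. inc s u) \<le> B"
        by (rule less.hyps[OF card]) (use less.prems in auto)
      then show ?thesis using sum True by simp
    next
      case False
      have "(\<Sum>s\<in>A - {m}. inc s u) \<le> bsup m u"
      proof (rule less.hyps[OF card])
        fix s assume "s \<in> A - {m}"
        then have "s \<in> preds m" using m less.prems by (auto simp: preds_def)
        then show "bump s u \<le> bsup m u" by (rule bsup_upper[OF u])
      qed (use less.prems bsup_nonneg u in auto)
      moreover have "inc m u = bump m u - bsup m u" using False by (auto simp: inc_def max_def split: if_splits)
      moreover have "bump m u \<le> B" using less.prems m by auto
      ultimately show ?thesis using sum by linarith
    qed
  qed
qed

lemma nn_sum_inc_le:
  assumes u: "u \<in> X"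
  shows "(\<integral>\<^sup>+s. ennreal (inc s u) \<partial>count_space D) \<le> ennreal (dD u)"
  by (rule nn_integral_count_space_le) (use u bump_le dD_nonneg inc_nonneg in \<open>auto intro!: inc_sum_le\<close>)

text \<open>Transfinite induction: the increments before s already add up to at least
  \<open>bsup s u\<close>, and \<open>inc s u\<close> makes up the difference to the bump at
  s.\<close>

lemma bump_le_partial:
  assumes u: "u \<in> X" and s: "s \<in> D"
  shows "ennreal (bump s u) \<le> (\<integral>\<^sup>+t. ennreal (inc t u) * indicator (insert s (preds s)) t \<partial>count_space D)"
  using s
proof (induction s rule: wf_induct_rule[OF wo_props(4)])
  case (1 s)
  let ?I = "\<lambda>A. \<integral>\<^sup>+t. ennreal (inc t u) * indicator A t \<partial>count_space D"
  have fin: "?I A < \<infinity>" for A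
  proof -
    have "?I A \<le> (\<integral>\<^sup>+t. ennreal (inc t u) \<partial>count_space D)" by (intro nn_integral_mono) (auto simp: indicator_def)
    also have "\<dots> \<le> ennreal (dD u)" by (rule nn_sum_inc_le[OF u])
    finally show ?thesis by (auto simp: le_less_trans)
  qed
  have sup: "ennreal (bsup s u) \<le> ?I (preds s)"
  proof -
    define B where "B = enn2real (?I (preds s))"
    have B: "?I (preds s) = ennreal B" "0 \<le> B" using fin[of "preds s"] by (auto simp: B_def)
    have "bsup s u \<le> B"
    proof (rule bsup_least[OF B(2)])
      fix t assume t: "t \<in> preds s"
      then have tD: "t \<in> D" "(t, s) \<in> wo - Id" by (auto simp: preds_def)
      have "ennreal (bump t u) \<le> ?I (insert t (preds t))" by (rule 1(1)[OF tD(2,1)])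
      also have "\<dots> \<le> ?I (preds s)"
      proof (rule nn_integral_mono)
        have "insert t (preds t) \<subseteq> preds s"
        proof
          fix a assume "a \<in> insert t (preds t)"
          then show "a \<in> preds s"
          proof
            assume "a \<in> preds t"
            then have a: "a \<in> D" "(a, t) \<in> wo" "a \<noteq> t" by (auto simp: preds_def)
            have "(a, s) \<in> wo" using a tD wo_props(1) by (meson DiffD1 transD)
            moreover have "a \<noteq> s" using a tD wo_props(2) by (auto dest: antisymD)
            ultimately show "a \<in> preds s" using a by (simp add: preds_def)
          qed (use t in simp)
        qed
        then show "ennreal (inc a u) * indicator (insert t (preds t)) a \<le> ennreal (inc a u) * indicator (preds s) a" for a
          by (auto simp: indicator_def)
      qed
      finally show "bump t u \<le> B" using B by (simp add: ennreal_le_iff)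
    qed
    then show ?thesis using B by (simp add: ennreal_leI)
  qed
  have split: "?I (insert s (preds s)) = ennreal (inc s u) + ?I (preds s)"
  proof -
    have "?I (insert s (preds s)) = (\<integral>\<^sup>+t. ennreal (inc t u) * indicator {s} t + ennreal (inc t u) * indicator (preds s) t \<partial>count_space D)"
      by (intro nn_integral_cong) (auto simp: indicator_def preds_def)
    also have "\<dots> = ?I {s} + ?I (preds s)" by (rule nn_integral_add) auto
    also have "?I {s} = ennreal (inc s u)"
    proof -
      have "?I {s} = (\<integral>\<^sup>+t. ennreal (inc s u) * indicator {s} t \<partial>count_space D)"
        by (intro nn_integral_cong) (auto simp: indicator_def)
      also have "\<dots> = ennreal (inc s u)"
        using 1(2) by (subst nn_integral_cmult_indicator) (auto simp: emeasure_count_space_finite)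
      finally show ?thesis .
    qed
    finally show ?thesis .
  qed
  have "bump s u \<le> inc s u + bsup s u" by (auto simp: inc_def)
  then have "ennreal (bump s u) \<le> ennreal (inc s u + bsup s u)" by (rule ennreal_leI)
  also have "\<dots> = ennreal (inc s u) + ennreal (bsup s u)" using bsup_nonneg u inc_nonneg by (intro ennreal_plus) auto
  also have "\<dots> \<le> ?I (insert s (preds s))" unfolding split by (intro add_left_mono sup)
  finally show ?case .
qed

text \<open>The positive parts of the increments of a running supremum along a well-ordering telescope to
  the total supremum, which gives a partition of unity without any paracompactness argument.\<close>

lemma nn_sum_inc:
  assumes u: "u \<in> X"
  shows "(\<integral>\<^sup>+s. ennreal (inc s u) \<partial>count_space D) = ennreal (dD u)"
proof (rule antisym[OF nn_sum_inc_le[OF u]])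
  let ?I = "\<integral>\<^sup>+s. ennreal (inc s u) \<partial>count_space D"
  have "?I < \<infinity>" using nn_sum_inc_le[OF u] by (rule le_less_trans) simp
  then obtain I where I: "?I = ennreal I" "0 \<le> I" by (cases ?I) auto
  have "dD u \<le> I"
  proof (rule field_le_epsilon)
    fix e :: real assume "0 < e"
    then obtain s where s: "s \<in> D" "d u s < dD u + e" using dD_approx[OF u] by blast
    have "ennreal (bump s u) \<le> (\<integral>\<^sup>+t. ennreal (inc t u) * indicator (insert s (preds s)) t \<partial>count_space D)"
      by (rule bump_le_partial[OF u s(1)])
    also have "\<dots> \<le> ?I" by (intro nn_integral_mono) (auto simp: indicator_def)
    finally have "bump s u \<le> I" using I by (simp add: ennreal_le_iff)
    then show "dD u \<le> I + e" using s by (auto simp: bump_def max_def split: if_splits)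
  qed
  then show "ennreal (dD u) \<le> ?I" using I by (simp add: ennreal_leI)
qed

text \<open>On the closure of D, where \<open>dD u = 0\<close>, all weights are 0 and the extension
  is defined differently.\<close>

definition "wgt s u = inc s u / dD u"

lemma wgt_nonneg: "u \<in> X \<Longrightarrow> 0 \<le> wgt s u"
  by (simp add: wgt_def inc_nonneg dD_nonneg)

lemma nn_sum_wgt:
  assumes u: "u \<in> X" "0 < dD u"
  shows "(\<integral>\<^sup>+s. ennreal (wgt s u) \<partial>count_space D) = 1"
proof -
  have "(\<integral>\<^sup>+s. ennreal (wgt s u) \<partial>count_space D) = (\<integral>\<^sup>+s. ennreal (1 / dD u) * ennreal (inc s u) \<partial>count_space D)"
    using u by (intro nn_integral_cong) (simp add: wgt_def ennreal_mult[symmetric] inc_nonneg)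
  also have "\<dots> = ennreal (1 / dD u) * ennreal (dD u)" by (subst nn_integral_cmult) (auto simp: nn_sum_inc[OF u(1)])
  also have "\<dots> = 1" using u by (simp add: ennreal_mult[symmetric])
  finally show ?thesis .
qed

lemma nn_sum_wgt_le: "u \<in> X \<Longrightarrow> (\<integral>\<^sup>+s. ennreal (wgt s u) \<partial>count_space D) \<le> 1"
proof (cases "0 < dD u")
  case False
  assume u: "u \<in> X"
  then have "dD u = 0" using False dD_nonneg[of u] by simp
  then show ?thesis by (simp add: wgt_def)
qed (simp add: nn_sum_wgt)

lemma wgt_support: "u \<in> X \<Longrightarrow> wgt s u \<noteq> 0 \<Longrightarrow> d u s \<le> 2 * dD u"
  using inc_support[of u s] by (auto simp: wgt_def)

text \<open>D is uncountable in general, while exchanging sums with integrals over M calls for a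
  countable index set; a summable family has countable support.\<close>

lemma wgt_countable:
  assumes u: "u \<in> X" shows "countable {s \<in> D. wgt s u \<noteq> 0}"
proof -
  have "integrable (count_space D) (\<lambda>s. wgt s u)"
    using nn_sum_wgt_le[OF u] wgt_nonneg[OF u] by (intro integrableI_nonneg) (auto intro: le_less_trans)
  then have "Infinite_Set_Sum.abs_summable_on (\<lambda>s. wgt s u) D" by (simp add: Infinite_Set_Sum.abs_summable_on_def)
  then have "Infinite_Sum.abs_summable_on (\<lambda>s. wgt s u) D" by (simp only: abs_summable_equivalent)
  then show ?thesis by (rule abs_summable_countable)
qed

text \<open>Scheffe's lemma for the counting measure: pointwise convergence, with total mass at most
  1 along the sequence and exactly 1 in the limit, gives l^1 convergence. Local finiteness of the
  partition does not enter.\<close>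

lemma wgt_tendsto:
  assumes u: "u \<in> X" "0 < dD u" and v: "\<And>j. v j \<in> X" "(\<lambda>j::nat. d (v j) u) \<longlonglongrightarrow> 0"
  shows "(\<lambda>j. \<integral>\<^sup>+s. ennreal \<bar>wgt s (v j) - wgt s u\<bar> \<partial>count_space D) \<longlonglongrightarrow> 0"
proof -
  have dlim: "(\<lambda>j. dD (v j)) \<longlonglongrightarrow> dD u"
    by (rule Lim_null[THEN iffD2], rule Lim_null_comparison[OF always_eventually v(2)]) (use dD_lip u v in auto)
  have "(\<lambda>j. \<integral>\<^sup>+s. norm (wgt s (v j) - wgt s u) \<partial>count_space D) \<longlonglongrightarrow> 0"
  proof (rule Scheffe_lemma2)
    show "integrable (count_space D) (\<lambda>s. wgt s u)"
      using nn_sum_wgt_le[OF u(1)] wgt_nonneg[OF u(1)] by (intro integrableI_nonneg) (auto intro: le_less_trans)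
    show "(\<integral>\<^sup>+s. ennreal (norm (wgt s (v j))) \<partial>count_space D) \<le> (\<integral>\<^sup>+s. ennreal (norm (wgt s u)) \<partial>count_space D)" for j
      using nn_sum_wgt_le[OF v(1)] nn_sum_wgt[OF u] wgt_nonneg[OF u(1)] wgt_nonneg[OF v(1)] by simp
    show "AE s in count_space D. (\<lambda>j. wgt s (v j)) \<longlonglongrightarrow> wgt s u"
    proof (rule AE_I2)
      fix s assume "s \<in> space (count_space D)"
      then have s: "s \<in> D" by simp
      have lim6: "(\<lambda>j. 6 * d (v j) u) \<longlonglongrightarrow> 0" using tendsto_mult[OF tendsto_const v(2), of 6] by simp
      have "(\<lambda>j. inc s (v j)) \<longlonglongrightarrow> inc s u"
        by (rule Lim_null[THEN iffD2], rule Lim_null_comparison[OF always_eventually lim6]) (use inc_lip u v s in auto)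
      then show "(\<lambda>j. wgt s (v j)) \<longlonglongrightarrow> wgt s u"
        unfolding wgt_def using u dlim by (intro tendsto_divide) auto
    qed
  qed auto
  then show ?thesis by simp
qed

end

section \<open>Weighted averages of integrable functions\<close>

lemma borel_measurable_nn_sum_countable:
  fixes g :: "'i \<Rightarrow> 'a \<Rightarrow> ennreal"
  assumes C: "countable C" and g: "\<And>s. s \<in> C \<Longrightarrow> g s \<in> borel_measurable M"
  shows "(\<lambda>x. \<integral>\<^sup>+s. g s x \<partial>count_space C) \<in> borel_measurable M"
proof -
  interpret sigma_finite_measure "count_space C" using C by (rule sigma_finite_measure_count_space_countable)
  have "(\<lambda>p. g (fst p) (snd p)) \<in> borel_measurable (count_space C \<Otimes>\<^sub>M M)"
    by (rule measurable_pair_measure_countable1[OF C]) (use g in auto)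
  from measurable_pair_swap[OF this] have "(\<lambda>(x, s). g s x) \<in> borel_measurable (M \<Otimes>\<^sub>M count_space C)"
    by (simp add: case_prod_beta)
  then show ?thesis by (rule borel_measurable_nn_integral)
qed

text \<open>Real sums are read off through \<open>enn2real\<close>, which sends infinity to 0; the
  two finiteness hypotheses confine this to a null set, off which the triangle inequality
  applies.\<close>

lemma L1_distance_of_sums:
  fixes A B :: "'i \<Rightarrow> 'a \<Rightarrow> real"
  assumes C: "countable C" and A: "\<And>s. s \<in> C \<Longrightarrow> A s \<in> borel_measurable M" and B: "\<And>s. s \<in> C \<Longrightarrow> B s \<in> borel_measurable M"
    and A0: "\<And>s x. s \<in> C \<Longrightarrow> 0 \<le> A s x" and B0: "\<And>s x. s \<in> C \<Longrightarrow> 0 \<le> B s x"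
    and fA: "(\<integral>\<^sup>+x. \<integral>\<^sup>+s. ennreal (A s x) \<partial>count_space C \<partial>M) < \<infinity>"
    and fB: "(\<integral>\<^sup>+x. \<integral>\<^sup>+s. ennreal (B s x) \<partial>count_space C \<partial>M) < \<infinity>"
  shows "(\<integral>\<^sup>+x. ennreal \<bar>enn2real (\<integral>\<^sup>+s. ennreal (A s x) \<partial>count_space C) - enn2real (\<integral>\<^sup>+s. ennreal (B s x) \<partial>count_space C)\<bar> \<partial>M)
    \<le> (\<integral>\<^sup>+s. \<integral>\<^sup>+x. ennreal \<bar>A s x - B s x\<bar> \<partial>M \<partial>count_space C)"
proof -
  have mA: "(\<lambda>x. \<integral>\<^sup>+s. ennreal (A s x) \<partial>count_space C) \<in> borel_measurable M"
    by (rule borel_measurable_nn_sum_countable[OF C]) (use A in measurable)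
  have mB: "(\<lambda>x. \<integral>\<^sup>+s. ennreal (B s x) \<partial>count_space C) \<in> borel_measurable M"
    by (rule borel_measurable_nn_sum_countable[OF C]) (use B in measurable)
  have "AE x in M. (\<integral>\<^sup>+s. ennreal (A s x) \<partial>count_space C) \<noteq> \<infinity>"
    by (rule nn_integral_PInf_AE[OF mA]) (use fA in auto)
  moreover have "AE x in M. (\<integral>\<^sup>+s. ennreal (B s x) \<partial>count_space C) \<noteq> \<infinity>"
    by (rule nn_integral_PInf_AE[OF mB]) (use fB in auto)
  ultimately have "AE x in M. ennreal \<bar>enn2real (\<integral>\<^sup>+s. ennreal (A s x) \<partial>count_space C) - enn2real (\<integral>\<^sup>+s. ennreal (B s x) \<partial>count_space C)\<bar>
    \<le> (\<integral>\<^sup>+s. ennreal \<bar>A s x - B s x\<bar> \<partial>count_space C)"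
  proof eventually_elim
    case (elim x)
    let ?a = "\<integral>\<^sup>+s. ennreal (A s x) \<partial>count_space C" and ?b = "\<integral>\<^sup>+s. ennreal (B s x) \<partial>count_space C"
      and ?c = "\<integral>\<^sup>+s. ennreal \<bar>A s x - B s x\<bar> \<partial>count_space C"
    have le: "(\<integral>\<^sup>+s. ennreal (U s x) \<partial>count_space C) \<le> (\<integral>\<^sup>+s. ennreal (V s x) \<partial>count_space C) + (\<integral>\<^sup>+s. ennreal \<bar>U s x - V s x\<bar> \<partial>count_space C)"
      if V: "\<And>s. s \<in> C \<Longrightarrow> 0 \<le> V s x" for U V :: "'i \<Rightarrow> 'a \<Rightarrow> real"
    proof -
      have "(\<integral>\<^sup>+s. ennreal (U s x) \<partial>count_space C) \<le> (\<integral>\<^sup>+s. ennreal (V s x) + ennreal \<bar>U s x - V s x\<bar> \<partial>count_space C)"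
      proof (rule nn_integral_mono)
        fix s assume "s \<in> space (count_space C)"
        then have "0 \<le> V s x" using V by simp
        then have "ennreal (U s x) \<le> ennreal (V s x + \<bar>U s x - V s x\<bar>)" by (intro ennreal_leI) simp
        then show "ennreal (U s x) \<le> ennreal (V s x) + ennreal \<bar>U s x - V s x\<bar>" using \<open>0 \<le> V s x\<close> by (simp add: ennreal_plus)
      qed
      then show ?thesis by (simp add: nn_integral_add)
    qed
    have 1: "?a \<le> ?b + ?c" by (rule le) (use B0 in auto)
    have 2: "?b \<le> ?a + ?c" using le[of A B] A0 by (simp add: abs_minus_commute)
    obtain a b where ab: "?a = ennreal a" "0 \<le> a" "?b = ennreal b" "0 \<le> b"
      using elim by (cases ?a; cases ?b) auto
    show ?case
    proof (cases ?c)
      case (real c)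
      have "a \<le> b + c" "b \<le> a + c" using 1 2 ab real by (simp_all flip: ennreal_plus)
      then show ?thesis using ab real by (simp add: ennreal_leI)
    qed simp
  qed
  then have "(\<integral>\<^sup>+x. ennreal \<bar>enn2real (\<integral>\<^sup>+s. ennreal (A s x) \<partial>count_space C) - enn2real (\<integral>\<^sup>+s. ennreal (B s x) \<partial>count_space C)\<bar> \<partial>M)
    \<le> (\<integral>\<^sup>+x. \<integral>\<^sup>+s. ennreal \<bar>A s x - B s x\<bar> \<partial>count_space C \<partial>M)" by (rule nn_integral_mono_AE)
  also have "\<dots> = (\<integral>\<^sup>+s. \<integral>\<^sup>+x. ennreal \<bar>A s x - B s x\<bar> \<partial>M \<partial>count_space C)"
    by (rule nn_integral_count_space_nn_integral[OF C]) (use A B in measurable)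
  finally show ?thesis .
qed

text \<open>\<open>G s\<close> will be the p-th power of the square function of an L^2 function that
  induces s.\<close>

locale L1_extension = pseudometric_with_subset d X D
  for d :: "'u \<Rightarrow> 'u \<Rightarrow> real" and X D +
  fixes G :: "'u \<Rightarrow> 'a \<Rightarrow> real" and M :: "'a measure" and Kc :: real
  assumes G_int: "s \<in> D \<Longrightarrow> integrable M (G s)" and G_nonneg: "s \<in> D \<Longrightarrow> 0 \<le> G s x"
    and Kc: "0 \<le> Kc"
    and G_lip: "s \<in> D \<Longrightarrow> t \<in> D \<Longrightarrow> (\<integral>\<^sup>+x. ennreal \<bar>G s x - G t x\<bar> \<partial>M) \<le> ennreal (Kc * d s t)"
begin

lemma G_measurable [measurable]: "s \<in> D \<Longrightarrow> G s \<in> borel_measurable M"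
  using G_int by auto

definition "supp u = {s \<in> D. wgt s u \<noteq> 0}"
text \<open>The extension off the closure of D. Summing over the support of the weights instead of D
  makes the index set countable.\<close>

definition "E0 u x = enn2real (\<integral>\<^sup>+s. ennreal (wgt s u * G s x) \<partial>count_space (supp u))"

lemma supp: "u \<in> X \<Longrightarrow> countable (supp u)" "supp u \<subseteq> D"
  using wgt_countable by (auto simp: supp_def)

lemma sum_over_superset:
  assumes "supp u \<subseteq> C" "C \<subseteq> D"
  shows "(\<integral>\<^sup>+s. ennreal (wgt s u * F s) \<partial>count_space C) = (\<integral>\<^sup>+s. ennreal (wgt s u * F s) \<partial>count_space (supp u))"
  by (rule nn_integral_count_space_eq) (use assms in \<open>auto simp: supp_def\<close>)

lemma E0_alt: "supp u \<subseteq> C \<Longrightarrow> C \<subseteq> D \<Longrightarrow> E0 u x = enn2real (\<integral>\<^sup>+s. ennreal (wgt s u * G s x) \<partial>count_space C)"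
  using sum_over_superset[of u C "\<lambda>s. G s x"] by (simp add: E0_def)

lemma sum_wgt_le: "u \<in> X \<Longrightarrow> C \<subseteq> D \<Longrightarrow> (\<integral>\<^sup>+s. ennreal (wgt s u) \<partial>count_space C) \<le> 1"
proof -
  assume u: "u \<in> X" and C: "C \<subseteq> D"
  have "(\<integral>\<^sup>+s. ennreal (wgt s u) \<partial>count_space C) \<le> (\<integral>\<^sup>+s. ennreal (wgt s u) \<partial>count_space D)"
    unfolding nn_integral_count_space_indicator[of C, simplified NO_MATCH_def, OF TrueI] nn_integral_count_space_indicator[of D, simplified NO_MATCH_def, OF TrueI]
    using C by (intro nn_integral_mono) (auto simp: indicator_def)
  also have "\<dots> \<le> 1" by (rule nn_sum_wgt_le[OF u])
  finally show ?thesis .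
qed

text \<open>An arbitrary base point; the L^1 norm of \<open>G s\<close> is bounded by that of
  \<open>G z0\<close> plus a multiple of the distance.\<close>

definition "z0 = (SOME z. z \<in> D)"
definition "gz = (LINT x|M. G z0 x)"

lemma z0: "z0 \<in> D" unfolding z0_def using Dne by (simp add: some_in_eq)

lemma gz: "0 \<le> gz" "(\<integral>\<^sup>+x. ennreal (G z0 x) \<partial>M) = ennreal gz"
  using z0 G_nonneg G_int by (auto simp: gz_def intro!: nn_integral_eq_integral integral_nonneg)

lemma G_norm: "s \<in> D \<Longrightarrow> (\<integral>\<^sup>+x. ennreal (G s x) \<partial>M) \<le> ennreal (gz + Kc * d s z0)"
proof -
  assume s: "s \<in> D"
  have "(\<integral>\<^sup>+x. ennreal (G s x) \<partial>M) \<le> (\<integral>\<^sup>+x. ennreal (G z0 x) + ennreal \<bar>G s x - G z0 x\<bar> \<partial>M)"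
    using G_nonneg[OF z0] by (intro nn_integral_mono) (simp flip: ennreal_plus add: ennreal_leI)
  also have "\<dots> = (\<integral>\<^sup>+x. ennreal (G z0 x) \<partial>M) + (\<integral>\<^sup>+x. ennreal \<bar>G s x - G z0 x\<bar> \<partial>M)"
    by (rule nn_integral_add) (use z0 s in measurable)
  also have "\<dots> \<le> ennreal gz + ennreal (Kc * d s z0)" using G_lip[OF s z0] gz by (intro add_mono) auto
  also have "\<dots> = ennreal (gz + Kc * d s z0)" using gz Kc d_nonneg[of s z0] s z0 DX' by (simp add: ennreal_plus)
  finally show ?thesis .
qed

lemma weighted_sum_le:
  assumes u: "u \<in> X" and C: "C \<subseteq> D" and b: "\<And>s. s \<in> C \<Longrightarrow> wgt s u \<noteq> 0 \<Longrightarrow> (\<integral>\<^sup>+x. ennreal \<bar>F s x\<bar> \<partial>M) \<le> ennreal b"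
    and F: "\<And>s. s \<in> C \<Longrightarrow> F s \<in> borel_measurable M"
  shows "(\<integral>\<^sup>+s. \<integral>\<^sup>+x. ennreal \<bar>wgt s u * F s x\<bar> \<partial>M \<partial>count_space C) \<le> ennreal b"
proof -
  have "(\<integral>\<^sup>+s. \<integral>\<^sup>+x. ennreal \<bar>wgt s u * F s x\<bar> \<partial>M \<partial>count_space C) \<le> (\<integral>\<^sup>+s. ennreal (wgt s u) * ennreal b \<partial>count_space C)"
  proof (rule nn_integral_mono)
    fix s assume "s \<in> space (count_space C)"
    then have s: "s \<in> C" by simp
    have "(\<integral>\<^sup>+x. ennreal \<bar>wgt s u * F s x\<bar> \<partial>M) = (\<integral>\<^sup>+x. ennreal (wgt s u) * ennreal \<bar>F s x\<bar> \<partial>M)"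
      using wgt_nonneg[OF u] by (intro nn_integral_cong) (simp add: abs_mult ennreal_mult)
    also have "\<dots> = ennreal (wgt s u) * (\<integral>\<^sup>+x. ennreal \<bar>F s x\<bar> \<partial>M)"
      by (rule nn_integral_cmult) (use F[OF s] in measurable)
    also have "\<dots> \<le> ennreal (wgt s u) * ennreal b"
      using b[OF s] by (cases "wgt s u = 0") (auto intro: mult_left_mono)
    finally show "(\<integral>\<^sup>+x. ennreal \<bar>wgt s u * F s x\<bar> \<partial>M) \<le> ennreal (wgt s u) * ennreal b" .
  qed
  also have "\<dots> = (\<integral>\<^sup>+s. ennreal (wgt s u) \<partial>count_space C) * ennreal b" by (rule nn_integral_multc) simp
  also have "\<dots> \<le> 1 * ennreal b" by (intro mult_right_mono sum_wgt_le u C) auto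
  finally show ?thesis by simp
qed

lemma E0_sum_finite:
  assumes u: "u \<in> X" and C: "countable C" "C \<subseteq> D"
  shows "(\<integral>\<^sup>+x. \<integral>\<^sup>+s. ennreal (wgt s u * G s x) \<partial>count_space C \<partial>M) < \<infinity>"
proof -
  have CD: "s \<in> C \<Longrightarrow> s \<in> D" for s using C by auto
  have "(\<integral>\<^sup>+x. \<integral>\<^sup>+s. ennreal (wgt s u * G s x) \<partial>count_space C \<partial>M) = (\<integral>\<^sup>+s. \<integral>\<^sup>+x. ennreal (wgt s u * G s x) \<partial>M \<partial>count_space C)"
    by (rule nn_integral_count_space_nn_integral[OF C(1)]) (use CD in measurable)
  also have "\<dots> = (\<integral>\<^sup>+s. \<integral>\<^sup>+x. ennreal \<bar>wgt s u * G s x\<bar> \<partial>M \<partial>count_space C)"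
    using wgt_nonneg[OF u] G_nonneg CD by (intro nn_integral_cong) (simp add: abs_mult)
  also have "\<dots> \<le> ennreal (gz + Kc * (2 * dD u + d u z0))"
  proof (rule weighted_sum_le[OF u C(2)])
    fix s assume s: "s \<in> C" "wgt s u \<noteq> 0"
    have X: "s \<in> X" "z0 \<in> X" using CD s z0 DX' by auto
    have "d s z0 \<le> d s u + d u z0" by (rule d_tri[OF X(1) u X(2)])
    also have "d s u \<le> 2 * dD u" using wgt_support[OF u s(2)] d_sym[OF u X(1)] by simp
    finally have le: "d s z0 \<le> 2 * dD u + d u z0" by simp
    have "(\<integral>\<^sup>+x. ennreal \<bar>G s x\<bar> \<partial>M) = (\<integral>\<^sup>+x. ennreal (G s x) \<partial>M)" using G_nonneg CD s by simp
    also have "\<dots> \<le> ennreal (gz + Kc * d s z0)" using CD s by (intro G_norm) auto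
    also have "\<dots> \<le> ennreal (gz + Kc * (2 * dD u + d u z0))"
      using Kc le by (intro ennreal_leI add_left_mono mult_left_mono) auto
    finally show "(\<integral>\<^sup>+x. ennreal \<bar>G s x\<bar> \<partial>M) \<le> \<dots>" .
  qed (use CD in auto)
  finally show ?thesis by (auto intro: le_less_trans)
qed

lemma E0_integrable: "u \<in> X \<Longrightarrow> integrable M (E0 u)"
proof (rule integrableI_nonneg)
  assume u: "u \<in> X"
  have "(\<lambda>x. \<integral>\<^sup>+s. ennreal (wgt s u * G s x) \<partial>count_space (supp u)) \<in> borel_measurable M"
    by (rule borel_measurable_nn_sum_countable[OF supp(1)[OF u]]) (use supp(2)[of u] in auto)
  then show "E0 u \<in> borel_measurable M" unfolding E0_def[abs_def] by measurable
  have "(\<integral>\<^sup>+x. ennreal (E0 u x) \<partial>M) \<le> (\<integral>\<^sup>+x. \<integral>\<^sup>+s. ennreal (wgt s u * G s x) \<partial>count_space (supp u) \<partial>M)"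
    unfolding E0_def by (intro nn_integral_mono) (simp add: ennreal_enn2real_if)
  also have "\<dots> < \<infinity>" by (rule E0_sum_finite[OF u supp(1)[OF u] supp(2)])
  finally show "(\<integral>\<^sup>+x. ennreal (E0 u x) \<partial>M) < \<infinity>" .
qed (simp add: E0_def)

text \<open>Every s of nonzero weight has d u s \<le> 2 dD u \<le> 2 d u t, hence d s t \<le> 3 d u
  t. As the weights sum to 1, the average is as close to \<open>G t\<close> as its terms
  are.\<close>

lemma E0_near:
  assumes u: "u \<in> X" "0 < dD u" and t: "t \<in> D"
  shows "(\<integral>\<^sup>+x. ennreal \<bar>E0 u x - G t x\<bar> \<partial>M) \<le> ennreal (3 * Kc * d u t)"
proof -
  have C: "countable (supp u)" "supp u \<subseteq> D" using supp u by auto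
  have CD: "s \<in> supp u \<Longrightarrow> s \<in> D" for s using C(2) by blast
  have sum1: "(\<integral>\<^sup>+s. ennreal (wgt s u) \<partial>count_space (supp u)) = 1"
    using sum_over_superset[of u D "\<lambda>_. 1"] nn_sum_wgt[OF u] supp(2)[of u] by simp
  have Gt: "(\<integral>\<^sup>+s. ennreal (wgt s u * G t x) \<partial>count_space (supp u)) = ennreal (G t x)" for x
  proof -
    have "(\<integral>\<^sup>+s. ennreal (wgt s u * G t x) \<partial>count_space (supp u)) = (\<integral>\<^sup>+s. ennreal (wgt s u) * ennreal (G t x) \<partial>count_space (supp u))"
      using wgt_nonneg[OF u(1)] G_nonneg[OF t] by (intro nn_integral_cong) (simp add: ennreal_mult)
    also have "\<dots> = ennreal (G t x)" by (simp add: nn_integral_multc sum1)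
    finally show ?thesis .
  qed
  have "(\<integral>\<^sup>+x. ennreal \<bar>E0 u x - G t x\<bar> \<partial>M) =
    (\<integral>\<^sup>+x. ennreal \<bar>enn2real (\<integral>\<^sup>+s. ennreal (wgt s u * G s x) \<partial>count_space (supp u)) - enn2real (\<integral>\<^sup>+s. ennreal (wgt s u * G t x) \<partial>count_space (supp u))\<bar> \<partial>M)"
    unfolding Gt E0_def using G_nonneg[OF t] by simp
  also have "\<dots> \<le> (\<integral>\<^sup>+s. \<integral>\<^sup>+x. ennreal \<bar>wgt s u * G s x - wgt s u * G t x\<bar> \<partial>M \<partial>count_space (supp u))"
  proof (rule L1_distance_of_sums[OF C(1)])
    show "(\<integral>\<^sup>+x. \<integral>\<^sup>+s. ennreal (wgt s u * G s x) \<partial>count_space (supp u) \<partial>M) < \<infinity>" by (rule E0_sum_finite[OF u(1) C])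
    show "(\<integral>\<^sup>+x. \<integral>\<^sup>+s. ennreal (wgt s u * G t x) \<partial>count_space (supp u) \<partial>M) < \<infinity>"
      unfolding Gt using G_norm[OF t] by (rule le_less_trans) simp
  qed (use CD t G_nonneg wgt_nonneg u in auto)
  also have "\<dots> = (\<integral>\<^sup>+s. \<integral>\<^sup>+x. ennreal \<bar>wgt s u * (G s x - G t x)\<bar> \<partial>M \<partial>count_space (supp u))"
    by (simp add: right_diff_distrib)
  also have "\<dots> \<le> ennreal (3 * Kc * d u t)"
  proof (rule weighted_sum_le[OF u(1) C(2)])
    fix s assume s: "s \<in> supp u" "wgt s u \<noteq> 0"
    have X: "s \<in> X" "t \<in> X" using CD s t DX' by auto
    have "d s t \<le> d s u + d u t" by (rule d_tri[OF X(1) u(1) X(2)])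
    also have "d s u \<le> 2 * dD u" using wgt_support[OF u(1) s(2)] d_sym[OF u(1) X(1)] by simp
    also have "dD u \<le> d u t" by (rule dD_le[OF u(1) t])
    finally have "d s t \<le> 3 * d u t" by simp
    then have "Kc * d s t \<le> 3 * Kc * d u t" using mult_left_mono[of "d s t" "3 * d u t" Kc] Kc by simp
    with G_lip[OF CD[OF s(1)] t] show "(\<integral>\<^sup>+x. ennreal \<bar>G s x - G t x\<bar> \<partial>M) \<le> ennreal (3 * Kc * d u t)"
      by (meson ennreal_leI order_trans)
  qed (use CD t in auto)
  finally show ?thesis .
qed

text \<open>Along points of D tending to u the functions G form a Cauchy sequence in L^1. An almost
  everywhere convergent subsequence provides the limit and Fatou's lemma the estimate. The maximum
  with 0 makes the limit nonnegative everywhere.\<close>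

lemma closure_limit:
  assumes u: "u \<in> X" "dD u = 0"
  shows "\<exists>F. integrable M F \<and> (\<forall>x. 0 \<le> F x) \<and> (\<forall>t\<in>D. (\<integral>\<^sup>+x. ennreal \<bar>F x - G t x\<bar> \<partial>M) \<le> ennreal (Kc * d u t))"
proof -
  have "\<forall>j. \<exists>s\<in>D. d u s < 1 / real (Suc j)" using dD_approx[OF u(1)] u(2) by (simp add: zero_less_divide_iff)
  then obtain s where s: "\<And>j. s j \<in> D" "\<And>j. d u (s j) < 1 / real (Suc j)" by metis
  have sX: "s j \<in> X" for j using s DX' by auto
  have dist: "d (s i) t \<le> 1 / real (Suc i) + d u t" if "t \<in> X" for i t
    using d_tri[OF sX u(1) that, of i] s(2)[of i] d_sym[OF sX u(1), of i] by simp
  have Lint: "(LINT x|M. norm (G (s i) x - G (s j) x)) \<le> Kc * d (s i) (s j)" for i j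
  proof -
    have "ennreal (LINT x|M. norm (G (s i) x - G (s j) x)) = (\<integral>\<^sup>+x. ennreal (norm (G (s i) x - G (s j) x)) \<partial>M)"
      using G_int s by (intro nn_integral_eq_integral[symmetric]) auto
    also have "\<dots> \<le> ennreal (Kc * d (s i) (s j))" using G_lip[OF s(1) s(1)] by simp
    finally show ?thesis using Kc d_nonneg[OF sX sX] by (subst (asm) ennreal_le_iff) auto
  qed
  have inv: "(\<lambda>i. 1 / real (Suc i)) \<longlonglongrightarrow> 0" using LIMSEQ_inverse_real_of_nat by (simp add: inverse_eq_divide)
  obtain r where r: "strict_mono r" "AE x in M. Cauchy (\<lambda>i. G (s (r i)) x)"
  proof (rule cauchy_L1_AE_cauchy_subseq[of M "\<lambda>j. G (s j)"])
    fix e :: real assume e: "0 < e"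
    have "(\<lambda>i. Kc * (1 / real (Suc i))) \<longlonglongrightarrow> Kc * 0" by (intro tendsto_intros inv)
    then have "eventually (\<lambda>i. Kc * (1 / real (Suc i)) < e / 2) sequentially" using e by (intro order_tendstoD) auto
    then obtain N where N: "\<And>i. N \<le> i \<Longrightarrow> Kc * (1 / real (Suc i)) < e / 2" by (auto simp: eventually_sequentially)
    have "(LINT x|M. norm (G (s i) x - G (s j) x)) < e" if "N \<le> i" "N \<le> j" for i j
    proof -
      have "d (s i) (s j) \<le> 1 / real (Suc i) + 1 / real (Suc j)" using dist[OF sX, of i j] s(2)[of j] by linarith
      then have "Kc * d (s i) (s j) \<le> Kc * (1 / real (Suc i) + 1 / real (Suc j))" using Kc by (intro mult_left_mono)
      also have "\<dots> = Kc * (1 / real (Suc i)) + Kc * (1 / real (Suc j))" by (rule distrib_left)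
      also have "\<dots> < e / 2 + e / 2" by (intro add_strict_mono N that)
      finally have "Kc * d (s i) (s j) < e" by simp
      with Lint[of i j] show ?thesis by (rule le_less_trans)
    qed
    then show "\<exists>N. \<forall>i\<ge>N. \<forall>j\<ge>N. (LINT x|M. norm (G (s i) x - G (s j) x)) < e" by blast
  qed (use G_int s in auto)
  define F where "F = (\<lambda>x. max 0 (lim (\<lambda>i. G (s (r i)) x)))"
  have [measurable]: "G (s i) \<in> borel_measurable M" for i using s by simp
  have Fm [measurable]: "F \<in> borel_measurable M" unfolding F_def by measurable
  have lim: "AE x in M. (\<lambda>i. G (s (r i)) x) \<longlonglongrightarrow> F x"
    using r(2)
  proof eventually_elim
    case (elim x)
    then have "convergent (\<lambda>i. G (s (r i)) x)" by (simp add: Cauchy_convergent_iff)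
    then have l: "(\<lambda>i. G (s (r i)) x) \<longlonglongrightarrow> lim (\<lambda>i. G (s (r i)) x)" by (simp add: convergent_LIMSEQ_iff)
    have "0 \<le> lim (\<lambda>i. G (s (r i)) x)" by (rule LIMSEQ_le_const[OF l]) (use G_nonneg s in auto)
    then show ?case using l by (simp add: F_def max_def)
  qed
  have near: "(\<integral>\<^sup>+x. ennreal \<bar>F x - G t x\<bar> \<partial>M) \<le> ennreal (Kc * d u t)" if t: "t \<in> D" for t
  proof -
    have [measurable]: "G t \<in> borel_measurable M" using t by simp
    have tX: "t \<in> X" using t DX' by simp
    have "(\<integral>\<^sup>+x. ennreal \<bar>F x - G t x\<bar> \<partial>M) = (\<integral>\<^sup>+x. liminf (\<lambda>i. ennreal \<bar>G (s (r i)) x - G t x\<bar>) \<partial>M)"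
    proof (rule nn_integral_cong_AE, use lim in eventually_elim)
      fix x assume "(\<lambda>i. G (s (r i)) x) \<longlonglongrightarrow> F x"
      then have "(\<lambda>i. ennreal \<bar>G (s (r i)) x - G t x\<bar>) \<longlonglongrightarrow> ennreal \<bar>F x - G t x\<bar>"
        by (intro tendsto_ennrealI tendsto_intros)
      then show "ennreal \<bar>F x - G t x\<bar> = liminf (\<lambda>i. ennreal \<bar>G (s (r i)) x - G t x\<bar>)"
        by (rule lim_imp_Liminf[OF trivial_limit_sequentially, symmetric])
    qed
    also have "\<dots> \<le> liminf (\<lambda>i. \<integral>\<^sup>+x. ennreal \<bar>G (s (r i)) x - G t x\<bar> \<partial>M)"
      by (rule nn_integral_liminf) measurable
    also have "\<dots> \<le> liminf (\<lambda>i. ennreal (Kc * (1 / real (Suc (r i)) + d u t)))"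
    proof (intro Liminf_mono always_eventually allI)
      fix i
      have "Kc * d (s (r i)) t \<le> Kc * (1 / real (Suc (r i)) + d u t)" using Kc dist[OF tX] by (intro mult_left_mono)
      then show "(\<integral>\<^sup>+x. ennreal \<bar>G (s (r i)) x - G t x\<bar> \<partial>M) \<le> ennreal (Kc * (1 / real (Suc (r i)) + d u t))"
        using G_lip[OF s(1) t, of "r i"] by (meson ennreal_leI order_trans)
    qed
    also have "\<dots> = ennreal (Kc * (0 + d u t))"
    proof (rule lim_imp_Liminf)
      have "(\<lambda>i. 1 / real (Suc (r i))) \<longlonglongrightarrow> 0" using LIMSEQ_subseq_LIMSEQ[OF inv r(1)] by (simp add: o_def)
      then show "(\<lambda>i. ennreal (Kc * (1 / real (Suc (r i)) + d u t))) \<longlonglongrightarrow> ennreal (Kc * (0 + d u t))"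
        by (intro tendsto_ennrealI tendsto_intros)
    qed simp
    finally show ?thesis by simp
  qed
  have "integrable M (\<lambda>x. F x - G (s 0) x)"
    using near[OF s(1), of 0] by (intro integrableI_bounded) (auto intro: le_less_trans)
  then have "integrable M (\<lambda>x. (F x - G (s 0) x) + G (s 0) x)" using G_int[OF s(1)] by (intro Bochner_Integration.integrable_add)
  then have "integrable M F" by simp
  moreover have "0 \<le> F x" for x by (simp add: F_def)
  ultimately show ?thesis using near by blast
qed

text \<open>For u in D the chosen function need not be \<open>G u\<close>; the estimate with t = u
  shows that they agree almost everywhere.\<close>

definition "Ext u = (if 0 < dD u then E0 u else (SOME F. integrable M F \<and> (\<forall>x. 0 \<le> F x) \<and> (\<forall>t\<in>D. (\<integral>\<^sup>+x. ennreal \<bar>F x - G t x\<bar> \<partial>M) \<le> ennreal (Kc * d u t))))"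

lemma Ext_props:
  assumes u: "u \<in> X"
  shows "integrable M (Ext u)" "0 \<le> Ext u x" "t \<in> D \<Longrightarrow> (\<integral>\<^sup>+x. ennreal \<bar>Ext u x - G t x\<bar> \<partial>M) \<le> ennreal (3 * Kc * d u t)"
proof -
  have "integrable M (Ext u) \<and> (\<forall>x. 0 \<le> Ext u x) \<and> (\<forall>t\<in>D. (\<integral>\<^sup>+x. ennreal \<bar>Ext u x - G t x\<bar> \<partial>M) \<le> ennreal (3 * Kc * d u t))"
  proof (cases "0 < dD u")
    case True
    then show ?thesis using u E0_integrable E0_near by (simp add: Ext_def E0_def[abs_def])
  next
    case False
    then have "dD u = 0" using dD_nonneg[OF u] by simp
    from someI_ex[OF closure_limit[OF u this]] False
    have F: "integrable M (Ext u)" "\<forall>x. 0 \<le> Ext u x" "\<forall>t\<in>D. (\<integral>\<^sup>+x. ennreal \<bar>Ext u x - G t x\<bar> \<partial>M) \<le> ennreal (Kc * d u t)"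
      by (simp_all add: Ext_def)
    have "ennreal (Kc * d u t) \<le> ennreal (3 * Kc * d u t)" if "t \<in> D" for t
      using Kc d_nonneg[OF u DX'[OF that]] by (intro ennreal_leI mult_right_mono) auto
    then show ?thesis using F by (meson order_trans)
  qed
  then show "integrable M (Ext u)" "0 \<le> Ext u x" "t \<in> D \<Longrightarrow> (\<integral>\<^sup>+x. ennreal \<bar>Ext u x - G t x\<bar> \<partial>M) \<le> ennreal (3 * Kc * d u t)"
    by auto
qed

text \<open>Off the closure of D the weights converge in l^1 and the functions \<open>G s\<close>
  involved are bounded in L^1. At a point of the closure, \<open>Ext (v j)\<close> and
  \<open>Ext u\<close> are both close to \<open>G s\<close> for a single s in D near u.\<close>

lemma Ext_continuous:
  assumes u: "u \<in> X" and v: "\<And>j. v j \<in> X" "(\<lambda>j::nat. d (v j) u) \<longlonglongrightarrow> 0"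
  shows "(\<lambda>j. \<integral>\<^sup>+x. ennreal \<bar>Ext (v j) x - Ext u x\<bar> \<partial>M) \<longlonglongrightarrow> 0"
proof (cases "0 < dD u")
  case True
  \<comment> \<open>Once d (v j) u < 1, every s of nonzero weight at u or v j satisfies d s z0 \<le>
    3 (d u z0 + 1); this bounds the norm of \<open>G s\<close> by B.\<close>
  define B where "B = gz + Kc * (3 * (d u z0 + 1))"
  have z0X: "z0 \<in> X" using z0 DX' by simp
  have B: "0 \<le> B" unfolding B_def using gz Kc d_nonneg[OF u z0X] by simp
  have dlim: "(\<lambda>j. dD (v j)) \<longlonglongrightarrow> dD u"
    by (rule Lim_null[THEN iffD2], rule Lim_null_comparison[OF always_eventually v(2)]) (use dD_lip u v in auto)
  have ev1: "eventually (\<lambda>j. 0 < dD (v j)) sequentially" using dlim True by (rule order_tendstoD)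
  have ev2: "eventually (\<lambda>j. d (v j) u < 1) sequentially" using v(2) by (rule order_tendstoD) simp
  have "(\<lambda>j. ennreal B * (\<integral>\<^sup>+s. ennreal \<bar>wgt s (v j) - wgt s u\<bar> \<partial>count_space D)) \<longlonglongrightarrow> ennreal B * 0"
    by (intro ennreal_tendsto_cmult wgt_tendsto[OF u True v]) auto
  then have lim: "(\<lambda>j. ennreal B * (\<integral>\<^sup>+s. ennreal \<bar>wgt s (v j) - wgt s u\<bar> \<partial>count_space D)) \<longlonglongrightarrow> 0" by simp
  have le: "eventually (\<lambda>j. (\<integral>\<^sup>+x. ennreal \<bar>Ext (v j) x - Ext u x\<bar> \<partial>M) \<le> ennreal B * (\<integral>\<^sup>+s. ennreal \<bar>wgt s (v j) - wgt s u\<bar> \<partial>count_space D)) sequentially"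
    using ev1 ev2
  proof eventually_elim
    case (elim j)
    let ?v = "v j"
    define C where "C = supp ?v \<union> supp u"
    have C: "countable C" "C \<subseteq> D" "supp ?v \<subseteq> C" "supp u \<subseteq> C" using supp u v by (auto simp: C_def)
    have CD: "s \<in> C \<Longrightarrow> s \<in> D" for s using C by auto
    have bd: "(\<integral>\<^sup>+x. ennreal (G s x) \<partial>M) \<le> ennreal B" if s: "s \<in> C" for s
    proof -
      have sX: "s \<in> X" using CD[OF s] DX' by simp
      have gen: "d s z0 \<le> 3 * d a z0" if a: "a \<in> X" and w: "wgt s a \<noteq> 0" for a
        using d_tri[OF sX a z0X] wgt_support[OF a w] d_sym[OF a sX] dD_le[OF a z0] by linarith
      have "d s z0 \<le> 3 * (d u z0 + 1)"
      proof (cases "wgt s u = 0")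
        case False
        from gen[OF u this] show ?thesis by simp
      next
        case True
        then have "wgt s ?v \<noteq> 0" using s by (auto simp: C_def supp_def)
        then have "d s z0 \<le> 3 * d ?v z0" by (rule gen[OF v(1)])
        moreover have "d ?v z0 \<le> d u z0 + 1" using d_tri[OF v(1) u z0X, of j] elim(2) by linarith
        moreover have "a \<le> 3 * b \<Longrightarrow> b \<le> c + 1 \<Longrightarrow> a \<le> 3 * (c + 1)" for a b c :: real by simp
        ultimately show ?thesis by blast
      qed
      then have "gz + Kc * d s z0 \<le> B" unfolding B_def using Kc by (intro add_left_mono mult_left_mono) auto
      then show ?thesis using G_norm[OF CD[OF s]] by (meson ennreal_leI order_trans)
    qed
    have "(\<integral>\<^sup>+x. ennreal \<bar>Ext ?v x - Ext u x\<bar> \<partial>M) = (\<integral>\<^sup>+x. ennreal \<bar>enn2real (\<integral>\<^sup>+s. ennreal (wgt s ?v * G s x) \<partial>count_space C) - enn2real (\<integral>\<^sup>+s. ennreal (wgt s u * G s x) \<partial>count_space C)\<bar> \<partial>M)"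
      using elim True by (simp add: Ext_def E0_alt[OF C(3,2)] E0_alt[OF C(4,2)])
    also have "\<dots> \<le> (\<integral>\<^sup>+s. \<integral>\<^sup>+x. ennreal \<bar>wgt s ?v * G s x - wgt s u * G s x\<bar> \<partial>M \<partial>count_space C)"
      by (rule L1_distance_of_sums[OF C(1)]) (use CD G_nonneg wgt_nonneg[OF u] wgt_nonneg[OF v(1)] E0_sum_finite[OF u C(1,2)] E0_sum_finite[OF v(1) C(1,2)] in auto)
    also have "\<dots> \<le> (\<integral>\<^sup>+s. ennreal B * ennreal \<bar>wgt s ?v - wgt s u\<bar> \<partial>count_space C)"
    proof (rule nn_integral_mono)
      fix s assume "s \<in> space (count_space C)"
      then have s: "s \<in> C" by simp
      have "(\<integral>\<^sup>+x. ennreal \<bar>wgt s ?v * G s x - wgt s u * G s x\<bar> \<partial>M) = (\<integral>\<^sup>+x. ennreal \<bar>wgt s ?v - wgt s u\<bar> * ennreal (G s x) \<partial>M)"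
        using G_nonneg[OF CD[OF s]] by (intro nn_integral_cong) (simp add: left_diff_distrib[symmetric] abs_mult ennreal_mult)
      also have "\<dots> = ennreal \<bar>wgt s ?v - wgt s u\<bar> * (\<integral>\<^sup>+x. ennreal (G s x) \<partial>M)"
        by (rule nn_integral_cmult) (use CD[OF s] in measurable)
      also have "\<dots> \<le> ennreal \<bar>wgt s ?v - wgt s u\<bar> * ennreal B" by (intro mult_left_mono bd s) auto
      finally show "(\<integral>\<^sup>+x. ennreal \<bar>wgt s ?v * G s x - wgt s u * G s x\<bar> \<partial>M) \<le> ennreal B * ennreal \<bar>wgt s ?v - wgt s u\<bar>"
        by (simp add: mult.commute)
    qed
    also have "\<dots> = ennreal B * (\<integral>\<^sup>+s. ennreal \<bar>wgt s ?v - wgt s u\<bar> \<partial>count_space C)" by (simp add: nn_integral_cmult)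
    also have "(\<integral>\<^sup>+s. ennreal \<bar>wgt s ?v - wgt s u\<bar> \<partial>count_space C) = (\<integral>\<^sup>+s. ennreal \<bar>wgt s ?v - wgt s u\<bar> \<partial>count_space D)"
    proof (rule nn_integral_count_space_eq)
      fix s assume "s \<in> D - C"
      then have "wgt s ?v = 0" "wgt s u = 0" using C(3,4) by (auto simp: supp_def)
      then show "ennreal \<bar>wgt s ?v - wgt s u\<bar> = 0" by simp
    qed (use C in auto)
    finally show ?case .
  qed
  show ?thesis
    by (rule tendsto_sandwich[OF _ le tendsto_const lim]) auto
next
  case False
  then have 0: "dD u = 0" using dD_nonneg[OF u] by simp
  show ?thesis
  proof (rule order_tendstoI)
    fix a :: ennreal assume "a < 0" then show "eventually (\<lambda>j. a < (\<integral>\<^sup>+x. ennreal \<bar>Ext (v j) x - Ext u x\<bar> \<partial>M)) sequentially" by simp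
  next
    fix a :: ennreal assume a: "0 < a"
    obtain e :: real where e: "0 < e" "ennreal e < a"
    proof (cases a)
      case (real r)
      then show ?thesis using a that[of "r / 2"] by (auto simp: ennreal_less_iff)
    next
      case top
      then show ?thesis using that[of 1] by auto
    qed
    \<comment> \<open>The errors 3 Kc d (v j) s and 3 Kc d u s, with d (v j) s \<le> 2 h and d u s
      \<le> h, add up to at most 9 Kc h. The summand 1 avoids division by 0.\<close>
    define h where "h = e / (9 * (Kc + 1))"
    have h: "0 < h" using e Kc by (simp add: h_def)
    obtain s where s: "s \<in> D" "d u s < h" using dD_approx[OF u h] 0 by auto
    have sX: "s \<in> X" using s DX' by simp
    have [measurable]: "G s \<in> borel_measurable M" "Ext u \<in> borel_measurable M" using s Ext_props(1)[OF u] by auto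
    have "eventually (\<lambda>j. d (v j) u < h) sequentially" using v(2) h by (rule order_tendstoD)
    then show "eventually (\<lambda>j. (\<integral>\<^sup>+x. ennreal \<bar>Ext (v j) x - Ext u x\<bar> \<partial>M) < a) sequentially"
    proof eventually_elim
      case (elim j)
      have [measurable]: "Ext (v j) \<in> borel_measurable M" using Ext_props(1)[OF v(1)] by auto
      have dvs: "d (v j) s \<le> 2 * h" using d_tri[OF v(1) u sX, of j] elim s by linarith
      have "(\<integral>\<^sup>+x. ennreal \<bar>Ext (v j) x - Ext u x\<bar> \<partial>M) \<le> (\<integral>\<^sup>+x. ennreal \<bar>Ext (v j) x - G s x\<bar> + ennreal \<bar>Ext u x - G s x\<bar> \<partial>M)"
        by (intro nn_integral_mono) (simp flip: ennreal_plus add: ennreal_leI)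
      also have "\<dots> = (\<integral>\<^sup>+x. ennreal \<bar>Ext (v j) x - G s x\<bar> \<partial>M) + (\<integral>\<^sup>+x. ennreal \<bar>Ext u x - G s x\<bar> \<partial>M)"
        by (rule nn_integral_add) measurable
      also have "\<dots> \<le> ennreal (3 * Kc * d (v j) s) + ennreal (3 * Kc * d u s)"
        by (intro add_mono Ext_props u v s)
      also have "\<dots> = ennreal (3 * Kc * d (v j) s + 3 * Kc * d u s)"
        using Kc d_nonneg[OF v(1) sX] d_nonneg[OF u sX] by (simp add: ennreal_plus)
      also have "\<dots> \<le> ennreal (9 * Kc * h)"
      proof (rule ennreal_leI)
        have "3 * Kc * d (v j) s + 3 * Kc * d u s \<le> 3 * Kc * (2 * h) + 3 * Kc * h"
          using Kc dvs s by (intro add_mono mult_left_mono) auto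
        then show "3 * Kc * d (v j) s + 3 * Kc * d u s \<le> 9 * Kc * h" by simp
      qed
      also have "\<dots> \<le> ennreal e"
      proof (rule ennreal_leI)
        have "9 * Kc * h \<le> 9 * (Kc + 1) * h" using h by simp
        also have "\<dots> = e" using Kc by (simp add: h_def)
        finally show "9 * Kc * h \<le> e" .
      qed
      finally show ?case using e by simp
    qed
  qed
qed

end

section \<open>Extension to the Hardy space\<close>

lemma ennpowr_tendsto_0:
  assumes h: "(h \<longlongrightarrow> 0) F" and p: "0 < p"
  shows "((\<lambda>j. ennpowr (h j) p) \<longlongrightarrow> 0) F"
proof (rule order_tendstoI)
  fix a :: ennreal assume a: "0 < a"
  then have "0 < ennpowr a (1 / p)" by (simp add: zero_less_iff_neq_zero)
  with h have "eventually (\<lambda>j. h j < ennpowr a (1 / p)) F" by (rule order_tendstoD)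
  then show "eventually (\<lambda>j. ennpowr (h j) p < a) F"
  proof eventually_elim
    case (elim j)
    show ?case
    proof (rule ccontr)
      assume "\<not> ennpowr (h j) p < a"
      then have "ennpowr a (1 / p) \<le> ennpowr (ennpowr (h j) p) (1 / p)" using p by (intro ennpowr_mono) auto
      then show False using elim p by (simp add: ennpowr_ennpowr)
    qed
  qed
qed simp

text \<open>For p < 1 the map g \<mapsto> g^(1/p) is not Lipschitz from L^1 into L^p; a small
  multiple of b restores an estimate. If a \<le> L b, the difference of powers is at most (\<eta>
  b)^(1/p). Otherwise b < a / L, so a itself is at most L / (L - 1) (a - b).\<close>

lemma powr_difference_powr_le:
  fixes a b \<eta> p :: real
  assumes p: "0 < p" and \<eta>: "0 < \<eta>" and b: "0 \<le> b" "b \<le> a"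
  defines "L \<equiv> (1 + \<eta> powr (1 / p)) powr p"
  shows "(a powr (1 / p) - b powr (1 / p)) powr p \<le> \<eta> * b + L / (L - 1) * (a - b)"
proof -
  have L: "1 < L" unfolding L_def using p \<eta> by (intro gr_one_powr) auto
  have mono: "b powr (1 / p) \<le> a powr (1 / p)" using p b by (intro powr_mono2) auto
  show ?thesis
  proof (cases "a \<le> L * b")
    case True
    have "a powr (1 / p) \<le> (L * b) powr (1 / p)" using True p b by (intro powr_mono2) auto
    also have "\<dots> = (1 + \<eta> powr (1 / p)) * b powr (1 / p)" using p b L by (simp add: powr_mult L_def powr_powr)
    finally have "a powr (1 / p) - b powr (1 / p) \<le> \<eta> powr (1 / p) * b powr (1 / p)" by (simp add: distrib_right)
    then have "(a powr (1 / p) - b powr (1 / p)) powr p \<le> (\<eta> powr (1 / p) * b powr (1 / p)) powr p"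
      using mono p by (intro powr_mono2) auto
    also have "\<dots> = \<eta> * b" using p \<eta> b by (simp add: powr_mult powr_powr)
    also have "\<dots> \<le> \<eta> * b + L / (L - 1) * (a - b)" using L b by simp
    finally show ?thesis .
  next
    case False
    have "(a powr (1 / p) - b powr (1 / p)) powr p \<le> (a powr (1 / p)) powr p"
      using mono p by (intro powr_mono2) auto
    also have "\<dots> = a" using p b by (simp add: powr_powr)
    also have "\<dots> \<le> L / (L - 1) * (a - b)" using False L by (simp add: field_simps)
    also have "\<dots> \<le> \<eta> * b + L / (L - 1) * (a - b)" using \<eta> b by simp
    finally show ?thesis .
  qed
qed

lemma powr_L1_tendsto:
  fixes F :: "nat \<Rightarrow> 'a \<Rightarrow> real"
  assumes p: "0 < p"
    and F: "\<And>j. integrable M (F j)" "\<And>j x. 0 \<le> F j x" and H: "integrable M H" "\<And>x. 0 \<le> H x"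
    and lim: "(\<lambda>j. \<integral>\<^sup>+x. ennreal \<bar>F j x - H x\<bar> \<partial>M) \<longlonglongrightarrow> 0"
  shows "(\<lambda>j. \<integral>\<^sup>+x. ennreal (\<bar>F j x powr (1 / p) - H x powr (1 / p)\<bar> powr p) \<partial>M) \<longlonglongrightarrow> 0"
proof (rule order_tendstoI)
  fix a :: ennreal assume a: "0 < a"
  obtain e :: real where e: "0 < e" "ennreal e < a"
  proof (cases a)
    case (real r)
    then show ?thesis using a that[of "r / 2"] by (auto simp: ennreal_less_iff)
  next
    case top
    then show ?thesis using that[of 1] by auto
  qed
  define A where "A = (LINT x|M. H x)"
  have A: "0 \<le> A" "(\<integral>\<^sup>+x. ennreal (H x) \<partial>M) = ennreal A"
    using H by (auto simp: A_def intro!: nn_integral_eq_integral integral_nonneg)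
  \<comment> \<open>Makes \<eta> times the integral of H at most e / 2; the other half is left for
    the L^1 distance times K.\<close>
  define \<eta> where "\<eta> = (e / 2) / (A + 1)"
  define L where "L = (1 + \<eta> powr (1 / p)) powr p"
  define K where "K = \<eta> + L / (L - 1)"
  have \<eta>: "0 < \<eta>" using e A by (simp add: \<eta>_def)
  have L: "1 < L" unfolding L_def using p \<eta> by (intro gr_one_powr) auto
  have K: "0 < K" using \<eta> L by (simp add: K_def add_pos_pos)
  have [measurable]: "F j \<in> borel_measurable M" "H \<in> borel_measurable M" for j using F H by auto
  have pw: "\<bar>s powr (1 / p) - t powr (1 / p)\<bar> powr p \<le> \<eta> * t + K * \<bar>s - t\<bar>" if "0 \<le> s" "0 \<le> t" for s t
  proof (cases "t \<le> s")
    case True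
    have "t powr (1 / p) \<le> s powr (1 / p)" using True that p by (intro powr_mono2) auto
    moreover have "L / (L - 1) * (s - t) \<le> K * (s - t)" using True \<eta> by (intro mult_right_mono) (auto simp: K_def)
    ultimately show ?thesis
      using powr_difference_powr_le[OF p \<eta> that(2) True] True by (simp add: L_def)
  next
    case False
    have "s powr (1 / p) \<le> t powr (1 / p)" using False that p by (intro powr_mono2) auto
    moreover have "L / (L - 1) * (t - s) \<le> K * (t - s)" using False \<eta> by (intro mult_right_mono) (auto simp: K_def)
    moreover have "\<eta> * s \<le> \<eta> * t" using \<eta> False by (intro mult_left_mono) auto
    ultimately show ?thesis
      using powr_difference_powr_le[OF p \<eta> that(1), of t] False by (simp add: L_def abs_minus_commute[of "s powr _"] abs_minus_commute[of s])
  qed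
  have bound: "(\<integral>\<^sup>+x. ennreal (\<bar>F j x powr (1 / p) - H x powr (1 / p)\<bar> powr p) \<partial>M)
    \<le> ennreal (\<eta> * A) + ennreal K * (\<integral>\<^sup>+x. ennreal \<bar>F j x - H x\<bar> \<partial>M)" for j
  proof -
    have "(\<integral>\<^sup>+x. ennreal (\<bar>F j x powr (1 / p) - H x powr (1 / p)\<bar> powr p) \<partial>M)
      \<le> (\<integral>\<^sup>+x. ennreal \<eta> * ennreal (H x) + ennreal K * ennreal \<bar>F j x - H x\<bar> \<partial>M)"
    proof (rule nn_integral_mono)
      fix x
      have "ennreal (\<bar>F j x powr (1 / p) - H x powr (1 / p)\<bar> powr p) \<le> ennreal (\<eta> * H x + K * \<bar>F j x - H x\<bar>)"
        by (intro ennreal_leI pw F H)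
      also have "\<dots> = ennreal \<eta> * ennreal (H x) + ennreal K * ennreal \<bar>F j x - H x\<bar>"
        using \<eta> K H by (simp add: ennreal_mult ennreal_plus)
      finally show "ennreal (\<bar>F j x powr (1 / p) - H x powr (1 / p)\<bar> powr p) \<le> \<dots>" .
    qed
    also have "\<dots> = (\<integral>\<^sup>+x. ennreal \<eta> * ennreal (H x) \<partial>M) + (\<integral>\<^sup>+x. ennreal K * ennreal \<bar>F j x - H x\<bar> \<partial>M)"
      by (rule nn_integral_add) measurable
    also have "(\<integral>\<^sup>+x. ennreal \<eta> * ennreal (H x) \<partial>M) = ennreal (\<eta> * A)"
      using A \<eta> by (subst nn_integral_cmult) (auto simp: ennreal_mult)
    also have "(\<integral>\<^sup>+x. ennreal K * ennreal \<bar>F j x - H x\<bar> \<partial>M) = ennreal K * (\<integral>\<^sup>+x. ennreal \<bar>F j x - H x\<bar> \<partial>M)"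
      by (rule nn_integral_cmult) measurable
    finally show ?thesis .
  qed
  have "0 < ennreal (e / (2 * K))" using e K by simp
  with lim have "eventually (\<lambda>j. (\<integral>\<^sup>+x. ennreal \<bar>F j x - H x\<bar> \<partial>M) < ennreal (e / (2 * K))) sequentially" by (rule order_tendstoD)
  then show "eventually (\<lambda>j. (\<integral>\<^sup>+x. ennreal (\<bar>F j x powr (1 / p) - H x powr (1 / p)\<bar> powr p) \<partial>M) < a) sequentially"
  proof eventually_elim
    case (elim j)
    note bound[of j]
    also have "ennreal (\<eta> * A) + ennreal K * (\<integral>\<^sup>+x. ennreal \<bar>F j x - H x\<bar> \<partial>M) \<le> ennreal (e / 2) + ennreal K * ennreal (e / (2 * K))"
    proof (intro add_mono mult_left_mono ennreal_leI)
      have "\<eta> * A \<le> \<eta> * (A + 1)" using \<eta> by simp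
      also have "\<dots> = e / 2"
        using A nonzero_divide_eq_eq[of "A + 1" "e / 2" \<eta>] by (simp only: \<eta>_def) linarith
      finally show "\<eta> * A \<le> e / 2" .
    qed (use elim in auto)
    also have "\<dots> = ennreal (e / 2) + ennreal (e / 2)" using K e by (simp flip: ennreal_mult)
    also have "\<dots> = ennreal e" using e by (simp flip: ennreal_plus)
    also have "\<dots> < a" by fact
    finally show ?case .
  qed
qed simp

section \<open>The Hardy quasi-norm and the pseudometric of its p-th power\<close>

lemma nontangential_max_triangle:
  assumes "\<And>\<psi>. cmod (u \<psi>) \<le> cmod (v \<psi>) + cmod (w \<psi>)"
  shows "nontangential_max \<phi> u x \<le> nontangential_max \<phi> v x + nontangential_max \<phi> w x"
  unfolding nontangential_max_def[of \<phi> u]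
proof (intro SUP_least)
  fix t y assume t: "t \<in> {0::real<..}" and y: "y \<in> {y. norm (x - y) \<le> t}"
  have "ennreal (cmod (dist_conv (dilate t \<phi>) u y)) \<le> ennreal (cmod (dist_conv (dilate t \<phi>) v y) + cmod (dist_conv (dilate t \<phi>) w y))"
    unfolding dist_conv_def by (intro ennreal_leI assms)
  also have "\<dots> = ennreal (cmod (dist_conv (dilate t \<phi>) v y)) + ennreal (cmod (dist_conv (dilate t \<phi>) w y))" by simp
  also have "\<dots> \<le> nontangential_max \<phi> v x + nontangential_max \<phi> w x"
    using t y by (intro add_mono nontangential_max_ge) auto
  finally show "ennreal (cmod (dist_conv (dilate t \<phi>) u y)) \<le> \<dots>" .
qed

text \<open>The p-th power of the quasi-norm, which satisfies the triangle inequality for p \<le>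
  1.\<close>

definition hardy_qnorm :: "('a::euclidean_space \<Rightarrow> complex) \<Rightarrow> real \<Rightarrow> (('a \<Rightarrow> complex) \<Rightarrow> complex) \<Rightarrow> ennreal" where
  "hardy_qnorm \<phi> p u = (\<integral>\<^sup>+x. ennpowr (nontangential_max \<phi> u x) p \<partial>lebesgue)"

lemma hardy_norm_eq: "hardy_norm \<phi> p u = ennpowr (hardy_qnorm \<phi> p u) (1 / p)"
  by (simp add: hardy_norm_def lp_norm_def hardy_qnorm_def)

text \<open>The hypothesis on moduli serves sums, differences and changes of sign alike.\<close>

lemma hardy_qnorm_triangle:
  assumes p: "0 < p" "p \<le> 1" and "\<And>\<psi>. cmod (u \<psi>) \<le> cmod (v \<psi>) + cmod (w \<psi>)"
  shows "hardy_qnorm \<phi> p u \<le> hardy_qnorm \<phi> p v + hardy_qnorm \<phi> p w"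
proof -
  have "hardy_qnorm \<phi> p u \<le> (\<integral>\<^sup>+x. ennpowr (nontangential_max \<phi> v x) p + ennpowr (nontangential_max \<phi> w x) p \<partial>lebesgue)"
    unfolding hardy_qnorm_def
    using p by (intro nn_integral_mono order_trans[OF ennpowr_mono ennpowr_add_le] nontangential_max_triangle assms) auto
  also have "\<dots> = hardy_qnorm \<phi> p v + hardy_qnorm \<phi> p w"
    unfolding hardy_qnorm_def by (rule nn_integral_add) measurable
  finally show ?thesis .
qed

lemma hardy_qnorm_0 [simp]: "hardy_qnorm \<phi> p (\<lambda>\<psi>. 0) = 0"
proof -
  have "nontangential_max \<phi> (\<lambda>\<psi>. 0) x \<le> 0" for x
    unfolding nontangential_max_def by (intro SUP_least) (simp add: dist_conv_def)
  then show ?thesis by (simp add: hardy_qnorm_def)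
qed

lemma zero_in_hardy_space: "(\<lambda>\<psi>. 0) \<in> hardy_space \<phi> p"
proof -
  have "\<exists>C m. \<forall>\<psi>. schwartz \<psi> \<longrightarrow> cmod 0 \<le> C * schwartz_seminorm m \<psi>" by (intro exI[of _ 0]) simp
  then show ?thesis by (simp add: hardy_space_def tempered_def hardy_norm_eq)
qed

definition hardy_dist :: "('a::euclidean_space \<Rightarrow> complex) \<Rightarrow> real \<Rightarrow> (('a \<Rightarrow> complex) \<Rightarrow> complex) \<Rightarrow> (('a \<Rightarrow> complex) \<Rightarrow> complex) \<Rightarrow> real" where
  "hardy_dist \<phi> p u v = enn2real (hardy_qnorm \<phi> p (\<lambda>\<psi>. u \<psi> - v \<psi>))"

lemma hardy_qnorm_diff_finite:
  assumes p: "0 < p" "p \<le> 1" and "u \<in> hardy_space \<phi> p" "v \<in> hardy_space \<phi> p"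
  shows "hardy_qnorm \<phi> p (\<lambda>\<psi>. u \<psi> - v \<psi>) < top"
proof -
  have "hardy_qnorm \<phi> p (\<lambda>\<psi>. u \<psi> - v \<psi>) \<le> hardy_qnorm \<phi> p u + hardy_qnorm \<phi> p v"
    by (intro hardy_qnorm_triangle p norm_triangle_ineq4)
  also have "\<dots> < top" using assms by (simp add: hardy_space_def hardy_norm_eq)
  finally show ?thesis .
qed

lemma ennreal_hardy_dist:
  assumes "0 < p" "p \<le> 1" "u \<in> hardy_space \<phi> p" "v \<in> hardy_space \<phi> p"
  shows "ennreal (hardy_dist \<phi> p u v) = hardy_qnorm \<phi> p (\<lambda>\<psi>. u \<psi> - v \<psi>)"
  using hardy_qnorm_diff_finite[OF assms] by (simp add: hardy_dist_def)

lemma hardy_dist_pseudometric: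
  assumes p: "0 < p" "p \<le> 1" and D: "D \<subseteq> hardy_space \<phi> p" "D \<noteq> {}"
  shows "pseudometric_with_subset (hardy_dist \<phi> p) (hardy_space \<phi> p) D"
proof
  fix u v w assume X: "u \<in> hardy_space \<phi> p" "v \<in> hardy_space \<phi> p" "w \<in> hardy_space \<phi> p"
  have nn: "0 \<le> hardy_dist \<phi> p a b" for a b by (simp add: hardy_dist_def)
  have "ennreal (hardy_dist \<phi> p u w) \<le> ennreal (hardy_dist \<phi> p u v) + ennreal (hardy_dist \<phi> p v w)"
    unfolding ennreal_hardy_dist[OF p X(1,3)] ennreal_hardy_dist[OF p X(1,2)] ennreal_hardy_dist[OF p X(2,3)]
    by (intro hardy_qnorm_triangle p) (metis diff_add_cancel add_diff_eq norm_triangle_ineq)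
  then show "hardy_dist \<phi> p u w \<le> hardy_dist \<phi> p u v + hardy_dist \<phi> p v w"
    using nn by (simp flip: ennreal_plus)
next
  fix u v assume "u \<in> hardy_space \<phi> p" "v \<in> hardy_space \<phi> p"
  have "hardy_qnorm \<phi> p (\<lambda>\<psi>. a \<psi> - b \<psi>) \<le> hardy_qnorm \<phi> p (\<lambda>\<psi>. b \<psi> - a \<psi>)" for a b
    using hardy_qnorm_triangle[OF p, of "\<lambda>\<psi>. a \<psi> - b \<psi>" "\<lambda>\<psi>. b \<psi> - a \<psi>" "\<lambda>\<psi>. 0" \<phi>]
    by (simp add: norm_minus_commute)
  then show "hardy_dist \<phi> p u v = hardy_dist \<phi> p v u" unfolding hardy_dist_def by (metis antisym)
qed (use D in \<open>auto simp: hardy_dist_def\<close>)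

lemma sq_integrable_diff:
  fixes f g :: "'a::euclidean_space \<Rightarrow> complex"
  assumes [measurable]: "f \<in> borel_measurable borel" "g \<in> borel_measurable borel"
    and "integrable lborel (\<lambda>x. (cmod (f x))\<^sup>2)" "integrable lborel (\<lambda>x. (cmod (g x))\<^sup>2)"
  shows "integrable lborel (\<lambda>x. (cmod (f x - g x))\<^sup>2)"
proof (rule Bochner_Integration.integrable_bound)
  show "integrable lborel (\<lambda>x. 2 * (cmod (f x))\<^sup>2 + 2 * (cmod (g x))\<^sup>2)" using assms by simp
  show "AE x in lborel. norm ((cmod (f x - g x))\<^sup>2) \<le> norm (2 * (cmod (f x))\<^sup>2 + 2 * (cmod (g x))\<^sup>2)"
  proof (rule AE_I2)
    fix x
    have "(cmod (f x - g x))\<^sup>2 \<le> (cmod (f x) + cmod (g x))\<^sup>2" by (intro power_mono norm_triangle_ineq4) simp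
    also have "\<dots> \<le> 2 * (cmod (f x))\<^sup>2 + 2 * (cmod (g x))\<^sup>2"
      using sum_squares_bound[of "cmod (f x)" "cmod (g x)"] by (simp add: power2_sum)
    finally show "norm ((cmod (f x - g x))\<^sup>2) \<le> norm (2 * (cmod (f x))\<^sup>2 + 2 * (cmod (g x))\<^sup>2)" by simp
  qed
qed measurable

section \<open>The extended operator\<close>

context lpso_op
begin

text \<open>Ensures that \<open>enn2real\<close> loses nothing almost everywhere on L^2.\<close>

lemma square_fun_finite_AE:
  assumes f: "f \<in> Lp_space 2"
  shows "AE x in lebesgue. square_fun lam f x < top"
proof -
  have [measurable]: "square_fun lam f \<in> borel_measurable lebesgue" using L2[OF f] by simp
  have "lp_norm 2 (square_fun lam f) \<le> ennreal CS * Lp_norm 2 f" using L2[OF f] by simp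
  also have "\<dots> < top" using f by (simp add: Lp_space_def ennreal_mult_less_top)
  finally have "(\<integral>\<^sup>+x. ennpowr (square_fun lam f x) 2 \<partial>lebesgue) \<noteq> \<infinity>" by (simp add: lp_norm_def)
  then have "AE x in lebesgue. ennpowr (square_fun lam f x) 2 \<noteq> \<infinity>" by (intro nn_integral_PInf_AE) auto
  then show ?thesis by (simp add: less_top)
qed

text \<open>With a, b, c the values of S f, S g and S (f - g), sublinearity gives a \<le> b + c and
  b \<le> a + c, and subadditivity of the p-th power gives |a^p - b^p| \<le> c^p. The Hardy estimate
  is then applied to the difference of Borel representatives.\<close>

lemma square_fun_lipschitz:
  fixes \<phi> :: "'a \<Rightarrow> complex"
  assumes p: "0 < p" "p \<le> 1" and \<phi>: "schwartz \<phi>"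
    and C: "\<And>f. f \<in> Lp_space 2 \<Longrightarrow> (\<integral>\<^sup>+x. ennpowr (square_fun lam f x) p \<partial>lebesgue) \<le> ennreal C * hardy_qnorm \<phi> p (dist_of f)"
    and f: "f \<in> Lp_space 2" and g: "g \<in> Lp_space 2"
  shows "(\<integral>\<^sup>+x. ennreal \<bar>enn2real (square_fun lam f x) powr p - enn2real (square_fun lam g x) powr p\<bar> \<partial>lebesgue)
    \<le> ennreal C * hardy_qnorm \<phi> p (\<lambda>\<psi>. dist_of f \<psi> - dist_of g \<psi>)"
proof -
  obtain f' where f': "f' \<in> borel_measurable borel" "AE x in lebesgue. f x = f' x"
    "integrable lborel (\<lambda>x. (cmod (f' x))\<^sup>2)" "f \<in> borel_measurable lebesgue" "f' \<in> borel_measurable lebesgue"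
    using Lp_space_2_representative[OF f] .
  obtain g' where g': "g' \<in> borel_measurable borel" "AE x in lebesgue. g x = g' x"
    "integrable lborel (\<lambda>x. (cmod (g' x))\<^sup>2)" "g \<in> borel_measurable lebesgue" "g' \<in> borel_measurable lebesgue"
    using Lp_space_2_representative[OF g] .
  define h where "h = (\<lambda>x. f' x - g' x)"
  have h: "h \<in> borel_measurable borel" "integrable lborel (\<lambda>x. (cmod (h x))\<^sup>2)"
    unfolding h_def using f' g' sq_integrable_diff by auto
  have h': "(\<lambda>x. g' x - f' x) \<in> borel_measurable borel" "integrable lborel (\<lambda>x. (cmod (g' x - f' x))\<^sup>2)"
    using f' g' sq_integrable_diff by auto
  have hL: "h \<in> Lp_space 2" using h Lp_space_2_iff by blast
  have "nontangential_max \<phi> (dist_of h) = nontangential_max \<phi> (\<lambda>\<psi>. dist_of f' \<psi> - dist_of g' \<psi>)"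
    unfolding h_def by (rule nontangential_max_diff[OF \<phi> f'(1,3) g'(1,3)])
  also have "\<dots> = nontangential_max \<phi> (\<lambda>\<psi>. dist_of f \<psi> - dist_of g \<psi>)"
    using dist_conv_cong_AE[OF \<phi> f'(4,5,2)] dist_conv_cong_AE[OF \<phi> g'(4,5,2)]
    by (simp add: nontangential_max_def dist_conv_def fun_eq_iff)
  finally have Nh: "hardy_qnorm \<phi> p (dist_of h) = hardy_qnorm \<phi> p (\<lambda>\<psi>. dist_of f \<psi> - dist_of g \<psi>)"
    by (simp add: hardy_qnorm_def)
  have Sf: "square_fun lam f = square_fun lam f'" by (rule square_fun_cong_AE[OF f'(4,5,2)])
  have Sg: "square_fun lam g = square_fun lam g'" by (rule square_fun_cong_AE[OF g'(4,5,2)])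
  have Sm: "square_fun lam (\<lambda>x. g' x - f' x) x = square_fun lam h x" for x
  proof -
    have "(\<lambda>y. lam k x y * (g' y - f' y)) = (\<lambda>y. - (lam k x y * h y))" for k
      by (simp add: h_def fun_eq_iff algebra_simps)
    then have "Lambda lam k (\<lambda>y. g' y - f' y) x = - Lambda lam k h x" for k
      unfolding Lambda_def by simp
    then show ?thesis by (simp add: square_fun_def)
  qed
  have le1: "square_fun lam f x \<le> square_fun lam g x + square_fun lam h x" for x
    using square_fun_add[OF g'(1) h(1) g'(3) h(2), of x] unfolding Sf Sg by (simp add: h_def)
  have le2: "square_fun lam g x \<le> square_fun lam f x + square_fun lam h x" for x
    using square_fun_add[OF f'(1) h'(1) f'(3) h'(2), of x] unfolding Sf Sg Sm by simp
  have "(\<integral>\<^sup>+x. ennreal \<bar>enn2real (square_fun lam f x) powr p - enn2real (square_fun lam g x) powr p\<bar> \<partial>lebesgue)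
    \<le> (\<integral>\<^sup>+x. ennpowr (square_fun lam h x) p \<partial>lebesgue)"
  proof (rule nn_integral_mono_AE)
    show "AE x in lebesgue. ennreal \<bar>enn2real (square_fun lam f x) powr p - enn2real (square_fun lam g x) powr p\<bar>
      \<le> ennpowr (square_fun lam h x) p"
      using square_fun_finite_AE[OF f] square_fun_finite_AE[OF g] square_fun_finite_AE[OF hL]
    proof eventually_elim
      case (elim x)
      obtain a b c where abc: "0 \<le> a" "0 \<le> b" "0 \<le> c" "square_fun lam f x = ennreal a"
        "square_fun lam g x = ennreal b" "square_fun lam h x = ennreal c"
        using elim by (metis less_top_ennreal)
      have "a \<le> b + c" "b \<le> a + c" using le1[of x] le2[of x] abc by (simp_all flip: ennreal_plus)
      then have "a powr p \<le> (b + c) powr p" "b powr p \<le> (a + c) powr p" using p abc by (auto intro!: powr_mono2)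
      then have "\<bar>a powr p - b powr p\<bar> \<le> c powr p"
        using powr_add_le_real[of b c p] powr_add_le_real[of a c p] abc p by (simp add: abs_le_iff)
      then show ?case using abc by (simp add: ennreal_leI)
    qed
  qed
  also have "\<dots> \<le> ennreal C * hardy_qnorm \<phi> p (dist_of h)" by (rule C[OF hL])
  finally show ?thesis unfolding Nh .
qed

theorem square_fun_extends:
  fixes \<phi> :: "'a \<Rightarrow> complex"
  assumes \<phi>: "schwartz \<phi>" and nz: "(LINT x|lebesgue. \<phi> x) \<noteq> 0"
    and p1: "real DIM('a) / (real DIM('a) + \<delta>) < p" "p \<le> 1"
  shows "extends_bounded_Hp_Lp \<phi> p (square_fun lam)"
proof -
  have "0 < real DIM('a) / (real DIM('a) + \<delta>)" using delta0 by (intro divide_pos_pos) (auto simp: add_pos_pos)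
  with p1 have p: "0 < p" "p \<le> 1" by linarith+
  obtain C where C: "0 < C" "\<And>f. f \<in> Lp_space 2 \<Longrightarrow> (\<integral>\<^sup>+x. ennpowr (square_fun lam f x) p \<partial>lebesgue) \<le> ennreal C * hardy_qnorm \<phi> p (dist_of f)"
    using square_fun_hardy_bound[OF \<phi> nz p1] unfolding hardy_qnorm_def by blast
  let ?X = "hardy_space \<phi> p"
  define D where "D = dist_of ` Lp_space 2 \<inter> ?X"
  define z :: "('a \<Rightarrow> complex) \<Rightarrow> complex" where "z = (\<lambda>\<psi>. 0)"
  have zX: "z \<in> ?X" unfolding z_def by (rule zero_in_hardy_space)
  have "dist_of (\<lambda>_::'a. 0) = z" by (simp add: z_def dist_of_def fun_eq_iff)
  moreover have "(\<lambda>_::'a. 0::complex) \<in> Lp_space 2" by (simp add: Lp_space_2_iff)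
  ultimately have zD: "z \<in> D" using zX unfolding D_def by blast
  \<comment> \<open>Several L^2 functions may induce the same functional. The choice is harmless: at
    distance 0 the Lipschitz estimate makes their square functions agree almost everywhere.\<close>
  define fsel where "fsel u = (SOME f. f \<in> Lp_space 2 \<and> dist_of f = u)" for u :: "('a \<Rightarrow> complex) \<Rightarrow> complex"
  have fsel: "fsel u \<in> Lp_space 2" "dist_of (fsel u) = u" if "u \<in> D" for u
  proof -
    have "\<exists>f. f \<in> Lp_space 2 \<and> dist_of f = u" using that by (auto simp: D_def)
    from someI_ex[OF this] show "fsel u \<in> Lp_space 2" "dist_of (fsel u) = u" by (auto simp: fsel_def)
  qed
  define G where "G u x = enn2real (square_fun lam (fsel u) x) powr p" for u x
  have lip: "(\<integral>\<^sup>+x. ennreal \<bar>enn2real (square_fun lam f x) powr p - enn2real (square_fun lam g x) powr p\<bar> \<partial>lebesgue)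
    \<le> ennreal C * hardy_qnorm \<phi> p (\<lambda>\<psi>. dist_of f \<psi> - dist_of g \<psi>)" if "f \<in> Lp_space 2" "g \<in> Lp_space 2" for f g
    by (rule square_fun_lipschitz[OF p \<phi> _ that]) (rule C(2))
  have DX: "D \<subseteq> ?X" by (simp add: D_def)
  have G_le: "(\<integral>\<^sup>+x. ennreal (G u x) \<partial>lebesgue) \<le> ennreal C * hardy_qnorm \<phi> p u" if u: "u \<in> D" for u
  proof -
    have "(\<integral>\<^sup>+x. ennreal (G u x) \<partial>lebesgue) \<le> (\<integral>\<^sup>+x. ennpowr (square_fun lam (fsel u) x) p \<partial>lebesgue)"
      by (intro nn_integral_mono) (simp add: G_def ennpowr_def)
    also have "\<dots> \<le> ennreal C * hardy_qnorm \<phi> p u" using C(2)[OF fsel(1)[OF u]] fsel(2)[OF u] by simp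
    finally show ?thesis .
  qed
  interpret pseudometric_with_subset "hardy_dist \<phi> p" ?X D
    using p DX zD by (intro hardy_dist_pseudometric) auto
  interpret L1_extension "hardy_dist \<phi> p" ?X D G lebesgue C
  proof
    fix s assume s: "s \<in> D"
    have [measurable]: "square_fun lam (fsel s) \<in> borel_measurable lebesgue" using L2[OF fsel(1)[OF s]] by simp
    have "hardy_qnorm \<phi> p s < top" using s DX by (auto simp: hardy_space_def hardy_norm_eq)
    then have "ennreal C * hardy_qnorm \<phi> p s < top" by (simp add: ennreal_mult_less_top)
    with G_le[OF s] have "(\<integral>\<^sup>+x. ennreal (G s x) \<partial>lebesgue) < \<infinity>" by (auto intro: le_less_trans)
    then show "integrable lebesgue (G s)" by (intro integrableI_nonneg) (auto simp: G_def[abs_def])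
  next
    fix s t assume s: "s \<in> D" "t \<in> D"
    have "(\<integral>\<^sup>+x. ennreal \<bar>G s x - G t x\<bar> \<partial>lebesgue) \<le> ennreal C * hardy_qnorm \<phi> p (\<lambda>\<psi>. s \<psi> - t \<psi>)"
      using lip[OF fsel(1)[OF s(1)] fsel(1)[OF s(2)]] fsel(2)[OF s(1)] fsel(2)[OF s(2)] by (simp add: G_def)
    also have "\<dots> = ennreal (C * hardy_dist \<phi> p s t)"
    proof -
      have X: "s \<in> ?X" "t \<in> ?X" using s DX by auto
      show ?thesis using C d_nonneg[OF X] by (simp add: ennreal_mult ennreal_hardy_dist[OF p X])
    qed
    finally show "(\<integral>\<^sup>+x. ennreal \<bar>G s x - G t x\<bar> \<partial>lebesgue) \<le> ennreal (C * hardy_dist \<phi> p s t)" .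
  qed (use C in \<open>auto simp: G_def\<close>)
  define T where "T u x = Ext u x powr (1 / p)" for u x
  have norm_T: "Lp_norm p (T u) = ennpowr (\<integral>\<^sup>+x. ennreal (Ext u x) \<partial>lebesgue) (1 / p)" if "u \<in> ?X" for u
    using Ext_props(2)[OF that] p by (simp add: Lp_norm_def lp_norm_def T_def powr_powr)
  \<comment> \<open>Comparison with the zero functional, where G has integral 0; the 3 is the
    constant in \<open>Ext_props\<close>.\<close>
  have int_Ext: "(\<integral>\<^sup>+x. ennreal (Ext u x) \<partial>lebesgue) \<le> ennreal (3 * C) * hardy_qnorm \<phi> p u" if u: "u \<in> ?X" for u
  proof -
    have [measurable]: "Ext u \<in> borel_measurable lebesgue" "G z \<in> borel_measurable lebesgue"
      using Ext_props(1)[OF u] zD by auto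
    have "(\<integral>\<^sup>+x. ennreal (Ext u x) \<partial>lebesgue) \<le> (\<integral>\<^sup>+x. ennreal \<bar>Ext u x - G z x\<bar> + ennreal (G z x) \<partial>lebesgue)"
      using G_nonneg[OF zD] by (intro nn_integral_mono) (simp flip: ennreal_plus add: ennreal_leI)
    also have "\<dots> = (\<integral>\<^sup>+x. ennreal \<bar>Ext u x - G z x\<bar> \<partial>lebesgue) + (\<integral>\<^sup>+x. ennreal (G z x) \<partial>lebesgue)"
      by (rule nn_integral_add) measurable
    also have "\<dots> \<le> ennreal (3 * C * hardy_dist \<phi> p u z) + ennreal C * hardy_qnorm \<phi> p z"
      by (intro add_mono Ext_props u zD G_le)
    also have "\<dots> = ennreal (3 * C) * hardy_qnorm \<phi> p (\<lambda>\<psi>. u \<psi> - z \<psi>)"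
      using C ennreal_hardy_dist[OF p u zX] d_nonneg[OF u zX] by (subst ennreal_mult) (auto simp: z_def)
    finally show ?thesis by (simp add: z_def)
  qed
  have agree: "AE x in lebesgue. 0 \<le> T (dist_of f) x \<and> square_fun lam f x = ennreal (T (dist_of f) x)"
    if f: "f \<in> Lp_space 2" and fX: "dist_of f \<in> ?X" for f
  proof -
    let ?u = "dist_of f"
    have uD: "?u \<in> D" using f fX by (simp add: D_def)
    have [measurable]: "Ext ?u \<in> borel_measurable lebesgue" "G ?u \<in> borel_measurable lebesgue" "square_fun lam f \<in> borel_measurable lebesgue"
      using Ext_props(1)[OF fX] uD L2[OF f] by auto
    have "(\<integral>\<^sup>+x. ennreal \<bar>Ext ?u x - G ?u x\<bar> \<partial>lebesgue) \<le> 0" using Ext_props(3)[OF fX uD] d_self[OF fX] by simp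
    then have "(\<integral>\<^sup>+x. ennreal \<bar>Ext ?u x - G ?u x\<bar> \<partial>lebesgue) = 0" by simp
    then have 1: "AE x in lebesgue. Ext ?u x = G ?u x" by (subst (asm) nn_integral_0_iff_AE) auto
    have "(\<integral>\<^sup>+x. ennreal \<bar>enn2real (square_fun lam f x) powr p - G ?u x\<bar> \<partial>lebesgue) \<le> 0"
      using lip[OF f fsel(1)[OF uD]] by (simp add: fsel(2)[OF uD] G_def)
    then have "(\<integral>\<^sup>+x. ennreal \<bar>enn2real (square_fun lam f x) powr p - G ?u x\<bar> \<partial>lebesgue) = 0" by simp
    then have 2: "AE x in lebesgue. enn2real (square_fun lam f x) powr p = G ?u x" by (subst (asm) nn_integral_0_iff_AE) auto
    from 1 2 square_fun_finite_AE[OF f] show ?thesis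
    proof eventually_elim
      case (elim x)
      have "Ext ?u x = enn2real (square_fun lam f x) powr p" using elim(1,2) by (rule trans[OF _ sym])
      then have "T ?u x = enn2real (square_fun lam f x)" using p by (simp add: T_def powr_powr)
      then show ?case using elim(3) by simp
    qed
  qed
  have T_bound: "Lp_norm p (T u) \<le> ennreal ((3 * C) powr (1 / p)) * hardy_norm \<phi> p u" if u: "u \<in> ?X" for u
  proof -
    have "Lp_norm p (T u) \<le> ennpowr (ennreal (3 * C) * hardy_qnorm \<phi> p u) (1 / p)"
      unfolding norm_T[OF u] using p int_Ext[OF u] by (intro ennpowr_mono) auto
    also have "\<dots> = ennreal ((3 * C) powr (1 / p)) * hardy_norm \<phi> p u"
      using p C by (simp add: ennpowr_mult hardy_norm_eq)
    finally show ?thesis .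
  qed
  have T_Lp: "T u \<in> Lp_space p" if u: "u \<in> ?X" for u
  proof -
    have [measurable]: "Ext u \<in> borel_measurable lebesgue" using Ext_props(1)[OF u] by auto
    have "T u \<in> borel_measurable lebesgue" unfolding T_def[abs_def] by measurable
    moreover have "ennreal ((3 * C) powr (1 / p)) * hardy_norm \<phi> p u < top"
      using u by (simp add: hardy_space_def ennreal_mult_less_top)
    ultimately show ?thesis using T_bound[OF u] by (auto simp: Lp_space_def intro: le_less_trans)
  qed
  \<comment> \<open>Convergence is given in the quasi-norm while the extension is continuous for its
    p-th power; \<open>ennpowr_tendsto_0\<close> passes to the p-th power at the start and back to
    the root at the end.\<close>
  have T_cont: "(\<lambda>j. Lp_norm p (\<lambda>x. T (v j) x - T u x)) \<longlonglongrightarrow> 0"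
    if u: "u \<in> ?X" and v: "\<And>j::nat. v j \<in> ?X" and lim: "(\<lambda>j. hardy_norm \<phi> p (\<lambda>\<psi>. v j \<psi> - u \<psi>)) \<longlonglongrightarrow> 0" for u v
  proof -
    have "(\<lambda>j. ennpowr (hardy_norm \<phi> p (\<lambda>\<psi>. v j \<psi> - u \<psi>)) p) \<longlonglongrightarrow> 0" by (rule ennpowr_tendsto_0[OF lim p(1)])
    then have "(\<lambda>j. ennreal (hardy_dist \<phi> p (v j) u)) \<longlonglongrightarrow> ennreal 0"
      using p by (simp add: hardy_norm_eq ennpowr_ennpowr ennreal_hardy_dist[OF p v u])
    then have "(\<lambda>j. hardy_dist \<phi> p (v j) u) \<longlonglongrightarrow> 0" using d_nonneg[OF v u] by (subst (asm) tendsto_ennreal_iff) auto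
    from Ext_continuous[OF u v this]
    have "(\<lambda>j. \<integral>\<^sup>+x. ennreal (\<bar>T (v j) x - T u x\<bar> powr p) \<partial>lebesgue) \<longlonglongrightarrow> 0"
      unfolding T_def using Ext_props(1,2)[OF u] Ext_props(1,2)[OF v] by (intro powr_L1_tendsto[OF p(1)]) auto
    then have "(\<lambda>j. ennpowr (\<integral>\<^sup>+x. ennreal (\<bar>T (v j) x - T u x\<bar> powr p) \<partial>lebesgue) (1 / p)) \<longlonglongrightarrow> 0"
      using p by (intro ennpowr_tendsto_0) auto
    then show ?thesis by (simp add: Lp_norm_def lp_norm_def)
  qed
  show ?thesis
    unfolding extends_bounded_Hp_Lp_def
    using agree T_Lp T_bound T_cont by (intro exI[of _ T] conjI) blast+
qed

end

theorem corollary1p2: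
  fixes lam :: "int \<Rightarrow> real ^ 'n \<Rightarrow> real ^ 'n \<Rightarrow> complex"
    and \<phi> :: "real ^ 'n \<Rightarrow> complex"
    and \<delta> p :: real
  assumes "0 < \<delta>" and "\<delta> \<le> 1"
    and "LPSO (real CARD('n) + 2 * \<delta>) \<delta> lam"
    and "bounded_on_L2 (square_fun lam)"
    and "schwartz \<phi>" and "(LINT x|lebesgue. \<phi> x) \<noteq> 0"
    and "real CARD('n) / (real CARD('n) + \<delta>) < p" and "p \<le> 1"
  shows "extends_bounded_Hp_Lp \<phi> p (square_fun lam)"
proof -
  let ?N = "real DIM(real ^ 'n) + 2 * \<delta>"
  obtain C where C: "\<And>k x y. cmod (lam k x y) \<le> C * Phi ?N k (x - y)"
    "\<And>k x y y'. cmod (lam k x y - lam k x y') \<le> C * norm (y - y') powr \<delta> * 2 powr (real_of_int k * \<delta>) *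
      (Phi ?N k (x - y) + Phi ?N k (x - y'))"
    using assms(3) unfolding LPSO_def by auto
  obtain C' where C': "\<And>f. f \<in> Lp_space 2 \<Longrightarrow>
      square_fun lam f \<in> borel_measurable lebesgue \<and> lp_norm 2 (square_fun lam f) \<le> ennreal C' * Lp_norm 2 f"
    using assms(4) unfolding bounded_on_L2_def by blast
  have Phi: "0 \<le> Phi N k x" for N k and x :: "real ^ 'n" by (simp add: Phi_def)
  \<comment> \<open>The constants in the hypotheses carry no sign; absolute values make them
    nonnegative and only weaken the bounds.\<close>
  interpret lpso_op lam "\<bar>C\<bar>" \<delta> "\<bar>C'\<bar>"
  proof
    show "cmod (lam k x y) \<le> \<bar>C\<bar> * Phi ?N k (x - y)" for k x y
      by (rule order_trans[OF C(1)]) (intro mult_right_mono Phi, simp)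
    show "cmod (lam k x y - lam k x y') \<le> \<bar>C\<bar> * norm (y - y') powr \<delta> * 2 powr (real_of_int k * \<delta>) *
      (Phi ?N k (x - y) + Phi ?N k (x - y'))" for k x y y'
      by (rule order_trans[OF C(2)]) (intro mult_right_mono add_nonneg_nonneg Phi, simp_all)
    show "square_fun lam f \<in> borel_measurable lebesgue \<and> lp_norm 2 (square_fun lam f) \<le> ennreal \<bar>C'\<bar> * Lp_norm 2 f"
      if "f \<in> Lp_space 2" for f
    proof -
      have "ennreal C' * Lp_norm 2 f \<le> ennreal \<bar>C'\<bar> * Lp_norm 2 f" by (intro mult_right_mono ennreal_leI) simp_all
      with C'[OF that] show ?thesis by (blast intro: order_trans)
    qed
  qed (use assms in auto)
  show ?thesis using assms by (intro square_fun_extends) auto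
qed

end
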